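(* $\mathbb{P}$-almost surely, the localized process $(g_n(t))_{t\in[0,2\pi]}:=\left(f_n\left(X+\frac{t}{n}\right)\right)_{t\in[0,2\pi]}$ converges in distribution under $\mathbb{P}_X$, as $n\to+\infty$, for the $\mathcal{C}^1$ topology on $\mathcal{C}^1([0,2\pi])$, to the limit process $(g_\infty(t))_{t\in[0,2\pi]}$ given by $$g_\infty:=\sqrt{2\pi\psi_\rho(X)}\,N,$$ where $N=(N_t)_{t\in[0,2\pi]}$ is the standard (centered, stationary, unit variance) Gaussian process with $\sin_c$ covariance function, independent of the uniform variable $X$.
   Context: Let $\mu_\rho$ be a symmetric probability measure on $[-\pi,\pi]$ (the spectral measure), regarded as a measure on the circle $\mathbb{R}/2\pi\mathbb{Z}$, and let $\rho(k)=\int_{-\pi}^{\pi}e^{-ikx}\,\mu_\rho(dx)$, $k\in\mathbb{Z}$. No assumption is made on $\mu_\rho$; $\psi_\rho$ denotes the density with respect to Lebesgue measure of the absolutely continuous part of $\mu_\rho$ (with $\psi_\rho=0$ if $\mu_\rho$ is purely singular), regarded as a $2\pi$-periodic function. On a probability space $(\Omega,\mathcal{F},\mathbb{P})$ with expectation $\mathbb{E}$, let $(a_k)_{k\ge1}$ and $(b_k)_{k\ge1}$ be two independent centered stationary Gaussian sequences with $\mathbb{E}[a_ka_\ell]=\mathbb{E}[b_kb_\ell]=\rho(|k-\ell|)$ for $k,\ell\ge1$ (so each variable has variance $\rho(0)=1$). For $n\ge1$ set $f_n(x)=\frac{1}{\sqrt n}\sum_{k=1}^n a_k\cos(kx)+b_k\sin(kx)$.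 $X$ is a random variable uniformly distributed on $[0,2\pi]$, independent of the coefficients $(a_k),(b_k)$; $\mathbb{P}_X$ denotes probability with respect to $X$ only (the coefficients being fixed). $\sin_c(u)=\sin(u)/u$ for $u\ne0$ and $\sin_c(0)=1$; so $\mathbb{E}[N_sN_t]=\sin_c(t-s)$, and $N$ is taken with $\mathcal{C}^1$ paths. *)

theory Defs
  imports "HOL-Probability.Probability"
begin

section \<open>The space of continuously differentiable functions on a compact interval\<close>

text \<open>
  Derivatives are taken within the interval, hence one-sided at the end points; functions are
  made \<^term>\<open>undefined\<close> outside the interval so that they are determined by their values on it.
\<close>

definition c1_deriv :: "real \<Rightarrow> real \<Rightarrow> (real \<Rightarrow> real) \<Rightarrow> real \<Rightarrow> real" where
  "c1_deriv a b f t = vector_derivative f (at t within {a..b})"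

definition c1_space :: "real \<Rightarrow> real \<Rightarrow> (real \<Rightarrow> real) set" where
  "c1_space a b = {f \<in> extensional {a..b}.
     f differentiable_on {a..b} \<and> continuous_on {a..b} (c1_deriv a b f)}"

text \<open>
  The value 0 off the carrier is immaterial for the topology; it is there because
  \<^locale>\<open>Metric_space\<close> requires the distance to be nonnegative on the whole type, and a real
  supremum of an unbounded set is unspecified.
\<close>

definition c1_dist :: "real \<Rightarrow> real \<Rightarrow> (real \<Rightarrow> real) \<Rightarrow> (real \<Rightarrow> real) \<Rightarrow> real" where
  "c1_dist a b f g =
     (if f \<in> c1_space a b \<and> g \<in> c1_space a b
      then (SUP t\<in>{a..b}. \<bar>f t - g t\<bar>) + (SUP t\<in>{a..b}. \<bar>c1_deriv a b f t - c1_deriv a b g t\<bar>)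
      else 0)"

definition c1_topology :: "real \<Rightarrow> real \<Rightarrow> (real \<Rightarrow> real) topology" where
  "c1_topology a b = Metric_space.mtopology (c1_space a b) (c1_dist a b)"

lemma sup_abs_diff_bdd:
  fixes u v :: "real \<Rightarrow> real"
  assumes "continuous_on {a..b} u" "continuous_on {a..b} v"
  shows "bdd_above ((\<lambda>t. \<bar>u t - v t\<bar>) ` {a..b})"
proof -
  have "compact ((\<lambda>t. \<bar>u t - v t\<bar>) ` {a..b})"
    by (intro compact_continuous_image continuous_intros assms) auto
  then show ?thesis
    by (simp add: bounded_imp_bdd_above compact_imp_bounded)
qed

lemma sup_abs_diff_upper:
  fixes u v :: "real \<Rightarrow> real"
  assumes "continuous_on {a..b} u" "continuous_on {a..b} v" "t \<in> {a..b}"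
  shows "\<bar>u t - v t\<bar> \<le> (SUP t\<in>{a..b}. \<bar>u t - v t\<bar>)"
  using sup_abs_diff_bdd[OF assms(1,2)] assms(3) by (rule cSUP_upper2) simp

lemma sup_abs_diff_nonneg:
  fixes u v :: "real \<Rightarrow> real"
  assumes "a \<le> b" "continuous_on {a..b} u" "continuous_on {a..b} v"
  shows "0 \<le> (SUP t\<in>{a..b}. \<bar>u t - v t\<bar>)"
  using sup_abs_diff_upper[OF assms(2,3), of a] assms(1) by force

lemma sup_abs_diff_triangle:
  fixes u v w :: "real \<Rightarrow> real"
  assumes "a \<le> b" "continuous_on {a..b} u" "continuous_on {a..b} v" "continuous_on {a..b} w"
  shows "(SUP t\<in>{a..b}. \<bar>u t - w t\<bar>) \<le> (SUP t\<in>{a..b}. \<bar>u t - v t\<bar>) + (SUP t\<in>{a..b}. \<bar>v t - w t\<bar>)"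
proof (rule cSUP_least)
  show "{a..b} \<noteq> {}" using assms(1) by simp
  fix t assume t: "t \<in> {a..b}"
  show "\<bar>u t - w t\<bar> \<le> (SUP t\<in>{a..b}. \<bar>u t - v t\<bar>) + (SUP t\<in>{a..b}. \<bar>v t - w t\<bar>)"
    using sup_abs_diff_upper[OF assms(2,3) t] sup_abs_diff_upper[OF assms(3,4) t] by linarith
qed

lemma c1_spaceD:
  assumes "f \<in> c1_space a b"
  shows "continuous_on {a..b} f" "continuous_on {a..b} (c1_deriv a b f)" "f \<in> extensional {a..b}"
  using assms by (auto simp: c1_space_def differentiable_imp_continuous_on)

lemma Metric_space_c1:
  assumes "a \<le> b"
  shows "Metric_space (c1_space a b) (c1_dist a b)"
proof
  note S = c1_spaceD(1,2)
  show "0 \<le> c1_dist a b f g" for f g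
    using sup_abs_diff_nonneg[OF assms S(1) S(1)] sup_abs_diff_nonneg[OF assms S(2) S(2)]
    by (auto simp: c1_dist_def)
  show "c1_dist a b f g = c1_dist a b g f" for f g
    by (simp add: c1_dist_def abs_minus_commute)
  show "c1_dist a b f g = 0 \<longleftrightarrow> f = g" if f: "f \<in> c1_space a b" and g: "g \<in> c1_space a b" for f g
  proof
    assume 0: "c1_dist a b f g = 0"
    have "f t = g t" if "t \<in> {a..b}" for t
      using 0 f g sup_abs_diff_upper[OF S(1)[OF f] S(1)[OF g] that]
        sup_abs_diff_nonneg[OF assms S(2)[OF f] S(2)[OF g]]
      by (simp add: c1_dist_def)
    then show "f = g"
      using c1_spaceD(3)[OF f] c1_spaceD(3)[OF g] by (rule extensionalityI[rotated 2])
  qed (use assms f in \<open>simp add: c1_dist_def\<close>)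
  show "c1_dist a b f h \<le> c1_dist a b f g + c1_dist a b g h"
    if f: "f \<in> c1_space a b" and g: "g \<in> c1_space a b" and h: "h \<in> c1_space a b" for f g h
    using f g h sup_abs_diff_triangle[OF assms S(1)[OF f] S(1)[OF g] S(1)[OF h]]
      sup_abs_diff_triangle[OF assms S(2)[OF f] S(2)[OF g] S(2)[OF h]]
    by (simp add: c1_dist_def)
qed

lemma topspace_c1_topology: "a \<le> b \<Longrightarrow> topspace (c1_topology a b) = c1_space a b"
  by (simp add: c1_topology_def Metric_space.topspace_mtopology Metric_space_c1)

section \<open>Convergence in distribution of random elements of a topological space\<close>

definition borel_of_topology :: "'s topology \<Rightarrow> 's measure" where
  "borel_of_topology T = sigma (topspace T) {U. openin T U}"

definition converges_in_distribution ::
  "'s topology \<Rightarrow> (nat \<Rightarrow> 'a measure) \<Rightarrow> (nat \<Rightarrow> 'a \<Rightarrow> 's) \<Rightarrow> 'b measure \<Rightarrow> ('b \<Rightarrow> 's) \<Rightarrow> bool"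
where
  "converges_in_distribution T P Y Q Z \<longleftrightarrow>
     (\<forall>n. Y n \<in> measurable (P n) (borel_of_topology T)) \<and>
     Z \<in> measurable Q (borel_of_topology T) \<and>
     (\<forall>F :: 's \<Rightarrow> real. continuous_map T euclideanreal F \<and> bounded (F ` topspace T) \<longrightarrow>
        (\<lambda>n. \<integral>x. F (Y n x) \<partial>P n) \<longlonglongrightarrow> (\<integral>x. F (Z x) \<partial>Q))"

section \<open>Independence of random elements with values in different types\<close>

text \<open>
  \<^const>\<open>prob_space.indep_var\<close> needs both random elements to have the same value type; the
  following is the right-hand side of \<open>indep_var_eq\<close> without that restriction.
\<close>

definition independent_elements ::
  "'w measure \<Rightarrow> 's measure \<Rightarrow> ('w \<Rightarrow> 's) \<Rightarrow> 't measure \<Rightarrow> ('w \<Rightarrow> 't) \<Rightarrow> bool"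
where
  "independent_elements M S X T Y \<longleftrightarrow>
     X \<in> measurable M S \<and> Y \<in> measurable M T \<and>
     prob_space.indep_set M
       (sigma_sets (space M) {X -` A \<inter> space M | A. A \<in> sets S})
       (sigma_sets (space M) {Y -` A \<inter> space M | A. A \<in> sets T})"

section \<open>Gaussian processes\<close>

text \<open>Almost surely constant variables count as Gaussian, with variance 0.\<close>

definition gaussian_variable :: "'w measure \<Rightarrow> ('w \<Rightarrow> real) \<Rightarrow> bool" where
  "gaussian_variable M Y \<longleftrightarrow> Y \<in> borel_measurable M \<and>
     (\<exists>m. (AE \<omega> in M. Y \<omega> = m) \<or> (\<exists>\<sigma>>0. distributed M lborel Y (normal_density m \<sigma>)))"

definition gaussian_process :: "'w measure \<Rightarrow> 'i set \<Rightarrow> ('i \<Rightarrow> 'w \<Rightarrow> real) \<Rightarrow> bool" where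
  "gaussian_process M I Y \<longleftrightarrow>
     (\<forall>J c. finite J \<and> J \<subseteq> I \<longrightarrow> gaussian_variable M (\<lambda>\<omega>. \<Sum>j\<in>J. c j * Y j \<omega>))"

definition centered_gaussian_process ::
  "'w measure \<Rightarrow> 'i set \<Rightarrow> ('i \<Rightarrow> 'w \<Rightarrow> real) \<Rightarrow> bool" where
  "centered_gaussian_process M I Y \<longleftrightarrow>
     gaussian_process M I Y \<and> (\<forall>i\<in>I. (\<integral>\<omega>. Y i \<omega> \<partial>M) = 0)"

section \<open>Spectral measure\<close>

definition spectral_measure :: "real measure \<Rightarrow> bool" where
  "spectral_measure \<mu> \<longleftrightarrow> prob_space \<mu> \<and> sets \<mu> = sets borel \<and>
     (AE x in \<mu>. x \<in> {-pi..pi}) \<and> distr \<mu> borel uminus = \<mu>"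

definition spectral_corr :: "real measure \<Rightarrow> int \<Rightarrow> complex" where
  "spectral_corr \<mu> k = (\<integral>x. exp (- \<i> * of_int k * of_real x) \<partial>\<mu>)"

text \<open>
  \<open>\<psi>\<close> is a finite \<open>2\<pi>\<close>-periodic version of the density in the Lebesgue decomposition of \<open>\<mu>\<close>,
  with \<open>\<nu>\<close> the singular part and \<open>S\<close> a Lebesgue null set carrying it.
\<close>

definition ac_density_of :: "real measure \<Rightarrow> (real \<Rightarrow> real) \<Rightarrow> bool" where
  "ac_density_of \<mu> \<psi> \<longleftrightarrow>
     \<psi> \<in> borel_measurable borel \<and> (\<forall>x. 0 \<le> \<psi> x) \<and> (\<forall>x. \<psi> (x + 2 * pi) = \<psi> x) \<and>
     (\<exists>\<nu> S. sets \<nu> = sets borel \<and>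
        S \<in> sets borel \<and> emeasure lborel S = 0 \<and> emeasure \<nu> (- S) = 0 \<and>
        (\<forall>A\<in>sets borel. emeasure \<mu> A =
           emeasure (density lborel (\<lambda>x. ennreal (\<psi> x * indicator {-pi..pi} x))) A + emeasure \<nu> A))"

section \<open>Random trigonometric polynomials and their localization\<close>

definition trig_poly :: "(nat \<Rightarrow> real) \<Rightarrow> (nat \<Rightarrow> real) \<Rightarrow> nat \<Rightarrow> real \<Rightarrow> real" where
  "trig_poly a b n x =
     1 / sqrt (real n) * (\<Sum>k=1..n. a k * cos (real k * x) + b k * sin (real k * x))"

text \<open>
  With the coefficients \<open>a\<close>, \<open>b\<close> fixed, \<open>x\<close> stands for the value of the uniform variable \<open>X\<close>;
  probability with respect to \<open>X\<close> only is then the law of \<open>X\<close> on the reals.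
\<close>

definition localized ::
  "(nat \<Rightarrow> real) \<Rightarrow> (nat \<Rightarrow> real) \<Rightarrow> nat \<Rightarrow> real \<Rightarrow> (real \<Rightarrow> real)" where
  "localized a b n x = (\<lambda>t\<in>{0..2*pi}. trig_poly a b n (x + t / real n))"

end

theory Submission
  imports Defs "HOL-Real_Asymp.Real_Asymp" "HOL-Library.Discrete_Functions"
begin

text \<open>
  The proof follows the method of characteristic functions, carried out for almost every realization
  of the coefficients.

  The finite-dimensional marginals of \<open>g\<^sub>n\<close> are tested with the cosine and sine of a linear
  combination \<open>\<Sum>j. \<lambda>\<^sub>j g\<^sub>n(t\<^sub>j)\<close>. As a function of \<open>X = x\<close> such a combination is again a random
  trigonometric polynomial \<open>Y x\<close>, with the Fourier multiplier \<open>h(k / n)\<close> where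
  \<open>h(s) = \<Sum>j. \<lambda>\<^sub>j cis (s t\<^sub>j)\<close>. For fixed \<open>x\<close> it is a centered Gaussian variable whose variance is
  the spectral measure smoothed at \<open>x\<close> by a kernel of Fejer type,
  \<open>\<bar>\<Sum>k\<le>n. h(k / n) cis (k v)\<bar>\<^sup>2 / n\<close>. The mean of this kernel over the circle is a Riemann sum of
  \<open>\<bar>h\<bar>\<^sup>2\<close> and tends to \<open>\<kappa> = Var (\<Sum>j. \<lambda>\<^sub>j N(t\<^sub>j))\<close>, because the integral of \<open>cos (s (t - t'))\<close> over
  the unit interval is \<open>sinc (t - t')\<close>. The variance therefore tends to \<open>2 pi \<psi>(x) \<kappa>\<close> in measure:
  the absolutely continuous part is smoothed to its density, and the singular part disappears from
  almost every point (\<open>kernel_smoothing_limit\<close>). So the mean of \<open>cos (Y X)\<close> over \<open>X\<close> and the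
  coefficients tends to the mean of \<open>exp (- pi \<kappa> \<psi>(X))\<close>, which is the corresponding quantity for
  \<open>sqrt (2 pi \<psi>(X)) N\<close>.

  To obtain the convergence for fixed coefficients, the mean over \<open>X\<close> is shown to concentrate
  (\<open>spatial_mean_concentration\<close>). Its variance is the double integral over \<open>x\<close> and \<open>y\<close> of the
  covariance of \<open>\<phi>(Y x)\<close> and \<open>\<phi>(Y y)\<close>, which for a function \<open>\<phi>\<close> with Lipschitz constant 1 of a
  Gaussian pair is in absolute value at most twice the covariance of \<open>Y x\<close> and \<open>Y y\<close>
  (\<open>normal_pair_covariance_bound\<close>). The double integral of the absolute value of the latter is at
  most the squared \<open>L\<^sup>1\<close> norm of a Dirichlet kernel divided by \<open>n\<close>, that is \<open>O(log\<^sup>2 n / n)\<close> for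
  every spectral measure. This is summable along the squares, and between squares Parseval's
  identity shows that the polynomials move little in \<open>L\<^sup>2\<close>, since the coefficients grow slower than
  a small power of their index.

  The same concentration with \<open>\<phi>\<close> the absolute value and \<open>h(s) = (\<i> s) ^ j\<close>, \<open>j < 4\<close>, bounds the
  means over \<open>X\<close> of \<open>g\<^sub>n\<close> and of its first three derivatives. A Sobolev inequality and the
  translation invariance of the law of \<open>X\<close> then give tightness in the space of continuously
  differentiable functions (\<open>localized_tight\<close>). Finally, tightness and convergence of the test
  functions imply convergence in distribution, because on compact sets of paths the linear span of
  the test functions is dense among the continuous functions by the Stone-Weierstrass theorem
  (\<open>converges_in_distribution_c1I\<close>).
\<close>

section \<open>Centered normal variables and Gaussian pairs\<close>

text \<open>
  The law is described as that of a multiple of a standard normal variable, and not by a density, so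
  that variance 0 needs no separate treatment.
\<close>

definition centered_normal :: "'w measure \<Rightarrow> ('w \<Rightarrow> real) \<Rightarrow> real \<Rightarrow> bool" where
  "centered_normal M Y v \<longleftrightarrow> Y \<in> borel_measurable M \<and> 0 \<le> v \<and>
     distr M borel Y = distr std_normal_distribution borel (\<lambda>z. sqrt v * z)"

lemma centered_normalI_char:
  assumes "prob_space M" and [measurable]: "Y \<in> borel_measurable M" and v: "0 \<le> v"
    and ch: "\<And>t. char (distr M borel Y) t = complex_of_real (exp (- (v * t\<^sup>2) / 2))"
  shows "centered_normal M Y v"
proof -
  interpret prob_space M by fact
  interpret S: prob_space std_normal_distribution
    by (rule prob_space_normal_density) simp
  have "distr M borel Y = distr std_normal_distribution borel (\<lambda>z. sqrt v * z)"
  proof (rule Levy_uniqueness)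
    show "real_distribution (distr M borel Y)"
      by (rule real_distribution_distr) simp
    show "real_distribution (distr std_normal_distribution borel (\<lambda>z. sqrt v * z))"
      by (rule S.real_distribution_distr) simp
    show "char (distr M borel Y) = char (distr std_normal_distribution borel (\<lambda>z. sqrt v * z))"
    proof
      fix t
      have "char (distr std_normal_distribution borel (\<lambda>z. sqrt v * z)) t
          = char std_normal_distribution (t * sqrt v)"
        by (simp add: char_def integral_distr mult_ac)
      also have "\<dots> = complex_of_real (exp (- (v * t\<^sup>2) / 2))"
        using v by (simp only: char_std_normal_distribution power_mult_distrib real_sqrt_pow2 mult.commute)
      finally show "char (distr M borel Y) t = char (distr std_normal_distribution borel (\<lambda>z. sqrt v * z)) t"
        using ch by simp
    qed
  qed
  then show ?thesis using v by (simp add: centered_normal_def)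
qed

lemma centered_normal_char:
  assumes "centered_normal M Y v"
  shows "char (distr M borel Y) t = complex_of_real (exp (- (v * t\<^sup>2) / 2))"
proof -
  have v: "0 \<le> v" and eq: "distr M borel Y = distr std_normal_distribution borel (\<lambda>z. sqrt v * z)"
    using assms by (auto simp: centered_normal_def)
  have "char (distr std_normal_distribution borel (\<lambda>z. sqrt v * z)) t
      = char std_normal_distribution (t * sqrt v)"
    by (simp add: char_def integral_distr mult_ac)
  also have "\<dots> = complex_of_real (exp (- (v * t\<^sup>2) / 2))"
    using v by (simp only: char_std_normal_distribution power_mult_distrib real_sqrt_pow2 mult.commute)
  finally show ?thesis using eq by simp
qed

lemma centered_normal_integral:
  fixes f :: "real \<Rightarrow> real"
  assumes "centered_normal M Y v" and [measurable]: "f \<in> borel_measurable borel"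
  shows "(\<integral>\<omega>. f (Y \<omega>) \<partial>M) = (\<integral>z. std_normal_density z * f (sqrt v * z) \<partial>lborel)"
    and "integrable M (\<lambda>\<omega>. f (Y \<omega>)) \<longleftrightarrow> integrable lborel (\<lambda>z. std_normal_density z * f (sqrt v * z))"
proof -
  have [measurable]: "Y \<in> borel_measurable M" and
    eq: "distr M borel Y = distr std_normal_distribution borel (\<lambda>z. sqrt v * z)"
    using assms by (auto simp: centered_normal_def)
  have "(\<integral>\<omega>. f (Y \<omega>) \<partial>M) = (\<integral>y. f y \<partial>distr M borel Y)"
    by (simp add: integral_distr)
  also have "\<dots> = (\<integral>z. f (sqrt v * z) \<partial>std_normal_distribution)"
    unfolding eq by (simp add: integral_distr)
  also have "\<dots> = (\<integral>z. std_normal_density z * f (sqrt v * z) \<partial>lborel)"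
    by (subst integral_density) auto
  finally show "(\<integral>\<omega>. f (Y \<omega>) \<partial>M) = (\<integral>z. std_normal_density z * f (sqrt v * z) \<partial>lborel)" .
  have "integrable M (\<lambda>\<omega>. f (Y \<omega>)) \<longleftrightarrow> integrable (distr M borel Y) f"
    by (simp add: integrable_distr_eq)
  also have "\<dots> \<longleftrightarrow> integrable std_normal_distribution (\<lambda>z. f (sqrt v * z))"
    unfolding eq by (simp add: integrable_distr_eq)
  also have "\<dots> \<longleftrightarrow> integrable lborel (\<lambda>z. std_normal_density z * f (sqrt v * z))"
    by (subst integrable_density) auto
  finally show "integrable M (\<lambda>\<omega>. f (Y \<omega>)) \<longleftrightarrow>
      integrable lborel (\<lambda>z. std_normal_density z * f (sqrt v * z))" .
qed

lemma centered_normal_moments: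
  assumes "centered_normal M Y v"
  shows "integrable M (\<lambda>\<omega>. Y \<omega> ^ k)"
    and "(\<integral>\<omega>. Y \<omega> ^ k \<partial>M) = sqrt v ^ k * (\<integral>z. std_normal_density z * z ^ k \<partial>lborel)"
proof -
  have i: "integrable lborel (\<lambda>z. std_normal_density z * z ^ k)"
    by (rule integrable_std_normal_moment)
  have eq: "(\<lambda>z. std_normal_density z * (sqrt v * z) ^ k) = (\<lambda>z. sqrt v ^ k * (std_normal_density z * z ^ k))"
    by (auto simp: power_mult_distrib)
  show "integrable M (\<lambda>\<omega>. Y \<omega> ^ k)"
    using i by (subst centered_normal_integral(2)[OF assms]) (auto simp: eq simp del: integrable_mult_left_iff)
  show "(\<integral>\<omega>. Y \<omega> ^ k \<partial>M) = sqrt v ^ k * (\<integral>z. std_normal_density z * z ^ k \<partial>lborel)"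
    by (subst centered_normal_integral(1)[OF assms]) (auto simp: eq)
qed

lemma centered_normal_second_moment:
  assumes "centered_normal M Y v"
  shows "(\<integral>\<omega>. (Y \<omega>)\<^sup>2 \<partial>M) = v"
  using centered_normal_moments(2)[OF assms, of 2] integral_std_normal_moment_even[of 1] assms
  by (simp add: centered_normal_def)

lemma centered_normal_cos_sin:
  assumes "centered_normal M Y v"
  shows "(\<integral>\<omega>. cos (Y \<omega>) \<partial>M) = exp (- v / 2)" "(\<integral>\<omega>. sin (Y \<omega>) \<partial>M) = 0"
proof -
  have [measurable]: "Y \<in> borel_measurable M" using assms by (auto simp: centered_normal_def)
  have "prob_space (distr std_normal_distribution borel (\<lambda>z. sqrt v * z))"
    by (rule prob_space.prob_space_distr, rule prob_space_normal_density) auto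
  then have p: "prob_space (distr M borel Y)" using assms by (simp add: centered_normal_def)
  interpret prob_space M
    using prob_space_distrD[OF _ p] by simp
  have i: "integrable M (\<lambda>\<omega>. iexp (Y \<omega>))"
    by (rule integrable_const_bound[where B=1]) auto
  have 1: "(\<integral>\<omega>. iexp (Y \<omega>) \<partial>M) = exp (- v / 2)"
    using centered_normal_char[OF assms, of 1] by (simp add: char_def integral_distr)
  have "(\<integral>\<omega>. cos (Y \<omega>) \<partial>M) = Re (\<integral>\<omega>. iexp (Y \<omega>) \<partial>M)"
    by (simp add: integral_Re[OF i, symmetric] Re_exp)
  then show "(\<integral>\<omega>. cos (Y \<omega>) \<partial>M) = exp (- v / 2)" by (simp add: 1)
  have "(\<integral>\<omega>. sin (Y \<omega>) \<partial>M) = Im (\<integral>\<omega>. iexp (Y \<omega>) \<partial>M)"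
    by (simp add: integral_Im[OF i, symmetric] Im_exp)
  then show "(\<integral>\<omega>. sin (Y \<omega>) \<partial>M) = 0" by (simp add: 1)
qed

lemma gaussian_variable_centered_normal:
  assumes "prob_space M" "gaussian_variable M Y" and mean: "(\<integral>\<omega>. Y \<omega> \<partial>M) = 0"
  shows "centered_normal M Y (\<integral>\<omega>. (Y \<omega>)\<^sup>2 \<partial>M)"
proof -
  interpret prob_space M by fact
  have [measurable]: "Y \<in> borel_measurable M"
    using assms by (auto simp: gaussian_variable_def)
  obtain m where m: "(AE \<omega> in M. Y \<omega> = m) \<or> (\<exists>\<sigma>>0. distributed M lborel Y (normal_density m \<sigma>))"
    using assms by (auto simp: gaussian_variable_def)
  have "\<exists>v. centered_normal M Y v"
    using m
  proof (elim disjE exE conjE)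
    assume ae: "AE \<omega> in M. Y \<omega> = m"
    have "(\<integral>\<omega>. Y \<omega> \<partial>M) = (\<integral>\<omega>. m \<partial>M)"
      using ae by (intro integral_cong_AE) auto
    then have m0: "m = 0" using mean by (simp add: prob_space)
    have "centered_normal M Y 0"
    proof (rule centered_normalI_char)
      fix t
      have "char (distr M borel Y) t = (\<integral>\<omega>. iexp (t * Y \<omega>) \<partial>M)"
        by (simp add: char_def integral_distr)
      also have "\<dots> = (\<integral>\<omega>. 1 \<partial>M)"
        using ae by (intro integral_cong_AE) (auto simp: m0)
      finally show "char (distr M borel Y) t = complex_of_real (exp (- (0 * t\<^sup>2) / 2))" by (simp add: prob_space)
    qed (auto intro: prob_space_axioms)
    then show ?thesis by blast
  next
    fix \<sigma> :: real assume s: "0 < \<sigma>" and d: "distributed M lborel Y (normal_density m \<sigma>)"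
    have "m = 0" using normal_distributed_expectation[OF s d] mean by simp
    then have d': "distributed M lborel (\<lambda>x. Y x / \<sigma>) std_normal_density"
      using d normal_standard_normal_convert[OF s, of Y 0] by simp
    have "distr M borel Y = distr (distr M lborel (\<lambda>x. Y x / \<sigma>)) borel (\<lambda>z. \<sigma> * z)"
      using s by (subst distr_distr) (auto simp: comp_def)
    also have "distr M lborel (\<lambda>x. Y x / \<sigma>) = std_normal_distribution"
      using d' by (simp add: distributed_def)
    finally have "centered_normal M Y (\<sigma>\<^sup>2)"
      using s by (simp add: centered_normal_def)
    then show ?thesis by blast
  qed
  then obtain v where v: "centered_normal M Y v" by blast
  then show ?thesis using centered_normal_second_moment[OF v] by simp
qed

lemma integrable_mult_of_squares:
  fixes f g :: "'a \<Rightarrow> real"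
  assumes [measurable]: "f \<in> borel_measurable M" "g \<in> borel_measurable M"
    and i: "integrable M (\<lambda>\<omega>. (f \<omega>)\<^sup>2)" "integrable M (\<lambda>\<omega>. (g \<omega>)\<^sup>2)"
  shows "integrable M (\<lambda>\<omega>. f \<omega> * g \<omega>)"
proof (rule Bochner_Integration.integrable_bound[where f="\<lambda>\<omega>. (f \<omega>)\<^sup>2 + (g \<omega>)\<^sup>2"])
  show "AE \<omega> in M. norm (f \<omega> * g \<omega>) \<le> norm ((f \<omega>)\<^sup>2 + (g \<omega>)\<^sup>2)"
  proof (rule AE_I2)
    fix \<omega>
    have "2 * \<bar>f \<omega>\<bar> * \<bar>g \<omega>\<bar> \<le> (f \<omega>)\<^sup>2 + (g \<omega>)\<^sup>2"
      using sum_squares_bound[of "\<bar>f \<omega>\<bar>" "\<bar>g \<omega>\<bar>"] by simp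
    moreover have "0 \<le> \<bar>f \<omega>\<bar> * \<bar>g \<omega>\<bar>" by simp
    ultimately show "norm (f \<omega> * g \<omega>) \<le> norm ((f \<omega>)\<^sup>2 + (g \<omega>)\<^sup>2)"
      unfolding real_norm_def abs_mult by linarith
  qed
qed (use i in auto)

lemma gaussian_process_linear_combination:
  assumes "prob_space M" and g: "centered_gaussian_process M I Y" and J: "finite J" "J \<subseteq> I"
  shows "centered_normal M (\<lambda>\<omega>. \<Sum>j\<in>J. c j * Y j \<omega>) (\<Sum>i\<in>J. \<Sum>j\<in>J. c i * c j * (\<integral>\<omega>. Y i \<omega> * Y j \<omega> \<partial>M))"
proof -
  interpret prob_space M by fact
  have gv: "gaussian_variable M (\<lambda>\<omega>. \<Sum>j\<in>J. c j * Y j \<omega>)" if "finite J" "J \<subseteq> I" for J c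
    using g that by (auto simp: centered_gaussian_process_def gaussian_process_def)
  have single: "centered_normal M (Y i) (\<integral>\<omega>. (Y i \<omega>)\<^sup>2 \<partial>M)" if "i \<in> I" for i
  proof (rule gaussian_variable_centered_normal)
    show "gaussian_variable M (Y i)" using gv[of "{i}" "\<lambda>_. 1"] that by simp
    show "(\<integral>\<omega>. Y i \<omega> \<partial>M) = 0" using g that by (auto simp: centered_gaussian_process_def)
  qed unfold_locales
  have m[measurable]: "Y i \<in> borel_measurable M" if "i \<in> I" for i
    using single[OF that] by (simp add: centered_normal_def)
  have i1: "integrable M (Y i)" and i2: "integrable M (\<lambda>\<omega>. (Y i \<omega>)\<^sup>2)" if "i \<in> I" for i
    using centered_normal_moments(1)[OF single[OF that], of 1] centered_normal_moments(1)[OF single[OF that], of 2] by auto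
  have i3: "integrable M (\<lambda>\<omega>. Y i \<omega> * Y j \<omega>)" if "i \<in> I" "j \<in> I" for i j
    using m i2 that by (intro integrable_mult_of_squares) auto
  have "centered_normal M (\<lambda>\<omega>. \<Sum>j\<in>J. c j * Y j \<omega>) (\<integral>\<omega>. (\<Sum>j\<in>J. c j * Y j \<omega>)\<^sup>2 \<partial>M)"
  proof (rule gaussian_variable_centered_normal[OF _ gv[OF J]])
    show "(\<integral>\<omega>. (\<Sum>j\<in>J. c j * Y j \<omega>) \<partial>M) = 0"
      using i1 J g by (subst Bochner_Integration.integral_sum) (auto simp: centered_gaussian_process_def subset_iff)
  qed unfold_locales
  also have "(\<integral>\<omega>. (\<Sum>j\<in>J. c j * Y j \<omega>)\<^sup>2 \<partial>M) = (\<integral>\<omega>. (\<Sum>i\<in>J. \<Sum>j\<in>J. (c i * c j) * (Y i \<omega> * Y j \<omega>)) \<partial>M)"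
    by (simp add: power2_eq_square sum_product mult_ac)
  also have "\<dots> = (\<Sum>i\<in>J. \<Sum>j\<in>J. c i * c j * (\<integral>\<omega>. Y i \<omega> * Y j \<omega> \<partial>M))"
    using i3 J by (subst Bochner_Integration.integral_sum, fastforce intro: Bochner_Integration.integrable_sum)
      (intro sum.cong refl, subst Bochner_Integration.integral_sum, auto simp: subset_iff)
  finally show ?thesis .
qed

lemma (in prob_space) centered_normal_add:
  assumes X: "centered_normal M X v" and Y: "centered_normal M Y w" and ind: "indep_var borel X borel Y"
  shows "centered_normal M (\<lambda>\<omega>. X \<omega> + Y \<omega>) (v + w)"
proof (rule centered_normalI_char)
  show "(\<lambda>\<omega>. X \<omega> + Y \<omega>) \<in> borel_measurable M" "0 \<le> v + w"
    using X Y by (auto simp: centered_normal_def)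
  show "char (distr M borel (\<lambda>\<omega>. X \<omega> + Y \<omega>)) t = complex_of_real (exp (- ((v + w) * t\<^sup>2) / 2))" for t
  proof -
    have "exp (- (v * t\<^sup>2) / 2) * exp (- (w * t\<^sup>2) / 2) = exp (- ((v + w) * t\<^sup>2) / 2)"
      by (simp add: exp_add[symmetric] field_simps)
    then show ?thesis
      by (simp only: char_distr_add[OF ind] centered_normal_char[OF X] centered_normal_char[OF Y] of_real_mult[symmetric])
  qed
qed unfold_locales

text \<open>
  Reweighting \<open>M\<close> by the density \<open>g / E g\<close> does not change the characteristic function of \<open>U\<close>. By
  uniqueness it does not change the law of \<open>U\<close> either, which is the claim.
\<close>

lemma (in prob_space) weighted_char_factorization:
  fixes U g :: "'a \<Rightarrow> real"
  assumes [measurable]: "U \<in> borel_measurable M" "g \<in> borel_measurable M"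
    and g: "\<And>\<omega>. \<omega> \<in> space M \<Longrightarrow> 0 \<le> g \<omega>" "\<And>\<omega>. \<omega> \<in> space M \<Longrightarrow> g \<omega> \<le> B"
    and c: "\<And>\<alpha>. (\<integral>\<omega>. g \<omega> * cos (\<alpha> * U \<omega>) \<partial>M) = (\<integral>\<omega>. g \<omega> \<partial>M) * (\<integral>\<omega>. cos (\<alpha> * U \<omega>) \<partial>M)"
    and s: "\<And>\<alpha>. (\<integral>\<omega>. g \<omega> * sin (\<alpha> * U \<omega>) \<partial>M) = (\<integral>\<omega>. g \<omega> \<partial>M) * (\<integral>\<omega>. sin (\<alpha> * U \<omega>) \<partial>M)"
    and [measurable]: "A \<in> sets borel"
  shows "(\<integral>\<omega>. g \<omega> * indicator A (U \<omega>) \<partial>M) = (\<integral>\<omega>. g \<omega> \<partial>M) * (\<integral>\<omega>. indicator A (U \<omega>) \<partial>M)"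
proof -
  define G where "G = (\<integral>\<omega>. g \<omega> \<partial>M)"
  have ig: "integrable M g"
    using g by (intro integrable_const_bound[where B=B]) auto
  have G0: "0 \<le> G" unfolding G_def using g by (auto intro: integral_nonneg_AE)
  show ?thesis
  proof (cases "G = 0")
    case True
    then have "AE \<omega> in M. g \<omega> = 0"
      using integral_nonneg_eq_0_iff_AE[OF ig] g by (simp add: G_def)
    then have "(\<integral>\<omega>. g \<omega> * indicator A (U \<omega>) \<partial>M) = (\<integral>\<omega>. 0 \<partial>M)"
      by (intro integral_cong_AE) auto
    then show ?thesis using True by (simp add: G_def)
  next
    case False
    then have Gp: "0 < G" using G0 by simp
    define Q where "Q = density M (\<lambda>\<omega>. ennreal (g \<omega> / G))"
    have iQ: "(\<integral>\<omega>. f \<omega> \<partial>Q) = (\<integral>\<omega>. g \<omega> * f \<omega> \<partial>M) / G"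
      if "f \<in> borel_measurable M" for f :: "'a \<Rightarrow> real"
      unfolding Q_def using that g Gp
      by (subst integral_density) (auto simp: AE_I2)
    have "emeasure Q (space Q) = (\<integral>\<^sup>+\<omega>. ennreal (g \<omega> / G) \<partial>M)"
      unfolding Q_def by (simp add: emeasure_density space_density cong: nn_integral_cong)
    also have "\<dots> = ennreal (\<integral>\<omega>. g \<omega> / G \<partial>M)"
      using g Gp ig by (intro nn_integral_eq_integral) auto
    also have "\<dots> = 1" using Gp by (simp add: G_def)
    finally have pQ: "prob_space Q" by (rule prob_spaceI)
    interpret Q: prob_space Q by fact
    have [measurable]: "U \<in> borel_measurable Q" by (simp add: Q_def)
    have "distr Q borel U = distr M borel U"
    proof (rule Levy_uniqueness)
      show "char (distr Q borel U) = char (distr M borel U)"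
      proof
        fix t
        have i: "integrable M (\<lambda>\<omega>. iexp (t * U \<omega>))"
          by (rule integrable_const_bound[where B=1]) auto
        have j: "integrable Q (\<lambda>\<omega>. iexp (t * U \<omega>))"
          by (rule Q.integrable_const_bound[where B=1]) auto
        have 1: "char (distr Q borel U) t = (\<integral>\<omega>. iexp (t * U \<omega>) \<partial>Q)"
          "char (distr M borel U) t = (\<integral>\<omega>. iexp (t * U \<omega>) \<partial>M)"
          by (simp_all add: char_def integral_distr)
        show "char (distr Q borel U) t = char (distr M borel U) t"
          unfolding 1
        proof (rule complex_eqI)
          show "Re (\<integral>\<omega>. iexp (t * U \<omega>) \<partial>Q) = Re (\<integral>\<omega>. iexp (t * U \<omega>) \<partial>M)"
            unfolding integral_Re[OF i, symmetric] integral_Re[OF j, symmetric]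
            using Gp c[of t] by (simp add: Re_exp iQ G_def)
          show "Im (\<integral>\<omega>. iexp (t * U \<omega>) \<partial>Q) = Im (\<integral>\<omega>. iexp (t * U \<omega>) \<partial>M)"
            unfolding integral_Im[OF i, symmetric] integral_Im[OF j, symmetric]
            using Gp s[of t] by (simp add: Im_exp iQ G_def)
        qed
      qed
    qed (auto intro: real_distribution_distr Q.real_distribution_distr)
    then have "(\<integral>y. indicator A y \<partial>distr Q borel U) = (\<integral>y. indicator A y \<partial>distr M borel U :: real)"
      by simp
    then have "(\<integral>\<omega>. indicator A (U \<omega>) \<partial>Q) = (\<integral>\<omega>. indicator A (U \<omega>) \<partial>M :: real)"
      by (subst (asm) (1 2) integral_distr) auto
    then show ?thesis
      using Gp by (simp add: iQ G_def[symmetric] field_simps del: integral_indicator)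
  qed
qed

text \<open>
  Independence follows from the factorization of the joint characteristic function using uniqueness
  of characteristic functions on the line only. First \<open>U\<close> is seen under the weights \<open>1 + cos (\<beta> W)\<close>
  and \<open>1 + sin (\<beta> W)\<close>, where the constant 1 makes the weight nonnegative. This gives the
  factorization of \<open>cos (\<beta> W)\<close> and \<open>sin (\<beta> W)\<close> against indicators of events of \<open>U\<close>, so that \<open>W\<close> can
  then be seen under these indicators as weights.
\<close>

lemma (in prob_space) indep_var_if_char_factors:
  fixes U W :: "'a \<Rightarrow> real"
  assumes U[measurable]: "U \<in> borel_measurable M" and W[measurable]: "W \<in> borel_measurable M"
    and c: "\<And>\<alpha> \<beta>. (\<integral>\<omega>. cos (\<alpha> * U \<omega> + \<beta> * W \<omega>) \<partial>M) = exp (- (\<alpha>\<^sup>2 * s + \<beta>\<^sup>2 * t) / 2)"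
    and sn: "\<And>\<alpha> \<beta>. (\<integral>\<omega>. sin (\<alpha> * U \<omega> + \<beta> * W \<omega>) \<partial>M) = 0"
  shows "indep_var borel U borel W"
proof -
  have ib: "integrable M f" if "f \<in> borel_measurable M" "\<And>\<omega>. \<bar>f \<omega>\<bar> \<le> 1" for f :: "'a \<Rightarrow> real"
    using that by (intro integrable_const_bound[where B=1]) auto
  have cU: "(\<integral>\<omega>. cos (\<alpha> * U \<omega>) \<partial>M) = exp (- (\<alpha>\<^sup>2 * s) / 2)" and sU: "(\<integral>\<omega>. sin (\<alpha> * U \<omega>) \<partial>M) = 0"
    and cW: "(\<integral>\<omega>. cos (\<alpha> * W \<omega>) \<partial>M) = exp (- (\<alpha>\<^sup>2 * t) / 2)" and sW: "(\<integral>\<omega>. sin (\<alpha> * W \<omega>) \<partial>M) = 0"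
    for \<alpha>
    using c[of \<alpha> 0] sn[of \<alpha> 0] c[of 0 \<alpha>] sn[of 0 \<alpha>] by simp_all
  have ci: "integrable M (\<lambda>\<omega>. cos (\<alpha> * U \<omega> + \<beta> * W \<omega>))"
    and si: "integrable M (\<lambda>\<omega>. sin (\<alpha> * U \<omega> + \<beta> * W \<omega>))" for \<alpha> \<beta>
    by (intro ib; simp)+
  have cc: "(\<integral>\<omega>. cos (\<beta> * W \<omega>) * cos (\<alpha> * U \<omega>) \<partial>M) = exp (- (\<beta>\<^sup>2 * t) / 2) * exp (- (\<alpha>\<^sup>2 * s) / 2)" for \<alpha> \<beta>
  proof -
    have "(\<integral>\<omega>. cos (\<beta> * W \<omega>) * cos (\<alpha> * U \<omega>) \<partial>M)
      = (\<integral>\<omega>. (cos (\<alpha> * U \<omega> + \<beta> * W \<omega>) + cos (\<alpha> * U \<omega> + (-\<beta>) * W \<omega>)) / 2 \<partial>M)"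
      by (intro Bochner_Integration.integral_cong) (auto simp: cos_add cos_diff sin_diff)
    also have "\<dots> = exp (- (\<alpha>\<^sup>2 * s + \<beta>\<^sup>2 * t) / 2)"
      by (simp only: integral_divide_zero Bochner_Integration.integral_add[OF ci ci] c) simp
    finally show ?thesis by (simp add: exp_add[symmetric] field_simps)
  qed
  have ss: "(\<integral>\<omega>. sin (\<beta> * W \<omega>) * sin (\<alpha> * U \<omega>) \<partial>M) = 0" for \<alpha> \<beta>
  proof -
    have "(\<integral>\<omega>. sin (\<beta> * W \<omega>) * sin (\<alpha> * U \<omega>) \<partial>M)
      = (\<integral>\<omega>. (cos (\<alpha> * U \<omega> + (-\<beta>) * W \<omega>) - cos (\<alpha> * U \<omega> + \<beta> * W \<omega>)) / 2 \<partial>M)"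
      by (intro Bochner_Integration.integral_cong) (auto simp: cos_add cos_diff sin_diff)
    also have "\<dots> = 0"
      by (simp only: integral_divide_zero Bochner_Integration.integral_diff[OF ci ci] c) simp
    finally show ?thesis .
  qed
  have sc: "(\<integral>\<omega>. sin (\<beta> * W \<omega>) * cos (\<alpha> * U \<omega>) \<partial>M) = 0" for \<alpha> \<beta>
  proof -
    have "(\<integral>\<omega>. sin (\<beta> * W \<omega>) * cos (\<alpha> * U \<omega>) \<partial>M)
      = (\<integral>\<omega>. (sin (\<alpha> * U \<omega> + \<beta> * W \<omega>) - sin (\<alpha> * U \<omega> + (-\<beta>) * W \<omega>)) / 2 \<partial>M)"
      by (intro Bochner_Integration.integral_cong) (auto simp: sin_add cos_diff sin_diff)
    also have "\<dots> = 0"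
      by (simp only: integral_divide_zero Bochner_Integration.integral_diff[OF si si] sn) simp
    finally show ?thesis .
  qed
  have cs: "(\<integral>\<omega>. cos (\<beta> * W \<omega>) * sin (\<alpha> * U \<omega>) \<partial>M) = 0" for \<alpha> \<beta>
  proof -
    have "(\<integral>\<omega>. cos (\<beta> * W \<omega>) * sin (\<alpha> * U \<omega>) \<partial>M)
      = (\<integral>\<omega>. (sin (\<alpha> * U \<omega> + \<beta> * W \<omega>) + sin (\<alpha> * U \<omega> + (-\<beta>) * W \<omega>)) / 2 \<partial>M)"
      by (intro Bochner_Integration.integral_cong) (auto simp: sin_add cos_diff sin_diff)
    also have "\<dots> = 0"
      by (simp only: integral_divide_zero Bochner_Integration.integral_add[OF si si] sn) simp
    finally show ?thesis .
  qed
  have i2: "integrable M (\<lambda>\<omega>. f \<omega> * g \<omega>)"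
    if "f \<in> borel_measurable M" "\<And>\<omega>. \<bar>f \<omega>\<bar> \<le> 1" "g \<in> borel_measurable M" "\<And>\<omega>. \<bar>g \<omega>\<bar> \<le> 1"
    for f g :: "'a \<Rightarrow> real"
    using that by (intro ib) (auto simp: abs_mult intro: mult_le_one)
  have A: "(\<integral>\<omega>. f \<omega> * indicator A (U \<omega>) \<partial>M) = (\<integral>\<omega>. f \<omega> \<partial>M) * (\<integral>\<omega>. indicator A (U \<omega>) \<partial>M)"
    if [measurable]: "A \<in> sets borel" and f[measurable]: "f \<in> borel_measurable M" "\<And>\<omega>. \<bar>f \<omega>\<bar> \<le> 1"
      and fc: "\<And>\<alpha>. (\<integral>\<omega>. f \<omega> * cos (\<alpha> * U \<omega>) \<partial>M) = (\<integral>\<omega>. f \<omega> \<partial>M) * (\<integral>\<omega>. cos (\<alpha> * U \<omega>) \<partial>M)"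
      and fs: "\<And>\<alpha>. (\<integral>\<omega>. f \<omega> * sin (\<alpha> * U \<omega>) \<partial>M) = (\<integral>\<omega>. f \<omega> \<partial>M) * (\<integral>\<omega>. sin (\<alpha> * U \<omega>) \<partial>M)"
    for A f
  proof -
    have add: "(\<integral>\<omega>. (1 + f \<omega>) * g \<omega> \<partial>M) = (\<integral>\<omega>. g \<omega> \<partial>M) + (\<integral>\<omega>. f \<omega> * g \<omega> \<partial>M)"
      if "g \<in> borel_measurable M" "\<And>\<omega>. \<bar>g \<omega>\<bar> \<le> 1" for g
    proof -
      have "(\<integral>\<omega>. (1 + f \<omega>) * g \<omega> \<partial>M) = (\<integral>\<omega>. g \<omega> + f \<omega> * g \<omega> \<partial>M)"
        by (simp add: algebra_simps)
      also have "\<dots> = (\<integral>\<omega>. g \<omega> \<partial>M) + (\<integral>\<omega>. f \<omega> * g \<omega> \<partial>M)"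
        using that f by (intro Bochner_Integration.integral_add ib i2) auto
      finally show ?thesis .
    qed
    have one: "(\<integral>\<omega>. 1 + f \<omega> \<partial>M) = 1 + (\<integral>\<omega>. f \<omega> \<partial>M)"
      using f by (subst Bochner_Integration.integral_add) (auto intro!: ib simp: prob_space)
    have "(\<integral>\<omega>. (1 + f \<omega>) * indicator A (U \<omega>) \<partial>M) = (\<integral>\<omega>. 1 + f \<omega> \<partial>M) * (\<integral>\<omega>. indicator A (U \<omega>) \<partial>M)"
    proof (rule weighted_char_factorization[where B=2])
      show "0 \<le> 1 + f \<omega>" "1 + f \<omega> \<le> 2" for \<omega> using f(2)[of \<omega>] by (auto simp: abs_le_iff)
      show "(\<integral>\<omega>. (1 + f \<omega>) * cos (\<alpha> * U \<omega>) \<partial>M) = (\<integral>\<omega>. 1 + f \<omega> \<partial>M) * (\<integral>\<omega>. cos (\<alpha> * U \<omega>) \<partial>M)" for \<alpha>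
        by (subst add) (auto simp: fc one algebra_simps)
      show "(\<integral>\<omega>. (1 + f \<omega>) * sin (\<alpha> * U \<omega>) \<partial>M) = (\<integral>\<omega>. 1 + f \<omega> \<partial>M) * (\<integral>\<omega>. sin (\<alpha> * U \<omega>) \<partial>M)" for \<alpha>
        by (subst add) (auto simp: fs one algebra_simps)
    qed auto
    then show ?thesis
      by (subst (asm) add) (auto simp: one algebra_simps indicator_def)
  qed
  have AW: "(\<integral>\<omega>. cos (\<beta> * W \<omega>) * indicator A (U \<omega>) \<partial>M) = (\<integral>\<omega>. cos (\<beta> * W \<omega>) \<partial>M) * (\<integral>\<omega>. indicator A (U \<omega>) \<partial>M)"
    "(\<integral>\<omega>. sin (\<beta> * W \<omega>) * indicator A (U \<omega>) \<partial>M) = (\<integral>\<omega>. sin (\<beta> * W \<omega>) \<partial>M) * (\<integral>\<omega>. indicator A (U \<omega>) \<partial>M)"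
    if "A \<in> sets borel" for A \<beta>
    using that by (intro A; simp add: cc cs sc ss cU sU cW sW)+
  have AB: "(\<integral>\<omega>. indicator A (U \<omega>) * indicator B (W \<omega>) \<partial>M)
      = (\<integral>\<omega>. indicator A (U \<omega>) \<partial>M) * (\<integral>\<omega>. indicator B (W \<omega>) \<partial>M :: real)"
    if [measurable]: "A \<in> sets borel" "B \<in> sets borel" for A B
    using AW[OF that(1)]
    by (intro weighted_char_factorization[where B=1]) (auto simp: mult.commute)
  show ?thesis
    unfolding indep_var_eq
  proof (intro conjI indep_set_sigma_sets)
    show "indep_set {U -` A \<inter> space M |A. A \<in> sets borel} {W -` A \<inter> space M |A. A \<in> sets borel}"
    proof (rule indep_setI)
      fix a b assume "a \<in> {U -` A \<inter> space M |A. A \<in> sets borel}" "b \<in> {W -` A \<inter> space M |A. A \<in> sets borel}"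
      then obtain A B where a: "a = U -` A \<inter> space M" and b: "b = W -` B \<inter> space M"
        and [measurable]: "A \<in> sets borel" "B \<in> sets borel" by auto
      have "prob (a \<inter> b) = (\<integral>\<omega>. indicator (a \<inter> b) \<omega> \<partial>M)" by (simp add: a b)
      also have "\<dots> = (\<integral>\<omega>. indicator A (U \<omega>) * indicator B (W \<omega>) \<partial>M)"
        by (intro Bochner_Integration.integral_cong) (auto simp: a b indicator_def)
      also have "\<dots> = (\<integral>\<omega>. indicator A (U \<omega>) \<partial>M) * (\<integral>\<omega>. indicator B (W \<omega>) \<partial>M)"
        by (intro AB) auto
      also have "(\<integral>\<omega>. indicator A (U \<omega>) \<partial>M) = (\<integral>\<omega>. indicator a \<omega> \<partial>M :: real)"
        by (intro Bochner_Integration.integral_cong) (auto simp: a indicator_def)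
      also have "(\<integral>\<omega>. indicator B (W \<omega>) \<partial>M) = (\<integral>\<omega>. indicator b \<omega> \<partial>M :: real)"
        by (intro Bochner_Integration.integral_cong) (auto simp: b indicator_def)
      finally show "prob (a \<inter> b) = prob a * prob b" by (simp add: a b)
    qed auto
    show "Int_stable {U -` A \<inter> space M |A. A \<in> sets borel}" "Int_stable {W -` A \<inter> space M |A. A \<in> sets borel}"
      by (auto simp: Int_stable_def; metis sets.Int vimage_Int Int_assoc Int_left_commute Int_absorb)+
  qed auto
qed

text \<open>
  Regression of \<open>V\<close> on \<open>U\<close>: write \<open>V = k U + W\<close> with \<open>k = c / s\<close> and \<open>W\<close> independent of \<open>U\<close> (if
  \<open>s = 0\<close>, then \<open>U\<close> is almost surely 0). Since \<open>\<phi>(U)\<close> and \<open>\<phi>(W)\<close> are independent, the covariance is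
  that of \<open>\<phi>(U) - \<phi>(0)\<close> and \<open>\<phi>(V) - \<phi>(W)\<close>. These are bounded by \<open>\<bar>U\<bar>\<close> and \<open>\<bar>k U\<bar>\<close>, so the mean of
  the product and the product of the means are each at most \<open>\<bar>k\<bar> s = \<bar>c\<bar>\<close>.
\<close>

lemma (in prob_space) normal_pair_covariance_bound:
  fixes \<phi> :: "real \<Rightarrow> real"
  assumes U[measurable]: "U \<in> borel_measurable M" and V[measurable]: "V \<in> borel_measurable M"
    and pair: "\<And>\<alpha> \<beta>. centered_normal M (\<lambda>\<omega>. \<alpha> * U \<omega> + \<beta> * V \<omega>) (\<alpha>\<^sup>2 * s + 2 * \<alpha> * \<beta> * c + \<beta>\<^sup>2 * t)"
    and lip: "\<And>x y. \<bar>\<phi> x - \<phi> y\<bar> \<le> \<bar>x - y\<bar>"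
  shows "\<bar>(\<integral>\<omega>. \<phi> (U \<omega>) * \<phi> (V \<omega>) \<partial>M) - (\<integral>\<omega>. \<phi> (U \<omega>) \<partial>M) * (\<integral>\<omega>. \<phi> (V \<omega>) \<partial>M)\<bar> \<le> 2 * \<bar>c\<bar>"
proof -
  have cont: "continuous_on UNIV \<phi>"
    by (rule lipschitz_on_continuous_on[where L=1]) (auto intro!: lipschitz_onI simp: dist_real_def lip)
  then have [measurable]: "\<phi> \<in> borel_measurable borel" by (rule borel_measurable_continuous_onI)
  have nU: "centered_normal M U s" and nV: "centered_normal M V t"
    using pair[of 1 0] pair[of 0 1] by simp_all
  have s0: "0 \<le> s" using nU by (simp add: centered_normal_def)
  have U2: "integrable M (\<lambda>\<omega>. (U \<omega>)\<^sup>2)" "(\<integral>\<omega>. (U \<omega>)\<^sup>2 \<partial>M) = s"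
    using centered_normal_moments(1)[OF nU] centered_normal_second_moment[OF nU] by auto
  have V2: "integrable M (\<lambda>\<omega>. (V \<omega>)\<^sup>2)"
    using centered_normal_moments(1)[OF nV] by auto
  have grow: "(\<phi> x)\<^sup>2 \<le> 2 * (\<phi> 0)\<^sup>2 + 2 * x\<^sup>2" for x
  proof -
    have "\<bar>\<phi> x\<bar> \<le> \<bar>\<phi> 0\<bar> + \<bar>x\<bar>" using lip[of x 0] by linarith
    then have "(\<phi> x)\<^sup>2 \<le> (\<bar>\<phi> 0\<bar> + \<bar>x\<bar>)\<^sup>2" by (metis abs_ge_zero power2_abs power_mono)
    also have "\<dots> \<le> 2 * (\<phi> 0)\<^sup>2 + 2 * x\<^sup>2"
      using sum_squares_bound[of "\<bar>\<phi> 0\<bar>" "\<bar>x\<bar>"] by (simp add: power2_sum)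
    finally show ?thesis .
  qed
  have sq: "integrable M (\<lambda>\<omega>. (\<phi> (Y \<omega>))\<^sup>2)"
    if [measurable]: "Y \<in> borel_measurable M" and i: "integrable M (\<lambda>\<omega>. (Y \<omega>)\<^sup>2)" for Y
    by (rule Bochner_Integration.integrable_bound[where f="\<lambda>\<omega>. 2 * (\<phi> 0)\<^sup>2 + 2 * (Y \<omega>)\<^sup>2"])
       (use i grow in auto)
  note pr = integrable_mult_of_squares[of _ M]
  have one: "integrable M (\<lambda>\<omega>. (1::real)\<^sup>2)" by simp
  have iU: "integrable M (\<lambda>\<omega>. \<phi> (U \<omega>))" and iV: "integrable M (\<lambda>\<omega>. \<phi> (V \<omega>))"
    and iUV: "integrable M (\<lambda>\<omega>. \<phi> (U \<omega>) * \<phi> (V \<omega>))"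
    using pr[OF _ _ sq[OF U U2(1)] one] pr[OF _ _ sq[OF V V2] one] pr[OF _ _ sq[OF U U2(1)] sq[OF V V2]]
    by simp_all
  have iaU: "integrable M (\<lambda>\<omega>. \<bar>U \<omega>\<bar>)"
    using pr[OF _ _ U2(1) one] by simp
  show ?thesis
  proof (cases "s = 0")
    case True
    have "AE \<omega> in M. (U \<omega>)\<^sup>2 = 0"
      using integral_nonneg_eq_0_iff_AE[OF U2(1)] U2(2) True by simp
    then have ae: "AE \<omega> in M. U \<omega> = 0" by simp
    have "(\<integral>\<omega>. \<phi> (U \<omega>) * \<phi> (V \<omega>) \<partial>M) = (\<integral>\<omega>. \<phi> 0 * \<phi> (V \<omega>) \<partial>M)"
      by (rule integral_cong_AE) (use ae in auto)
    moreover have "(\<integral>\<omega>. \<phi> (U \<omega>) \<partial>M) = (\<integral>\<omega>. \<phi> 0 \<partial>M)"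
      by (rule integral_cong_AE) (use ae in auto)
    ultimately show ?thesis by (simp add: prob_space)
  next
    case False
    then have s: "0 < s" using s0 by simp
    define k where "k = c / s"
    define W where "W = (\<lambda>\<omega>. V \<omega> - k * U \<omega>)"
    have W[measurable]: "W \<in> borel_measurable M" by (simp add: W_def)
    have W2: "integrable M (\<lambda>\<omega>. (W \<omega>)\<^sup>2)"
    proof -
      have "(\<lambda>\<omega>. (W \<omega>)\<^sup>2) = (\<lambda>\<omega>. (V \<omega>)\<^sup>2 + (k\<^sup>2 * (U \<omega>)\<^sup>2 - 2 * k * (U \<omega> * V \<omega>)))"
        by (auto simp: W_def power2_eq_square algebra_simps)
      then show ?thesis using V2 U2(1) pr[OF U V U2(1) V2] by auto
    qed
    have lin: "\<alpha> * U \<omega> + \<beta> * W \<omega> = (\<alpha> - \<beta> * k) * U \<omega> + \<beta> * V \<omega>" for \<alpha> \<beta> \<omega>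
      by (simp add: W_def algebra_simps)
    have var: "(\<alpha> - \<beta> * k)\<^sup>2 * s + 2 * (\<alpha> - \<beta> * k) * \<beta> * c + \<beta>\<^sup>2 * t = \<alpha>\<^sup>2 * s + \<beta>\<^sup>2 * (t - c\<^sup>2 / s)" for \<alpha> \<beta>
      using s by (simp add: k_def power2_eq_square field_simps)
    have ind: "indep_var borel U borel W"
    proof (rule indep_var_if_char_factors[OF U W])
      show "expectation (\<lambda>\<omega>. cos (\<alpha> * U \<omega> + \<beta> * W \<omega>)) = exp (- (\<alpha>\<^sup>2 * s + \<beta>\<^sup>2 * (t - c\<^sup>2 / s)) / 2)" for \<alpha> \<beta>
        unfolding lin centered_normal_cos_sin(1)[OF pair] var ..
      show "expectation (\<lambda>\<omega>. sin (\<alpha> * U \<omega> + \<beta> * W \<omega>)) = 0" for \<alpha> \<beta>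
        unfolding lin by (rule centered_normal_cos_sin(2)[OF pair])
    qed
    have ind': "indep_var borel (\<phi> \<circ> U) borel (\<phi> \<circ> W)"
      by (rule indep_var_compose[OF ind]) auto
    have iW: "integrable M (\<lambda>\<omega>. \<phi> (W \<omega>))" and iUW: "integrable M (\<lambda>\<omega>. \<phi> (U \<omega>) * \<phi> (W \<omega>))"
      using pr[OF _ _ sq[OF W W2] one] pr[OF _ _ sq[OF U U2(1)] sq[OF W W2]] by simp_all
    have prod: "(\<integral>\<omega>. \<phi> (U \<omega>) * \<phi> (W \<omega>) \<partial>M) = (\<integral>\<omega>. \<phi> (U \<omega>) \<partial>M) * (\<integral>\<omega>. \<phi> (W \<omega>) \<partial>M)"
      using indep_var_lebesgue_integral[OF ind'] iU iW by (simp add: comp_def)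
    define A where "A = (\<lambda>\<omega>. \<phi> (U \<omega>) - \<phi> 0)"
    define B where "B = (\<lambda>\<omega>. \<phi> (V \<omega>) - \<phi> (W \<omega>))"
    have Ab: "\<bar>A \<omega>\<bar> \<le> \<bar>U \<omega>\<bar>" for \<omega> using lip[of "U \<omega>" 0] by (simp add: A_def)
    have Bb: "\<bar>B \<omega>\<bar> \<le> \<bar>k\<bar> * \<bar>U \<omega>\<bar>" for \<omega>
      using lip[of "V \<omega>" "W \<omega>"] by (simp add: B_def W_def abs_mult)
    have iA: "integrable M A" and iB: "integrable M B" unfolding A_def B_def using iU iV iW by auto
    have iAB: "integrable M (\<lambda>\<omega>. A \<omega> * B \<omega>)"
    proof -
      have "(\<lambda>\<omega>. A \<omega> * B \<omega>) = (\<lambda>\<omega>. (\<phi> (U \<omega>) * \<phi> (V \<omega>) - \<phi> (U \<omega>) * \<phi> (W \<omega>)) - \<phi> 0 * (\<phi> (V \<omega>) - \<phi> (W \<omega>)))"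
        by (auto simp: A_def B_def algebra_simps)
      then show ?thesis using iUV iUW iV iW by auto
    qed
    have AB: "(\<integral>\<omega>. A \<omega> * B \<omega> \<partial>M) = ((\<integral>\<omega>. \<phi> (U \<omega>) * \<phi> (V \<omega>) \<partial>M) - (\<integral>\<omega>. \<phi> (U \<omega>) \<partial>M) * (\<integral>\<omega>. \<phi> (W \<omega>) \<partial>M))
       - \<phi> 0 * ((\<integral>\<omega>. \<phi> (V \<omega>) \<partial>M) - (\<integral>\<omega>. \<phi> (W \<omega>) \<partial>M))"
    proof -
      have "(\<lambda>\<omega>. A \<omega> * B \<omega>) = (\<lambda>\<omega>. (\<phi> (U \<omega>) * \<phi> (V \<omega>) - \<phi> (U \<omega>) * \<phi> (W \<omega>)) - \<phi> 0 * (\<phi> (V \<omega>) - \<phi> (W \<omega>)))"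
        by (auto simp: A_def B_def algebra_simps)
      then show ?thesis using iUV iUW iV iW by (simp add: prod)
    qed
    have EA: "(\<integral>\<omega>. A \<omega> \<partial>M) = (\<integral>\<omega>. \<phi> (U \<omega>) \<partial>M) - \<phi> 0"
      and EB: "(\<integral>\<omega>. B \<omega> \<partial>M) = (\<integral>\<omega>. \<phi> (V \<omega>) \<partial>M) - (\<integral>\<omega>. \<phi> (W \<omega>) \<partial>M)"
      unfolding A_def B_def using iU iV iW by (simp_all add: prob_space)
    have "(\<integral>\<omega>. \<phi> (U \<omega>) * \<phi> (V \<omega>) \<partial>M) - (\<integral>\<omega>. \<phi> (U \<omega>) \<partial>M) * (\<integral>\<omega>. \<phi> (V \<omega>) \<partial>M)
       = (\<integral>\<omega>. A \<omega> * B \<omega> \<partial>M) - (\<integral>\<omega>. A \<omega> \<partial>M) * (\<integral>\<omega>. B \<omega> \<partial>M)"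
      unfolding AB EA EB by (simp add: algebra_simps)
    moreover have "\<bar>\<integral>\<omega>. A \<omega> * B \<omega> \<partial>M\<bar> \<le> \<bar>c\<bar>"
    proof -
      have "\<bar>\<integral>\<omega>. A \<omega> * B \<omega> \<partial>M\<bar> \<le> (\<integral>\<omega>. \<bar>k\<bar> * (U \<omega>)\<^sup>2 \<partial>M)"
      proof (rule order.trans[OF integral_abs_bound integral_mono])
        show "\<bar>A \<omega> * B \<omega>\<bar> \<le> \<bar>k\<bar> * (U \<omega>)\<^sup>2" for \<omega>
          using mult_mono[OF Ab Bb, of \<omega> \<omega>] by (simp add: abs_mult power2_eq_square mult_ac)
      qed (use iAB U2 in auto)
      also have "\<dots> = \<bar>c\<bar>" using U2 s by (simp add: k_def)
      finally show ?thesis .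
    qed
    moreover have "\<bar>(\<integral>\<omega>. A \<omega> \<partial>M) * (\<integral>\<omega>. B \<omega> \<partial>M)\<bar> \<le> \<bar>c\<bar>"
    proof -
      define m where "m = (\<integral>\<omega>. \<bar>U \<omega>\<bar> \<partial>M)"
      have a: "\<bar>\<integral>\<omega>. A \<omega> \<partial>M\<bar> \<le> m" unfolding m_def
        by (rule order.trans[OF integral_abs_bound integral_mono]) (use iA iaU Ab in auto)
      have b: "\<bar>\<integral>\<omega>. B \<omega> \<partial>M\<bar> \<le> (\<integral>\<omega>. \<bar>k\<bar> * \<bar>U \<omega>\<bar> \<partial>M)"
        by (rule order.trans[OF integral_abs_bound integral_mono]) (use iB iaU Bb in auto)
      have m2: "m\<^sup>2 \<le> s"
        using variance_positive[of "\<lambda>\<omega>. \<bar>U \<omega>\<bar>"] variance_eq[of "\<lambda>\<omega>. \<bar>U \<omega>\<bar>"] iaU U2 by (simp add: m_def)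
      have "\<bar>(\<integral>\<omega>. A \<omega> \<partial>M) * (\<integral>\<omega>. B \<omega> \<partial>M)\<bar> \<le> m * (\<bar>k\<bar> * m)"
        unfolding abs_mult using a b by (intro mult_mono) (auto simp: m_def)
      also have "\<dots> \<le> \<bar>k\<bar> * s" using mult_left_mono[OF m2, of "\<bar>k\<bar>"] by (simp add: power2_eq_square mult_ac)
      also have "\<dots> = \<bar>c\<bar>" using s by (simp add: k_def)
      finally show ?thesis .
    qed
    ultimately show ?thesis by linarith
  qed
qed

section \<open>Continuously differentiable functions and their compact sets\<close>

text \<open>
  The pointwise topology on functions is Hausdorff because it is separated by the coordinates. The
  Stone-Weierstrass theorem is applied below to a compact subset of \<^typ>\<open>real \<times> (real \<Rightarrow> real)\<close> and
  requires this of the whole type.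
\<close>

instance "fun" :: (type, t0_space) t0_space
proof
  fix f g :: "'a \<Rightarrow> 'b" assume "f \<noteq> g"
  then obtain i where i: "f i \<noteq> g i" by auto
  then obtain U where U: "open U" "\<not> (f i \<in> U \<longleftrightarrow> g i \<in> U)"
    using separation_t0[THEN iffD1, OF i] by blast
  then show "\<exists>U. open U \<and> \<not> (f \<in> U \<longleftrightarrow> g \<in> U)"
    by (intro exI[of _ "(\<lambda>h. h i) -` U"]) (auto intro!: open_vimage)
qed

instance "fun" :: (type, t1_space) t1_space
proof
  fix f g :: "'a \<Rightarrow> 'b" assume "f \<noteq> g"
  then obtain i where i: "f i \<noteq> g i" by auto
  then obtain U where U: "open U" "f i \<in> U" "g i \<notin> U"
    using separation_t1[THEN iffD1, OF i] by blast
  then show "\<exists>U. open U \<and> f \<in> U \<and> g \<notin> U"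
    by (intro exI[of _ "(\<lambda>h. h i) -` U"]) (auto intro!: open_vimage)
qed

instance "fun" :: (type, t2_space) t2_space
proof
  fix f g :: "'a \<Rightarrow> 'b" assume "f \<noteq> g"
  then obtain i where i: "f i \<noteq> g i" by auto
  then obtain U V where UV: "open U" "open V" "f i \<in> U" "g i \<in> V" "U \<inter> V = {}"
    using hausdorff[OF i] by blast
  have "open ((\<lambda>h. h i) -` U)" "open ((\<lambda>h. h i) -` V)"
    using UV by (auto intro!: open_vimage)
  then show "\<exists>U V. open U \<and> open V \<and> f \<in> U \<and> g \<in> V \<and> U \<inter> V = {}"
    using UV by (intro exI[of _ "(\<lambda>h. h i) -` U"] exI[of _ "(\<lambda>h. h i) -` V"]) auto
qed

lemma c1_has_deriv:
  assumes "f \<in> c1_space a b" "t \<in> {a..b}"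
  shows "(f has_real_derivative c1_deriv a b f t) (at t within {a..b})"
  using assms vector_derivative_works[of f "at t within {a..b}"]
  by (auto simp: c1_space_def c1_deriv_def has_real_derivative_iff_has_vector_derivative
      differentiable_on_def)

lemma c1_derivI:
  assumes "a < b" "t \<in> {a..b}" "(f has_real_derivative d) (at t within {a..b})"
  shows "c1_deriv a b f t = d"
  using assms unfolding c1_deriv_def has_real_derivative_iff_has_vector_derivative
  by (intro vector_derivative_within_closed_interval)

lemma c1_spaceI:
  assumes "a < b" "f \<in> extensional {a..b}" "continuous_on {a..b} u"
    and d: "\<And>t. t \<in> {a..b} \<Longrightarrow> (f has_real_derivative u t) (at t within {a..b})"
  shows "f \<in> c1_space a b" "\<And>t. t \<in> {a..b} \<Longrightarrow> c1_deriv a b f t = u t"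
proof -
  show eq: "c1_deriv a b f t = u t" if "t \<in> {a..b}" for t
    using c1_derivI[OF assms(1) that d[OF that]] .
  have "continuous_on {a..b} (c1_deriv a b f)"
    using continuous_on_cong[of "{a..b}" "{a..b}" "c1_deriv a b f" u] eq assms(3) by simp
  moreover have "f differentiable_on {a..b}"
    unfolding differentiable_on_def
    using d field_differentiable_imp_differentiable field_differentiable_def by blast
  ultimately show "f \<in> c1_space a b" using assms(2) by (auto simp: c1_space_def)
qed

lemma c1_value_bound:
  assumes "f \<in> c1_space a b" "g \<in> c1_space a b" "t \<in> {a..b}"
    and e: "\<And>t. t \<in> {a..b} \<Longrightarrow> \<bar>c1_deriv a b f t - c1_deriv a b g t\<bar> \<le> e"
  shows "\<bar>f t - g t\<bar> \<le> \<bar>f a - g a\<bar> + e * (b - a)"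
proof -
  have a: "a \<in> {a..b}" using assms(3) by simp
  have "norm ((f t - g t) - (f a - g a)) \<le> e * norm (t - a)"
  proof (rule field_differentiable_bound[where S="{a..b}"])
    show "((\<lambda>t. f t - g t) has_real_derivative (c1_deriv a b f t - c1_deriv a b g t)) (at t within {a..b})"
      if "t \<in> {a..b}" for t
      by (intro DERIV_diff c1_has_deriv assms that)
  qed (use assms a in auto)
  also have "\<dots> \<le> e * (b - a)"
    using assms(3) e[OF a] by (intro mult_left_mono) auto
  finally show ?thesis by simp
qed

lemma c1_dist_le:
  assumes "f \<in> c1_space a b" "g \<in> c1_space a b" "a < b"
    and e0: "\<bar>f a - g a\<bar> \<le> e0"
    and e: "\<And>t. t \<in> {a..b} \<Longrightarrow> \<bar>c1_deriv a b f t - c1_deriv a b g t\<bar> \<le> e"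
  shows "c1_dist a b f g \<le> e0 + e * (b - a) + e"
proof -
  have "(SUP t\<in>{a..b}. \<bar>f t - g t\<bar>) \<le> e0 + e * (b - a)"
    using c1_value_bound[OF assms(1,2) _ e] e0 assms(3) by (intro cSUP_least) force+
  moreover have "(SUP t\<in>{a..b}. \<bar>c1_deriv a b f t - c1_deriv a b g t\<bar>) \<le> e"
    using e assms(3) by (intro cSUP_least) auto
  ultimately show ?thesis using assms by (simp add: c1_dist_def)
qed

lemma c1_dist_ge:
  assumes "f \<in> c1_space a b" "g \<in> c1_space a b" "t \<in> {a..b}"
  shows "\<bar>f t - g t\<bar> \<le> c1_dist a b f g"
proof -
  note S = c1_spaceD(1,2)
  have "a \<le> b" using assms by auto
  then show ?thesis
  using sup_abs_diff_upper[OF S(1)[OF assms(1)] S(1)[OF assms(2)] assms(3)]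
    sup_abs_diff_nonneg[OF _ S(2)[OF assms(1)] S(2)[OF assms(2)]] assms
  by (simp add: c1_dist_def)
qed

text \<open>
  A continuously differentiable function is encoded as the pair of its value at the left end point
  and its derivative; this is the decoding map.
\<close>

definition primitive_from :: "real \<Rightarrow> real \<Rightarrow> real \<times> (real \<Rightarrow> real) \<Rightarrow> real \<Rightarrow> real" where
  "primitive_from a b p = (\<lambda>t\<in>{a..b}. fst p + integral {a..t} (snd p))"

lemma primitive_from_c1:
  assumes "a < b" "continuous_on {a..b} (snd p)"
  shows "primitive_from a b p \<in> c1_space a b"
    and "t \<in> {a..b} \<Longrightarrow> c1_deriv a b (primitive_from a b p) t = snd p t"
    and "primitive_from a b p a = fst p"
proof -
  have d: "(primitive_from a b p has_real_derivative snd p t) (at t within {a..b})"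
    if t: "t \<in> {a..b}" for t
  proof (rule has_field_derivative_transform_within[OF _ zero_less_one t])
    show "((\<lambda>t. fst p + integral {a..t} (snd p)) has_real_derivative snd p t) (at t within {a..b})"
      using integral_has_real_derivative[OF assms(2) t] by (auto intro!: derivative_eq_intros)
  qed (auto simp: primitive_from_def)
  show "primitive_from a b p \<in> c1_space a b"
    "t \<in> {a..b} \<Longrightarrow> c1_deriv a b (primitive_from a b p) t = snd p t"
    using c1_spaceI[OF assms(1) _ assms(2) d] by (auto simp: primitive_from_def)
  show "primitive_from a b p a = fst p" using assms(1) by (simp add: primitive_from_def)
qed

text \<open>
  These sets play the role of the compact sets of the space (Arzela-Ascoli applied to the
  derivative). The modulus of continuity is prescribed only for the oscillations \<open>1 / (j + 1)\<close>.
\<close>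

definition c1_compact :: "real \<Rightarrow> real \<Rightarrow> real \<Rightarrow> (nat \<Rightarrow> real) \<Rightarrow> (real \<Rightarrow> real) set" where
  "c1_compact a b R \<delta> = {f \<in> c1_space a b. \<bar>f a\<bar> \<le> R \<and> (\<forall>t\<in>{a..b}. \<bar>c1_deriv a b f t\<bar> \<le> R) \<and>
     (\<forall>j. \<forall>s\<in>{a..b}. \<forall>t\<in>{a..b}. \<bar>s - t\<bar> \<le> \<delta> j \<longrightarrow> \<bar>c1_deriv a b f s - c1_deriv a b f t\<bar> \<le> 1 / Suc j)}"

text \<open>
  The encodings of the elements of \<open>c1_compact\<close>, with the derivative extended by 0. They are given
  the topology of pointwise convergence, for which compactness is Tychonoff's theorem; the extension
  by 0 keeps all coordinates in compact intervals and makes the encoding unique.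
\<close>

definition c1_parameters :: "real \<Rightarrow> real \<Rightarrow> real \<Rightarrow> (nat \<Rightarrow> real) \<Rightarrow> (real \<times> (real \<Rightarrow> real)) set" where
  "c1_parameters a b R \<delta> = {p. \<bar>fst p\<bar> \<le> R \<and> (\<forall>t. \<bar>snd p t\<bar> \<le> R * indicator {a..b} t) \<and>
     (\<forall>j. \<forall>s\<in>{a..b}. \<forall>t\<in>{a..b}. \<bar>s - t\<bar> \<le> \<delta> j \<longrightarrow> \<bar>snd p s - snd p t\<bar> \<le> 1 / Suc j)}"

lemma compact_c1_parameters: "compact (c1_parameters a b R \<delta>)"
proof -
  let ?B = "\<Pi>\<^sub>E t\<in>UNIV. {- R * indicator {a..b} t .. R * indicator {a..b} t :: real}"
  have "compactin (product_topology (\<lambda>_. euclideanreal) UNIV) ?B"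
    by (subst compactin_PiE) auto
  then have B: "compact ?B" by (simp add: euclidean_product_topology)
  have cl: "closed {p::real \<times> (real \<Rightarrow> real). \<bar>snd p s - snd p t\<bar> \<le> c}" for s t c
    by (intro closed_Collect_le continuous_intros continuous_on_product_then_coordinatewise)
  have "c1_parameters a b R \<delta> = ({-R..R} \<times> ?B) \<inter>
     (\<Inter>j. \<Inter>s\<in>{a..b}. \<Inter>t\<in>{t\<in>{a..b}. \<bar>s - t\<bar> \<le> \<delta> j}. {p. \<bar>snd p s - snd p t\<bar> \<le> 1 / Suc j})"
    by (auto simp: c1_parameters_def abs_le_iff PiE_def Pi_def minus_le_iff)
  also have "compact \<dots>"
    by (intro compact_Int_closed compact_Times B compact_Icc closed_INT ballI cl)
  finally show ?thesis .
qed

lemma c1_parameters_continuous: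
  assumes p: "p \<in> c1_parameters a b R \<delta>" and \<delta>: "\<And>j. 0 < \<delta> j"
  shows "continuous_on {a..b} (snd p)"
  unfolding continuous_on_iff
proof (intro ballI allI impI)
  fix s e :: real assume s: "s \<in> {a..b}" and "0 < e"
  then obtain j where j: "1 / Suc j < e" using nat_approx_posE by blast
  show "\<exists>d>0. \<forall>t\<in>{a..b}. dist t s < d \<longrightarrow> dist (snd p t) (snd p s) < e"
  proof (intro exI conjI ballI impI)
    fix t assume t: "t \<in> {a..b}" "dist t s < \<delta> j"
    then have "\<bar>snd p t - snd p s\<bar> \<le> 1 / Suc j"
      using p s by (auto simp: c1_parameters_def dist_real_def)
    then show "dist (snd p t) (snd p s) < e" using j by (simp add: dist_real_def)
  qed (rule \<delta>)
qed

lemma c1_compact_parametrized: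
  assumes f: "f \<in> c1_compact a b R \<delta>" and "a < b"
  obtains p where "p \<in> c1_parameters a b R \<delta>" "f = primitive_from a b p"
proof -
  define p where "p = (f a, \<lambda>t. if t \<in> {a..b} then c1_deriv a b f t else 0)"
  have fc: "f \<in> c1_space a b" using f by (simp add: c1_compact_def)
  have "p \<in> c1_parameters a b R \<delta>"
    using f by (auto simp: p_def c1_compact_def c1_parameters_def indicator_def)
  moreover have "f = primitive_from a b p"
  proof
    fix t show "f t = primitive_from a b p t"
    proof (cases "t \<in> {a..b}")
      case True
      have "(c1_deriv a b f has_integral (f t - f a)) {a..t}"
      proof (rule fundamental_theorem_of_calculus)
        show "(f has_vector_derivative c1_deriv a b f x) (at x within {a..t})" if "x \<in> {a..t}" for x
          using c1_has_deriv[OF fc, of x] that True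
          by (auto simp: has_real_derivative_iff_has_vector_derivative
              intro: has_vector_derivative_within_subset)
      qed (use True in auto)
      then have "(snd p has_integral (f t - f a)) {a..t}"
        by (rule has_integral_eq[rotated]) (use True in \<open>auto simp: p_def\<close>)
      then show ?thesis using True by (simp add: primitive_from_def p_def integral_unique)
    next
      case False
      then show ?thesis using c1_spaceD(3)[OF fc] by (simp add: primitive_from_def extensional_def del: atLeastAtMost_iff)
    qed
  qed
  ultimately show ?thesis by (rule that)
qed

lemma finite_net_Icc:
  fixes a b d :: real
  assumes "0 < d"
  obtains T where "finite T" "T \<subseteq> {a..b}" "\<And>t. t \<in> {a..b} \<Longrightarrow> \<exists>s\<in>T. \<bar>t - s\<bar> < d"
proof -
  have "\<exists>k. finite k \<and> k \<subseteq> {a..b} \<and> {a..b} \<subseteq> (\<Union>x\<in>k. ball x d)"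
    using seq_compact_imp_totally_bounded[of "{a..b}"] assms compact_imp_seq_compact compact_Icc by blast
  then show ?thesis using that by (fastforce simp: dist_real_def abs_minus_commute)
qed

text \<open>
  Pointwise closeness of two derivatives on a finite net is uniform closeness, because both obey the
  same modulus of continuity. Hence the decoding map is continuous from the pointwise topology to
  the metric of the space.
\<close>

lemma primitive_from_continuous:
  assumes p: "p \<in> c1_parameters a b R \<delta>" and \<delta>: "\<And>j. 0 < \<delta> j" and "a < b" "0 < e"
  obtains A where "open A" "p \<in> A"
    "\<And>q. q \<in> c1_parameters a b R \<delta> \<Longrightarrow> q \<in> A \<Longrightarrow> c1_dist a b (primitive_from a b p) (primitive_from a b q) < e"
proof -
  \<comment> \<open>The value at a contributes \<open>\<eta>\<close>, the derivatives \<open>3 \<eta>\<close> pointwise and \<open>3 \<eta> (b - a)\<close> after integration;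
    one more \<open>\<eta>\<close> makes the final inequality strict.\<close>
  define \<eta> where "\<eta> = e / (5 + 3 * (b - a))"
  have \<eta>: "0 < \<eta>" using assms by (simp add: \<eta>_def)
  obtain j where j: "1 / Suc j < \<eta>" using nat_approx_posE \<eta> by blast
  obtain T where T: "finite T" "T \<subseteq> {a..b}" "\<And>t. t \<in> {a..b} \<Longrightarrow> \<exists>s\<in>T. \<bar>t - s\<bar> < \<delta> j"
    by (rule finite_net_Icc[OF \<delta>[of j], of a b]) blast
  define A where "A = {q::real \<times> (real \<Rightarrow> real). \<bar>fst q - fst p\<bar> < \<eta>} \<inter> (\<Inter>t\<in>T. {q. \<bar>snd q t - snd p t\<bar> < \<eta>})"
  have "open A"
    unfolding A_def using T(1)
    by (intro open_Int open_INT ballI open_Collect_less continuous_intros continuous_on_product_then_coordinatewise)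
  moreover have "p \<in> A" using \<eta> by (simp add: A_def)
  moreover have "c1_dist a b (primitive_from a b p) (primitive_from a b q) < e"
    if q: "q \<in> c1_parameters a b R \<delta>" "q \<in> A" for q
  proof -
    note c = primitive_from_c1[OF \<open>a < b\<close> c1_parameters_continuous[OF p \<delta>]]
      primitive_from_c1[OF \<open>a < b\<close> c1_parameters_continuous[OF q(1) \<delta>]]
    have "c1_dist a b (primitive_from a b p) (primitive_from a b q) \<le> \<eta> + 3 * \<eta> * (b - a) + 3 * \<eta>"
    proof (rule c1_dist_le[OF c(1,4) \<open>a < b\<close>])
      show "\<bar>primitive_from a b p a - primitive_from a b q a\<bar> \<le> \<eta>"
        using q(2) unfolding c(3,6) by (auto simp: A_def)
      fix t assume t: "t \<in> {a..b}"
      obtain s where s: "s \<in> T" "\<bar>t - s\<bar> < \<delta> j" using T(3)[OF t] by blast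
      have "s \<in> {a..b}" using s T by auto
      then have "\<bar>snd p t - snd p s\<bar> \<le> 1 / Suc j" "\<bar>snd q t - snd q s\<bar> \<le> 1 / Suc j"
        using p q(1) s(2) t unfolding c1_parameters_def by auto
      moreover have "\<bar>snd q s - snd p s\<bar> < \<eta>" using q(2) s(1) by (auto simp: A_def)
      ultimately show "\<bar>c1_deriv a b (primitive_from a b p) t - c1_deriv a b (primitive_from a b q) t\<bar> \<le> 3 * \<eta>"
        unfolding c(2)[OF t] c(5)[OF t] using j by linarith
    qed
    also have "\<dots> < 2 * \<eta> + 3 * \<eta> * (b - a) + 3 * \<eta>" using \<eta> by simp
    also have "\<dots> = \<eta> * (5 + 3 * (b - a))" by (simp add: algebra_simps)
    also have "\<dots> = e" using \<open>a < b\<close> by (simp add: \<eta>_def)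
    finally show ?thesis .
  qed
  ultimately show ?thesis by (rule that)
qed

lemma continuous_map_c1_neighbourhood:
  fixes F :: "(real \<Rightarrow> real) \<Rightarrow> real"
  assumes F: "continuous_map (c1_topology a b) euclideanreal F" and "a \<le> b"
    and f: "f \<in> c1_space a b" and "open B" "F f \<in> B"
  shows "\<exists>d>0. \<forall>g\<in>c1_space a b. c1_dist a b f g < d \<longrightarrow> F g \<in> B"
proof -
  interpret Metric_space "c1_space a b" "c1_dist a b" by (rule Metric_space_c1) fact
  have "openin mtopology {g \<in> topspace mtopology. F g \<in> B}"
    using F \<open>open B\<close> unfolding c1_topology_def continuous_map_def by auto
  then obtain r where "r > 0" "mball f r \<subseteq> {g \<in> c1_space a b. F g \<in> B}"
    unfolding openin_mtopology using f \<open>F f \<in> B\<close> by auto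
  then show ?thesis using f by (intro exI[of _ r]) (auto simp: subset_iff)
qed

lemma continuous_on_parameters:
  fixes F :: "(real \<Rightarrow> real) \<Rightarrow> real"
  assumes F: "continuous_map (c1_topology a b) euclideanreal F" and "a < b" and \<delta>: "\<And>j. 0 < \<delta> j"
  shows "continuous_on (c1_parameters a b R \<delta>) (\<lambda>p. F (primitive_from a b p))"
  unfolding continuous_on_topological
proof (intro ballI allI impI)
  fix p B assume p: "p \<in> c1_parameters a b R \<delta>" and B: "open B" "F (primitive_from a b p) \<in> B"
  have c: "primitive_from a b q \<in> c1_space a b" if "q \<in> c1_parameters a b R \<delta>" for q
    by (rule primitive_from_c1(1)[OF \<open>a < b\<close> c1_parameters_continuous[OF that \<delta>]])
  have "\<exists>d>0. \<forall>g\<in>c1_space a b. c1_dist a b (primitive_from a b p) g < d \<longrightarrow> F g \<in> B"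
    by (rule continuous_map_c1_neighbourhood) (use F \<open>a < b\<close> c[OF p] B in auto)
  then obtain d where d: "0 < d"
    "\<And>g. g \<in> c1_space a b \<Longrightarrow> c1_dist a b (primitive_from a b p) g < d \<Longrightarrow> F g \<in> B"
    by blast
  obtain A where A: "open A" "p \<in> A"
    "\<And>q. q \<in> c1_parameters a b R \<delta> \<Longrightarrow> q \<in> A \<Longrightarrow> c1_dist a b (primitive_from a b p) (primitive_from a b q) < d"
    by (rule primitive_from_continuous[OF p \<delta> \<open>a < b\<close> d(1)]) blast
  show "\<exists>A. open A \<and> p \<in> A \<and> (\<forall>q\<in>c1_parameters a b R \<delta>. q \<in> A \<longrightarrow> F (primitive_from a b q) \<in> B)"
    by (intro exI[of _ A] conjI ballI impI A d(2) c)
qed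

lemma continuous_map_c1_evaluation:
  assumes "a \<le> b" "t \<in> {a..b}"
  shows "continuous_map (c1_topology a b) euclideanreal (\<lambda>f. f t)"
proof -
  interpret Metric_space "c1_space a b" "c1_dist a b" by (rule Metric_space_c1) fact
  show ?thesis
    unfolding continuous_map_def c1_topology_def
  proof (intro conjI allI impI)
    fix U :: "real set" assume "openin euclideanreal U"
    then have U: "open U" by simp
    show "openin mtopology {f \<in> topspace mtopology. f t \<in> U}"
      unfolding openin_mtopology
    proof (intro conjI allI impI)
      fix f assume f: "f \<in> {f \<in> topspace mtopology. f t \<in> U}"
      then obtain r where r: "r > 0" "ball (f t) r \<subseteq> U" using U openE by blast
      have "mball f r \<subseteq> {f \<in> topspace mtopology. f t \<in> U}"
      proof
        fix g assume g: "g \<in> mball f r"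
        then have "\<bar>f t - g t\<bar> < r" using c1_dist_ge[of f a b g t] assms f by auto
        then show "g \<in> {f \<in> topspace mtopology. f t \<in> U}" using g r by (auto simp: dist_real_def)
      qed
      then show "\<exists>r>0. mball f r \<subseteq> {f \<in> topspace mtopology. f t \<in> U}" using r by blast
    qed auto
  qed auto
qed

section \<open>Trigonometric functionals\<close>

text \<open>
  A list of pairs (coefficient, time) stands for a finite linear combination of point evaluations;
  the same time may occur several times, so that sums are concatenations.
\<close>

definition point_evaluations :: "(real \<times> real) list \<Rightarrow> (real \<Rightarrow> real) \<Rightarrow> real" where
  "point_evaluations xs g = (\<Sum>(l, t)\<leftarrow>xs. l * g t)"

lemma point_evaluations_simps [simp]:
  "point_evaluations [] g = 0"
  "point_evaluations (x # xs) g = fst x * g (snd x) + point_evaluations xs g"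
  "point_evaluations (xs @ ys) g = point_evaluations xs g + point_evaluations ys g"
  "point_evaluations (map (\<lambda>x. (- fst x, snd x)) xs) g = - point_evaluations xs g"
proof -
  show "point_evaluations (map (\<lambda>x. (- fst x, snd x)) xs) g = - point_evaluations xs g"
    by (induction xs) (auto simp: point_evaluations_def)
qed (auto simp: point_evaluations_def split: prod.splits)

text \<open>
  Only rational coefficients and times are used inside the cosines and sines, so that there are
  countably many of these cosines and sines. An almost sure statement then holds for all of them at
  once and, by linearity, for the whole class.
\<close>

inductive trig_functional :: "real set \<Rightarrow> ((real \<Rightarrow> real) \<Rightarrow> real) \<Rightarrow> bool" for T where
  cos: "set xs \<subseteq> \<rat> \<times> T \<Longrightarrow> trig_functional T (\<lambda>g. c * cos (point_evaluations xs g))"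
| sin: "set xs \<subseteq> \<rat> \<times> T \<Longrightarrow> trig_functional T (\<lambda>g. c * sin (point_evaluations xs g))"
| add: "trig_functional T A \<Longrightarrow> trig_functional T B \<Longrightarrow> trig_functional T (\<lambda>g. A g + B g)"

lemma trig_functional_const: "trig_functional T (\<lambda>g. c)"
  using trig_functional.cos[of "[]" T c] by simp

text \<open>
  The addition formulas turn products of cosines and sines into sums; the pair of lists \<open>xs\<close>, \<open>ys\<close>
  becomes \<open>xs @ ys\<close> and the concatenation of \<open>xs\<close> with the negated \<open>ys\<close>.
\<close>

lemma trig_functional_mult:
  assumes "trig_functional T A" "trig_functional T B"
  shows "trig_functional T (\<lambda>g. A g * B g)"
  using assms(1)
proof induction
  case (cos xs c)
  show ?case using assms(2)
  proof induction
    case (cos ys d)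
    have "trig_functional T (\<lambda>g. (c * d / 2) * cos (point_evaluations (xs @ ys) g)
       + (c * d / 2) * cos (point_evaluations (xs @ map (\<lambda>x. (- fst x, snd x)) ys) g))"
      using cos \<open>set xs \<subseteq> _\<close> by (intro trig_functional.intros) auto
    then show ?case by (simp add: cos_add cos_diff algebra_simps)
  next
    case (sin ys d)
    have "trig_functional T (\<lambda>g. (c * d / 2) * sin (point_evaluations (xs @ ys) g)
       + (- (c * d / 2)) * sin (point_evaluations (xs @ map (\<lambda>x. (- fst x, snd x)) ys) g))"
      using sin \<open>set xs \<subseteq> _\<close> by (intro trig_functional.intros) auto
    then show ?case by (simp add: sin_add sin_diff algebra_simps)
  next
    case (add A B)
    then show ?case using trig_functional.add[OF add.IH] by (simp add: algebra_simps)
  qed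
next
  case (sin xs c)
  show ?case using assms(2)
  proof induction
    case (cos ys d)
    have "trig_functional T (\<lambda>g. (c * d / 2) * sin (point_evaluations (xs @ ys) g)
       + (c * d / 2) * sin (point_evaluations (xs @ map (\<lambda>x. (- fst x, snd x)) ys) g))"
      using cos \<open>set xs \<subseteq> _\<close> by (intro trig_functional.intros) auto
    then show ?case by (simp add: sin_add sin_diff algebra_simps)
  next
    case (sin ys d)
    have "trig_functional T (\<lambda>g. (- (c * d / 2)) * cos (point_evaluations (xs @ ys) g)
       + (c * d / 2) * cos (point_evaluations (xs @ map (\<lambda>x. (- fst x, snd x)) ys) g))"
      using sin \<open>set xs \<subseteq> _\<close> by (intro trig_functional.intros) auto
    then show ?case by (simp add: cos_add cos_diff algebra_simps)
  next
    case (add A B)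
    then show ?case using trig_functional.add[OF add.IH] by (simp add: algebra_simps)
  qed
next
  case (add A C)
  then show ?case using trig_functional.add[OF add.IH] by (simp add: algebra_simps)
qed

lemma trig_functional_bounded: "trig_functional T A \<Longrightarrow> \<exists>C. \<forall>g. \<bar>A g\<bar> \<le> C"
proof (induction rule: trig_functional.induct)
  case (add A B)
  then obtain C D where "\<forall>g. \<bar>A g\<bar> \<le> C" "\<forall>g. \<bar>B g\<bar> \<le> D" by blast
  then have "\<forall>g. \<bar>A g + B g\<bar> \<le> C + D" by (meson abs_triangle_ineq add_mono order_trans)
  then show ?case by blast
qed (auto simp: abs_mult intro!: exI[of _ "\<bar>_\<bar>"] mult_left_le)

lemma trig_functional_polynomial:
  fixes p :: "real \<Rightarrow> real"
  assumes "real_polynomial_function p" "trig_functional T A"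
  shows "trig_functional T (\<lambda>g. p (A g))"
  using assms(1)
proof induction
  case (linear f)
  then obtain c where c: "f = (\<lambda>x. x * c)" using real_bounded_linear by blast
  show ?case unfolding c by (intro trig_functional_mult assms trig_functional_const)
qed (auto intro: trig_functional_mult trig_functional_const trig_functional.add)

lemma continuous_map_trig_functional:
  assumes "trig_functional T A" "a \<le> b" "T \<subseteq> {a..b}"
  shows "continuous_map (c1_topology a b) euclideanreal A"
proof -
  have L: "continuous_map (c1_topology a b) euclideanreal (point_evaluations xs)" if "set xs \<subseteq> \<rat> \<times> T" for xs
    using that
  proof (induction xs)
    case (Cons x xs)
    then have "continuous_map (c1_topology a b) euclideanreal (\<lambda>g. fst x * g (snd x) + point_evaluations xs g)"
      using assms by (intro continuous_map_add continuous_map_real_mult continuous_map_c1_evaluation) auto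
    then show ?case by simp
  next
    case Nil
    have "point_evaluations [] = (\<lambda>g. 0)" by auto
    then show ?case by simp
  qed
  have H: "continuous_map (c1_topology a b) euclideanreal (\<lambda>g. h (point_evaluations xs g))"
    if "set xs \<subseteq> \<rat> \<times> T" "continuous_on UNIV h" for xs and h :: "real \<Rightarrow> real"
    using continuous_map_compose[OF L[OF that(1)], of euclideanreal h] that(2) by (simp add: comp_def)
  then have *: "set xs \<subseteq> \<rat> \<times> T \<Longrightarrow> continuous_map (c1_topology a b) euclideanreal (\<lambda>g. cos (point_evaluations xs g))"
    "set xs \<subseteq> \<rat> \<times> T \<Longrightarrow> continuous_map (c1_topology a b) euclideanreal (\<lambda>g. sin (point_evaluations xs g))" for xs
    using H[of xs cos] H[of xs sin] by (simp_all add: continuous_on_cos continuous_on_sin continuous_on_id)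
  show ?thesis using assms(1)
    by induction (auto intro!: continuous_map_add continuous_map_real_mult *)
qed

lemma dense_rationals_Icc:
  fixes a b :: real assumes "a < b"
  shows "closure (\<rat> \<inter> {a..b}) = {a..b}"
proof
  have "closure ({a<..<b} \<inter> \<rat>) = closure {a<..<b}"
    by (rule closure_open_Int_superset) (auto simp: Rats_closure_real)
  then have "{a..b} = closure ({a<..<b} \<inter> \<rat>)" using assms by simp
  also have "\<dots> \<subseteq> closure (\<rat> \<inter> {a..b})" by (rule closure_mono) auto
  finally show "{a..b} \<subseteq> closure (\<rat> \<inter> {a..b})" .
  show "closure (\<rat> \<inter> {a..b}) \<subseteq> {a..b}" by (rule closure_minimal) auto
qed

text \<open>
  Two distinct functions differ at a rational time. Multiplying by a small rational frequency brings
  the two values there closer than a period, and then cosine and sine together tell them apart.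
\<close>

lemma trig_functional_separates:
  assumes f: "f \<in> c1_space a b" and g: "g \<in> c1_space a b" and "f \<noteq> g" "a < b"
  shows "\<exists>A. trig_functional (\<rat> \<inter> {a..b}) A \<and> A f \<noteq> A g"
proof -
  have "\<exists>t\<in>\<rat> \<inter> {a..b}. f t \<noteq> g t"
  proof (rule ccontr)
    assume n: "\<not> ?thesis"
    have "f t - g t = 0" if "t \<in> {a..b}" for t
    proof (rule continuous_constant_on_closure[of "\<rat> \<inter> {a..b}" "\<lambda>t. f t - g t" 0 t])
      show "continuous_on (closure (\<rat> \<inter> {a..b})) (\<lambda>t. f t - g t)"
        unfolding dense_rationals_Icc[OF \<open>a < b\<close>]
        by (intro continuous_on_diff c1_spaceD(1) f g)
    qed (use n that in \<open>auto simp: dense_rationals_Icc[OF \<open>a < b\<close>]\<close>)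
    then have "f = g"
      using c1_spaceD(3)[OF f] c1_spaceD(3)[OF g] by (intro extensionalityI[of f "{a..b}" g]) auto
    then show False using \<open>f \<noteq> g\<close> by simp
  qed
  then obtain t where t: "t \<in> \<rat> \<inter> {a..b}" "f t \<noteq> g t" by blast
  obtain n :: nat where n: "\<bar>f t - g t\<bar> < of_nat n" using reals_Archimedean2 by blast
  define l where "l = 1 / real (Suc n)"
  have l: "l \<in> \<rat>" "0 < l" by (auto simp: l_def)
  have small: "\<bar>l * f t - l * g t\<bar> < 1"
  proof -
    have "\<bar>l * f t - l * g t\<bar> = l * \<bar>f t - g t\<bar>" using l(2) by (simp add: abs_mult flip: right_diff_distrib)
    also have "\<dots> < 1" using n by (simp add: l_def field_simps)
    finally show ?thesis .
  qed
  have "cos (l * f t) \<noteq> cos (l * g t) \<or> sin (l * f t) \<noteq> sin (l * g t)"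
  proof (rule ccontr)
    assume "\<not> ?thesis"
    then have "sin (l * f t) = sin (l * g t) \<and> cos (l * f t) = cos (l * g t)" by simp
    then obtain m where m: "l * f t = l * g t + 2 * pi * of_int m"
      by (metis sin_cos_eq_iff mult.commute)
    then have "\<bar>2 * pi * of_int m\<bar> < 1" using small by simp
    then have "2 * pi * \<bar>of_int m\<bar> < 1" by (simp add: abs_mult)
    moreover have "2 * pi * 1 \<le> 2 * pi * \<bar>of_int m\<bar>" if "m \<noteq> 0"
      using that by (intro mult_left_mono) auto
    ultimately have "m = 0" using pi_gt3 by fastforce
    then show False using m t(2) l(2) by simp
  qed
  then show ?thesis
  proof
    assume "cos (l * f t) \<noteq> cos (l * g t)"
    then show ?thesis using trig_functional.cos[of "[(l, t)]" "\<rat> \<inter> {a..b}" 1] l t(1)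
      by (intro exI[of _ "\<lambda>g. 1 * cos (point_evaluations [(l, t)] g)"]) auto
  next
    assume "sin (l * f t) \<noteq> sin (l * g t)"
    then show ?thesis using trig_functional.sin[of "[(l, t)]" "\<rat> \<inter> {a..b}" 1] l t(1)
      by (intro exI[of _ "\<lambda>g. 1 * sin (point_evaluations [(l, t)] g)"]) auto
  qed
qed

text \<open>
  Stone-Weierstrass on the compact set of encodings gives an approximation \<open>A\<close> that is good on the
  compact set, with no control elsewhere. Composing \<open>A\<close> with a polynomial close to the truncation at
  \<open>\<plusminus> B\<close> on the range of \<open>A\<close> stays inside the algebra and gives a global bound, while \<open>F\<close>, which
  takes values in \<open>[-B, B]\<close>, is not affected by the truncation.
\<close>

lemma trig_functional_approximation:
  fixes F :: "(real \<Rightarrow> real) \<Rightarrow> real"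
  assumes F: "continuous_map (c1_topology a b) euclideanreal F" and "a < b" and \<delta>: "\<And>j. 0 < \<delta> j"
    and B: "\<And>f. f \<in> c1_space a b \<Longrightarrow> \<bar>F f\<bar> \<le> B" and "0 < e"
  obtains A where "trig_functional (\<rat> \<inter> {a..b}) A"
    "\<And>f. f \<in> c1_compact a b R \<delta> \<Longrightarrow> \<bar>A f - F f\<bar> \<le> 2 * e" "\<And>f. \<bar>A f\<bar> \<le> B + e"
proof -
  let ?K = "c1_parameters a b R \<delta>" and ?T = "\<rat> \<inter> {a..b}"
  note c = primitive_from_c1[OF \<open>a < b\<close> c1_parameters_continuous[OF _ \<delta>]]
  define P where "P = (\<lambda>h. \<exists>A. trig_functional ?T A \<and> h = (\<lambda>p. A (primitive_from a b p)))"
  have "\<exists>h. P h \<and> (\<forall>x\<in>?K. \<bar>F (primitive_from a b x) - h x\<bar> < e)"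
  proof (rule Stone_Weierstrass_HOL[where P=P and f="\<lambda>p. F (primitive_from a b p)"])
    show "P (\<lambda>p. c)" for c unfolding P_def using trig_functional_const by blast
    show "P f \<and> P g \<Longrightarrow> P (\<lambda>x. f x + g x)" for f g unfolding P_def using trig_functional.add by blast
    show "P f \<and> P g \<Longrightarrow> P (\<lambda>x. f x * g x)" for f g unfolding P_def using trig_functional_mult by blast
    show "P f \<Longrightarrow> continuous_on ?K f" for f
      unfolding P_def using continuous_map_trig_functional[of ?T _ a b] \<open>a < b\<close>
      by (auto intro!: continuous_on_parameters \<delta>)
    show "\<exists>f. P f \<and> f p \<noteq> f q" if "p \<in> ?K \<and> q \<in> ?K \<and> p \<noteq> q" for p q
    proof -
      have pq: "p \<in> ?K" "q \<in> ?K" "p \<noteq> q" using that by auto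
      have "primitive_from a b p \<noteq> primitive_from a b q"
      proof
        assume eq: "primitive_from a b p = primitive_from a b q"
        then have "fst p = fst q" using c(3)[OF pq(1)] c(3)[OF pq(2)] by simp
        moreover have "snd p t = snd q t" for t
        proof (cases "t \<in> {a..b}")
          case True
          then show ?thesis using c(2)[OF pq(1) True] c(2)[OF pq(2) True] eq by simp
        next
          case False
          have "\<bar>snd p t\<bar> \<le> R * indicator {a..b} t" "\<bar>snd q t\<bar> \<le> R * indicator {a..b} t"
            using pq(1,2) by (auto simp: c1_parameters_def)
          then show ?thesis using False by simp
        qed
        ultimately show False using pq(3) by (simp add: prod_eq_iff fun_eq_iff)
      qed
      then show ?thesis
        using trig_functional_separates[OF c(1)[OF pq(1)] c(1)[OF pq(2)] _ \<open>a < b\<close>] unfolding P_def by blast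
    qed
  qed (use compact_c1_parameters continuous_on_parameters[OF F \<open>a < b\<close> \<delta>] \<open>0 < e\<close> in auto)
  then obtain A where A: "trig_functional ?T A"
    and Ae: "\<And>p. p \<in> ?K \<Longrightarrow> \<bar>F (primitive_from a b p) - A (primitive_from a b p)\<bar> < e"
    unfolding P_def by blast
  obtain C where C: "\<And>g. \<bar>A g\<bar> \<le> C" using trig_functional_bounded[OF A] by blast
  define cl where "cl = (\<lambda>y::real. max (- B) (min B y))"
  have B0: "0 \<le> B" using B[OF primitive_from_c1(1)[OF \<open>a < b\<close>, of "(0, \<lambda>_. 0)"]] by (simp add: order.trans[OF abs_ge_zero])
  have "continuous_on {-C..C} cl" unfolding cl_def by (intro continuous_intros)
  then obtain q where q: "real_polynomial_function q" "\<And>y. y \<in> {-C..C} \<Longrightarrow> \<bar>cl y - q y\<bar> < e"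
    using Stone_Weierstrass_real_polynomial_function[OF compact_Icc _ \<open>0 < e\<close>] by blast
  have AC: "A g \<in> {-C..C}" for g using C[of g] by (auto simp: abs_le_iff)
  show ?thesis
  proof (rule that[of "\<lambda>g. q (A g)"])
    show "trig_functional ?T (\<lambda>g. q (A g))" by (rule trig_functional_polynomial[OF q(1) A])
    show "\<bar>q (A f)\<bar> \<le> B + e" for f
      using q(2)[OF AC[of f]] B0 unfolding cl_def by (auto simp: max_def min_def split: if_splits)
    show "\<bar>q (A f) - F f\<bar> \<le> 2 * e" if f: "f \<in> c1_compact a b R \<delta>" for f
    proof -
      obtain p where p: "p \<in> ?K" "f = primitive_from a b p" using c1_compact_parametrized[OF f \<open>a < b\<close>] .
      have 1: "\<bar>F f - A f\<bar> < e" using Ae[OF p(1)] p(2) by simp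
      have "\<bar>F f\<bar> \<le> B" using B f by (auto simp: c1_compact_def)
      then have "\<bar>cl (A f) - F f\<bar> \<le> \<bar>F f - A f\<bar>" unfolding cl_def by (auto simp: max_def min_def)
      then show ?thesis using q(2)[OF AC[of f]] 1 by linarith
    qed
  qed
qed

section \<open>Random continuously differentiable functions\<close>

lemma borel_measurable_c1_deriv:
  assumes "a < b" and Y: "\<And>\<omega>. \<omega> \<in> space M \<Longrightarrow> Y \<omega> \<in> c1_space a b"
    and ev: "\<And>t. t \<in> {a..b} \<Longrightarrow> (\<lambda>\<omega>. Y \<omega> t) \<in> borel_measurable M" and t: "t \<in> {a..b}"
  shows "(\<lambda>\<omega>. c1_deriv a b (Y \<omega>) t) \<in> borel_measurable M"
proof -
  obtain s where s: "s \<in> {a..b}" "s \<noteq> t" using assms(1) t by (metis atLeastAtMost_iff less_irrefl order.refl less_imp_le)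
  define x where "x = (\<lambda>n::nat. t + (s - t) / real (Suc n))"
  have x: "x n \<in> {a..b} - {t}" for n
  proof -
    define h where "h = 1 / real (Suc n)"
    have h: "0 \<le> h" "h \<le> 1" by (auto simp: h_def)
    have "x n = t + (s - t) * h" by (simp add: x_def h_def)
    then have "x n = (1 - h) *\<^sub>R t + h *\<^sub>R s" by (simp add: algebra_simps)
    then have "x n \<in> {a..b}" using convexD[of "{a..b}" t s "1 - h" h] s t h by simp
    moreover have "x n \<noteq> t" using s by (simp add: x_def)
    ultimately show ?thesis by simp
  qed
  have xl: "x \<longlonglongrightarrow> t + 0"
    unfolding x_def by (intro tendsto_add tendsto_const real_tendsto_divide_at_top[OF tendsto_const]
      filterlim_compose[OF filterlim_real_sequentially filterlim_Suc])
  show ?thesis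
  proof (rule borel_measurable_LIMSEQ_real)
    fix \<omega> assume "\<omega> \<in> space M"
    then have "((\<lambda>y. (Y \<omega> y - Y \<omega> t) / (y - t)) \<longlongrightarrow> c1_deriv a b (Y \<omega>) t) (at t within {a..b})"
      using c1_has_deriv[OF Y t] by (simp add: has_field_derivative_iff)
    then show "(\<lambda>n. (Y \<omega> (x n) - Y \<omega> t) / (x n - t)) \<longlonglongrightarrow> c1_deriv a b (Y \<omega>) t"
      unfolding tendsto_at_iff_sequentially using x xl by (auto simp: comp_def)
  next
    show "(\<lambda>\<omega>. (Y \<omega> (x n) - Y \<omega> t) / (x n - t)) \<in> borel_measurable M" for n
      using x t by (intro borel_measurable_divide borel_measurable_diff ev borel_measurable_const) auto
  qed
qed

text \<open>
  The space is separable: the countably many sets \<open>E (m, v, N, xs)\<close> have diameter of order \<open>1 / m\<close>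
  and cover it for each \<open>m\<close>, so every open set is the union of those contained in it. Here \<open>v\<close> is a
  rational approximation to the value at the left end point and \<open>xs\<close> lists rational approximations
  to the derivative on the cells of a mesh of width \<open>1 / N\<close>. Membership in such a set is a condition
  on countably many values and derivatives, hence measurable.
\<close>

lemma measurable_borel_of_c1:
  assumes "a < b" and Y: "\<And>\<omega>. \<omega> \<in> space M \<Longrightarrow> Y \<omega> \<in> c1_space a b"
    and ev: "\<And>t. t \<in> {a..b} \<Longrightarrow> (\<lambda>\<omega>. Y \<omega> t) \<in> borel_measurable M"
  shows "Y \<in> measurable M (borel_of_topology (c1_topology a b))"
proof -
  interpret C: Metric_space "c1_space a b" "c1_dist a b" by (rule Metric_space_c1) (use assms in simp)
  define E :: "nat \<times> rat \<times> nat \<times> rat list \<Rightarrow> (real \<Rightarrow> real) set" where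
    "E = (\<lambda>(m, v, N, xs). {f \<in> c1_space a b. \<bar>f a - of_rat v\<bar> \<le> 1 / Suc m \<and>
       (\<forall>t\<in>\<rat> \<inter> {a..b}. \<bar>c1_deriv a b f t - of_rat (xs ! nat \<lfloor>real N * (t - a)\<rfloor>)\<bar> \<le> 1 / Suc m)})"
  have small: "c1_dist a b f g \<le> (2 / Suc m) * (2 + (b - a))"
    if f: "f \<in> E (m, v, N, xs)" and g: "g \<in> E (m, v, N, xs)" for f g m v N xs
  proof -
    have fc: "f \<in> c1_space a b" and gc: "g \<in> c1_space a b" using f g by (auto simp: E_def)
    have "c1_dist a b f g \<le> 2 / Suc m + (2 / Suc m) * (b - a) + 2 / Suc m"
    proof (rule c1_dist_le[OF fc gc \<open>a < b\<close>])
      have "\<bar>f a - of_rat v\<bar> \<le> 1 / Suc m" "\<bar>g a - of_rat v\<bar> \<le> 1 / Suc m" using f g by (auto simp: E_def)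
      moreover have "2 / real (Suc m) = 1 / Suc m + 1 / Suc m" by (simp add: add_divide_distrib[symmetric])
      ultimately show "\<bar>f a - g a\<bar> \<le> 2 / Suc m" by linarith
      fix t assume t: "t \<in> {a..b}"
      show "\<bar>c1_deriv a b f t - c1_deriv a b g t\<bar> \<le> 2 / Suc m"
      proof (rule continuous_le_on_closure[of "\<rat> \<inter> {a..b}" "\<lambda>t. \<bar>c1_deriv a b f t - c1_deriv a b g t\<bar>"])
        show "continuous_on (closure (\<rat> \<inter> {a..b})) (\<lambda>t. \<bar>c1_deriv a b f t - c1_deriv a b g t\<bar>)"
          unfolding dense_rationals_Icc[OF \<open>a < b\<close>] by (intro continuous_intros c1_spaceD(2) fc gc)
        show "t \<in> closure (\<rat> \<inter> {a..b})" unfolding dense_rationals_Icc[OF \<open>a < b\<close>] by fact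
        fix q assume q: "q \<in> \<rat> \<inter> {a..b}"
        define r :: real where "r = of_rat (xs ! nat \<lfloor>real N * (q - a)\<rfloor>)"
        have "\<bar>c1_deriv a b f q - r\<bar> \<le> 1 / Suc m" "\<bar>c1_deriv a b g q - r\<bar> \<le> 1 / Suc m"
          using f g q unfolding E_def r_def by blast+
        moreover have "2 / real (Suc m) = 1 / Suc m + 1 / Suc m" by (simp add: add_divide_distrib[symmetric])
        ultimately show "\<bar>c1_deriv a b f q - c1_deriv a b g q\<bar> \<le> 2 / Suc m" by linarith
      qed
    qed
    also have "c + c * (b - a) + c = c * (2 + (b - a))" for c :: real by (simp add: algebra_simps)
    finally show ?thesis .
  qed
  have cover: "\<exists>v N xs. f \<in> E (m, v, N, xs)" if f: "f \<in> c1_space a b" for f m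
  proof -
    define e where "e = 1 / (2 * real (Suc m))"
    have e: "e > 0" by (simp add: e_def)
    have rat: "\<exists>q::rat. \<bar>y - of_rat q\<bar> < e" for y :: real
    proof -
      obtain q where "y < of_rat q" "of_rat q < y + e" using of_rat_dense[of y "y + e"] e by auto
      then show ?thesis by (intro exI[of _ q]) auto
    qed
    obtain v where v: "\<bar>f a - of_rat v\<bar> < e" using rat by blast
    obtain r where r: "\<And>y. \<bar>y - of_rat (r y)\<bar> < e" using rat by metis
    have "uniformly_continuous_on {a..b} (c1_deriv a b f)"
      using c1_spaceD(2)[OF f] compact_uniformly_continuous by blast
    then obtain d where d: "d > 0" "\<And>s t. s \<in> {a..b} \<Longrightarrow> t \<in> {a..b} \<Longrightarrow> dist t s < d \<Longrightarrow>
        dist (c1_deriv a b f t) (c1_deriv a b f s) < e"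
      unfolding uniformly_continuous_on_def using e by metis
    obtain N :: nat where N: "1 / d < real N" using reals_Archimedean2 by blast
    then have Np: "0 < real N" using d(1) by (smt (verit) divide_pos_pos)
    have Nd: "1 / real N < d" using N d(1) Np by (simp add: field_simps)
    define xs where "xs = map (\<lambda>i. r (c1_deriv a b f (a + real i / real N))) [0..<Suc (nat \<lfloor>real N * (b - a)\<rfloor>)]"
    have "\<bar>c1_deriv a b f t - of_rat (xs ! nat \<lfloor>real N * (t - a)\<rfloor>)\<bar> \<le> 1 / Suc m"
      if t: "t \<in> {a..b}" for t
    proof -
      define i where "i = nat \<lfloor>real N * (t - a)\<rfloor>"
      have nn: "0 \<le> real N * (t - a)" using t Np by simp
      have "real N * (t - a) \<le> real N * (b - a)" using t Np by simp
      then have il: "i < Suc (nat \<lfloor>real N * (b - a)\<rfloor>)"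
        unfolding i_def by (intro le_imp_less_Suc nat_mono floor_mono)
      have ri: "real i \<le> real N * (t - a)" "real N * (t - a) < real i + 1"
        using nn by (auto simp: i_def)
      define s where "s = a + real i / real N"
      have s1: "s \<le> t" using ri(1) Np by (simp add: s_def field_simps)
      have "t - s = (real N * (t - a) - real i) / real N" using Np by (simp add: s_def field_simps)
      also have "\<dots> < 1 / real N" using ri(2) Np by (intro divide_strict_right_mono) auto
      finally have s2: "t - s < 1 / real N" .
      have "s \<in> {a..b}" using s1 t Np by (auto simp: s_def)
      then have "dist (c1_deriv a b f t) (c1_deriv a b f s) < e"
        using s1 s2 Nd t by (intro d(2)) (auto simp: dist_real_def)
      moreover have "xs ! i = r (c1_deriv a b f s)"
        using il unfolding xs_def s_def by (simp del: upt_Suc)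
      ultimately have "\<bar>c1_deriv a b f t - of_rat (xs ! i)\<bar> < e + e"
        using r[of "c1_deriv a b f s"] by (simp add: dist_real_def)
      also have "e + e = 1 / Suc m" by (simp add: e_def field_simps)
      finally show ?thesis by (simp add: i_def)
    qed
    moreover have "\<bar>f a - of_rat v\<bar> \<le> 1 / Suc m"
    proof -
      have "e \<le> 1 / Suc m" by (simp add: e_def field_simps)
      then show ?thesis using v by linarith
    qed
    ultimately have "f \<in> E (m, v, N, xs)" using f by (auto simp: E_def)
    then show ?thesis by blast
  qed
  have Em: "{\<omega> \<in> space M. Y \<omega> \<in> E p} \<in> sets M" for p
  proof -
    obtain m v N xs where p: "p = (m, v, N, xs)" by (cases p) auto
    have [measurable]: "(\<lambda>\<omega>. Y \<omega> a) \<in> borel_measurable M" using ev \<open>a < b\<close> by simp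
    have 1: "{\<omega> \<in> space M. Y \<omega> \<in> E p} = {\<omega> \<in> space M. \<bar>Y \<omega> a - of_rat v\<bar> \<le> 1 / Suc m \<and>
       (\<forall>t\<in>\<rat> \<inter> {a..b}. \<bar>c1_deriv a b (Y \<omega>) t - of_rat (xs ! nat \<lfloor>real N * (t - a)\<rfloor>)\<bar> \<le> 1 / Suc m)}"
      using Y by (auto simp: p E_def)
    have [measurable]: "{\<omega> \<in> space M. \<forall>t\<in>\<rat> \<inter> {a..b}. \<bar>c1_deriv a b (Y \<omega>) t - of_rat (xs ! nat \<lfloor>real N * (t - a)\<rfloor>)\<bar> \<le> 1 / Suc m} \<in> sets M"
    proof (rule sets.sets_Collect_countable_All')
      show "{\<omega> \<in> space M. \<bar>c1_deriv a b (Y \<omega>) t - of_rat (xs ! nat \<lfloor>real N * (t - a)\<rfloor>)\<bar> \<le> 1 / Suc m} \<in> sets M"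
        if "t \<in> \<rat> \<inter> {a..b}" for t
      proof -
        have [measurable]: "(\<lambda>\<omega>. c1_deriv a b (Y \<omega>) t) \<in> borel_measurable M"
          using that by (intro borel_measurable_c1_deriv[OF \<open>a < b\<close> Y ev]) auto
        show ?thesis by measurable
      qed
      show "countable (\<rat> \<inter> {a..b})" by (intro countable_Int1 countable_rat)
    qed
    show ?thesis unfolding 1 by (intro sets.sets_Collect_conj) measurable
  qed
  show ?thesis
    unfolding borel_of_topology_def
  proof (rule measurable_measure_of)
    show "{U. openin (c1_topology a b) U} \<subseteq> Pow (topspace (c1_topology a b))"
      using openin_subset by blast
    show "Y \<in> space M \<rightarrow> topspace (c1_topology a b)"
      using Y \<open>a < b\<close> by (auto simp: topspace_c1_topology)
    fix U assume "U \<in> {U. openin (c1_topology a b) U}"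
    then have U: "U \<subseteq> c1_space a b" "\<And>f. f \<in> U \<Longrightarrow> \<exists>r>0. C.mball f r \<subseteq> U"
      by (auto simp: c1_topology_def C.openin_mtopology)
    have "Y -` U \<inter> space M = (\<Union>p\<in>{p. E p \<subseteq> U}. {\<omega> \<in> space M. Y \<omega> \<in> E p})"
    proof (intro set_eqI iffI)
      fix \<omega> assume w: "\<omega> \<in> Y -` U \<inter> space M"
      then obtain r where r: "r > 0" "C.mball (Y \<omega>) r \<subseteq> U" using U(2)[of "Y \<omega>"] by auto
      obtain m :: nat where m: "1 / real (Suc m) < r / (2 * (2 + (b - a)))"
        using nat_approx_posE[of "r / (2 * (2 + (b - a)))"] r(1) \<open>a < b\<close> by auto
      then have m': "(2 / Suc m) * (2 + (b - a)) < r"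
        using \<open>a < b\<close> by (simp add: field_simps)
      obtain v N xs where e: "Y \<omega> \<in> E (m, v, N, xs)" using cover Y w by blast
      have "E (m, v, N, xs) \<subseteq> C.mball (Y \<omega>) r"
      proof
        fix g assume g: "g \<in> E (m, v, N, xs)"
        then have "g \<in> c1_space a b" by (simp add: E_def)
        then show "g \<in> C.mball (Y \<omega>) r" using small[OF e g] m' Y w by simp
      qed
      then show "\<omega> \<in> (\<Union>p\<in>{p. E p \<subseteq> U}. {\<omega> \<in> space M. Y \<omega> \<in> E p})"
        using e r(2) w by blast
    qed blast
    also have "\<dots> \<in> sets M" using Em by (intro sets.countable_UN'') auto
    finally show "Y -` U \<inter> space M \<in> sets M" .
  qed
qed

lemma borel_measurable_continuous_map:
  fixes F :: "'s \<Rightarrow> real"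
  assumes "continuous_map T euclideanreal F"
  shows "F \<in> borel_measurable (borel_of_topology T)"
proof (rule borel_measurableI)
  fix S :: "real set" assume "open S"
  then have "openin T {x \<in> topspace T. F x \<in> S}"
    using assms by (auto simp: continuous_map_def)
  moreover have sub: "{U. openin T U} \<subseteq> Pow (topspace T)" using openin_subset by blast
  moreover have "F -` S \<inter> space (borel_of_topology T) = {x \<in> topspace T. F x \<in> S}"
    unfolding borel_of_topology_def space_measure_of[OF sub] by auto
  ultimately show "F -` S \<inter> space (borel_of_topology T) \<in> sets (borel_of_topology T)"
    by (simp add: borel_of_topology_def sets_measure_of sigma_sets.Basic)
qed

lemma c1_compact_mono:
  assumes "R \<le> R'" "\<And>j. \<delta>' j \<le> \<delta> j"
  shows "c1_compact a b R \<delta> \<subseteq> c1_compact a b R' \<delta>'"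
proof
  fix f assume f: "f \<in> c1_compact a b R \<delta>"
  have "\<bar>c1_deriv a b f s - c1_deriv a b f t\<bar> \<le> 1 / Suc j"
    if "s \<in> {a..b}" "t \<in> {a..b}" "\<bar>s - t\<bar> \<le> \<delta>' j" for j s t
  proof -
    have "\<bar>s - t\<bar> \<le> \<delta> j" using that(3) assms(2)[of j] by linarith
    then show ?thesis using f that(1,2) unfolding c1_compact_def by blast
  qed
  then show "f \<in> c1_compact a b R' \<delta>'"
    using f assms(1) unfolding c1_compact_def by fastforce
qed

lemma (in prob_space) eventually_full_probability:
  assumes "\<And>n::nat. A n \<in> events" "\<And>n. A n \<subseteq> A (Suc n)" "(\<Union>n. A n) = space M" "0 < e"
  obtains n where "prob (space M - A n) < e"
proof -
  have "(\<lambda>n. prob (A n)) \<longlonglongrightarrow> prob (\<Union>n. A n)"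
    using assms by (intro finite_Lim_measure_incseq) (auto simp: incseq_Suc_iff)
  then have "(\<lambda>n. prob (A n)) \<longlonglongrightarrow> 1" using assms(3) by (simp add: prob_space)
  then have "\<forall>\<^sub>F n in sequentially. 1 - e < prob (A n)"
    using assms(4) by (intro order_tendstoD(1)) auto
  then obtain n where "1 - e < prob (A n)" by (auto simp: eventually_sequentially)
  then show ?thesis using that[of n] prob_compl[OF assms(1)[of n]] by simp
qed

text \<open>
  Every path satisfies some bound and has some modulus of continuity, so a bound and, for each \<open>j\<close>,
  a modulus for the oscillation \<open>1 / (j + 1)\<close> hold outside small events. The exceptional
  probabilities \<open>e / 2\<close> and \<open>e / 4 * 2\<^sup>-\<^sup>j\<close> add up to \<open>e\<close>. Events are stated with rational times
  only, to be measurable, and extended to all times by continuity.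
\<close>

lemma (in prob_space) c1_random_element_tight:
  assumes "a < b" and Y: "\<And>\<omega>. \<omega> \<in> space M \<Longrightarrow> Y \<omega> \<in> c1_space a b"
    and ev: "\<And>t. t \<in> {a..b} \<Longrightarrow> (\<lambda>\<omega>. Y \<omega> t) \<in> borel_measurable M" and "0 < e"
  shows "\<exists>R \<delta>. (\<forall>j. 0 < \<delta> j) \<and> (\<exists>A\<in>events. prob (space M - A) \<le> e \<and> (\<forall>\<omega>\<in>A. Y \<omega> \<in> c1_compact a b R \<delta>))"
proof -
  let ?T = "\<rat> \<inter> {a..b}" and ?d = "\<lambda>\<omega>. c1_deriv a b (Y \<omega>)"
  have cT: "countable ?T" by (intro countable_Int1 countable_rat)
  have dm: "(\<lambda>\<omega>. ?d \<omega> t) \<in> borel_measurable M" if "t \<in> {a..b}" for t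
    by (rule borel_measurable_c1_deriv[OF \<open>a < b\<close> Y ev that])
  have [measurable]: "(\<lambda>\<omega>. Y \<omega> a) \<in> borel_measurable M" using ev \<open>a < b\<close> by simp
  define A where "A = (\<lambda>n::nat. {\<omega> \<in> space M. \<bar>Y \<omega> a\<bar> \<le> real n \<and> (\<forall>t\<in>?T. \<bar>?d \<omega> t\<bar> \<le> real n)})"
  define B where "B = (\<lambda>j n::nat. {\<omega> \<in> space M. \<forall>s\<in>?T. \<forall>t\<in>?T. \<bar>s - t\<bar> < 1 / Suc n \<longrightarrow> \<bar>?d \<omega> s - ?d \<omega> t\<bar> \<le> 1 / Suc j})"
  have Ae: "A n \<in> events" for n
    unfolding A_def
    by (intro sets.sets_Collect_conj sets.sets_Collect_countable_All'[OF _ cT] borel_measurable_le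
       borel_measurable_abs dm borel_measurable_const) auto
  have Be: "B j n \<in> events" for j n
    unfolding B_def
    by (intro sets.sets_Collect_countable_All'[OF _ cT] sets.sets_Collect_imp sets.sets_Collect_const borel_measurable_le
       borel_measurable_abs borel_measurable_diff dm borel_measurable_const) auto
  obtain n where n: "prob (space M - A n) < e / 2"
  proof (rule eventually_full_probability[of A "e / 2"])
    show "A k \<subseteq> A (Suc k)" for k unfolding A_def by force
    show "(\<Union>n. A n) = space M"
    proof (intro equalityI subsetI)
      fix \<omega> assume w: "\<omega> \<in> space M"
      have "compact (?d \<omega> ` {a..b})"
        by (intro compact_continuous_image c1_spaceD(2)[OF Y[OF w]] compact_Icc)
      then obtain K where K: "\<And>t. t \<in> {a..b} \<Longrightarrow> \<bar>?d \<omega> t\<bar> \<le> K"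
        using compact_imp_bounded bounded_real by (metis imageI)
      obtain k where "max \<bar>Y \<omega> a\<bar> K \<le> real k" using real_arch_simple by blast
      then have "\<omega> \<in> A k" using w K unfolding A_def by (auto intro: order.trans[OF K])
      then show "\<omega> \<in> (\<Union>n. A n)" by blast
    qed (auto simp: A_def)
  qed (use Ae \<open>0 < e\<close> in auto)
  have "\<exists>n. prob (space M - B j n) < e / 4 * (1 / 2) ^ j" for j
  proof -
    obtain n where "prob (space M - B j n) < e / 4 * (1 / 2) ^ j"
    proof (rule eventually_full_probability[of "B j" "e / 4 * (1 / 2) ^ j"])
      show "B j k \<subseteq> B j (Suc k)" for k
      proof
        fix \<omega> assume w: "\<omega> \<in> B j k"
        have "1 / real (Suc (Suc k)) \<le> 1 / real (Suc k)" by (intro divide_left_mono) auto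
        then show "\<omega> \<in> B j (Suc k)" using w unfolding B_def by fastforce
      qed
      show "(\<Union>n. B j n) = space M"
      proof (intro equalityI subsetI)
        fix \<omega> assume w: "\<omega> \<in> space M"
        have "uniformly_continuous_on {a..b} (?d \<omega>)"
          using c1_spaceD(2)[OF Y[OF w]] compact_uniformly_continuous by blast
        then obtain d where d: "d > 0" "\<And>s t. s \<in> {a..b} \<Longrightarrow> t \<in> {a..b} \<Longrightarrow> dist t s < d \<Longrightarrow>
            dist (?d \<omega> t) (?d \<omega> s) < 1 / Suc j"
          unfolding uniformly_continuous_on_def by (metis of_nat_0_less_iff zero_less_Suc zero_less_divide_1_iff)
        obtain k where k: "1 / real (Suc k) < d" using nat_approx_posE[OF d(1)] by blast
        have "\<bar>?d \<omega> s - ?d \<omega> t\<bar> \<le> 1 / Suc j" if "s \<in> ?T" "t \<in> ?T" "\<bar>s - t\<bar> < 1 / Suc k" for s t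
          using d(2)[of t s] that k by (auto simp: dist_real_def)
        then have "\<omega> \<in> B j k" using w unfolding B_def by blast
        then show "\<omega> \<in> (\<Union>n. B j n)" by blast
      qed (auto simp: B_def)
    qed (use Be \<open>0 < e\<close> in auto)
    then show ?thesis by blast
  qed
  then obtain N where N: "\<And>j. prob (space M - B j (N j)) < e / 4 * (1 / 2) ^ j" by metis
  \<comment> \<open>The factor 2 leaves room for approximating s and t by rationals at distance below \<open>1 / (N j + 1)\<close>.\<close>
  define \<delta> where "\<delta> = (\<lambda>j. 1 / (2 * real (Suc (N j))))"
  define G where "G = A n \<inter> (\<Inter>j. B j (N j))"
  have Ge: "G \<in> events" unfolding G_def using Ae Be by (intro sets.Int sets.countable_INT') auto
  have "prob (space M - G) \<le> prob (space M - A n) + prob (\<Union>j. space M - B j (N j))"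
  proof -
    have "space M - G \<subseteq> (space M - A n) \<union> (\<Union>j. space M - B j (N j))" by (auto simp: G_def)
    then have "prob (space M - G) \<le> prob ((space M - A n) \<union> (\<Union>j. space M - B j (N j)))"
      using Ae Be by (intro finite_measure_mono) auto
    also have "\<dots> \<le> prob (space M - A n) + prob (\<Union>j. space M - B j (N j))"
      using Ae Be by (intro measure_Un_le) auto
    finally show ?thesis .
  qed
  also have "prob (\<Union>j. space M - B j (N j)) \<le> (\<Sum>j. prob (space M - B j (N j)))"
  proof (rule finite_measure_subadditive_countably)
    show "summable (\<lambda>j. prob (space M - B j (N j)))"
      by (rule summable_comparison_test'[where g="\<lambda>j. e / 4 * (1 / 2) ^ j" and N=0])
         (use N in \<open>auto intro: less_imp_le\<close>)
  qed (use Be in auto)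
  also have "\<dots> \<le> (\<Sum>j. e / 4 * (1 / 2) ^ j)"
  proof (rule suminf_le)
    show "summable (\<lambda>j. prob (space M - B j (N j)))"
      by (rule summable_comparison_test'[where g="\<lambda>j. e / 4 * (1 / 2) ^ j" and N=0])
         (use N in \<open>auto intro: less_imp_le\<close>)
  qed (use N in \<open>auto intro: less_imp_le\<close>)
  also have "\<dots> = e / 4 * (\<Sum>j. (1 / 2) ^ j)" by (rule suminf_mult) (simp add: summable_geometric)
  also have "\<dots> = e / 2" by (subst suminf_geometric) auto
  finally have pG: "prob (space M - G) \<le> e" using n by linarith
  have "Y \<omega> \<in> c1_compact a b (real n) \<delta>" if w: "\<omega> \<in> G" for \<omega>
  proof -
    have wA: "\<omega> \<in> A n" and wB: "\<And>j. \<omega> \<in> B j (N j)" using w by (auto simp: G_def)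
    have ws: "\<omega> \<in> space M" using wA by (simp add: A_def)
    note cd = c1_spaceD(2)[OF Y[OF ws]]
    have "\<bar>?d \<omega> t\<bar> \<le> real n" if t: "t \<in> {a..b}" for t
    proof (rule continuous_le_on_closure[of ?T "\<lambda>t. \<bar>?d \<omega> t\<bar>"])
      show "continuous_on (closure ?T) (\<lambda>t. \<bar>?d \<omega> t\<bar>)" unfolding dense_rationals_Icc[OF \<open>a < b\<close>]
        by (intro continuous_intros cd)
      show "t \<in> closure ?T" unfolding dense_rationals_Icc[OF \<open>a < b\<close>] by fact
    qed (use wA in \<open>auto simp: A_def\<close>)
    moreover have "\<bar>?d \<omega> s - ?d \<omega> t\<bar> \<le> 1 / Suc j"
      if s: "s \<in> {a..b}" and t: "t \<in> {a..b}" and st: "\<bar>s - t\<bar> \<le> \<delta> j" for s t j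
    proof -
      obtain u where u: "\<And>i. u i \<in> ?T" "u \<longlonglongrightarrow> s"
        using s dense_rationals_Icc[OF \<open>a < b\<close>] closure_sequential[of s ?T] by auto
      obtain v where v: "\<And>i. v i \<in> ?T" "v \<longlonglongrightarrow> t"
        using t dense_rationals_Icc[OF \<open>a < b\<close>] closure_sequential[of t ?T] by auto
      have l: "(\<lambda>i. ?d \<omega> (u i)) \<longlonglongrightarrow> ?d \<omega> s" "(\<lambda>i. ?d \<omega> (v i)) \<longlonglongrightarrow> ?d \<omega> t"
        using u v s t by (auto intro!: continuous_on_tendsto_compose[OF cd])
      have "\<delta> j < 1 / Suc (N j)" by (simp add: \<delta>_def field_simps)
      then have "\<forall>\<^sub>F i in sequentially. \<bar>u i - v i\<bar> < 1 / Suc (N j)"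
        using st by (intro order_tendstoD(2)[OF tendsto_rabs[OF tendsto_diff[OF u(2) v(2)]]]) auto
      then have "\<forall>\<^sub>F i in sequentially. \<bar>?d \<omega> (u i) - ?d \<omega> (v i)\<bar> \<le> 1 / Suc j"
        using wB[of j] u(1) v(1) unfolding B_def by (auto elim!: eventually_mono)
      then show ?thesis
        by (intro tendsto_upperbound[OF tendsto_rabs[OF tendsto_diff[OF l]]]) auto
    qed
    ultimately show ?thesis using Y[OF ws] wA by (auto simp: c1_compact_def A_def)
  qed
  then show ?thesis using pG Ge by (intro exI[of _ "real n"] exI[of _ \<delta>]) (auto simp: \<delta>_def)
qed

text \<open>
  All the laws charge a common compact set up to probability \<open>e\<close>. A bounded continuous \<open>F\<close> is
  replaced by a trigonometric functional \<open>A\<close> that is \<open>2 e\<close>-close to \<open>F\<close> on this set and bounded by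
  \<open>B + e\<close> everywhere. The error in expectation is at most \<open>2 e + (2 B + 1) e\<close>, and the expectations
  of \<open>A\<close> converge by assumption.
\<close>

lemma converges_in_distribution_c1I:
  fixes P :: "nat \<Rightarrow> 'a measure"
  assumes "a < b" and P: "\<And>n. prob_space (P n)" and Q: "prob_space Q"
    and Y: "\<And>n x. x \<in> space (P n) \<Longrightarrow> Y n x \<in> c1_space a b"
    and Ym: "\<And>n t. t \<in> {a..b} \<Longrightarrow> (\<lambda>x. Y n x t) \<in> borel_measurable (P n)"
    and Z: "\<And>x. x \<in> space Q \<Longrightarrow> Z x \<in> c1_space a b"
    and Zm: "\<And>t. t \<in> {a..b} \<Longrightarrow> (\<lambda>x. Z x t) \<in> borel_measurable Q"
    and cosl: "\<And>xs. set xs \<subseteq> \<rat> \<times> (\<rat> \<inter> {a..b}) \<Longrightarrow>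
      (\<lambda>n. \<integral>x. cos (point_evaluations xs (Y n x)) \<partial>P n) \<longlonglongrightarrow> (\<integral>x. cos (point_evaluations xs (Z x)) \<partial>Q)"
    and sinl: "\<And>xs. set xs \<subseteq> \<rat> \<times> (\<rat> \<inter> {a..b}) \<Longrightarrow>
      (\<lambda>n. \<integral>x. sin (point_evaluations xs (Y n x)) \<partial>P n) \<longlonglongrightarrow> (\<integral>x. sin (point_evaluations xs (Z x)) \<partial>Q)"
    and tight: "\<And>e. 0 < e \<Longrightarrow> \<exists>R \<delta>. (\<forall>j. 0 < \<delta> j) \<and>
      (\<forall>n. \<exists>A\<in>sets (P n). measure (P n) (space (P n) - A) \<le> e \<and> (\<forall>x\<in>A. Y n x \<in> c1_compact a b R \<delta>))"
  shows "converges_in_distribution (c1_topology a b) P Y Q Z"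
  unfolding converges_in_distribution_def
proof (intro conjI allI impI)
  have YM: "Y n \<in> measurable (P n) (borel_of_topology (c1_topology a b))" for n
    by (rule measurable_borel_of_c1[OF \<open>a < b\<close> Y Ym])
  then show "Y n \<in> measurable (P n) (borel_of_topology (c1_topology a b))" for n .
  show ZM: "Z \<in> measurable Q (borel_of_topology (c1_topology a b))"
    by (rule measurable_borel_of_c1[OF \<open>a < b\<close> Z Zm])
  fix F :: "(real \<Rightarrow> real) \<Rightarrow> real"
  assume "continuous_map (c1_topology a b) euclideanreal F \<and> bounded (F ` topspace (c1_topology a b))"
  then have F: "continuous_map (c1_topology a b) euclideanreal F"
    and "bounded (F ` c1_space a b)" using \<open>a < b\<close> by (auto simp: topspace_c1_topology)
  then obtain B0 where B0: "\<And>f. f \<in> c1_space a b \<Longrightarrow> \<bar>F f\<bar> \<le> B0" by (auto simp: bounded_real)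
  define B where "B = max B0 0"
  have B: "\<And>f. f \<in> c1_space a b \<Longrightarrow> \<bar>F f\<bar> \<le> B" and Bp: "0 \<le> B" using B0 by (force simp: B_def)+
  let ?T = "\<rat> \<inter> {a..b}"
  have mes: "(\<lambda>x. G (W x)) \<in> borel_measurable N"
    if "continuous_map (c1_topology a b) euclideanreal G" "W \<in> measurable N (borel_of_topology (c1_topology a b))"
    for G :: "(real \<Rightarrow> real) \<Rightarrow> real" and W :: "'c \<Rightarrow> real \<Rightarrow> real" and N
    using measurable_compose[OF that(2) borel_measurable_continuous_map[OF that(1)]] .
  have cA: "continuous_map (c1_topology a b) euclideanreal A" if "trig_functional ?T A" for A
    using that \<open>a < b\<close> by (intro continuous_map_trig_functional[of ?T]) auto
  have ib: "integrable N (\<lambda>x. G (W x))"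
    if "continuous_map (c1_topology a b) euclideanreal G" "W \<in> measurable N (borel_of_topology (c1_topology a b))"
      "prob_space N" "\<And>x. x \<in> space N \<Longrightarrow> \<bar>G (W x)\<bar> \<le> C"
    for G :: "(real \<Rightarrow> real) \<Rightarrow> real" and W :: "'c \<Rightarrow> real \<Rightarrow> real" and N C
  proof -
    interpret N: prob_space N by fact
    show ?thesis using that(4) mes[OF that(1,2)] by (intro N.integrable_const_bound[where B=C]) auto
  qed
  have iA: "integrable N (\<lambda>x. A (W x))"
    if "trig_functional ?T A" "W \<in> measurable N (borel_of_topology (c1_topology a b))" "prob_space N"
    for A and W :: "'c \<Rightarrow> real \<Rightarrow> real" and N
    using trig_functional_bounded[OF that(1)] ib[OF cA[OF that(1)] that(2,3)] by metis
  have lim: "(\<lambda>n. \<integral>x. A (Y n x) \<partial>P n) \<longlonglongrightarrow> (\<integral>x. A (Z x) \<partial>Q)" if "trig_functional ?T A" for A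
    using that
  proof induction
    case (cos xs c)
    then show ?case using tendsto_mult_left[OF cosl] by simp
  next
    case (sin xs c)
    then show ?case using tendsto_mult_left[OF sinl] by simp
  next
    case (add A C)
    have "(\<lambda>n. (\<integral>x. A (Y n x) \<partial>P n) + (\<integral>x. C (Y n x) \<partial>P n)) \<longlonglongrightarrow> (\<integral>x. A (Z x) \<partial>Q) + (\<integral>x. C (Z x) \<partial>Q)"
      by (intro tendsto_add add)
    then show ?case
      by (simp add: iA[OF add.hyps(1) YM P] iA[OF add.hyps(2) YM P] iA[OF add.hyps(1) ZM Q] iA[OF add.hyps(2) ZM Q])
  qed
  have err: "\<bar>(\<integral>x. F (W x) \<partial>N) - (\<integral>x. A (W x) \<partial>N)\<bar> \<le> (2 * B + 3) * e"
    if N: "prob_space N" and W: "W \<in> measurable N (borel_of_topology (c1_topology a b))"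
      and Wc: "\<And>x. x \<in> space N \<Longrightarrow> W x \<in> c1_space a b"
      and A: "trig_functional ?T A" and Ab: "\<And>f. \<bar>A f\<bar> \<le> B + e"
      and G: "G \<in> sets N" "measure N (space N - G) \<le> e" and GA: "\<And>x. x \<in> G \<Longrightarrow> \<bar>A (W x) - F (W x)\<bar> \<le> 2 * e"
      and e: "0 < e" "e \<le> 1"
    for N and W :: "'c \<Rightarrow> real \<Rightarrow> real" and A e G
  proof -
    interpret N: prob_space N by fact
    have i1: "integrable N (\<lambda>x. F (W x))" using B Wc by (intro ib[OF F W N, of B]) auto
    have i2: "integrable N (\<lambda>x. A (W x))" by (rule iA[OF A W N])
    have i3: "integrable N (\<lambda>x. indicator (space N - G) x :: real)"
      using G(1) by (intro integrable_real_indicator) (auto simp: less_top[symmetric])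
    have i4: "(\<integral>x. indicator (space N - G) x \<partial>N) = measure N (space N - G)"
    proof -
      have "(space N - G) \<inter> space N = space N - G" by blast
      then show ?thesis by simp
    qed
    have "\<bar>(\<integral>x. F (W x) \<partial>N) - (\<integral>x. A (W x) \<partial>N)\<bar> = \<bar>\<integral>x. F (W x) - A (W x) \<partial>N\<bar>"
      using i1 i2 by simp
    also have "\<dots> \<le> (\<integral>x. 2 * e + (2 * B + 1) * indicator (space N - G) x \<partial>N)"
    proof (rule order.trans[OF integral_abs_bound integral_mono])
      show "integrable N (\<lambda>x. 2 * e + (2 * B + 1) * indicator (space N - G) x)"
        by (intro Bochner_Integration.integrable_add integrable_mult_right N.integrable_const i3)
      fix x assume x: "x \<in> space N"
      show "\<bar>F (W x) - A (W x)\<bar> \<le> 2 * e + (2 * B + 1) * indicator (space N - G) x"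
      proof (cases "x \<in> G")
        case True
        then show ?thesis using GA[of x] by (simp add: abs_minus_commute)
      next
        case False
        then have "indicator (space N - G) x = (1::real)" using x by simp
        then show ?thesis using B[OF Wc[OF x]] Ab[of "W x"] e by simp
      qed
    qed (use i1 i2 in auto)
    also have "\<dots> = 2 * e + (2 * B + 1) * measure N (space N - G)"
      by (subst Bochner_Integration.integral_add[OF N.integrable_const integrable_mult_right[OF i3]])
         (simp only: integral_mult_right_zero i4 lebesgue_integral_const N.prob_space scaleR_one)
    also have "\<dots> \<le> 2 * e + (2 * B + 1) * e" using G(2) Bp by (intro add_left_mono mult_left_mono) auto
    finally show ?thesis by (simp add: algebra_simps)
  qed
  show "(\<lambda>n. \<integral>x. F (Y n x) \<partial>P n) \<longlonglongrightarrow> (\<integral>x. F (Z x) \<partial>Q)"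
  proof (rule LIMSEQ_I)
    fix r :: real assume r: "0 < r"
    define e where "e = min 1 (r / (4 * (2 * B + 3)))"
    have e: "0 < e" "e \<le> 1" using r Bp by (auto simp: e_def)
    have er: "(2 * B + 3) * e \<le> r / 4"
    proof -
      have "(2 * B + 3) * e \<le> (2 * B + 3) * (r / (4 * (2 * B + 3)))"
        using Bp by (intro mult_left_mono) (auto simp: e_def)
      also have "\<dots> = r / 4" using Bp by (simp add: field_simps)
      finally show ?thesis .
    qed
    obtain R1 \<delta>1 where 1: "\<And>j. 0 < \<delta>1 j" "\<And>n. \<exists>A\<in>sets (P n). measure (P n) (space (P n) - A) \<le> e \<and> (\<forall>x\<in>A. Y n x \<in> c1_compact a b R1 \<delta>1)"
      using tight[OF e(1)] by metis
    obtain R2 \<delta>2 A2 where 2: "\<And>j. 0 < \<delta>2 j" "A2 \<in> sets Q" "measure Q (space Q - A2) \<le> e" "\<And>x. x \<in> A2 \<Longrightarrow> Z x \<in> c1_compact a b R2 \<delta>2"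
      using prob_space.c1_random_element_tight[OF Q \<open>a < b\<close> Z Zm e(1)] by metis
    define R where "R = max R1 R2"
    define \<delta> where "\<delta> = (\<lambda>j. min (\<delta>1 j) (\<delta>2 j))"
    have \<delta>: "\<And>j. 0 < \<delta> j" using 1(1) 2(1) by (simp add: \<delta>_def)
    have K1: "c1_compact a b R1 \<delta>1 \<subseteq> c1_compact a b R \<delta>" and K2: "c1_compact a b R2 \<delta>2 \<subseteq> c1_compact a b R \<delta>"
      by (intro c1_compact_mono; simp add: R_def \<delta>_def)+
    obtain A where A: "trig_functional ?T A"
      "\<And>f. f \<in> c1_compact a b R \<delta> \<Longrightarrow> \<bar>A f - F f\<bar> \<le> 2 * e" "\<And>f. \<bar>A f\<bar> \<le> B + e"
      using trig_functional_approximation[where \<delta>=\<delta> and R=R, OF F \<open>a < b\<close> _ B e(1)] \<delta> by blast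
    have eY: "\<bar>(\<integral>x. F (Y n x) \<partial>P n) - (\<integral>x. A (Y n x) \<partial>P n)\<bar> \<le> r / 4" for n
    proof -
      obtain G where G: "G \<in> sets (P n)" "measure (P n) (space (P n) - G) \<le> e" "\<And>x. x \<in> G \<Longrightarrow> Y n x \<in> c1_compact a b R1 \<delta>1"
        using 1(2) by blast
      have "\<bar>(\<integral>x. F (Y n x) \<partial>P n) - (\<integral>x. A (Y n x) \<partial>P n)\<bar> \<le> (2 * B + 3) * e"
        by (rule err[OF P YM Y A(1,3) G(1,2) _ e]) (use G(3) K1 A(2) in blast)+
      then show ?thesis using er by linarith
    qed
    have eZ: "\<bar>(\<integral>x. F (Z x) \<partial>Q) - (\<integral>x. A (Z x) \<partial>Q)\<bar> \<le> r / 4"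
    proof -
      have "\<bar>(\<integral>x. F (Z x) \<partial>Q) - (\<integral>x. A (Z x) \<partial>Q)\<bar> \<le> (2 * B + 3) * e"
        by (rule err[OF Q ZM Z A(1,3) 2(2,3) _ e]) (use 2(4) K2 A(2) in blast)+
      then show ?thesis using er by linarith
    qed
    obtain n0 where n0: "\<And>n. n \<ge> n0 \<Longrightarrow> \<bar>(\<integral>x. A (Y n x) \<partial>P n) - (\<integral>x. A (Z x) \<partial>Q)\<bar> < r / 4"
      using LIMSEQ_D[OF lim[OF A(1)], of "r / 4"] r by auto
    have "norm ((\<integral>x. F (Y n x) \<partial>P n) - (\<integral>x. F (Z x) \<partial>Q)) < r" if "n \<ge> n0" for n
      using eY[of n] eZ n0[OF that] r unfolding real_norm_def by linarith
    then show "\<exists>n0. \<forall>n\<ge>n0. norm ((\<integral>x. F (Y n x) \<partial>P n) - (\<integral>x. F (Z x) \<partial>Q)) < r" by blast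
  qed
qed

section \<open>The uniform law on the circle\<close>

text \<open>
  The uniform law on a period, kept as a measure on the real line: the circle is only seen through
  the periodicity of the integrands.
\<close>

definition circle :: "real measure" where
  "circle = uniform_measure lborel {0..2*pi}"

lemma sets_circle [measurable_cong, simp]: "sets circle = sets borel"
  and space_circle [simp]: "space circle = UNIV"
  by (simp_all add: circle_def)

lemma prob_space_circle: "prob_space circle"
  unfolding circle_def by (rule prob_space_uniform_measure) auto

interpretation circle: prob_space circle by (rule prob_space_circle)

lemma nn_integral_circle:
  assumes [measurable]: "f \<in> borel_measurable borel"
  shows "(\<integral>\<^sup>+x. f x \<partial>circle) = (\<integral>\<^sup>+x. f x * indicator {0..2*pi} x \<partial>lborel) / ennreal (2 * pi)"
  unfolding circle_def by (subst nn_integral_uniform_measure) auto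

text \<open>
  Translate, cut at the end of the period and translate the overhanging piece back.
\<close>

lemma nn_integral_periodic_window:
  fixes f :: "real \<Rightarrow> ennreal"
  assumes [measurable]: "f \<in> borel_measurable borel" and per: "\<And>x. f (x + 2 * pi) = f x"
    and r: "0 \<le> r" "r \<le> 2 * pi"
  shows "(\<integral>\<^sup>+x. f (x + r) * indicator {0..2*pi} x \<partial>lborel) = (\<integral>\<^sup>+x. f x * indicator {0..2*pi} x \<partial>lborel)"
proof -
  have half_open: "(\<integral>\<^sup>+x. g x * indicator {0..2*pi} x \<partial>lborel) = (\<integral>\<^sup>+x. g x * indicator {0<..2*pi} x \<partial>lborel)"
    if [measurable]: "g \<in> borel_measurable borel" for g :: "real \<Rightarrow> ennreal"
  proof (rule nn_integral_cong_AE)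
    show "AE x in lborel. g x * indicator {0..2*pi} x = g x * indicator {0<..2*pi} x"
      using AE_lborel_singleton[of 0] by eventually_elim (auto simp: indicator_def)
  qed
  have "(\<integral>\<^sup>+x. f (x + r) * indicator {0..2*pi} x \<partial>lborel) = (\<integral>\<^sup>+x. f (x + r) * indicator {0<..2*pi} x \<partial>lborel)"
    by (rule half_open) measurable
  also have "\<dots> = (\<integral>\<^sup>+x. f (r + 1 * x) * indicator {r<..r + 2*pi} (r + 1 * x) \<partial>lborel)"
    by (intro nn_integral_cong) (auto simp: indicator_def add.commute)
  also have "\<dots> = (\<integral>\<^sup>+x. f x * indicator {r<..r + 2*pi} x \<partial>lborel)"
    using nn_integral_real_affine[of "\<lambda>x. f x * indicator {r<..r + 2*pi} x" 1 r] by simp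
  also have "\<dots> = (\<integral>\<^sup>+x. f x * indicator {r<..2*pi} x + f x * indicator {2*pi<..2*pi + r} x \<partial>lborel)"
    using r by (intro nn_integral_cong) (auto simp: indicator_def)
  also have "\<dots> = (\<integral>\<^sup>+x. f x * indicator {r<..2*pi} x \<partial>lborel) + (\<integral>\<^sup>+x. f x * indicator {2*pi<..2*pi + r} x \<partial>lborel)"
    by (intro nn_integral_add) auto
  also have "(\<integral>\<^sup>+x. f x * indicator {2*pi<..2*pi + r} x \<partial>lborel)
     = (\<integral>\<^sup>+x. f (2 * pi + 1 * x) * indicator {2*pi<..2*pi + r} (2 * pi + 1 * x) \<partial>lborel)"
    using nn_integral_real_affine[of "\<lambda>x. f x * indicator {2*pi<..2*pi + r} x" 1 "2 * pi"] by simp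
  also have "\<dots> = (\<integral>\<^sup>+x. f x * indicator {0<..r} x \<partial>lborel)"
    using per by (intro nn_integral_cong) (auto simp: indicator_def add.commute)
  also have "(\<integral>\<^sup>+x. f x * indicator {r<..2*pi} x \<partial>lborel) + (\<integral>\<^sup>+x. f x * indicator {0<..r} x \<partial>lborel)
     = (\<integral>\<^sup>+x. f x * indicator {r<..2*pi} x + f x * indicator {0<..r} x \<partial>lborel)"
    by (intro nn_integral_add[symmetric]) auto
  also have "\<dots> = (\<integral>\<^sup>+x. f x * indicator {0<..2*pi} x \<partial>lborel)"
    using r by (intro nn_integral_cong) (auto simp: indicator_def)
  also have "\<dots> = (\<integral>\<^sup>+x. f x * indicator {0..2*pi} x \<partial>lborel)"
    by (rule half_open[symmetric]) measurable
  finally show ?thesis .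
qed

lemma periodic_int_multiple:
  fixes f :: "real \<Rightarrow> 'b"
  assumes "\<And>x. f (x + 2 * pi) = f x"
  shows "f (x + 2 * pi * of_int k) = f x"
proof -
  have n: "f (x + 2 * pi * of_nat n) = f x" for n x
    by (induction n) (use assms[of "x + 2 * pi * of_nat _"] in \<open>auto simp: algebra_simps\<close>)
  show ?thesis
  proof (cases "0 \<le> k")
    case True
    then show ?thesis using n[of x "nat k"] by simp
  next
    case False
    then show ?thesis using n[of "x + 2 * pi * of_int k" "nat (- k)"] by simp
  qed
qed

lemma nn_integral_circle_shift:
  fixes f :: "real \<Rightarrow> ennreal"
  assumes [measurable]: "f \<in> borel_measurable borel" and per: "\<And>x. f (x + 2 * pi) = f x"
  shows "(\<integral>\<^sup>+x. f (x + s) \<partial>circle) = (\<integral>\<^sup>+x. f x \<partial>circle)"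
proof -
  define k where "k = \<lfloor>s / (2 * pi)\<rfloor>"
  define r where "r = s - 2 * pi * of_int k"
  have "of_int k \<le> s / (2 * pi)" "s / (2 * pi) < of_int k + 1" by (auto simp: k_def)
  then have r: "0 \<le> r" "r \<le> 2 * pi" by (auto simp: r_def field_simps)
  have "f (x + s) = f (x + r)" for x
    using periodic_int_multiple[of f "x + r" k] per by (simp add: r_def)
  then have "(\<integral>\<^sup>+x. f (x + s) \<partial>circle) = (\<integral>\<^sup>+x. f (x + r) \<partial>circle)" by simp
  also have "\<dots> = (\<integral>\<^sup>+x. f x \<partial>circle)"
    using nn_integral_periodic_window[of f r] per r by (simp add: nn_integral_circle)
  finally show ?thesis .
qed

lemma distr_circle_shift:
  assumes [measurable]: "f \<in> borel_measurable borel" and per: "\<And>x. f (x + 2 * pi) = f x"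
  shows "distr circle borel (\<lambda>x. f (x + s)) = distr circle borel f"
proof (rule measure_eqI)
  fix A :: "'a set" assume "A \<in> sets (distr circle borel (\<lambda>x. f (x + s)))"
  then have [measurable]: "A \<in> sets borel" by simp
  have [measurable]: "f \<in> borel_measurable circle" "(\<lambda>x. f (x + s)) \<in> borel_measurable circle"
    by (simp_all cong: measurable_cong_sets)
  have "emeasure (distr circle borel g) A = (\<integral>\<^sup>+x. indicator A (g x) \<partial>circle)"
    if [measurable]: "g \<in> borel_measurable circle" for g :: "real \<Rightarrow> 'a"
    by (subst nn_integral_indicator[symmetric]) (auto simp: nn_integral_distr simp del: nn_integral_indicator)
  then show "emeasure (distr circle borel (\<lambda>x. f (x + s))) A = emeasure (distr circle borel f) A"
    using nn_integral_circle_shift[of "\<lambda>x. indicator A (f x)" s] per by simp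
qed simp

lemma integral_circle_shift:
  fixes f :: "real \<Rightarrow> 'b :: {banach, second_countable_topology}"
  assumes m[measurable]: "f \<in> borel_measurable borel" and per: "\<And>x. f (x + 2 * pi) = f x"
  shows "(\<integral>x. f (x + s) \<partial>circle) = (\<integral>x. f x \<partial>circle)"
proof -
  have [measurable]: "f \<in> borel_measurable circle" "(\<lambda>x. f (x + s)) \<in> borel_measurable circle"
    by (simp_all cong: measurable_cong_sets)
  have "(\<integral>x. f (x + s) \<partial>circle) = (\<integral>y. y \<partial>distr circle borel (\<lambda>x. f (x + s)))"
    by (simp add: integral_distr)
  also have "\<dots> = (\<integral>x. f x \<partial>circle)"
    unfolding distr_circle_shift[OF m per] by (simp add: integral_distr)
  finally show ?thesis .
qed

lemma integrable_circle_continuous: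
  fixes f :: "real \<Rightarrow> real"
  assumes "continuous_on UNIV f" "\<And>x. \<bar>f x\<bar> \<le> B"
  shows "integrable circle f"
  using assms by (intro circle.integrable_const_bound[where B=B])
    (auto simp: borel_measurable_continuous_onI cong: measurable_cong_sets)

text \<open>
  Translation by half a wavelength, \<open>pi / m\<close>, changes the sign of the integrand but not the
  integral.
\<close>

lemma circle_orthogonality:
  assumes "m \<noteq> (0::int)"
  shows "(\<integral>x. cos (of_int m * x) \<partial>circle) = 0" "(\<integral>x. sin (of_int m * x) \<partial>circle) = 0"
proof -
  have s: "of_int m * (x + pi / of_int m) = of_int m * x + pi" for x :: real
    using assms by (simp add: field_simps)
  have p: "of_int m * (x + 2 * pi) = of_int m * x + of_int m * (2 * pi)" for x :: real
    by (simp add: algebra_simps)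
  have c: "cos (of_int m * (x + 2 * pi)) = cos (of_int m * x)" for x :: real
    unfolding p cos_add using cos_int_2pin[of m] sin_int_2pin[of m] by (simp add: mult_ac)
  have d: "sin (of_int m * (x + 2 * pi)) = sin (of_int m * x)" for x :: real
    unfolding p sin_add using cos_int_2pin[of m] sin_int_2pin[of m] by (simp add: mult_ac)
  have "(\<integral>x. cos (of_int m * x) \<partial>circle) = (\<integral>x. cos (of_int m * (x + pi / of_int m)) \<partial>circle)"
    by (rule integral_circle_shift[symmetric]) (simp_all add: c)
  also have "\<dots> = - (\<integral>x. cos (of_int m * x) \<partial>circle)" unfolding s by simp
  finally show "(\<integral>x. cos (of_int m * x) \<partial>circle) = 0" by simp
  have "(\<integral>x. sin (of_int m * x) \<partial>circle) = (\<integral>x. sin (of_int m * (x + pi / of_int m)) \<partial>circle)"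
    by (rule integral_circle_shift[symmetric]) (simp_all add: d)
  also have "\<dots> = - (\<integral>x. sin (of_int m * x) \<partial>circle)" unfolding s by simp
  finally show "(\<integral>x. sin (of_int m * x) \<partial>circle) = 0" by simp
qed

lemma circle_parseval:
  fixes c :: "nat \<Rightarrow> complex"
  assumes "finite A"
  shows "(\<integral>x. (cmod (\<Sum>k\<in>A. c k * cis (real k * x)))\<^sup>2 \<partial>circle) = (\<Sum>k\<in>A. (cmod (c k))\<^sup>2)"
proof -
  have "(cmod (\<Sum>k\<in>A. c k * cis (real k * x)))\<^sup>2
     = (\<Sum>k\<in>A. \<Sum>l\<in>A. Re (c k * cnj (c l)) * cos (of_int (int k - int l) * x)
          - Im (c k * cnj (c l)) * sin (of_int (int k - int l) * x))" for x
  proof -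
    have "complex_of_real ((cmod (\<Sum>k\<in>A. c k * cis (real k * x)))\<^sup>2)
       = (\<Sum>k\<in>A. c k * cis (real k * x)) * cnj (\<Sum>k\<in>A. c k * cis (real k * x))"
      by (rule complex_norm_square)
    also have "\<dots> = (\<Sum>k\<in>A. \<Sum>l\<in>A. (c k * cnj (c l)) * cis (of_int (int k - int l) * x))"
      unfolding cnj_sum sum_product
    proof (intro sum.cong refl)
      fix k l
      have "cis (real k * x) * cnj (cis (real l * x)) = cis (of_int (int k - int l) * x)"
        by (simp add: cis_cnj cis_mult left_diff_distrib)
      then show "c k * cis (real k * x) * cnj (c l * cis (real l * x))
          = c k * cnj (c l) * cis (of_int (int k - int l) * x)"
        by (simp add: mult_ac)
    qed
    finally have "(cmod (\<Sum>k\<in>A. c k * cis (real k * x)))\<^sup>2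
       = Re (\<Sum>k\<in>A. \<Sum>l\<in>A. (c k * cnj (c l)) * cis (of_int (int k - int l) * x))"
      by (metis Re_complex_of_real)
    then show ?thesis by simp
  qed
  then have "(\<integral>x. (cmod (\<Sum>k\<in>A. c k * cis (real k * x)))\<^sup>2 \<partial>circle)
     = (\<integral>x. (\<Sum>k\<in>A. \<Sum>l\<in>A. Re (c k * cnj (c l)) * cos (of_int (int k - int l) * x)
          - Im (c k * cnj (c l)) * sin (of_int (int k - int l) * x)) \<partial>circle)" by simp
  also have "\<dots> = (\<Sum>k\<in>A. \<Sum>l\<in>A. Re (c k * cnj (c l)) * (\<integral>x. cos (of_int (int k - int l) * x) \<partial>circle)
          - Im (c k * cnj (c l)) * (\<integral>x. sin (of_int (int k - int l) * x) \<partial>circle))"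
  proof -
    have 1: "integrable circle (\<lambda>x. cos (y * x))" "integrable circle (\<lambda>x. sin (y * x))" for y :: real
      by (rule integrable_circle_continuous[where B=1]; auto intro!: continuous_intros)+
    show ?thesis
      by (simp only: Bochner_Integration.integral_sum Bochner_Integration.integrable_sum
        Bochner_Integration.integral_diff Bochner_Integration.integrable_diff integrable_mult_right 1 integral_mult_right_zero)
  qed
  also have "\<dots> = (\<Sum>k\<in>A. \<Sum>l\<in>A. if l = k then (cmod (c k))\<^sup>2 else 0)"
  proof (intro sum.cong refl)
    fix k l
    show "Re (c k * cnj (c l)) * (\<integral>x. cos (of_int (int k - int l) * x) \<partial>circle)
          - Im (c k * cnj (c l)) * (\<integral>x. sin (of_int (int k - int l) * x) \<partial>circle)
       = (if l = k then (cmod (c k))\<^sup>2 else 0)"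
    proof (cases "l = k")
      case True
      moreover have "circle.prob UNIV = 1" using circle.prob_space by simp
      ultimately show ?thesis using True cmod_power2[of "c k"] by (simp add: power2_eq_square)
    next
      case False
      then have "int k - int l \<noteq> 0" by simp
      then show ?thesis using circle_orthogonality[of "int k - int l"] False by simp
    qed
  qed
  also have "\<dots> = (\<Sum>k\<in>A. (cmod (c k))\<^sup>2)" using assms by (simp add: sum.delta)
  finally show ?thesis .
qed

section \<open>Dirichlet kernels with Lipschitz weights\<close>

text \<open>
  Weights are evaluated at the frequencies \<open>k / n\<close>, hence on the unit interval; one constant serves
  as bound and as Lipschitz constant.
\<close>

definition weight :: "real \<Rightarrow> (real \<Rightarrow> complex) \<Rightarrow> bool" where
  "weight B h \<longleftrightarrow> 0 < B \<and> (\<forall>s\<in>{0..1}. cmod (h s) \<le> B) \<and> (\<forall>s\<in>{0..1}. \<forall>t\<in>{0..1}. cmod (h s - h t) \<le> B * \<bar>s - t\<bar>)"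

definition dirichlet :: "(real \<Rightarrow> complex) \<Rightarrow> nat \<Rightarrow> real \<Rightarrow> complex" where
  "dirichlet h n v = (\<Sum>k=1..n. h (real k / real n) * cis (real k * v))"

lemma continuous_dirichlet [continuous_intros]:
  "continuous_on S f \<Longrightarrow> continuous_on S (\<lambda>x. dirichlet h n (f x))"
  unfolding dirichlet_def cis_conv_exp by (intro continuous_intros)

lemma borel_measurable_dirichlet [measurable]: "dirichlet h n \<in> borel_measurable borel"
  by (intro borel_measurable_continuous_onI continuous_dirichlet continuous_on_id)

lemma dirichlet_periodic: "dirichlet h n (v + 2 * pi) = dirichlet h n v"
proof -
  have "cis (real k * (v + 2 * pi)) = cis (real k * v)" for k
  proof -
    have "cis (real k * (v + 2 * pi)) = cis (real k * v) * cis (2 * pi * real k)"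
      by (simp add: cis_mult algebra_simps)
    also have "cis (2 * pi * real k) = 1" by (rule cis_multiple_2pi) simp
    finally show ?thesis by simp
  qed
  then show ?thesis by (simp add: dirichlet_def)
qed

lemma weightD:
  assumes "weight B h"
  shows "0 < B" "s \<in> {0..1} \<Longrightarrow> cmod (h s) \<le> B"
    "s \<in> {0..1} \<Longrightarrow> t \<in> {0..1} \<Longrightarrow> cmod (h s - h t) \<le> B * \<bar>s - t\<bar>"
  using assms by (auto simp: weight_def)

lemma dirichlet_bound:
  assumes "weight B h"
  shows "cmod (dirichlet h n v) \<le> B * real n"
proof -
  have "cmod (dirichlet h n v) \<le> (\<Sum>k=1..n. B)"
    unfolding dirichlet_def
    by (intro sum_norm_le) (auto simp: norm_mult divide_simps intro!: weightD(2)[OF assms])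
  then show ?thesis by (simp add: mult.commute)
qed

text \<open>
  Summation by parts: multiplication by \<open>1 - cis v\<close> leaves two boundary terms and the increments of
  \<open>h\<close>, whose sum is at most the Lipschitz constant.
\<close>

lemma dirichlet_abel:
  assumes w: "weight B h"
  shows "cmod (1 - cis v) * cmod (dirichlet h n v) \<le> 3 * B"
proof (cases "n = 0")
  case True
  then show ?thesis using weightD(1)[OF w] by (simp add: dirichlet_def)
next
  case False
  define g where "g = (\<lambda>k::nat. h (real k / real n))"
  have B: "0 < B" using weightD(1)[OF w] .
  have ab: "(1 - cis v) * (\<Sum>k=1..Suc m. g k * cis (real k * v))
      = g 1 * cis v - g (Suc m) * cis (real (m + 2) * v) + (\<Sum>k=1..m. (g (Suc k) - g k) * cis (real (Suc k) * v))" for m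
  proof (induction m)
    case 0
    have "cis v * cis v = cis (2 * v)" by (simp add: cis_mult)
    then show ?case by (simp add: algebra_simps numeral_2_eq_2)
  next
    case (Suc m)
    have e: "cis (real (m + 3) * v) = cis v * cis (real (m + 2) * v)" by (simp add: cis_mult algebra_simps)
    have "(1 - cis v) * (\<Sum>k=1..Suc (Suc m). g k * cis (real k * v))
       = (1 - cis v) * (\<Sum>k=1..Suc m. g k * cis (real k * v)) + (1 - cis v) * (g (m + 2) * cis (real (m + 2) * v))"
      by (simp add: algebra_simps)
    also have "\<dots> = g 1 * cis v - g (Suc (Suc m)) * cis (real (Suc m + 2) * v)
       + (\<Sum>k=1..Suc m. (g (Suc k) - g k) * cis (real (Suc k) * v))"
      unfolding Suc using e by (simp add: algebra_simps eval_nat_numeral)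
    finally show ?case .
  qed
  obtain m where n: "n = Suc m" using False not0_implies_Suc by blast
  have gB: "cmod (g k) \<le> B" if "k \<le> n" for k
    unfolding g_def using that False by (intro weightD(2)[OF w]) (auto simp: divide_simps)
  have gd: "cmod (g (Suc k) - g k) \<le> B / real n" if "k < n" for k
  proof -
    have "cmod (g (Suc k) - g k) \<le> B * \<bar>real (Suc k) / real n - real k / real n\<bar>"
      unfolding g_def using that False by (intro weightD(3)[OF w]) (auto simp: divide_simps)
    also have "real (Suc k) / real n - real k / real n = 1 / real n"
      by (simp add: diff_divide_distrib[symmetric])
    finally show ?thesis by simp
  qed
  have "cmod (1 - cis v) * cmod (dirichlet h n v) = cmod ((1 - cis v) * (\<Sum>k=1..Suc m. g k * cis (real k * v)))"
    unfolding norm_mult dirichlet_def g_def n ..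
  also have "\<dots> \<le> cmod (g 1 * cis v) + cmod (g (Suc m) * cis (real (m + 2) * v))
      + (\<Sum>k=1..m. cmod ((g (Suc k) - g k) * cis (real (Suc k) * v)))"
    unfolding ab by (rule order.trans[OF norm_triangle_ineq add_mono[OF norm_triangle_ineq4 norm_sum]])
  also have "\<dots> \<le> B + B + (\<Sum>k=1..m. B / real n)"
    using gB gd n by (intro add_mono sum_mono) (auto simp: norm_mult)
  also have "(\<Sum>k=1..m. B / real n) \<le> B"
    using B n by (simp add: field_simps)
  finally show ?thesis by simp
qed

lemma cmod_1_minus_cis: "cmod (1 - cis v) = 2 * \<bar>sin (v / 2)\<bar>"
  using dist_exp_i_1[of v] by (simp add: cis_conv_exp norm_minus_commute)

lemma sin_ge_half:
  assumes "0 \<le> y" "y \<le> pi / 2"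
  shows "y / 2 \<le> sin y"
proof (cases "y \<le> pi / 3")
  case True
  have "(\<lambda>y. sin y - y / 2) 0 \<le> (\<lambda>y. sin y - y / 2) y"
  proof (rule DERIV_nonneg_imp_nondecreasing[OF assms(1)])
    fix x assume x: "0 \<le> x" "x \<le> y"
    have "((\<lambda>y. sin y - y / 2) has_real_derivative cos x - 1 / 2) (at x)"
      by (auto intro!: derivative_eq_intros)
    moreover have "cos (pi / 3) \<le> cos x" using x True pi_gt_zero by (intro cos_monotone_0_pi_le) auto
    ultimately show "\<exists>d. ((\<lambda>y. sin y - y / 2) has_real_derivative d) (at x) \<and> 0 \<le> d"
      by (intro exI[of _ "cos x - 1 / 2"]) (simp add: cos_60)
  qed
  then show ?thesis by simp
next
  case False
  have "sin (pi / 3) \<le> sin y" using False assms by (intro sin_monotone_2pi_le) auto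
  then have "sqrt 3 / 2 \<le> sin y" by (simp add: sin_60)
  moreover have "1.6 \<le> sqrt 3" by (rule real_le_rsqrt) (simp add: power2_eq_square)
  moreover have "pi < 3.2" using pi_approx by simp
  ultimately show ?thesis using assms by simp
qed

text \<open>
  Close to the multiples of \<open>2 pi\<close> the trivial bound \<open>B n\<close> is used, elsewhere summation by parts
  with \<open>\<bar>1 - cis v\<bar> = 2 \<bar>sin (v / 2)\<bar> \<ge> y / 2\<close>, where \<open>y\<close> is the distance to the nearest multiple.
  Adding the two end points of the period avoids a case distinction in the integral.
\<close>

lemma dirichlet_bound_near:
  assumes w: "weight B h" and v: "0 \<le> v" "v \<le> 2 * pi" and n: "1 \<le> n"
  shows "cmod (dirichlet h n v) \<le> 12 * B * (real n / (1 + real n * v) + real n / (1 + real n * (2 * pi - v)))"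
proof -
  have B: "0 < B" using weightD(1)[OF w] .
  have *: "cmod (dirichlet h n v) \<le> 12 * B * (real n / (1 + real n * y))"
    if y: "0 \<le> y" "y / 4 \<le> \<bar>sin (v / 2)\<bar>" for y
  proof (cases "real n * y \<le> 1")
    case True
    have "real n / 2 \<le> real n / (1 + real n * y)"
      using True y by (intro divide_left_mono) (auto intro!: mult_pos_pos add_pos_nonneg)
    then have "12 * B * (real n / 2) \<le> 12 * B * (real n / (1 + real n * y))"
      using B by (intro mult_left_mono) auto
    moreover have "B * real n \<le> 12 * B * (real n / 2)" using B by simp
    ultimately have "B * real n \<le> 12 * B * (real n / (1 + real n * y))" by linarith
    then show ?thesis using dirichlet_bound[OF w, of n v] by linarith
  next
    case False
    then have yp: "0 < y" using y by (cases "y = 0") auto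
    have "2 * (y / 4) * cmod (dirichlet h n v) \<le> 2 * \<bar>sin (v / 2)\<bar> * cmod (dirichlet h n v)"
      using y by (intro mult_right_mono mult_left_mono) auto
    also have "\<dots> \<le> 3 * B" using dirichlet_abel[OF w, of v n] by (simp add: cmod_1_minus_cis)
    finally have "cmod (dirichlet h n v) \<le> 6 * B / y" using yp by (simp add: field_simps)
    also have "\<dots> \<le> 12 * B * (real n / (1 + real n * y))"
    proof -
      have "6 * B * (1 + real n * y) \<le> 6 * B * (2 * (real n * y))"
      proof (rule mult_left_mono)
        show "1 + real n * y \<le> 2 * (real n * y)" using False by linarith
      qed (use B in simp)
      moreover have "0 < 1 + real n * y" using yp by (simp add: add_pos_nonneg)
      ultimately have "6 * B / y \<le> 6 * B * (2 * real n) / (1 + real n * y)"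
        using yp by (simp add: divide_le_eq le_divide_eq mult_ac)
      then show ?thesis by (simp add: mult_ac)
    qed
    finally show ?thesis .
  qed
  have pos: "0 \<le> 12 * B * (real n / (1 + real n * y))" if "0 \<le> y" for y using B that by simp
  show ?thesis
  proof (cases "v \<le> pi")
    case True
    have "v / 4 \<le> \<bar>sin (v / 2)\<bar>" using sin_ge_half[of "v / 2"] True v by simp
    then show ?thesis using *[OF v(1)] pos[of "2 * pi - v"] v by (simp add: distrib_left)
  next
    case False
    have "(2 * pi - v) / 4 \<le> \<bar>sin (v / 2)\<bar>"
      using sin_ge_half[of "pi - v / 2"] False v by (simp add: sin_diff)
    then show ?thesis using *[of "2 * pi - v"] pos[of v] v by (simp add: distrib_left)
  qed
qed

text \<open>
  The logarithmic growth of the Lebesgue constants survives Lipschitz weights.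
\<close>

lemma dirichlet_L1:
  assumes w: "weight B h" and n: "1 \<le> n"
  shows "(\<integral>\<^sup>+v. ennreal (cmod (dirichlet h n v)) \<partial>circle) \<le> ennreal (12 * B * ln (1 + 2 * pi * real n))"
proof -
  have B: "0 < B" using weightD(1)[OF w] .
  have n0: "0 < real n" using n by simp
  let ?f = "\<lambda>v. real n / (1 + real n * v)" and ?g = "\<lambda>v. real n / (1 + real n * (2 * pi - v))"
  let ?L = "ln (1 + 2 * pi * real n)"
  have L: "0 \<le> ?L" using n0 by (intro ln_ge_zero) simp
  have f: "(\<integral>\<^sup>+v. ennreal (?f v) * indicator {0..2*pi} v \<partial>lborel) = ln (1 + real n * (2 * pi)) - ln (1 + real n * 0)"
    using n0 by (intro nn_integral_FTC_Icc)
      (auto intro!: derivative_eq_intros simp: add_pos_nonneg)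
  have "(\<integral>\<^sup>+v. ennreal (?g v) * indicator {0..2*pi} v \<partial>lborel)
      = (- ln (1 + real n * (2 * pi - 2 * pi))) - (- ln (1 + real n * (2 * pi - 0)))"
    using n0 by (intro nn_integral_FTC_Icc)
      (auto intro!: derivative_eq_intros simp: add_pos_nonneg)
  then have g: "(\<integral>\<^sup>+v. ennreal (?g v) * indicator {0..2*pi} v \<partial>lborel) = ?L"
    by (simp add: mult_ac)
  have f: "(\<integral>\<^sup>+v. ennreal (?f v) * indicator {0..2*pi} v \<partial>lborel) = ?L" unfolding f by (simp add: mult_ac)
  have "(\<integral>\<^sup>+v. ennreal (cmod (dirichlet h n v)) * indicator {0..2*pi} v \<partial>lborel)
     \<le> (\<integral>\<^sup>+v. ennreal (12 * B) * (ennreal (?f v) * indicator {0..2*pi} v + ennreal (?g v) * indicator {0..2*pi} v) \<partial>lborel)"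
  proof (intro nn_integral_mono)
    fix v :: real
    show "ennreal (cmod (dirichlet h n v)) * indicator {0..2*pi} v
      \<le> ennreal (12 * B) * (ennreal (?f v) * indicator {0..2*pi} v + ennreal (?g v) * indicator {0..2*pi} v)"
    proof (cases "v \<in> {0..2*pi}")
      case True
      then have "0 \<le> ?f v" "0 \<le> ?g v" using n0 by auto
      then show ?thesis using True dirichlet_bound_near[OF w, of v n] n B
        by (simp add: ennreal_mult[symmetric] ennreal_plus[symmetric] ennreal_leI del: ennreal_plus)
    qed simp
  qed
  also have "\<dots> = ennreal (12 * B) * (ennreal ?L + ennreal ?L)"
    by (subst nn_integral_cmult) (auto simp: nn_integral_add f g)
  also have "\<dots> = ennreal (24 * B * ?L)"
    using L B by (simp add: ennreal_mult[symmetric] ennreal_plus[symmetric] del: ennreal_plus)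
  finally have "(\<integral>\<^sup>+v. ennreal (cmod (dirichlet h n v)) \<partial>circle) \<le> ennreal (24 * B * ?L) / ennreal (2 * pi)"
    by (subst nn_integral_circle) (auto intro: divide_right_mono_ennreal)
  also have "\<dots> = ennreal (24 * B * ?L / (2 * pi))"
    using L B by (subst divide_ennreal) auto
  also have "\<dots> \<le> ennreal (12 * B * ?L)"
  proof (rule ennreal_leI)
    have "24 * B * ?L / (2 * pi) \<le> 24 * B * ?L / 2" using L B pi_gt3 by (intro divide_left_mono) auto
    then show "24 * B * ?L / (2 * pi) \<le> 12 * B * ?L" by simp
  qed
  finally show ?thesis .
qed

lemma dirichlet_L2:
  "(\<integral>v. (cmod (dirichlet h n v))\<^sup>2 \<partial>circle) = (\<Sum>k=1..n. (cmod (h (real k / real n)))\<^sup>2)"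
  unfolding dirichlet_def by (rule circle_parseval) simp

section \<open>Fejer kernels with Lipschitz weights\<close>

text \<open>
  The uniform law on the period that carries the spectral measure; for periodic integrands it agrees
  with \<open>circle\<close>.
\<close>

definition window :: "real measure" where
  "window = uniform_measure lborel {-pi..pi}"

lemma sets_window [measurable_cong, simp]: "sets window = sets borel"
  and space_window [simp]: "space window = UNIV"
  by (simp_all add: window_def)

lemma prob_space_window: "prob_space window"
  unfolding window_def by (rule prob_space_uniform_measure) auto

interpretation window: prob_space window by (rule prob_space_window)

lemma nn_integral_window:
  assumes [measurable]: "f \<in> borel_measurable borel"
  shows "(\<integral>\<^sup>+x. f x \<partial>window) = (\<integral>\<^sup>+x. f x * indicator {-pi..pi} x \<partial>lborel) / ennreal (2 * pi)"
  unfolding window_def by (subst nn_integral_uniform_measure) auto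

lemma AE_windowI:
  assumes "AE x in lborel. x \<in> {-pi..pi} \<longrightarrow> P x"
  shows "AE x in window. P x"
  unfolding window_def by (rule AE_uniform_measureI) (use assms in auto)

lemma AE_window_interior: "AE x in window. -pi < x \<and> x < pi"
  by (rule AE_windowI) (use AE_lborel_singleton[of pi] AE_lborel_singleton[of "-pi"] in eventually_elim, auto)

lemma nn_integral_window_periodic:
  fixes f :: "real \<Rightarrow> ennreal"
  assumes [measurable]: "f \<in> borel_measurable borel" and per: "\<And>x. f (x + 2 * pi) = f x"
  shows "(\<integral>\<^sup>+x. f x \<partial>window) = (\<integral>\<^sup>+x. f x \<partial>circle)"
proof -
  have "(\<integral>\<^sup>+x. f x * indicator {-pi..pi} x \<partial>lborel)
      = (\<integral>\<^sup>+x. f (-pi + 1 * x) * indicator {-pi..pi} (-pi + 1 * x) \<partial>lborel)"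
    using nn_integral_real_affine[of "\<lambda>x. f x * indicator {-pi..pi} x" 1 "-pi"] by simp
  also have "\<dots> = (\<integral>\<^sup>+x. f (x + (-pi)) * indicator {0..2*pi} x \<partial>lborel)"
    by (intro nn_integral_cong) (auto simp: indicator_def)
  finally have "(\<integral>\<^sup>+x. f x \<partial>window) = (\<integral>\<^sup>+x. f (x + (-pi)) \<partial>circle)"
    by (subst nn_integral_window, simp, subst nn_integral_circle) auto
  also have "\<dots> = (\<integral>\<^sup>+x. f x \<partial>circle)"
    by (rule nn_integral_circle_shift) (auto simp: per)
  finally show ?thesis .
qed

lemma integral_window_periodic:
  fixes f :: "real \<Rightarrow> real"
  assumes [measurable]: "f \<in> borel_measurable borel" and per: "\<And>x. f (x + 2 * pi) = f x"
  shows "(\<integral>x. f x \<partial>window) = (\<integral>x. f x \<partial>circle)"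
proof -
  have [measurable]: "f \<in> borel_measurable window" "f \<in> borel_measurable circle"
    by (simp_all cong: measurable_cong_sets)
  have "distr window borel f = distr circle borel f"
  proof (rule measure_eqI)
    fix A assume "A \<in> sets (distr window borel f)"
    then have [measurable]: "A \<in> sets borel" by simp
    have "emeasure (distr N borel f) A = (\<integral>\<^sup>+x. indicator A (f x) \<partial>N)"
      if [measurable]: "f \<in> borel_measurable N" for N :: "real measure"
      by (subst nn_integral_indicator[symmetric]) (auto simp: nn_integral_distr simp del: nn_integral_indicator)
    then show "emeasure (distr window borel f) A = emeasure (distr circle borel f) A"
      using nn_integral_window_periodic[of "\<lambda>x. indicator A (f x)"] per by simp
  qed simp
  then have "(\<integral>y. y \<partial>distr window borel f) = (\<integral>y. y \<partial>distr circle borel f)" by simp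
  then show ?thesis by (simp add: integral_distr)
qed

text \<open>
  For \<open>h = 1\<close> this is the Fejer kernel. In general it is the variance kernel: the variance of the
  random polynomial with weight \<open>h\<close> at \<open>x\<close> is the integral of \<open>fejer h n (x - u)\<close> against the
  spectral measure.
\<close>

definition fejer :: "(real \<Rightarrow> complex) \<Rightarrow> nat \<Rightarrow> real \<Rightarrow> real" where
  "fejer h n v = (cmod (dirichlet h n v))\<^sup>2 / real n"

text \<open>
  By Parseval, the integral of \<open>fejer h n\<close> with respect to the uniform law.
\<close>

definition kernel_mass :: "(real \<Rightarrow> complex) \<Rightarrow> nat \<Rightarrow> real" where
  "kernel_mass h n = (\<Sum>k=1..n. (cmod (h (real k / real n)))\<^sup>2) / real n"

lemma kernel_nonneg [simp]: "0 \<le> fejer h n v" by (simp add: fejer_def)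
lemma kernel_mass_nonneg [simp]: "0 \<le> kernel_mass h n" by (simp add: kernel_mass_def sum_nonneg)

lemma kernel_periodic: "fejer h n (v + 2 * pi) = fejer h n v"
  by (simp add: fejer_def dirichlet_periodic)

lemma continuous_kernel [continuous_intros]:
  "continuous_on S f \<Longrightarrow> continuous_on S (\<lambda>x. fejer h n (f x))"
  unfolding fejer_def by (cases "n = 0") (auto intro!: continuous_intros)

lemma borel_measurable_kernel [measurable]: "fejer h n \<in> borel_measurable borel"
  by (intro borel_measurable_continuous_onI continuous_kernel continuous_on_id)

lemma kernel_bound:
  assumes w: "weight B h"
  shows "fejer h n v \<le> B\<^sup>2 * real n"
proof (cases "n = 0")
  case False
  have "(cmod (dirichlet h n v))\<^sup>2 \<le> (B * real n)\<^sup>2"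
    using dirichlet_bound[OF w] by (intro power_mono) auto
  then show ?thesis using False by (simp add: fejer_def field_simps power2_eq_square)
qed (simp add: fejer_def)

lemma kernel_mass_bound:
  assumes w: "weight B h"
  shows "kernel_mass h n \<le> B\<^sup>2"
proof (cases "n = 0")
  case False
  have "(\<Sum>k=1..n. (cmod (h (real k / real n)))\<^sup>2) \<le> (\<Sum>k=1..n. B\<^sup>2)"
    by (intro sum_mono power_mono weightD(2)[OF w]) (auto simp: divide_simps)
  then show ?thesis using False by (simp add: kernel_mass_def field_simps)
qed (simp add: kernel_mass_def)

lemma kernel_away:
  assumes w: "weight B h" and s: "0 < s" "s \<le> \<bar>sin (v / 2)\<bar>"
  shows "fejer h n v \<le> (9 * B\<^sup>2 / (4 * s\<^sup>2)) / real n"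
proof -
  have "2 * s * cmod (dirichlet h n v) \<le> 2 * \<bar>sin (v / 2)\<bar> * cmod (dirichlet h n v)"
    using s by (intro mult_right_mono) auto
  also have "\<dots> \<le> 3 * B" using dirichlet_abel[OF w, of v n] by (simp add: cmod_1_minus_cis)
  finally have "cmod (dirichlet h n v) \<le> 3 * B / (2 * s)" using s by (simp add: field_simps)
  then have "(cmod (dirichlet h n v))\<^sup>2 \<le> (3 * B / (2 * s))\<^sup>2" by (intro power_mono) auto
  also have "\<dots> = 9 * B\<^sup>2 / (4 * s\<^sup>2)" by (simp add: power_divide power_mult_distrib)
  finally show ?thesis unfolding fejer_def by (intro divide_right_mono) auto
qed

lemma integrable_kernel:
  assumes "finite_measure m" "sets m = sets borel" and w: "weight B h"
  shows "integrable m (\<lambda>u. fejer h n (x - u))" "integrable m (\<lambda>u. fejer h n (u - x))"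
proof -
  interpret finite_measure m by fact
  have [measurable_cong]: "sets m = sets borel" by fact
  show "integrable m (\<lambda>u. fejer h n (x - u))" "integrable m (\<lambda>u. fejer h n (u - x))"
    using kernel_bound[OF w] by (auto intro!: integrable_const_bound[where B="B\<^sup>2 * real n"])
qed

lemma integral_kernel_shift: "(\<integral>x. fejer h n (x - u) \<partial>circle) = kernel_mass h n"
proof -
  have "(\<integral>x. fejer h n (x + (- u)) \<partial>circle) = (\<integral>x. fejer h n x \<partial>circle)"
    by (rule integral_circle_shift) (auto simp: kernel_periodic)
  then show ?thesis by (simp add: fejer_def kernel_mass_def dirichlet_L2)
qed

text \<open>
  The kernel need not be even when \<open>h\<close> is not real, so integrating in \<open>u\<close> uses Parseval for the
  conjugate polynomial.
\<close>

lemma integral_kernel_reflected: "(\<integral>u. fejer h n (x - u) \<partial>circle) = kernel_mass h n"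
proof -
  have "cmod (dirichlet h n (x - u)) = cmod (\<Sum>k=1..n. cnj (h (real k / real n) * cis (real k * x)) * cis (real k * u))" for u
  proof -
    have "cmod (dirichlet h n (x - u)) = cmod (cnj (dirichlet h n (x - u)))" by simp
    also have "cnj (dirichlet h n (x - u)) = (\<Sum>k=1..n. cnj (h (real k / real n) * cis (real k * x)) * cis (real k * u))"
      unfolding dirichlet_def cnj_sum by (intro sum.cong refl) (simp add: cis_cnj cis_mult algebra_simps)
    finally show ?thesis .
  qed
  then show ?thesis
    using circle_parseval[of "{1..n}" "\<lambda>k. cnj (h (real k / real n) * cis (real k * x))"]
    by (simp add: fejer_def kernel_mass_def norm_mult)
qed

lemma integral_kernel_window:
  "(\<integral>x. fejer h n (x - u) \<partial>window) = kernel_mass h n"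
  "(\<integral>u. fejer h n (x - u) \<partial>window) = kernel_mass h n"
proof -
  have "fejer h n (x + 2 * pi - u) = fejer h n (x - u)" for x u
    using kernel_periodic[of h n "x - u"] by (simp add: algebra_simps)
  then show "(\<integral>x. fejer h n (x - u) \<partial>window) = kernel_mass h n"
    by (subst integral_window_periodic) (auto simp: integral_kernel_shift)
  have "fejer h n (x - (u + 2 * pi)) = fejer h n (x - u)" for x u
    using kernel_periodic[of h n "x - u - 2 * pi"] by (simp add: algebra_simps)
  then show "(\<integral>u. fejer h n (x - u) \<partial>window) = kernel_mass h n"
    by (subst integral_window_periodic) (auto simp: integral_kernel_reflected)
qed

lemma nn_integral_kernel_window:
  assumes w: "weight B h"
  shows "(\<integral>\<^sup>+x. ennreal (fejer h n (x - u)) \<partial>window) = ennreal (kernel_mass h n)"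
  using integral_kernel_window(1)[of h n u] integrable_kernel(2)[OF window.finite_measure_axioms sets_window w, of n u]
  by (subst nn_integral_eq_integral) auto

text \<open>
  On a compact set \<open>T\<close> inside the period, \<open>\<bar>sin ((x - u) / 2)\<bar>\<close> is bounded away from 0 when \<open>x\<close> is
  an interior point outside \<open>T\<close>, and summation by parts bounds the kernel by \<open>O(1 / n)\<close> there.
\<close>

lemma kernel_small_on_closed:
  assumes w: "weight B h" and x: "-pi < x" "x < pi" and T: "closed T" "T \<subseteq> {-pi..pi}" "x \<notin> T"
  shows "\<exists>q\<ge>0. \<forall>u\<in>T. \<forall>n. fejer h n (x - u) \<le> q / real n"
proof (cases "T = {}")
  case False
  have "compact T" using T by (metis bounded_closed_interval bounded_subset compact_eq_bounded_closed)
  moreover have "continuous_on T (\<lambda>u. \<bar>sin ((x - u) / 2)\<bar>)" by (intro continuous_intros) auto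
  ultimately obtain u0 where u0: "u0 \<in> T" "\<And>u. u \<in> T \<Longrightarrow> \<bar>sin ((x - u0) / 2)\<bar> \<le> \<bar>sin ((x - u) / 2)\<bar>"
    using continuous_attains_inf[OF _ False] by metis
  have "u0 \<in> {-pi..pi}" using u0(1) T(2) by blast
  then have "-pi \<le> u0" "u0 \<le> pi" by auto
  then have "x - u0 < 2 * pi" "u0 - x < 2 * pi" using x by linarith+
  then have "(x - u0) / 2 < pi" "- ((x - u0) / 2) < pi" by (simp_all add: field_simps)
  then have "\<bar>(x - u0) / 2\<bar> < pi" by (rule abs_less_iff[THEN iffD2, OF conjI])
  moreover have "(x - u0) / 2 \<noteq> 0" using u0(1) T(3) by auto
  ultimately have "sin ((x - u0) / 2) \<noteq> 0"
    using sin_eq_0_pi[of "(x - u0) / 2"] by (auto simp: abs_less_iff)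
  then have "0 < \<bar>sin ((x - u0) / 2)\<bar>" by simp
  then show ?thesis using kernel_away[OF w _ u0(2)] by (intro exI[of _ "9 * B\<^sup>2 / (4 * \<bar>sin ((x - u0) / 2)\<bar>\<^sup>2)"]) auto
qed auto

text \<open>
  The kernel has mass tending to \<open>\<kappa>\<close>; it is small away from \<open>x\<close>, and near \<open>x\<close> the function \<open>\<phi>\<close> is
  almost constant.
\<close>

lemma kernel_approximates_identity:
  assumes w: "weight B h" and \<kappa>: "kernel_mass h \<longlonglongrightarrow> \<kappa>"
    and x: "-pi < x" "x < pi" and \<phi>: "continuous_on UNIV \<phi>"
  shows "(\<lambda>n. \<integral>u. fejer h n (x - u) * \<phi> u \<partial>window) \<longlonglongrightarrow> \<kappa> * \<phi> x"
proof -
  have [measurable]: "\<phi> \<in> borel_measurable borel" using \<phi> by (rule borel_measurable_continuous_onI)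
  have [measurable]: "\<phi> \<in> borel_measurable window" by (simp cong: measurable_cong_sets)
  have "compact (\<phi> ` {-pi..pi})" by (intro compact_continuous_image continuous_on_subset[OF \<phi>]) auto
  then obtain M where M: "\<And>u. u \<in> {-pi..pi} \<Longrightarrow> \<bar>\<phi> u\<bar> \<le> M"
    using compact_imp_bounded bounded_real by (metis imageI)
  have M0: "0 \<le> M" using M[of x] x by auto
  have J: "AE u in window. u \<in> {-pi..pi}" by (rule AE_windowI) simp
  have ik: "integrable window (\<lambda>u. fejer h n (x - u))" for n
    by (rule integrable_kernel(1)[OF window.finite_measure_axioms sets_window w])
  have ik2: "integrable window (\<lambda>u. fejer h n (x - u) * \<psi> u)"
    if [measurable]: "\<psi> \<in> borel_measurable window" and "AE u in window. \<bar>\<psi> u\<bar> \<le> C" for n \<psi> C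
  proof (rule Bochner_Integration.integrable_bound[where f="\<lambda>u. C * fejer h n (x - u)"])
    show "AE u in window. norm (fejer h n (x - u) * \<psi> u) \<le> norm (C * fejer h n (x - u))"
      using that(2)
    proof eventually_elim
      case (elim u)
      then have "fejer h n (x - u) * \<bar>\<psi> u\<bar> \<le> fejer h n (x - u) * \<bar>C\<bar>" by (intro mult_left_mono) auto
      then show ?case by (simp add: abs_mult mult.commute)
    qed
  qed (use ik in auto)
  have ip: "integrable window (\<lambda>u. fejer h n (x - u) * \<phi> u)" for n
    by (rule ik2[where C=M]) (use J M in auto)
  have id: "integrable window (\<lambda>u. fejer h n (x - u) * (\<phi> u - \<phi> x))" for n
  proof (rule ik2[where C="2 * M"])
    show "AE u in window. \<bar>\<phi> u - \<phi> x\<bar> \<le> 2 * M"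
      using J
    proof eventually_elim
      case (elim u)
      show ?case using M[OF elim] M[of x] x by auto
    qed
  qed measurable
  have diff: "(\<integral>u. fejer h n (x - u) * \<phi> u \<partial>window) - kernel_mass h n * \<phi> x = (\<integral>u. fejer h n (x - u) * (\<phi> u - \<phi> x) \<partial>window)" for n
    using ip ik by (simp add: right_diff_distrib integral_kernel_window)
  have "(\<lambda>n. (\<integral>u. fejer h n (x - u) * \<phi> u \<partial>window) - kernel_mass h n * \<phi> x) \<longlonglongrightarrow> 0"
  proof (rule LIMSEQ_I)
    fix e :: real assume e: "0 < e"
    define e' where "e' = e / (2 * (B\<^sup>2 + 1))"
    have B1: "0 < B\<^sup>2 + 1" by (simp add: add_nonneg_pos)
    have e': "0 < e'" using e B1 by (simp add: e'_def)
    obtain d where d: "0 < d" "\<And>u. dist u x < d \<Longrightarrow> dist (\<phi> u) (\<phi> x) < e'"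
      using \<phi> e' unfolding continuous_on_iff by (metis UNIV_I)
    let ?T = "{-pi..pi} \<inter> {u. d \<le> \<bar>u - x\<bar>}"
    have "closed ?T" by (intro closed_Int closed_Collect_le continuous_intros closed_atLeastAtMost)
    then obtain q where q: "0 \<le> q" "\<And>u n. u \<in> ?T \<Longrightarrow> fejer h n (x - u) \<le> q / real n"
      using kernel_small_on_closed[OF w x, of ?T] d(1) by auto
    obtain N :: nat where N: "4 * M * q / e < real N" using reals_Archimedean2 by blast
    have "norm ((\<integral>u. fejer h n (x - u) * \<phi> u \<partial>window) - kernel_mass h n * \<phi> x - 0) < e" if n: "n \<ge> max 1 N" for n
    proof -
      have np: "0 < real n" using n by simp
      have "\<bar>\<integral>u. fejer h n (x - u) * (\<phi> u - \<phi> x) \<partial>window\<bar> \<le> (\<integral>u. e' * fejer h n (x - u) + 2 * M * q / real n \<partial>window)"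
      proof (rule order.trans[OF integral_abs_bound integral_mono_AE])
        show "AE u in window. \<bar>fejer h n (x - u) * (\<phi> u - \<phi> x)\<bar> \<le> e' * fejer h n (x - u) + 2 * M * q / real n"
          using J
        proof eventually_elim
          case (elim u)
          have r: "0 \<le> 2 * M * q / real n" using M0 q by simp
          show ?case
          proof (cases "\<bar>u - x\<bar> < d")
            case True
            then have "\<bar>\<phi> u - \<phi> x\<bar> \<le> e'" using d(2)[of u] by (simp add: dist_real_def)
            then have "fejer h n (x - u) * \<bar>\<phi> u - \<phi> x\<bar> \<le> fejer h n (x - u) * e'" by (intro mult_left_mono) auto
            then show ?thesis using r by (simp add: abs_mult mult.commute)
          next
            case False
            then have "fejer h n (x - u) \<le> q / real n" using q(2) elim by auto
            moreover have "\<bar>\<phi> u - \<phi> x\<bar> \<le> 2 * M" using M[OF elim] M[of x] x by auto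
            ultimately have "fejer h n (x - u) * \<bar>\<phi> u - \<phi> x\<bar> \<le> (q / real n) * (2 * M)"
              using q(1) by (intro mult_mono) auto
            moreover have "0 \<le> e' * fejer h n (x - u)" using e' by simp
            ultimately show ?thesis by (simp add: abs_mult mult_ac)
          qed
        qed
      qed (use id ik in auto)
      also have "\<dots> = e' * kernel_mass h n + 2 * M * q / real n"
        using ik window.prob_space by (simp add: integral_kernel_window)
      also have "\<dots> \<le> e' * B\<^sup>2 + 2 * M * q / real n"
        using e' kernel_mass_bound[OF w] by (intro add_right_mono mult_left_mono) auto
      also have "e' * B\<^sup>2 \<le> e / 2"
      proof -
        have "e' * B\<^sup>2 \<le> e' * (B\<^sup>2 + 1)" using e' by (intro mult_left_mono) auto
        also have "\<dots> = e / 2"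
        proof -
          have "e / (2 * c) * c = e / 2" if "0 < c" for c using that by simp
          from this[OF B1] show ?thesis unfolding e'_def .
        qed
        finally show ?thesis .
      qed
      also have "2 * M * q / real n < e / 2"
      proof -
        have "4 * M * q / e < real n" using N n by linarith
        then show ?thesis using e np by (simp add: field_simps)
      qed
      finally show ?thesis unfolding diff by simp
    qed
    then show "\<exists>N. \<forall>n\<ge>N. norm ((\<integral>u. fejer h n (x - u) * \<phi> u \<partial>window) - kernel_mass h n * \<phi> x - 0) < e" by blast
  qed
  moreover have "(\<lambda>n. kernel_mass h n * \<phi> x) \<longlonglongrightarrow> \<kappa> * \<phi> x" by (intro tendsto_mult_right \<kappa>)
  ultimately have "(\<lambda>n. ((\<integral>u. fejer h n (x - u) * \<phi> u \<partial>window) - kernel_mass h n * \<phi> x) + kernel_mass h n * \<phi> x) \<longlonglongrightarrow> 0 + \<kappa> * \<phi> x"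
    by (rule tendsto_add)
  then show ?thesis by simp
qed

section \<open>Smoothing of a spectral measure\<close>

text \<open>
  Truncate \<open>\<psi>\<close> at a level \<open>m\<close>; a measurable function is an almost everywhere limit of continuous
  ones, and after truncating these as well dominated convergence applies.
\<close>

lemma continuous_dense_L1_window:
  fixes \<psi> :: "real \<Rightarrow> real"
  assumes [measurable]: "\<psi> \<in> borel_measurable borel" and nn: "\<And>x. 0 \<le> \<psi> x" and i: "integrable window \<psi>" and e: "0 < e"
  shows "\<exists>\<phi>. continuous_on UNIV \<phi> \<and> integrable window \<phi> \<and> (\<integral>x. \<bar>\<psi> x - \<phi> x\<bar> \<partial>window) < e"
proof -
  have [measurable]: "\<psi> \<in> borel_measurable window" by (simp cong: measurable_cong_sets)
  have "(\<lambda>m. \<integral>x. \<bar>\<psi> x - min (real m) (\<psi> x)\<bar> \<partial>window) \<longlonglongrightarrow> (\<integral>x. 0 \<partial>window)"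
  proof (rule integral_dominated_convergence[where w=\<psi>])
    show "AE x in window. (\<lambda>m. \<bar>\<psi> x - min (real m) (\<psi> x)\<bar>) \<longlonglongrightarrow> 0"
    proof (rule AE_I2)
      fix x
      have "\<forall>\<^sub>F m in sequentially. \<bar>\<psi> x - min (real m) (\<psi> x)\<bar> = 0"
        using eventually_ge_at_top[of "nat \<lceil>\<psi> x\<rceil>"] by eventually_elim linarith
      then show "(\<lambda>m. \<bar>\<psi> x - min (real m) (\<psi> x)\<bar>) \<longlonglongrightarrow> 0" by (rule tendsto_eventually)
    qed
    show "AE x in window. norm \<bar>\<psi> x - min (real m) (\<psi> x)\<bar> \<le> \<psi> x" for m
      using nn by (intro AE_I2) (auto simp: min_def)
  qed (use i in auto)
  then obtain m where m: "(\<integral>x. \<bar>\<psi> x - min (real m) (\<psi> x)\<bar> \<partial>window) < e / 2"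
    using order_tendstoD(2)[of _ "0::real" sequentially "e / 2"] e by (auto simp: eventually_sequentially)
  have "\<psi> \<in> borel_measurable lebesgue" by (intro measurable_completion) simp
  then have "\<psi> measurable_on UNIV" using lebesgue_measurable_imp_measurable_on_nnreal_UNIV nn by blast
  then obtain N g where N: "negligible N" and g: "\<And>n. continuous_on UNIV (g n)"
    "\<And>x. x \<notin> N \<Longrightarrow> (\<lambda>n. g n x) \<longlonglongrightarrow> \<psi> x"
    by (auto simp: measurable_on_def)
  define \<phi> where "\<phi> = (\<lambda>n x. max 0 (min (real m) (g n x)))"
  have c: "continuous_on UNIV (\<phi> n)" for n unfolding \<phi>_def by (intro continuous_intros g)
  have [measurable]: "\<phi> n \<in> borel_measurable borel" for n using c by (rule borel_measurable_continuous_onI)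
  have [measurable]: "\<phi> n \<in> borel_measurable window" for n by (simp cong: measurable_cong_sets)
  have i\<phi>: "integrable window (\<phi> n)" for n
  proof (rule window.integrable_const_bound[where B="real m"])
    show "AE x in window. norm (\<phi> n x) \<le> real m" by (auto simp: \<phi>_def)
  qed measurable
  have im: "integrable window (\<lambda>x. min (real m) (\<psi> x))"
    by (rule window.integrable_const_bound[where B="real m"]) (use nn in \<open>auto simp: min_def\<close>)
  have "AE x in lebesgue. x \<notin> N" using N by (simp add: negligible_iff_null_sets AE_not_in)
  then have N': "AE x in window. x \<notin> N" by (intro AE_windowI) (auto simp: AE_completion_iff elim!: eventually_mono)
  have "(\<lambda>n. \<integral>x. \<bar>min (real m) (\<psi> x) - \<phi> n x\<bar> \<partial>window) \<longlonglongrightarrow> (\<integral>x. 0 \<partial>window)"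
  proof (rule integral_dominated_convergence[where w="\<lambda>_. real m"])
    show "AE x in window. (\<lambda>n. \<bar>min (real m) (\<psi> x) - \<phi> n x\<bar>) \<longlonglongrightarrow> 0"
      using N'
    proof eventually_elim
      case (elim x)
      have "(\<lambda>n. \<bar>min (real m) (\<psi> x) - \<phi> n x\<bar>) \<longlonglongrightarrow> \<bar>min (real m) (\<psi> x) - max 0 (min (real m) (\<psi> x))\<bar>"
        unfolding \<phi>_def by (intro tendsto_intros g elim)
      then show ?case using nn[of x] by (simp add: max_def)
    qed
    show "AE x in window. norm \<bar>min (real m) (\<psi> x) - \<phi> n x\<bar> \<le> real m" for n
    proof (rule AE_I2)
      fix x
      have "0 \<le> min (real m) (\<psi> x)" "min (real m) (\<psi> x) \<le> real m" "0 \<le> \<phi> n x" "\<phi> n x \<le> real m"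
        using nn by (auto simp: \<phi>_def)
      then show "norm \<bar>min (real m) (\<psi> x) - \<phi> n x\<bar> \<le> real m" unfolding real_norm_def by linarith
    qed
  qed auto
  then obtain n where n: "(\<integral>x. \<bar>min (real m) (\<psi> x) - \<phi> n x\<bar> \<partial>window) < e / 2"
    using order_tendstoD(2)[of _ "0::real" sequentially "e / 2"] e by (auto simp: eventually_sequentially)
  have "(\<integral>x. \<bar>\<psi> x - \<phi> n x\<bar> \<partial>window) \<le> (\<integral>x. \<bar>\<psi> x - min (real m) (\<psi> x)\<bar> + \<bar>min (real m) (\<psi> x) - \<phi> n x\<bar> \<partial>window)"
    using i im i\<phi> by (intro integral_mono) auto
  also have "\<dots> = (\<integral>x. \<bar>\<psi> x - min (real m) (\<psi> x)\<bar> \<partial>window) + (\<integral>x. \<bar>min (real m) (\<psi> x) - \<phi> n x\<bar> \<partial>window)"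
    using i im i\<phi> by (intro Bochner_Integration.integral_add) auto
  also have "\<dots> < e" using m n by linarith
  finally show ?thesis using c i\<phi> by blast
qed

text \<open>
  Fubini: smoothing by the kernel multiplies the total mass by \<open>kernel_mass h n\<close>, uniformly bounded
  in \<open>n\<close>. It makes the smoothing of a small measure small in the mean.
\<close>

lemma integral_kernel_smoothing:
  assumes w: "weight B h" and m: "finite_measure m" "sets m = sets borel"
    and g: "integrable m g" "\<And>u. 0 \<le> g u" and n: "1 \<le> n"
  shows "integrable m (\<lambda>u. fejer h n (x - u) * g u)"
    and "integrable window (\<lambda>x. \<integral>u. fejer h n (x - u) * g u \<partial>m)"
    and "(\<integral>x. (\<integral>u. fejer h n (x - u) * g u \<partial>m) \<partial>window) = kernel_mass h n * (\<integral>u. g u \<partial>m)"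
proof -
  interpret m: finite_measure m by fact
  interpret P: pair_sigma_finite window m ..
  have [measurable_cong]: "sets m = sets borel" by fact
  have [measurable]: "g \<in> borel_measurable m" using g by auto
  have i: "integrable m (\<lambda>u. fejer h n (x - u) * g u)" for x
  proof (rule Bochner_Integration.integrable_bound[where f="\<lambda>u. (B\<^sup>2 * real n) * g u"])
    show "AE u in m. norm (fejer h n (x - u) * g u) \<le> norm ((B\<^sup>2 * real n) * g u)"
      using kernel_bound[OF w, of n] g(2) by (intro AE_I2) (auto simp: abs_mult intro!: mult_right_mono)
  qed (use g in auto)
  then show "integrable m (\<lambda>u. fejer h n (x - u) * g u)" .
  have nn: "0 \<le> (\<integral>u. fejer h n (x - u) * g u \<partial>m)" for x
    using g by (intro integral_nonneg_AE) auto
  have meas: "(\<lambda>x. \<integral>u. fejer h n (x - u) * g u \<partial>m) \<in> borel_measurable window"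
    by (rule m.borel_measurable_lebesgue_integral) measurable
  have "(\<integral>\<^sup>+x. ennreal (\<integral>u. fejer h n (x - u) * g u \<partial>m) \<partial>window)
      = (\<integral>\<^sup>+x. (\<integral>\<^sup>+u. ennreal (fejer h n (x - u) * g u) \<partial>m) \<partial>window)"
    using g by (intro nn_integral_cong nn_integral_eq_integral[symmetric] i) auto
  also have "\<dots> = (\<integral>\<^sup>+u. (\<integral>\<^sup>+x. ennreal (fejer h n (x - u) * g u) \<partial>window) \<partial>m)"
    by (rule P.Fubini'[symmetric]) measurable
  also have "\<dots> = (\<integral>\<^sup>+u. ennreal (kernel_mass h n) * ennreal (g u) \<partial>m)"
  proof (intro nn_integral_cong)
    fix u
    have "(\<integral>\<^sup>+x. ennreal (fejer h n (x - u) * g u) \<partial>window) = (\<integral>\<^sup>+x. ennreal (fejer h n (x - u)) * ennreal (g u) \<partial>window)"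
      using g by (intro nn_integral_cong ennreal_mult) auto
    also have "\<dots> = ennreal (kernel_mass h n) * ennreal (g u)"
      by (subst nn_integral_multc) (auto simp: nn_integral_kernel_window[OF w])
    finally show "(\<integral>\<^sup>+x. ennreal (fejer h n (x - u) * g u) \<partial>window) = ennreal (kernel_mass h n) * ennreal (g u)" .
  qed
  also have "\<dots> = ennreal (kernel_mass h n) * ennreal (\<integral>u. g u \<partial>m)"
    using g by (subst nn_integral_cmult) (auto simp: nn_integral_eq_integral)
  also have "\<dots> = ennreal (kernel_mass h n * (\<integral>u. g u \<partial>m))"
    using g by (intro ennreal_mult[symmetric] integral_nonneg_AE) auto
  finally have eq: "(\<integral>\<^sup>+x. ennreal (\<integral>u. fejer h n (x - u) * g u \<partial>m) \<partial>window) = ennreal (kernel_mass h n * (\<integral>u. g u \<partial>m))" .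
  show "integrable window (\<lambda>x. \<integral>u. fejer h n (x - u) * g u \<partial>m)"
    using meas nn eq by (intro integrableI_nonneg) auto
  have "0 \<le> kernel_mass h n * (\<integral>u. g u \<partial>m)" using g by (intro mult_nonneg_nonneg integral_nonneg_AE) auto
  then show "(\<integral>x. (\<integral>u. fejer h n (x - u) * g u \<partial>m) \<partial>window) = kernel_mass h n * (\<integral>u. g u \<partial>m)"
    using eq nn meas by (subst integral_eq_nn_integral) auto
qed

text \<open>
  Off the null set \<open>S\<close> carrying the singular part, the spectral measure has density \<open>\<psi>\<close> with respect
  to Lebesgue measure on the period, that is density \<open>2 pi \<psi>\<close> with respect to \<open>window\<close>.
\<close>

lemma spectral_decomposition:
  assumes sp: "spectral_measure \<mu>" and ac: "ac_density_of \<mu> \<psi>"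
  obtains S where "S \<in> sets borel" "emeasure lborel S = 0" "integrable window \<psi>"
    "\<And>f C. f \<in> borel_measurable borel \<Longrightarrow> (\<And>x. 0 \<le> f x) \<Longrightarrow> (\<And>x. f x \<le> C) \<Longrightarrow>
      (\<integral>x. f x \<partial>\<mu>) = 2 * pi * (\<integral>x. f x * \<psi> x \<partial>window) + (\<integral>x. f x * indicator S x \<partial>\<mu>)"
proof -
  let ?J = "{-pi..pi}"
  have [measurable]: "\<psi> \<in> borel_measurable borel" and \<psi>0: "\<And>x. 0 \<le> \<psi> x"
    using ac by (auto simp: ac_density_of_def)
  have [measurable]: "\<psi> \<in> borel_measurable window" by (simp cong: measurable_cong_sets)
  have [measurable_cong]: "sets \<mu> = sets borel" using sp by (auto simp: spectral_measure_def)
  interpret \<mu>: prob_space \<mu> using sp by (auto simp: spectral_measure_def)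
  define D where "D = density lborel (\<lambda>x. ennreal (\<psi> x * indicator ?J x))"
  obtain \<nu> S where \<nu>[measurable_cong]: "sets \<nu> = sets borel" and S[measurable]: "S \<in> sets borel"
    and S0: "emeasure lborel S = 0" and \<nu>0: "emeasure \<nu> (- S) = 0"
    and \<mu>eq: "\<And>A. A \<in> sets borel \<Longrightarrow> emeasure \<mu> A = emeasure D A + emeasure \<nu> A"
    using ac unfolding ac_density_of_def D_def by blast
  have DS: "emeasure D (A \<inter> S) = 0" if [measurable]: "A \<in> sets borel" for A
  proof -
    have "A \<inter> S \<in> null_sets lborel" using S0 null_sets_subset[of S lborel "A \<inter> S"] by (auto simp: null_sets_def)
    then show ?thesis unfolding D_def by (subst emeasure_density) (auto intro!: nn_integral_null_set)
  qed
  have den: "density \<mu> (indicator (- S)) = D"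
  proof (rule measure_eqI)
    show "sets (density \<mu> (indicator (- S))) = sets D" by (simp add: D_def \<open>sets \<mu> = sets borel\<close>)
    fix A assume "A \<in> sets (density \<mu> (indicator (- S)))"
    then have A[measurable]: "A \<in> sets borel" by (simp add: \<open>sets \<mu> = sets borel\<close>)
    have "emeasure (density \<mu> (indicator (- S))) A = (\<integral>\<^sup>+x. indicator (A - S) x \<partial>\<mu>)"
    proof -
      have "indicator (- S) x * indicator A x = (indicator (A - S) x :: ennreal)" for x
        by (auto simp: indicator_def)
      then show ?thesis by (subst emeasure_density) auto
    qed
    also have "\<dots> = emeasure \<mu> (A - S)" by simp
    also have "\<dots> = emeasure D (A - S) + emeasure \<nu> (A - S)" by (rule \<mu>eq) simp
    also have "emeasure \<nu> (A - S) = 0"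
      using emeasure_mono[of "A - S" "- S" \<nu>] \<nu>0 by (auto simp: \<nu>)
    also have "emeasure D (A - S) = emeasure D A"
    proof -
      have "emeasure D A = emeasure D (A - S) + emeasure D (A \<inter> S)"
        by (subst plus_emeasure) (auto simp: D_def intro!: arg_cong2[where f=emeasure])
      then show ?thesis using DS by simp
    qed
    finally show "emeasure (density \<mu> (indicator (- S))) A = emeasure D A" by simp
  qed
  have nn: "(\<integral>\<^sup>+x. f x \<partial>\<mu>) = ennreal (2 * pi) * (\<integral>\<^sup>+x. f x * ennreal (\<psi> x) \<partial>window) + (\<integral>\<^sup>+x. f x * indicator S x \<partial>\<mu>)"
    if [measurable]: "f \<in> borel_measurable borel" for f :: "real \<Rightarrow> ennreal"
  proof -
    have "(\<integral>\<^sup>+x. f x \<partial>\<mu>) = (\<integral>\<^sup>+x. indicator (- S) x * f x + f x * indicator S x \<partial>\<mu>)"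
      by (intro nn_integral_cong) (auto simp: indicator_def)
    also have "\<dots> = (\<integral>\<^sup>+x. indicator (- S) x * f x \<partial>\<mu>) + (\<integral>\<^sup>+x. f x * indicator S x \<partial>\<mu>)"
      by (intro nn_integral_add) auto
    also have "(\<integral>\<^sup>+x. indicator (- S) x * f x \<partial>\<mu>) = (\<integral>\<^sup>+x. f x \<partial>D)"
      unfolding den[symmetric] by (subst nn_integral_density) auto
    also have "\<dots> = (\<integral>\<^sup>+x. (f x * ennreal (\<psi> x)) * indicator ?J x \<partial>lborel)"
      unfolding D_def by (subst nn_integral_density) (auto intro!: nn_integral_cong simp: indicator_def mult_ac)
    also have "\<dots> = ennreal (2 * pi) * (\<integral>\<^sup>+x. f x * ennreal (\<psi> x) \<partial>window)"
      by (subst nn_integral_window) (auto simp: ennreal_times_divide mult.commute[of "ennreal (2 * pi)"]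
         intro!: mult_divide_eq_ennreal[symmetric])
    finally show ?thesis .
  qed
  have "ennreal (2 * pi) * (\<integral>\<^sup>+x. ennreal (\<psi> x) \<partial>window) \<le> 1"
  proof -
    have "ennreal (2 * pi) * (\<integral>\<^sup>+x. ennreal (\<psi> x) \<partial>window) \<le> (\<integral>\<^sup>+x. 1 \<partial>\<mu>)"
      using nn[of "\<lambda>_. 1"] by simp
    then show ?thesis using \<mu>.emeasure_space_1 by simp
  qed
  then have "ennreal (2 * pi) * (\<integral>\<^sup>+x. ennreal (\<psi> x) \<partial>window) \<noteq> \<top>" by (metis ennreal_one_less_top leD)
  then have "(\<integral>\<^sup>+x. ennreal (\<psi> x) \<partial>window) < \<infinity>"
    by (auto simp: less_top[symmetric] ennreal_mult_eq_top_iff)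
  then have i\<psi>: "integrable window \<psi>"
    using \<psi>0 by (intro integrableI_nonneg) auto
  show ?thesis
  proof (rule that[OF S S0 i\<psi>])
    fix f :: "real \<Rightarrow> real" and C
    assume [measurable]: "f \<in> borel_measurable borel" and f0: "\<And>x. 0 \<le> f x" and fC: "\<And>x. f x \<le> C"
    have [measurable]: "f \<in> borel_measurable window" by (simp cong: measurable_cong_sets)
    have 1: "integrable \<mu> f" using f0 fC by (intro \<mu>.integrable_const_bound[where B=C]) auto
    have 2: "integrable \<mu> (\<lambda>x. f x * indicator S x)"
      using 1 by (rule Bochner_Integration.integrable_bound) (auto simp: indicator_def)
    have 3: "integrable window (\<lambda>x. f x * \<psi> x)"
      by (rule Bochner_Integration.integrable_bound[where f="\<lambda>x. C * \<psi> x"])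
         (use i\<psi> f0 fC \<psi>0 in \<open>auto simp: abs_mult intro!: mult_right_mono order.trans[OF _ abs_ge_self]\<close>)
    have "ennreal (\<integral>x. f x \<partial>\<mu>) = (\<integral>\<^sup>+x. ennreal (f x) \<partial>\<mu>)"
      using 1 f0 by (intro nn_integral_eq_integral[symmetric]) auto
    also have "\<dots> = ennreal (2 * pi) * (\<integral>\<^sup>+x. ennreal (f x) * ennreal (\<psi> x) \<partial>window) + (\<integral>\<^sup>+x. ennreal (f x) * indicator S x \<partial>\<mu>)"
      by (rule nn) measurable
    also have "(\<integral>\<^sup>+x. ennreal (f x) * ennreal (\<psi> x) \<partial>window) = ennreal (\<integral>x. f x * \<psi> x \<partial>window)"
      using 3 f0 \<psi>0 by (subst nn_integral_eq_integral[symmetric]) (auto simp: ennreal_mult)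
    also have "(\<integral>\<^sup>+x. ennreal (f x) * indicator S x \<partial>\<mu>) = ennreal (\<integral>x. f x * indicator S x \<partial>\<mu>)"
      using 2 f0 by (subst nn_integral_eq_integral[symmetric]) (auto intro!: nn_integral_cong simp: indicator_def)
    also have "ennreal (2 * pi) * ennreal (\<integral>x. f x * \<psi> x \<partial>window) + ennreal (\<integral>x. f x * indicator S x \<partial>\<mu>)
       = ennreal (2 * pi * (\<integral>x. f x * \<psi> x \<partial>window) + (\<integral>x. f x * indicator S x \<partial>\<mu>))"
      using f0 \<psi>0 by (simp add: ennreal_mult ennreal_plus integral_nonneg_AE)
    finally show "(\<integral>x. f x \<partial>\<mu>) = 2 * pi * (\<integral>x. f x * \<psi> x \<partial>window) + (\<integral>x. f x * indicator S x \<partial>\<mu>)"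
      using f0 \<psi>0 by (subst (asm) ennreal_inj) (auto intro!: integral_nonneg_AE add_nonneg_nonneg mult_nonneg_nonneg)
  qed
qed

lemma abs_exp_neg_diff_le:
  fixes x y :: real
  assumes "0 \<le> x" "0 \<le> y"
  shows "\<bar>exp (- x) - exp (- y)\<bar> \<le> min 1 \<bar>x - y\<bar>"
proof -
  have *: "exp (- x) - exp (- y) \<le> \<bar>x - y\<bar>" if "0 \<le> x" for x y :: real
  proof -
    have "exp (- x) * (1 - exp (x - y)) \<le> 1 * \<bar>x - y\<bar>"
    proof (cases "x \<le> y")
      case True
      have "1 - exp (x - y) \<le> y - x" using exp_ge_add_one_self[of "x - y"] by linarith
      then show ?thesis using True that by (intro mult_mono) auto
    next
      case False
      then have "exp (- x) * (1 - exp (x - y)) \<le> 0" by (intro mult_nonneg_nonpos) auto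
      then show ?thesis by simp
    qed
    then show ?thesis by (simp add: right_diff_distrib exp_add[symmetric])
  qed
  have "exp (- x) \<le> 1" "exp (- y) \<le> 1" "0 < exp (- x)" "0 < exp (- y)" using assms by auto
  then have "\<bar>exp (- x) - exp (- y)\<bar> \<le> 1" unfolding abs_le_iff by linarith
  then show ?thesis using *[OF assms(1), of y] *[OF assms(2), of x] by (auto simp: abs_le_iff abs_minus_commute)
qed

lemma kernel_singular_vanishes:
  assumes w: "weight B h" and "finite_measure \<mu>" "sets \<mu> = sets borel"
    and C: "closed C" "C \<subseteq> {-pi..pi}" and x: "-pi < x" "x < pi" "x \<notin> C"
  shows "(\<lambda>n. \<integral>u. fejer h n (x - u) * indicator C u \<partial>\<mu>) \<longlonglongrightarrow> 0"
proof -
  interpret \<mu>: finite_measure \<mu> by fact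
  have [measurable_cong]: "sets \<mu> = sets borel" by fact
  have [measurable]: "C \<in> sets borel" using C by simp
  obtain q where q: "0 \<le> q" "\<And>u n. u \<in> C \<Longrightarrow> fejer h n (x - u) \<le> q / real n"
    using kernel_small_on_closed[OF w x(1,2) C x(3)] by blast
  have b: "(\<integral>u. fejer h n (x - u) * indicator C u \<partial>\<mu>) \<le> q * measure \<mu> (space \<mu>) / real n" for n
  proof -
    have "(\<integral>u. fejer h n (x - u) * indicator C u \<partial>\<mu>) \<le> (\<integral>u. q / real n \<partial>\<mu>)"
    proof (rule integral_mono)
      show "integrable \<mu> (\<lambda>u. fejer h n (x - u) * indicator C u)"
        using kernel_bound[OF w, of n]
        by (intro \<mu>.integrable_const_bound[where B="B\<^sup>2 * real n"]) (auto simp: indicator_def)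
      show "fejer h n (x - u) * indicator C u \<le> q / real n" for u
        using q by (auto simp: indicator_def)
    qed auto
    then show ?thesis by (simp add: mult.commute)
  qed
  show ?thesis
  proof (rule tendsto_sandwich[OF _ _ tendsto_const])
    show "\<forall>\<^sub>F n in sequentially. 0 \<le> (\<integral>u. fejer h n (x - u) * indicator C u \<partial>\<mu>)"
      by (intro always_eventually allI integral_nonneg_AE AE_I2) auto
    show "\<forall>\<^sub>F n in sequentially. (\<integral>u. fejer h n (x - u) * indicator C u \<partial>\<mu>) \<le> q * measure \<mu> (space \<mu>) / real n"
      using b by (intro always_eventually allI)
    show "(\<lambda>n. q * measure \<mu> (space \<mu>) / real n) \<longlonglongrightarrow> 0"
      by (intro real_tendsto_divide_at_top[OF tendsto_const] filterlim_real_sequentially)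
  qed
qed

text \<open>
  Half the smoothed spectral measure converges to \<open>pi * \<kappa> * \<psi>\<close> in measure. The density \<open>\<psi>\<close> is
  replaced by a continuous \<open>\<phi>\<close> close to it in \<open>L\<^sup>1\<close>, and the null set carrying the singular part by
  a compact subset \<open>C\<close> that carries all but \<open>\<epsilon>\<close> of it. The errors of these replacements, \<open>A\<close> and \<open>E\<close>
  below, are small in the mean uniformly in \<open>n\<close>. What remains converges pointwise: the smoothing of
  \<open>\<phi>\<close> to \<open>\<kappa> * \<phi>\<close>, and the smoothing of the singular part on \<open>C\<close> to 0 off the null set \<open>C\<close>. The
  function \<open>exp (- y)\<close> of \<open>y \<ge> 0\<close> is bounded and Lipschitz, so it tolerates both kinds of
  convergence.
\<close>

theorem kernel_smoothing_limit:
  assumes sp: "spectral_measure \<mu>" and ac: "ac_density_of \<mu> \<psi>" and w: "weight B h"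
    and \<kappa>: "kernel_mass h \<longlonglongrightarrow> \<kappa>"
  shows "(\<lambda>n. \<integral>x. exp (- (\<integral>u. fejer h n (x - u) \<partial>\<mu>) / 2) \<partial>circle) \<longlonglongrightarrow> (\<integral>x. exp (- (pi * \<kappa> * \<psi> x)) \<partial>circle)"
proof -
  let ?J = "{-pi..pi}"
  have [measurable]: "\<psi> \<in> borel_measurable borel" and \<psi>0: "\<And>x. 0 \<le> \<psi> x" and \<psi>p: "\<And>x. \<psi> (x + 2 * pi) = \<psi> x"
    using ac by (auto simp: ac_density_of_def)
  have [measurable]: "\<psi> \<in> borel_measurable window" by (simp cong: measurable_cong_sets)
  have s\<mu>[measurable_cong]: "sets \<mu> = sets borel" using sp by (auto simp: spectral_measure_def)
  interpret \<mu>: prob_space \<mu> using sp by (auto simp: spectral_measure_def)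
  have sp\<mu>: "space \<mu> = UNIV" using sets_eq_imp_space_eq[OF s\<mu>] by simp
  have \<kappa>0: "0 \<le> \<kappa>" by (rule LIMSEQ_le_const[OF \<kappa>]) auto
  have \<kappa>B: "\<kappa> \<le> B\<^sup>2" by (rule LIMSEQ_le_const2[OF \<kappa>]) (use kernel_mass_bound[OF w] in auto)
  have Bp: "0 < B" using weightD(1)[OF w] .
  obtain S where S[measurable]: "S \<in> sets borel" and S0: "emeasure lborel S = 0" and i\<psi>: "integrable window \<psi>"
    and dec: "\<And>f C. f \<in> borel_measurable borel \<Longrightarrow> (\<And>x. 0 \<le> f x) \<Longrightarrow> (\<And>x. f x \<le> C) \<Longrightarrow>
      (\<integral>x. f x \<partial>\<mu>) = 2 * pi * (\<integral>x. f x * \<psi> x \<partial>window) + (\<integral>x. f x * indicator S x \<partial>\<mu>)"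
    by (rule spectral_decomposition[OF sp ac]) blast
  define V where "V = (\<lambda>n x. \<integral>u. fejer h n (x - u) \<partial>\<mu>)"
  have Vm: "V n \<in> borel_measurable borel" for n
    unfolding V_def by (rule \<mu>.borel_measurable_lebesgue_integral) measurable
  have Vm'[measurable]: "V n \<in> borel_measurable window" for n using Vm by (simp cong: measurable_cong_sets)
  have V0: "0 \<le> V n x" for n x unfolding V_def by (intro integral_nonneg_AE) auto
  have main: "\<exists>N. \<forall>n\<ge>N. (\<integral>x. \<bar>exp (- V n x / 2) - exp (- (pi * \<kappa> * \<psi> x))\<bar> \<partial>window) < e" if e: "0 < e" for e
  proof -
    \<comment> \<open>Three error terms of size at most \<open>4 B\<^sup>2 \<epsilon>\<close>, \<open>B\<^sup>2 \<epsilon>\<close> and \<open>4 B\<^sup>2 \<epsilon>\<close> (using \<open>pi \<le> 4\<close>) must stay below \<open>e / 2\<close>.\<close>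
    define \<epsilon> where "\<epsilon> = e / (10 * (B\<^sup>2 * 2))"
    have \<epsilon>: "0 < \<epsilon>" using e Bp by (simp add: \<epsilon>_def)
    obtain \<phi> where \<phi>: "continuous_on UNIV \<phi>" "integrable window \<phi>" "(\<integral>x. \<bar>\<psi> x - \<phi> x\<bar> \<partial>window) < \<epsilon>"
      using continuous_dense_L1_window[OF _ \<psi>0 i\<psi> \<epsilon>] by auto
    have [measurable]: "\<phi> \<in> borel_measurable window" using \<phi>(2) by auto
    have "\<exists>C\<in>{K. K \<subseteq> S \<inter> ?J \<and> compact K}. emeasure \<mu> (S \<inter> ?J) < emeasure \<mu> C + ennreal \<epsilon>"
    proof (rule SUP_approx_ennreal[OF \<epsilon>])
      show "emeasure \<mu> (S \<inter> ?J) = (SUP K\<in>{K. K \<subseteq> S \<inter> ?J \<and> compact K}. emeasure \<mu> K)"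
        by (rule inner_regular[OF s\<mu>]) auto
    qed auto
    then obtain C where C: "C \<subseteq> S \<inter> ?J" "compact C" "emeasure \<mu> (S \<inter> ?J) < emeasure \<mu> C + ennreal \<epsilon>" by auto
    have Cc: "closed C" using C(2) by (rule compact_imp_closed)
    then have [measurable]: "C \<in> sets borel" by simp
    have mC: "measure \<mu> (S - C) \<le> \<epsilon>"
    proof -
      have "AE x in \<mu>. x \<in> ?J" using sp by (auto simp: spectral_measure_def)
      then have "AE x in \<mu>. x \<in> S - C \<longleftrightarrow> x \<in> S \<inter> ?J - C" by eventually_elim auto
      then have "measure \<mu> (S - C) = measure \<mu> (S \<inter> ?J - C)"
        by (rule measure_eq_AE) auto
      also have "\<dots> = measure \<mu> (S \<inter> ?J) - measure \<mu> C"
        using C(1) by (intro \<mu>.finite_measure_Diff) auto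
      also have "\<dots> \<le> \<epsilon>"
        using C(3) \<epsilon> by (simp add: \<mu>.emeasure_eq_measure ennreal_plus[symmetric] ennreal_less_iff del: ennreal_plus)
      finally show ?thesis .
    qed
    have Cnull: "AE x in window. x \<notin> C"
    proof (rule AE_windowI)
      have "C \<in> null_sets lborel"
        using S0 C(1) null_sets_subset[of S lborel C] by (auto simp: null_sets_def)
      then have "AE x in lborel. x \<notin> C" by (rule AE_not_in)
      then show "AE x in lborel. x \<in> ?J \<longrightarrow> x \<notin> C" by eventually_elim simp
    qed
    define A where "A = (\<lambda>n x. \<integral>u. fejer h n (x - u) * \<bar>\<psi> u - \<phi> u\<bar> \<partial>window)"
    define E where "E = (\<lambda>n x. \<integral>u. fejer h n (x - u) * indicator (S - C) u \<partial>\<mu>)"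
    define D where "D = (\<lambda>n x. \<integral>u. fejer h n (x - u) * indicator C u \<partial>\<mu>)"
    define b where "b = (\<lambda>n x. \<bar>(\<integral>u. fejer h n (x - u) * \<phi> u \<partial>window) - \<kappa> * \<phi> x\<bar>)"
    have [measurable]: "b n \<in> borel_measurable window" "D n \<in> borel_measurable window" for n
    proof -
      have [measurable]: "(\<lambda>x. \<integral>u. fejer h n (x - u) * \<phi> u \<partial>window) \<in> borel_measurable window"
        by (rule window.borel_measurable_lebesgue_integral) measurable
      show "b n \<in> borel_measurable window" unfolding b_def by measurable
      show "D n \<in> borel_measurable window" unfolding D_def
        by (rule \<mu>.borel_measurable_lebesgue_integral) measurable
    qed
    have i\<psi>\<phi>: "integrable window (\<lambda>u. \<bar>\<psi> u - \<phi> u\<bar>)" using i\<psi> \<phi>(2) by auto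
    note kA = integral_kernel_smoothing[OF w window.finite_measure_axioms sets_window i\<psi>\<phi>]
    have iSC: "integrable \<mu> (\<lambda>u. indicator (S - C) u :: real)" and iC: "integrable \<mu> (\<lambda>u. indicator C u :: real)"
      by (auto intro!: integrable_real_indicator simp: less_top[symmetric])
    note kE = integral_kernel_smoothing[OF w \<mu>.finite_measure_axioms s\<mu> iSC]
    note kD = integral_kernel_smoothing[OF w \<mu>.finite_measure_axioms s\<mu> iC]
    have pw: "\<bar>V n x / 2 - pi * \<kappa> * \<psi> x\<bar> \<le> pi * A n x + E n x + pi * \<kappa> * \<bar>\<psi> x - \<phi> x\<bar> + pi * b n x + D n x"
      if n: "1 \<le> n" for n x
    proof -
      have "V n x = 2 * pi * (\<integral>u. fejer h n (x - u) * \<psi> u \<partial>window) + (\<integral>u. fejer h n (x - u) * indicator S u \<partial>\<mu>)"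
        unfolding V_def by (rule dec[of "\<lambda>u. fejer h n (x - u)" "B\<^sup>2 * real n"]) (use kernel_bound[OF w] in auto)
      moreover have "(\<integral>u. fejer h n (x - u) * indicator S u \<partial>\<mu>) = D n x + E n x"
      proof -
        have "(\<integral>u. fejer h n (x - u) * indicator S u \<partial>\<mu>)
          = (\<integral>u. fejer h n (x - u) * indicator C u + fejer h n (x - u) * indicator (S - C) u \<partial>\<mu>)"
          using C(1) by (intro Bochner_Integration.integral_cong) (auto simp: indicator_def)
        also have "\<dots> = D n x + E n x" unfolding D_def E_def
          using n by (intro Bochner_Integration.integral_add kD(1) kE(1)) auto
        finally show ?thesis .
      qed
      moreover have "\<bar>(\<integral>u. fejer h n (x - u) * \<psi> u \<partial>window) - (\<integral>u. fejer h n (x - u) * \<phi> u \<partial>window)\<bar> \<le> A n x"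
      proof -
        have i1: "integrable window (\<lambda>u. fejer h n (x - u) * \<psi> u)"
          by (rule integral_kernel_smoothing(1)[OF w window.finite_measure_axioms sets_window i\<psi> \<psi>0 n])
        have i3: "integrable window (\<lambda>u. fejer h n (x - u) * \<bar>\<psi> u - \<phi> u\<bar>)" by (rule kA(1)[OF _ n]) simp
        have i3': "integrable window (\<lambda>u. fejer h n (x - u) * (\<psi> u - \<phi> u))"
          using i3 by (rule Bochner_Integration.integrable_bound) (auto simp: abs_mult)
        have i2: "integrable window (\<lambda>u. fejer h n (x - u) * \<phi> u)"
          using Bochner_Integration.integrable_diff[OF i1 i3'] by (simp add: algebra_simps)
        have "\<bar>(\<integral>u. fejer h n (x - u) * \<psi> u \<partial>window) - (\<integral>u. fejer h n (x - u) * \<phi> u \<partial>window)\<bar>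
           = \<bar>\<integral>u. fejer h n (x - u) * (\<psi> u - \<phi> u) \<partial>window\<bar>"
          using i1 i2 by (simp add: right_diff_distrib)
        also have "\<dots> \<le> (\<integral>u. \<bar>fejer h n (x - u) * (\<psi> u - \<phi> u)\<bar> \<partial>window)" by (rule integral_abs_bound)
        also have "\<dots> = A n x" unfolding A_def by (simp add: abs_mult)
        finally show ?thesis .
      qed
      moreover have "0 \<le> D n x" "0 \<le> E n x" unfolding D_def E_def by (intro integral_nonneg_AE AE_I2; simp)+
      ultimately have "\<bar>V n x / 2 - pi * \<kappa> * \<psi> x\<bar> \<le> \<bar>pi * ((\<integral>u. fejer h n (x - u) * \<psi> u \<partial>window) - (\<integral>u. fejer h n (x - u) * \<phi> u \<partial>window))\<bar>
         + \<bar>pi * ((\<integral>u. fejer h n (x - u) * \<phi> u \<partial>window) - \<kappa> * \<phi> x)\<bar> + \<bar>pi * \<kappa> * (\<psi> x - \<phi> x)\<bar> + D n x + E n x"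
      proof -
        have gen: "\<bar>(2 * p * i1 + (d + e)) / 2 - p * k * s\<bar> \<le> \<bar>p * (i1 - i2)\<bar> + \<bar>p * (i2 - k * f)\<bar> + \<bar>p * k * (s - f)\<bar> + d + e"
          if "0 \<le> d" "0 \<le> e" for p i1 i2 d e k s f :: real
        proof -
          have "(2 * p * i1 + (d + e)) / 2 - p * k * s = p * (i1 - i2) + p * (i2 - k * f) - p * k * (s - f) + (d + e) / 2"
            by (simp add: field_simps)
          moreover have "\<bar>A + B - C + t\<bar> \<le> \<bar>A\<bar> + \<bar>B\<bar> + \<bar>C\<bar> + d + e" if "0 \<le> t" "t \<le> d + e" for A B C t :: real
            using that by linarith
          moreover have "0 \<le> (d + e) / 2" "(d + e) / 2 \<le> d + e" using that by simp_all
          ultimately show ?thesis by simp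
        qed
        have "V n x = 2 * pi * (\<integral>u. fejer h n (x - u) * \<psi> u \<partial>window) + (D n x + E n x)"
          using \<open>V n x = _\<close> \<open>(\<integral>u. fejer h n (x - u) * indicator S u \<partial>\<mu>) = _\<close> by simp
        then show ?thesis
          by (simp only:) (rule gen[OF \<open>0 \<le> D n x\<close> \<open>0 \<le> E n x\<close>])
      qed
      also have "\<dots> \<le> pi * A n x + pi * b n x + pi * \<kappa> * \<bar>\<psi> x - \<phi> x\<bar> + D n x + E n x"
      proof -
        have "\<bar>pi * ((\<integral>u. fejer h n (x - u) * \<psi> u \<partial>window) - (\<integral>u. fejer h n (x - u) * \<phi> u \<partial>window))\<bar> \<le> pi * A n x"
          unfolding abs_mult using \<open>\<bar>_ - _\<bar> \<le> A n x\<close> by simp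
        then show ?thesis using \<kappa>0 by (simp add: abs_mult b_def)
      qed
      finally show ?thesis by simp
    qed
    have l1: "(\<lambda>n. \<integral>x. min 1 (pi * b n x) \<partial>window) \<longlonglongrightarrow> (\<integral>x. 0 \<partial>window)"
    proof (rule integral_dominated_convergence[where w="\<lambda>_. 1"])
      show "AE x in window. (\<lambda>n. min 1 (pi * b n x)) \<longlonglongrightarrow> 0"
        using AE_window_interior
      proof eventually_elim
        case (elim x)
        have "(\<lambda>n. min 1 (pi * b n x)) \<longlonglongrightarrow> min 1 (pi * \<bar>\<kappa> * \<phi> x - \<kappa> * \<phi> x\<bar>)"
          unfolding b_def using elim by (intro tendsto_intros kernel_approximates_identity[OF w \<kappa> _ _ \<phi>(1)]) auto
        then show ?case by simp
      qed
      show "AE x in window. norm (min 1 (pi * b n x)) \<le> 1" for n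
      proof (rule AE_I2)
        fix x have "0 \<le> pi * b n x" by (simp add: b_def)
        then show "norm (min 1 (pi * b n x)) \<le> 1" by simp
      qed
    qed auto
    have l2: "(\<lambda>n. \<integral>x. min 1 (D n x) \<partial>window) \<longlonglongrightarrow> (\<integral>x. 0 \<partial>window)"
    proof (rule integral_dominated_convergence[where w="\<lambda>_. 1"])
      show "AE x in window. (\<lambda>n. min 1 (D n x)) \<longlonglongrightarrow> 0"
        using AE_window_interior Cnull
      proof eventually_elim
        case (elim x)
        have "(\<lambda>n. D n x) \<longlonglongrightarrow> 0" unfolding D_def
          using kernel_singular_vanishes[OF w \<mu>.finite_measure_axioms s\<mu> Cc _ _ _ elim(2)] elim C(1) by auto
        then have "(\<lambda>n. min 1 (D n x)) \<longlonglongrightarrow> min 1 0" by (intro tendsto_intros)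
        then show ?case by simp
      qed
      show "AE x in window. norm (min 1 (D n x)) \<le> 1" for n
      proof (rule AE_I2)
        fix x have "0 \<le> D n x" unfolding D_def by (intro integral_nonneg_AE AE_I2) simp
        then show "norm (min 1 (D n x)) \<le> 1" by simp
      qed
    qed auto
    have "(\<lambda>n. (\<integral>x. min 1 (pi * b n x) \<partial>window) + (\<integral>x. min 1 (D n x) \<partial>window)) \<longlonglongrightarrow> 0"
      using tendsto_add[OF l1 l2] by simp
    then have "\<forall>\<^sub>F n in sequentially. (\<integral>x. min 1 (pi * b n x) \<partial>window) + (\<integral>x. min 1 (D n x) \<partial>window) < e / 2"
      using e by (intro order_tendstoD(2)) auto
    then obtain N where N: "\<And>n. n \<ge> N \<Longrightarrow> (\<integral>x. min 1 (pi * b n x) \<partial>window) + (\<integral>x. min 1 (D n x) \<partial>window) < e / 2"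
      by (auto simp: eventually_sequentially)
    have "(\<integral>x. \<bar>exp (- V n x / 2) - exp (- (pi * \<kappa> * \<psi> x))\<bar> \<partial>window) < e" if n: "n \<ge> max 1 N" for n
    proof -
      have n1: "1 \<le> n" using n by simp
      have iA: "integrable window (A n)" and iA': "(\<integral>x. A n x \<partial>window) = kernel_mass h n * (\<integral>u. \<bar>\<psi> u - \<phi> u\<bar> \<partial>window)"
        unfolding A_def using kA(2,3)[OF _ n1] by auto
      have iE: "integrable window (E n)" and iE': "(\<integral>x. E n x \<partial>window) = kernel_mass h n * measure \<mu> (S - C)"
        unfolding E_def using kE(2,3)[OF _ n1] sp\<mu> by (auto simp: Int_absorb1)
      have ib: "integrable window (\<lambda>x. min 1 (pi * b n x))"
      proof (rule window.integrable_const_bound[where B=1])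
        show "AE x in window. norm (min 1 (pi * b n x)) \<le> 1"
        proof (rule AE_I2)
          fix x have "0 \<le> pi * b n x" by (simp add: b_def)
          then show "norm (min 1 (pi * b n x)) \<le> 1" by simp
        qed
      qed measurable
      have iD: "integrable window (\<lambda>x. min 1 (D n x))"
      proof (rule window.integrable_const_bound[where B=1])
        show "AE x in window. norm (min 1 (D n x)) \<le> 1"
        proof (rule AE_I2)
          fix x have "0 \<le> D n x" unfolding D_def by (intro integral_nonneg_AE AE_I2) simp
          then show "norm (min 1 (D n x)) \<le> 1" by simp
        qed
      qed measurable
      have "(\<integral>x. \<bar>exp (- V n x / 2) - exp (- (pi * \<kappa> * \<psi> x))\<bar> \<partial>window)
         \<le> (\<integral>x. (pi * A n x + E n x + pi * \<kappa> * \<bar>\<psi> x - \<phi> x\<bar>) + (min 1 (pi * b n x) + min 1 (D n x)) \<partial>window)"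
      proof (rule integral_mono)
        show "integrable window (\<lambda>x. \<bar>exp (- V n x / 2) - exp (- (pi * \<kappa> * \<psi> x))\<bar>)"
        proof (rule window.integrable_const_bound[where B=1])
          show "AE x in window. norm \<bar>exp (- V n x / 2) - exp (- (pi * \<kappa> * \<psi> x))\<bar> \<le> 1"
            using abs_exp_neg_diff_le V0 \<psi>0 \<kappa>0 by (intro AE_I2) (simp add: abs_exp_neg_diff_le[THEN order.trans])
        qed measurable
        show "integrable window (\<lambda>x. (pi * A n x + E n x + pi * \<kappa> * \<bar>\<psi> x - \<phi> x\<bar>) + (min 1 (pi * b n x) + min 1 (D n x)))"
          by (intro Bochner_Integration.integrable_add integrable_mult_right iA iE i\<psi>\<phi> ib iD)
        fix x
        have "\<bar>exp (- (V n x / 2)) - exp (- (pi * \<kappa> * \<psi> x))\<bar> \<le> min 1 \<bar>V n x / 2 - pi * \<kappa> * \<psi> x\<bar>"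
          using V0 \<psi>0 \<kappa>0 by (intro abs_exp_neg_diff_le) auto
        also have "\<dots> \<le> (pi * A n x + E n x + pi * \<kappa> * \<bar>\<psi> x - \<phi> x\<bar>) + (min 1 (pi * b n x) + min 1 (D n x))"
        proof -
          have "0 \<le> A n x" "0 \<le> E n x" "0 \<le> D n x" unfolding A_def E_def D_def
            by (intro integral_nonneg_AE AE_I2; simp)+
          moreover have "0 \<le> b n x" by (simp add: b_def)
          ultimately have "0 \<le> pi * A n x" "0 \<le> E n x" "0 \<le> D n x" "0 \<le> pi * b n x" "0 \<le> pi * \<kappa> * \<bar>\<psi> x - \<phi> x\<bar>"
            using \<kappa>0 by simp_all
          then show ?thesis using pw[OF n1, of x] unfolding min_def by auto
        qed
        finally show "\<bar>exp (- V n x / 2) - exp (- (pi * \<kappa> * \<psi> x))\<bar>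
          \<le> (pi * A n x + E n x + pi * \<kappa> * \<bar>\<psi> x - \<phi> x\<bar>) + (min 1 (pi * b n x) + min 1 (D n x))" by simp
      qed
      also have "\<dots> = (pi * (\<integral>x. A n x \<partial>window) + (\<integral>x. E n x \<partial>window) + pi * \<kappa> * (\<integral>x. \<bar>\<psi> x - \<phi> x\<bar> \<partial>window))
         + ((\<integral>x. min 1 (pi * b n x) \<partial>window) + (\<integral>x. min 1 (D n x) \<partial>window))"
        by (simp add: iA iE i\<psi>\<phi> ib iD)
      also have "\<dots> < (pi * (B\<^sup>2 * \<epsilon>) + B\<^sup>2 * \<epsilon> + pi * B\<^sup>2 * \<epsilon>) + e / 2"
      proof (rule add_le_less_mono)
        have d: "0 \<le> (\<integral>u. \<bar>\<psi> u - \<phi> u\<bar> \<partial>window)" by (intro integral_nonneg_AE) auto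
        have "(\<integral>x. A n x \<partial>window) \<le> B\<^sup>2 * \<epsilon>" unfolding iA'
          using kernel_mass_bound[OF w] \<phi>(3) d by (intro mult_mono) auto
        moreover have "(\<integral>x. E n x \<partial>window) \<le> B\<^sup>2 * \<epsilon>" unfolding iE'
          using kernel_mass_bound[OF w] mC by (intro mult_mono) auto
        moreover have "pi * \<kappa> * (\<integral>x. \<bar>\<psi> x - \<phi> x\<bar> \<partial>window) \<le> pi * B\<^sup>2 * \<epsilon>"
          using \<kappa>B \<kappa>0 \<phi>(3) d by (intro mult_mono) auto
        ultimately show "pi * (\<integral>x. A n x \<partial>window) + (\<integral>x. E n x \<partial>window) + pi * \<kappa> * (\<integral>x. \<bar>\<psi> x - \<phi> x\<bar> \<partial>window)
           \<le> pi * (B\<^sup>2 * \<epsilon>) + B\<^sup>2 * \<epsilon> + pi * B\<^sup>2 * \<epsilon>" by (intro add_mono mult_left_mono) auto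
        show "(\<integral>x. min 1 (pi * b n x) \<partial>window) + (\<integral>x. min 1 (D n x) \<partial>window) < e / 2" using N n by simp
      qed
      also have "\<dots> \<le> e"
      proof -
        have "pi \<le> 4" using pi_less_4 by simp
        then have "pi * (B\<^sup>2 * \<epsilon>) \<le> 4 * (B\<^sup>2 * \<epsilon>)" using \<epsilon> by (intro mult_right_mono) auto
        moreover have "B\<^sup>2 * \<epsilon> = e / 20" using Bp by (simp add: \<epsilon>_def)
        moreover have "pi * y + y + z + e / 2 \<le> e" if "pi * y \<le> 4 * y" "y = e / 20" "z = pi * y" for y z
          using that e by linarith
        ultimately show ?thesis by (simp only: mult.assoc)
      qed
      finally show ?thesis .
    qed
    then show ?thesis by blast
  qed
  have iV: "integrable window (\<lambda>x. exp (- V n x / 2))" for n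
    by (rule window.integrable_const_bound[where B=1]) (use V0 in auto)
  have ie: "integrable window (\<lambda>x. exp (- (pi * \<kappa> * \<psi> x)))"
    by (rule window.integrable_const_bound[where B=1]) (use \<psi>0 \<kappa>0 in auto)
  have "(\<lambda>n. \<integral>x. exp (- V n x / 2) \<partial>window) \<longlonglongrightarrow> (\<integral>x. exp (- (pi * \<kappa> * \<psi> x)) \<partial>window)"
  proof (rule LIMSEQ_I)
    fix e :: real assume "0 < e"
    then obtain N where N: "\<And>n. n \<ge> N \<Longrightarrow> (\<integral>x. \<bar>exp (- V n x / 2) - exp (- (pi * \<kappa> * \<psi> x))\<bar> \<partial>window) < e"
      using main by blast
    have "norm ((\<integral>x. exp (- V n x / 2) \<partial>window) - (\<integral>x. exp (- (pi * \<kappa> * \<psi> x)) \<partial>window)) < e" if "n \<ge> N" for n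
    proof -
      have "norm ((\<integral>x. exp (- V n x / 2) \<partial>window) - (\<integral>x. exp (- (pi * \<kappa> * \<psi> x)) \<partial>window))
         = \<bar>\<integral>x. exp (- V n x / 2) - exp (- (pi * \<kappa> * \<psi> x)) \<partial>window\<bar>" using iV ie by simp
      also have "\<dots> \<le> (\<integral>x. \<bar>exp (- V n x / 2) - exp (- (pi * \<kappa> * \<psi> x))\<bar> \<partial>window)" by (rule integral_abs_bound)
      finally show ?thesis using N[OF that] by simp
    qed
    then show "\<exists>N. \<forall>n\<ge>N. norm ((\<integral>x. exp (- V n x / 2) \<partial>window) - (\<integral>x. exp (- (pi * \<kappa> * \<psi> x)) \<partial>window)) < e" by blast
  qed
  moreover have "V n (x + 2 * pi) = V n x" for n x
  proof -
    have "fejer h n (x + 2 * pi - u) = fejer h n (x - u)" for u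
      using kernel_periodic[of h n "x - u"] by (simp add: algebra_simps)
    then show ?thesis by (simp add: V_def)
  qed
  then have "(\<integral>x. exp (- V n x / 2) \<partial>window) = (\<integral>x. exp (- V n x / 2) \<partial>circle)" for n
    using Vm[of n] by (intro integral_window_periodic) auto
  moreover have "(\<integral>x. exp (- (pi * \<kappa> * \<psi> x)) \<partial>window) = (\<integral>x. exp (- (pi * \<kappa> * \<psi> x)) \<partial>circle)"
    using \<psi>p by (intro integral_window_periodic) auto
  ultimately show ?thesis by (simp add: V_def)
qed

section \<open>Trigonometric polynomials with Gaussian coefficients\<close>

text \<open>
  The random trigonometric polynomial with the Fourier multiplier \<open>h(k / n)\<close>. The multiplier
  \<open>cis (s t)\<close> shifts the argument by \<open>t / n\<close>, and \<open>(\<i> s) ^ j\<close> takes the \<open>j\<close>-th derivative with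
  respect to this \<open>t\<close>; so all functionals of the localized process that are needed are of this form.
\<close>

definition wpoly :: "(nat \<Rightarrow> real) \<Rightarrow> (nat \<Rightarrow> real) \<Rightarrow> (real \<Rightarrow> complex) \<Rightarrow> nat \<Rightarrow> real \<Rightarrow> real" where
  "wpoly a b h n x = (\<Sum>k=1..n. a k * Re (h (real k / real n) * cis (real k * x) / sqrt n)
      + b k * Im (h (real k / real n) * cis (real k * x) / sqrt n))"

locale gaussian_coefficients = prob_space M for M :: "'w measure" +
  fixes \<mu> :: "real measure" and a b :: "nat \<Rightarrow> 'w \<Rightarrow> real"
  assumes spectral: "spectral_measure \<mu>"
    and gaussian_a: "centered_gaussian_process M {1..} a"
    and gaussian_b: "centered_gaussian_process M {1..} b"
    and cov_a: "\<And>k l. k \<ge> 1 \<Longrightarrow> l \<ge> 1 \<Longrightarrow>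
           complex_of_real (\<integral>\<omega>. a k \<omega> * a l \<omega> \<partial>M) = spectral_corr \<mu> \<bar>int k - int l\<bar>"
    and cov_b: "\<And>k l. k \<ge> 1 \<Longrightarrow> l \<ge> 1 \<Longrightarrow>
           complex_of_real (\<integral>\<omega>. b k \<omega> * b l \<omega> \<partial>M) = spectral_corr \<mu> \<bar>int k - int l\<bar>"
    and independent: "indep_var
           (Pi\<^sub>M {1..} (\<lambda>_. borel)) (\<lambda>\<omega>. \<lambda>k\<in>{1..}. a k \<omega>)
           (Pi\<^sub>M {1..} (\<lambda>_. borel)) (\<lambda>\<omega>. \<lambda>k\<in>{1..}. b k \<omega>)"
begin

sublocale spectral: prob_space \<mu>
  using spectral by (auto simp: spectral_measure_def)

lemma sets_spectral [measurable_cong, simp]: "sets \<mu> = sets borel"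
  using spectral by (auto simp: spectral_measure_def)

lemma space_spectral [simp]: "space \<mu> = UNIV"
  using sets_eq_imp_space_eq[OF sets_spectral] by simp

lemma measurable_coefficients [measurable]:
  "k \<ge> 1 \<Longrightarrow> a k \<in> borel_measurable M" "k \<ge> 1 \<Longrightarrow> b k \<in> borel_measurable M"
  using gaussian_process_linear_combination[OF prob_space_axioms gaussian_a, of "{k}" "\<lambda>_. 1"]
    gaussian_process_linear_combination[OF prob_space_axioms gaussian_b, of "{k}" "\<lambda>_. 1"]
  by (auto simp: centered_normal_def)

text \<open>
  Both coefficient families have the covariance \<open>\<integral> cis (- (k - l) u) \<mu>(du)\<close>, which is real. The
  first family contributes its quadratic form at the real parts of the \<open>c k\<close>, the second one at the
  imaginary parts, and the sum is the Hermitian form, the integral of a squared modulus.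
\<close>

lemma combination_normal:
  "centered_normal M (\<lambda>\<omega>. \<Sum>k=1..n. a k \<omega> * Re (c k) + b k \<omega> * Im (c k))
     (\<integral>u. (cmod (\<Sum>k=1..n. c k * cis (- (real k * u))))\<^sup>2 \<partial>\<mu>)"
proof -
  define r where "r = (\<lambda>k l. \<integral>\<omega>. a k \<omega> * a l \<omega> \<partial>M)"
  have rc: "complex_of_real (r k l) = spectral_corr \<mu> \<bar>int k - int l\<bar>" if "k \<ge> 1" "l \<ge> 1" for k l
    unfolding r_def using that by (rule cov_a)
  have rb: "(\<integral>\<omega>. b k \<omega> * b l \<omega> \<partial>M) = r k l" if "k \<ge> 1" "l \<ge> 1" for k l
    using cov_b[OF that] rc[OF that] by (metis of_real_eq_iff)
  define A where "A = (\<lambda>\<omega>. \<Sum>k\<in>{1..n}. Re (c k) * a k \<omega>)"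
  define C where "C = (\<lambda>\<omega>. \<Sum>k\<in>{1..n}. Im (c k) * b k \<omega>)"
  have nA: "centered_normal M A (\<Sum>k\<in>{1..n}. \<Sum>l\<in>{1..n}. Re (c k) * Re (c l) * r k l)"
    unfolding A_def r_def by (rule gaussian_process_linear_combination[OF prob_space_axioms gaussian_a]) auto
  have "centered_normal M C (\<Sum>k\<in>{1..n}. \<Sum>l\<in>{1..n}. Im (c k) * Im (c l) * (\<integral>\<omega>. b k \<omega> * b l \<omega> \<partial>M))"
    unfolding C_def by (rule gaussian_process_linear_combination[OF prob_space_axioms gaussian_b]) auto
  then have nC: "centered_normal M C (\<Sum>k\<in>{1..n}. \<Sum>l\<in>{1..n}. Im (c k) * Im (c l) * r k l)"
    by (simp add: rb)
  have "indep_var borel ((\<lambda>f. \<Sum>k\<in>{1..n}. Re (c k) * f k) \<circ> (\<lambda>\<omega>. \<lambda>k\<in>{1..}. a k \<omega>))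
      borel ((\<lambda>f. \<Sum>k\<in>{1..n}. Im (c k) * f k) \<circ> (\<lambda>\<omega>. \<lambda>k\<in>{1..}. b k \<omega>))"
    by (rule indep_var_compose[OF independent]; measurable)
  moreover have "(\<lambda>f. \<Sum>k\<in>{1..n}. Re (c k) * f k) \<circ> (\<lambda>\<omega>. \<lambda>k\<in>{1..}. a k \<omega>) = A"
    "(\<lambda>f. \<Sum>k\<in>{1..n}. Im (c k) * f k) \<circ> (\<lambda>\<omega>. \<lambda>k\<in>{1..}. b k \<omega>) = C"
    by (auto simp: A_def C_def fun_eq_iff intro!: sum.cong)
  ultimately have ind: "indep_var borel A borel C" by simp
  have "(\<lambda>\<omega>. A \<omega> + C \<omega>) = (\<lambda>\<omega>. \<Sum>k=1..n. a k \<omega> * Re (c k) + b k \<omega> * Im (c k))"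
    by (simp add: A_def C_def sum.distrib mult.commute)
  moreover have "(\<Sum>k\<in>{1..n}. \<Sum>l\<in>{1..n}. Re (c k) * Re (c l) * r k l) + (\<Sum>k\<in>{1..n}. \<Sum>l\<in>{1..n}. Im (c k) * Im (c l) * r k l)
     = (\<integral>u. (cmod (\<Sum>k=1..n. c k * cis (- (real k * u))))\<^sup>2 \<partial>\<mu>)"
  proof -
    have e: "(\<integral>u. cis (- (of_int (int k - int l) * u)) \<partial>\<mu>) = complex_of_real (r k l)" if kl: "k \<ge> 1" "l \<ge> 1" for k l
    proof -
      have sc: "spectral_corr \<mu> m = (\<integral>u. cis (- (of_int m * u)) \<partial>\<mu>)" for m
        unfolding spectral_corr_def cis_conv_exp
        by (intro Bochner_Integration.integral_cong refl) (simp add: mult_ac)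
      show ?thesis
      proof (cases "l \<le> k")
        case True
        then show ?thesis using rc[OF kl] sc[of "int k - int l"] by simp
      next
        case False
        have "(\<integral>u. cis (- (of_int (int k - int l) * u)) \<partial>\<mu>) = (\<integral>u. cnj (cis (- (of_int (int l - int k) * u))) \<partial>\<mu>)"
          by (intro Bochner_Integration.integral_cong refl) (simp add: cis_cnj algebra_simps)
        also have "\<dots> = cnj (\<integral>u. cis (- (of_int (int l - int k) * u)) \<partial>\<mu>)" by simp
        also have "\<dots> = complex_of_real (r k l)"
          using False rc[OF kl] sc[of "int l - int k"] by (metis abs_minus_commute abs_of_nonneg complex_cnj_complex_of_real
              diff_ge_0_iff_ge nat_le_linear of_nat_le_iff)
        finally show ?thesis .
      qed
    qed
    have ic: "integrable \<mu> (\<lambda>u. z * cis (- (y * u)))" for z y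
      by (rule spectral.integrable_const_bound[where B="cmod z"]) (auto simp: norm_mult cis_conv_exp)
    have "complex_of_real (\<integral>u. (cmod (\<Sum>k=1..n. c k * cis (- (real k * u))))\<^sup>2 \<partial>\<mu>)
       = (\<integral>u. complex_of_real ((cmod (\<Sum>k=1..n. c k * cis (- (real k * u))))\<^sup>2) \<partial>\<mu>)"
      by (rule integral_complex_of_real[symmetric])
    also have "\<dots> = (\<integral>u. (\<Sum>k=1..n. \<Sum>l=1..n. (c k * cnj (c l)) * cis (- (of_int (int k - int l) * u))) \<partial>\<mu>)"
    proof (intro Bochner_Integration.integral_cong refl)
      fix u
      show "complex_of_real ((cmod (\<Sum>k=1..n. c k * cis (- (real k * u))))\<^sup>2)
        = (\<Sum>k=1..n. \<Sum>l=1..n. (c k * cnj (c l)) * cis (- (of_int (int k - int l) * u)))"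
        unfolding complex_norm_square cnj_sum sum_product
      proof (intro sum.cong refl)
        fix k l
        have "cis (- (real k * u)) * cnj (cis (- (real l * u))) = cis (- (of_int (int k - int l) * u))"
          by (simp add: cis_cnj cis_mult left_diff_distrib)
        then show "c k * cis (- (real k * u)) * cnj (c l * cis (- (real l * u)))
            = c k * cnj (c l) * cis (- (of_int (int k - int l) * u))"
          by (simp add: mult_ac)
      qed
    qed
    also have "\<dots> = (\<Sum>k=1..n. \<Sum>l=1..n. (c k * cnj (c l)) * (\<integral>u. cis (- (of_int (int k - int l) * u)) \<partial>\<mu>))"
      by (simp only: Bochner_Integration.integral_sum Bochner_Integration.integrable_sum ic integral_mult_right_zero)
    also have "\<dots> = (\<Sum>k=1..n. \<Sum>l=1..n. (c k * cnj (c l)) * complex_of_real (r k l))"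
      by (intro sum.cong refl) (subst e, auto)
    finally have "(\<integral>u. (cmod (\<Sum>k=1..n. c k * cis (- (real k * u))))\<^sup>2 \<partial>\<mu>)
       = Re (\<Sum>k=1..n. \<Sum>l=1..n. (c k * cnj (c l)) * complex_of_real (r k l))"
      by (metis Re_complex_of_real)
    also have "\<dots> = (\<Sum>k\<in>{1..n}. \<Sum>l\<in>{1..n}. Re (c k) * Re (c l) * r k l + Im (c k) * Im (c l) * r k l)"
      by (simp add: algebra_simps)
    also have "\<dots> = (\<Sum>k\<in>{1..n}. \<Sum>l\<in>{1..n}. Re (c k) * Re (c l) * r k l) + (\<Sum>k\<in>{1..n}. \<Sum>l\<in>{1..n}. Im (c k) * Im (c l) * r k l)"
      by (simp add: sum.distrib)
    finally show ?thesis by simp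
  qed
  ultimately show ?thesis using centered_normal_add[OF nA nC ind] by simp
qed

abbreviation Y :: "(real \<Rightarrow> complex) \<Rightarrow> nat \<Rightarrow> real \<Rightarrow> 'w \<Rightarrow> real" where
  "Y h n x \<omega> \<equiv> wpoly (\<lambda>k. a k \<omega>) (\<lambda>k. b k \<omega>) h n x"

text \<open>
  The covariance of the polynomial at the points \<open>x\<close> and \<open>y\<close> in terms of the spectral measure, see
  \<open>Y_pair_normal\<close>.
\<close>

definition covar :: "(real \<Rightarrow> complex) \<Rightarrow> nat \<Rightarrow> real \<Rightarrow> real \<Rightarrow> real" where
  "covar h n x y = (\<integral>u. Re (dirichlet h n (x - u) * cnj (dirichlet h n (y - u))) \<partial>\<mu>) / real n"

lemma dirichlet_shift:
  "(\<Sum>k=1..n. h (real k / real n) * cis (real k * x) / sqrt n * cis (- (real k * u))) = dirichlet h n (x - u) / sqrt n"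
  unfolding dirichlet_def sum_divide_distrib
  by (intro sum.cong refl) (simp add: cis_mult algebra_simps)

lemma Y_pair_normal:
  assumes w: "weight B h"
  shows "centered_normal M (\<lambda>\<omega>. \<alpha> * Y h n x \<omega> + \<beta> * Y h n y \<omega>)
    (\<alpha>\<^sup>2 * (\<integral>u. fejer h n (x - u) \<partial>\<mu>) + 2 * \<alpha> * \<beta> * covar h n x y + \<beta>\<^sup>2 * (\<integral>u. fejer h n (y - u) \<partial>\<mu>))"
proof -
  let ?D = "dirichlet h n"
  define c where "c = (\<lambda>x k. h (real k / real n) * cis (real k * x) / sqrt n)"
  have lin: "(\<lambda>\<omega>. \<alpha> * Y h n x \<omega> + \<beta> * Y h n y \<omega>) = (\<lambda>\<omega>. \<Sum>k=1..n. a k \<omega> * Re (\<alpha> * c x k + \<beta> * c y k) + b k \<omega> * Im (\<alpha> * c x k + \<beta> * c y k))"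
    by (simp add: wpoly_def c_def fun_eq_iff sum_distrib_left sum.distrib[symmetric] algebra_simps)
  have s: "(\<Sum>k=1..n. (\<alpha> * c x k + \<beta> * c y k) * cis (- (real k * u)))
      = \<alpha> * (?D (x - u) / sqrt n) + \<beta> * (?D (y - u) / sqrt n)" for u
    unfolding dirichlet_shift[symmetric] c_def by (simp add: sum_distrib_left sum.distrib[symmetric] algebra_simps)
  have sq: "(cmod (\<alpha> * (p / sqrt n) + \<beta> * (q / sqrt n)))\<^sup>2
     = \<alpha>\<^sup>2 * ((cmod p)\<^sup>2 / n) + (2 * \<alpha> * \<beta> / n) * Re (p * cnj q) + \<beta>\<^sup>2 * ((cmod q)\<^sup>2 / n)" for p q :: complex
  proof (cases "n = 0")
    case False
    have "\<alpha> * (p / sqrt n) + \<beta> * (q / sqrt n) = (\<alpha> * p + \<beta> * q) / sqrt n"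
      by (simp add: add_divide_distrib)
    then have "(cmod (\<alpha> * (p / sqrt n) + \<beta> * (q / sqrt n)))\<^sup>2 = (cmod (\<alpha> * p + \<beta> * q))\<^sup>2 / n"
      by (simp add: norm_divide power_divide)
    also have "\<dots> = (\<alpha>\<^sup>2 * (cmod p)\<^sup>2 + 2 * \<alpha> * \<beta> * Re (p * cnj q) + \<beta>\<^sup>2 * (cmod q)\<^sup>2) / n"
      unfolding cmod_power2 by (simp add: power2_eq_square algebra_simps)
    finally show ?thesis by (simp add: add_divide_distrib)
  qed simp
  have n1: "(\<lambda>u. Re (?D (x - u) * cnj (?D (y - u)))) \<in> borel_measurable \<mu>"
  proof -
    have "continuous_on UNIV (\<lambda>u. Re (?D (x - u) * cnj (?D (y - u))))" by (intro continuous_intros)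
    then show ?thesis by (simp add: borel_measurable_continuous_onI cong: measurable_cong_sets)
  qed
  have i1: "integrable \<mu> (\<lambda>u. Re (?D (x - u) * cnj (?D (y - u))))"
  proof (rule spectral.integrable_const_bound[where B="(B * real n) * (B * real n)"])
    show "AE u in \<mu>. norm (Re (?D (x - u) * cnj (?D (y - u)))) \<le> (B * real n) * (B * real n)"
    proof (rule AE_I2)
      fix u
      have "norm (Re (?D (x - u) * cnj (?D (y - u)))) \<le> cmod (?D (x - u)) * cmod (?D (y - u))"
        by (metis abs_Re_le_cmod complex_mod_cnj norm_mult real_norm_def)
      also have "\<dots> \<le> (B * real n) * (B * real n)"
        using weightD(1)[OF w] by (intro mult_mono dirichlet_bound[OF w]) auto
      finally show "norm (Re (?D (x - u) * cnj (?D (y - u)))) \<le> (B * real n) * (B * real n)" .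
    qed
  qed (rule n1)
  note i2 = integrable_kernel(1)[OF spectral.finite_measure_axioms sets_spectral w]
  have "(\<integral>u. (cmod (\<Sum>k=1..n. (\<alpha> * c x k + \<beta> * c y k) * cis (- (real k * u))))\<^sup>2 \<partial>\<mu>)
     = (\<integral>u. \<alpha>\<^sup>2 * fejer h n (x - u) + (2 * \<alpha> * \<beta> / n) * Re (?D (x - u) * cnj (?D (y - u))) + \<beta>\<^sup>2 * fejer h n (y - u) \<partial>\<mu>)"
    unfolding s sq fejer_def ..
  also have "\<dots> = (\<integral>u. \<alpha>\<^sup>2 * fejer h n (x - u) \<partial>\<mu>) + (\<integral>u. (2 * \<alpha> * \<beta> / n) * Re (?D (x - u) * cnj (?D (y - u))) \<partial>\<mu>)
      + (\<integral>u. \<beta>\<^sup>2 * fejer h n (y - u) \<partial>\<mu>)"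
    by (subst Bochner_Integration.integral_add, intro Bochner_Integration.integrable_add integrable_mult_right i1 i2,
        intro integrable_mult_right i2, subst Bochner_Integration.integral_add)
      (intro integrable_mult_right i1 i2 refl)+
  also have "\<dots> = \<alpha>\<^sup>2 * (\<integral>u. fejer h n (x - u) \<partial>\<mu>) + 2 * \<alpha> * \<beta> * covar h n x y + \<beta>\<^sup>2 * (\<integral>u. fejer h n (y - u) \<partial>\<mu>)"
    by (simp only: integral_mult_right_zero covar_def) simp
  finally show ?thesis
    using combination_normal[where n=n and c="\<lambda>k. \<alpha> * c x k + \<beta> * c y k"] unfolding lin by simp
qed

end

section \<open>The variance of spatial means\<close>

lemma nn_integral_dirichlet_shift:
  assumes w: "weight B h" and n: "1 \<le> n"
  shows "(\<integral>\<^sup>+x. ennreal (cmod (dirichlet h n (x - u))) \<partial>circle) \<le> ennreal (12 * B * ln (1 + 2 * pi * real n))"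
proof -
  have "(\<integral>\<^sup>+x. ennreal (cmod (dirichlet h n (x + (- u)))) \<partial>circle) = (\<integral>\<^sup>+x. ennreal (cmod (dirichlet h n x)) \<partial>circle)"
    by (rule nn_integral_circle_shift) (auto simp: dirichlet_periodic)
  then show ?thesis using dirichlet_L1[OF w n] by simp
qed

context gaussian_coefficients
begin

lemma covar_measurable [measurable]:
  "(\<lambda>p. covar h n (fst p) (snd p)) \<in> borel_measurable (circle \<Otimes>\<^sub>M circle)"
proof -
  have [measurable]: "dirichlet h n \<in> measurable borel borel" by simp
  have "(\<lambda>p. \<integral>u. Re (dirichlet h n (fst p - u) * cnj (dirichlet h n (snd p - u))) \<partial>\<mu>) \<in> borel_measurable (circle \<Otimes>\<^sub>M circle)"
  proof (rule spectral.borel_measurable_lebesgue_integral)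
    have [measurable]: "(\<lambda>q. dirichlet h n (fst (fst q) - snd q)) \<in> borel_measurable ((circle \<Otimes>\<^sub>M circle) \<Otimes>\<^sub>M \<mu>)"
      "(\<lambda>q. dirichlet h n (snd (fst q) - snd q)) \<in> borel_measurable ((circle \<Otimes>\<^sub>M circle) \<Otimes>\<^sub>M \<mu>)"
      by measurable
    have "(\<lambda>q. Re (dirichlet h n (fst (fst q) - snd q)) * Re (dirichlet h n (snd (fst q) - snd q))
        + Im (dirichlet h n (fst (fst q) - snd q)) * Im (dirichlet h n (snd (fst q) - snd q)))
        \<in> borel_measurable ((circle \<Otimes>\<^sub>M circle) \<Otimes>\<^sub>M \<mu>)"
      by measurable
    then show "(\<lambda>(p, u). Re (dirichlet h n (fst p - u) * cnj (dirichlet h n (snd p - u))))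
        \<in> borel_measurable ((circle \<Otimes>\<^sub>M circle) \<Otimes>\<^sub>M \<mu>)"
      by (simp add: split_beta')
  qed
  then show ?thesis unfolding covar_def by measurable
qed

lemma covar_bound:
  assumes w: "weight B h"
  shows "\<bar>covar h n x y\<bar> \<le> B\<^sup>2 * real n"
proof (cases "n = 0")
  case False
  have "\<bar>\<integral>u. Re (dirichlet h n (x - u) * cnj (dirichlet h n (y - u))) \<partial>\<mu>\<bar> \<le> (\<integral>u. (B * real n)\<^sup>2 \<partial>\<mu>)"
  proof (rule order.trans[OF integral_abs_bound])
    have "\<bar>Re (dirichlet h n (x - u) * cnj (dirichlet h n (y - u)))\<bar> \<le> (B * real n)\<^sup>2" for u
    proof -
      have "\<bar>Re (dirichlet h n (x - u) * cnj (dirichlet h n (y - u)))\<bar> \<le> cmod (dirichlet h n (x - u)) * cmod (dirichlet h n (y - u))"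
        by (metis abs_Re_le_cmod complex_mod_cnj norm_mult)
      also have "\<dots> \<le> (B * real n) * (B * real n)"
        using weightD(1)[OF w] by (intro mult_mono dirichlet_bound[OF w]) auto
      finally show ?thesis by (simp add: power2_eq_square)
    qed
    then show "(\<integral>u. \<bar>Re (dirichlet h n (x - u) * cnj (dirichlet h n (y - u)))\<bar> \<partial>\<mu>) \<le> (\<integral>u. (B * real n)\<^sup>2 \<partial>\<mu>)"
      by (intro Bochner_Integration.integral_mono' spectral.integrable_const) auto
  qed
  then have "\<bar>covar h n x y\<bar> \<le> (B * real n)\<^sup>2 / real n"
    using spectral.prob_space unfolding covar_def by (simp add: divide_right_mono)
  then show ?thesis using False by (simp add: power2_eq_square)
qed (simp add: covar_def)

text \<open>
  Under the integral over \<open>u\<close> the covariance is dominated by a product of two translated Dirichlet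
  kernels. Integrating first over \<open>x\<close> and \<open>y\<close> gives the square of an \<open>L\<^sup>1\<close> norm, of order \<open>log\<^sup>2 n\<close>,
  whatever the spectral measure.
\<close>

lemma covar_L1:
  assumes w: "weight B h" and n: "1 \<le> n"
  shows "(\<integral>p. \<bar>covar h n (fst p) (snd p)\<bar> \<partial>(circle \<Otimes>\<^sub>M circle)) \<le> (12 * B * ln (1 + 2 * pi * real n))\<^sup>2 / real n"
proof -
  let ?L = "12 * B * ln (1 + 2 * pi * real n)" and ?D = "\<lambda>x. cmod (dirichlet h n x)"
  have n0: "0 < real n" using n by simp
  have L0: "0 \<le> ?L" using weightD(1)[OF w] n0 by (intro mult_nonneg_nonneg ln_ge_zero) auto
  interpret CC: pair_sigma_finite circle circle ..
  interpret CCp: pair_prob_space circle circle ..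
  interpret CM: pair_sigma_finite "circle \<Otimes>\<^sub>M circle" \<mu> ..
  have [measurable]: "?D \<in> borel_measurable borel" by measurable
  have "(\<integral>\<^sup>+p. ennreal \<bar>covar h n (fst p) (snd p)\<bar> \<partial>(circle \<Otimes>\<^sub>M circle))
     \<le> (\<integral>\<^sup>+p. (\<integral>\<^sup>+u. ennreal (?D (fst p - u) * ?D (snd p - u) / real n) \<partial>\<mu>) \<partial>(circle \<Otimes>\<^sub>M circle))"
  proof (rule nn_integral_mono)
    fix p :: "real \<times> real"
    have nb: "norm (Re (dirichlet h n (fst p - u) * cnj (dirichlet h n (snd p - u))) / real n) \<le> ?D (fst p - u) * ?D (snd p - u) / real n" for u
    proof -
      have "\<bar>Re (dirichlet h n (fst p - u) * cnj (dirichlet h n (snd p - u)))\<bar> \<le> ?D (fst p - u) * ?D (snd p - u)"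
        by (metis abs_Re_le_cmod complex_mod_cnj norm_mult)
      then show ?thesis using n0 by (simp add: divide_right_mono)
    qed
    define g where "g = (\<lambda>u. Re (dirichlet h n (fst p - u) * cnj (dirichlet h n (snd p - u))) / real n)"
    have "covar h n (fst p) (snd p) = (\<integral>u. g u \<partial>\<mu>)"
      unfolding covar_def g_def by simp
    then have "ennreal \<bar>covar h n (fst p) (snd p)\<bar> \<le> (\<integral>\<^sup>+u. ennreal (norm (g u)) \<partial>\<mu>)"
      using integral_norm_bound_ennreal[of \<mu> g]
      by (cases "integrable \<mu> g") (auto simp: not_integrable_integral_eq)
    also have "\<dots> \<le> (\<integral>\<^sup>+u. ennreal (?D (fst p - u) * ?D (snd p - u) / real n) \<partial>\<mu>)"
      unfolding g_def by (intro nn_integral_mono ennreal_leI nb)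
    finally show "ennreal \<bar>covar h n (fst p) (snd p)\<bar> \<le> (\<integral>\<^sup>+u. ennreal (?D (fst p - u) * ?D (snd p - u) / real n) \<partial>\<mu>)" .
  qed
  also have "\<dots> = (\<integral>\<^sup>+u. (\<integral>\<^sup>+p. ennreal (?D (fst p - u) * ?D (snd p - u) / real n) \<partial>(circle \<Otimes>\<^sub>M circle)) \<partial>\<mu>)"
    by (rule CM.Fubini'[symmetric]) measurable
  also have "\<dots> \<le> (\<integral>\<^sup>+u. ennreal (?L\<^sup>2 / real n) \<partial>\<mu>)"
  proof (rule nn_integral_mono)
    fix u
    have "(\<integral>\<^sup>+p. ennreal (?D (fst p - u) * ?D (snd p - u) / real n) \<partial>(circle \<Otimes>\<^sub>M circle))
      = (\<integral>\<^sup>+x. (\<integral>\<^sup>+y. ennreal (?D (x - u) * ?D (y - u) / real n) \<partial>circle) \<partial>circle)"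
      by (subst circle.nn_integral_fst[symmetric]) auto
    also have "\<dots> = (\<integral>\<^sup>+x. (\<integral>\<^sup>+y. ennreal (1 / real n) * (ennreal (?D (x - u)) * ennreal (?D (y - u))) \<partial>circle) \<partial>circle)"
      using n0 by (intro nn_integral_cong) (simp add: ennreal_mult[symmetric] del: ennreal_mult)
    also have "\<dots> = ennreal (1 / real n) * ((\<integral>\<^sup>+x. ennreal (?D (x - u)) \<partial>circle) * (\<integral>\<^sup>+y. ennreal (?D (y - u)) \<partial>circle))"
      by (simp add: nn_integral_cmult nn_integral_multc)
    also have "\<dots> \<le> ennreal (1 / real n) * (ennreal ?L * ennreal ?L)"
      by (intro mult_left_mono mult_mono nn_integral_dirichlet_shift[OF w n]) auto
    also have "ennreal ?L * ennreal ?L = ennreal (?L * ?L)"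
      by (rule ennreal_mult[symmetric]) (use L0 in auto)
    also have "ennreal (1 / real n) * ennreal (?L * ?L) = ennreal (1 / real n * (?L * ?L))"
      by (rule ennreal_mult[symmetric]; (rule zero_le_square | simp))
    also have "1 / real n * (?L * ?L) = ?L\<^sup>2 / real n" by (simp add: power2_eq_square)
    finally show "(\<integral>\<^sup>+p. ennreal (?D (fst p - u) * ?D (snd p - u) / real n) \<partial>(circle \<Otimes>\<^sub>M circle)) \<le> ennreal (?L\<^sup>2 / real n)" .
  qed
  also have "\<dots> = ennreal (?L\<^sup>2 / real n)" using spectral.emeasure_space_1 by simp
  finally have 1: "(\<integral>\<^sup>+p. ennreal \<bar>covar h n (fst p) (snd p)\<bar> \<partial>(circle \<Otimes>\<^sub>M circle)) \<le> ennreal (?L\<^sup>2 / real n)" .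
  have "integrable (circle \<Otimes>\<^sub>M circle) (\<lambda>p. \<bar>covar h n (fst p) (snd p)\<bar>)"
    by (rule CCp.integrable_const_bound[where B="B\<^sup>2 * real n"]) (use covar_bound[OF w] in auto)
  then have "ennreal (\<integral>p. \<bar>covar h n (fst p) (snd p)\<bar> \<partial>(circle \<Otimes>\<^sub>M circle)) \<le> ennreal (?L\<^sup>2 / real n)"
    using 1 by (subst nn_integral_eq_integral[symmetric]) auto
  then show ?thesis using n0 by (simp add: ennreal_le_iff)
qed

lemma measurable_Y [measurable]: "(\<lambda>p. Y h n (fst p) (snd p)) \<in> borel_measurable (circle \<Otimes>\<^sub>M M)"
proof -
  have c: "continuous_on UNIV (\<lambda>x. h (real k / real n) * cis (real k * x) / sqrt n)" for k
    unfolding cis_conv_exp by (cases "n = 0") (auto intro!: continuous_intros)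
  have [measurable]: "(\<lambda>x. Re (h (real k / real n) * cis (real k * x) / sqrt n)) \<in> borel_measurable circle"
    "(\<lambda>x. Im (h (real k / real n) * cis (real k * x) / sqrt n)) \<in> borel_measurable circle" for k
    using borel_measurable_continuous_onI[OF continuous_on_Re[OF c[of k]]]
      borel_measurable_continuous_onI[OF continuous_on_Im[OF c[of k]]]
    by (simp_all cong: measurable_cong_sets)
  show ?thesis unfolding wpoly_def
  proof (intro borel_measurable_sum borel_measurable_add borel_measurable_times)
    fix k assume "k \<in> {1..n}"
    then have [measurable]: "a k \<in> borel_measurable M" "b k \<in> borel_measurable M" by auto
    show "(\<lambda>p. a k (snd p)) \<in> borel_measurable (circle \<Otimes>\<^sub>M M)" "(\<lambda>p. b k (snd p)) \<in> borel_measurable (circle \<Otimes>\<^sub>M M)"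
      "(\<lambda>p. Re (h (real k / real n) * cis (real k * fst p) / sqrt n)) \<in> borel_measurable (circle \<Otimes>\<^sub>M M)"
      "(\<lambda>p. Im (h (real k / real n) * cis (real k * fst p) / sqrt n)) \<in> borel_measurable (circle \<Otimes>\<^sub>M M)"
      by measurable
  qed
qed

text \<open>
  A square integrable bound for the polynomial, uniform in the point; it serves to apply Fubini.
\<close>

definition envelope :: "real \<Rightarrow> nat \<Rightarrow> 'w \<Rightarrow> real" where
  "envelope B n \<omega> = B * (\<Sum>k=1..n. \<bar>a k \<omega>\<bar> + \<bar>b k \<omega>\<bar>)"

lemma Y_le_envelope:
  assumes w: "weight B h"
  shows "\<bar>Y h n x \<omega>\<bar> \<le> envelope B n \<omega>"
proof (cases "n = 0")
  case False
  have c: "cmod (h (real k / real n) * cis (real k * x) / sqrt n) \<le> B" if "k \<in> {1..n}" for k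
  proof -
    have "cmod (h (real k / real n) * cis (real k * x) / sqrt n) = cmod (h (real k / real n)) / sqrt n"
      by (simp add: norm_mult norm_divide)
    also have "\<dots> \<le> B / 1"
      using that weightD(1)[OF w] False by (intro frac_le weightD(2)[OF w]) auto
    finally show ?thesis by simp
  qed
  have "\<bar>Y h n x \<omega>\<bar> \<le> (\<Sum>k=1..n. \<bar>a k \<omega>\<bar> * B + \<bar>b k \<omega>\<bar> * B)"
    unfolding wpoly_def
  proof (rule order.trans[OF sum_abs sum_mono])
    fix k assume k: "k \<in> {1..n}"
    let ?z = "h (real k / real n) * cis (real k * x) / sqrt n"
    have "\<bar>a k \<omega> * Re ?z + b k \<omega> * Im ?z\<bar> \<le> \<bar>a k \<omega>\<bar> * \<bar>Re ?z\<bar> + \<bar>b k \<omega>\<bar> * \<bar>Im ?z\<bar>"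
      by (metis abs_mult abs_triangle_ineq)
    also have "\<dots> \<le> \<bar>a k \<omega>\<bar> * B + \<bar>b k \<omega>\<bar> * B"
      using c[OF k] abs_Re_le_cmod[of ?z] abs_Im_le_cmod[of ?z] by (intro add_mono mult_left_mono) linarith+
    finally show "\<bar>a k \<omega> * Re ?z + b k \<omega> * Im ?z\<bar> \<le> \<bar>a k \<omega>\<bar> * B + \<bar>b k \<omega>\<bar> * B" .
  qed
  also have "\<dots> = envelope B n \<omega>" by (simp add: envelope_def sum_distrib_left algebra_simps)
  finally show ?thesis .
qed (simp add: wpoly_def envelope_def)

lemma coefficient_normal:
  assumes "k \<ge> 1"
  shows "centered_normal M (a k) 1" "centered_normal M (b k) 1"
proof -
  have "spectral_corr \<mu> 0 = 1" using spectral.prob_space by (simp add: spectral_corr_def)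
  then have "complex_of_real (\<integral>\<omega>. a k \<omega> * a k \<omega> \<partial>M) = complex_of_real 1"
    "complex_of_real (\<integral>\<omega>. b k \<omega> * b k \<omega> \<partial>M) = complex_of_real 1"
    using cov_a[OF assms assms] cov_b[OF assms assms] by simp_all
  then have "(\<integral>\<omega>. a k \<omega> * a k \<omega> \<partial>M) = 1" "(\<integral>\<omega>. b k \<omega> * b k \<omega> \<partial>M) = 1"
    unfolding of_real_eq_iff .
  then show "centered_normal M (a k) 1" "centered_normal M (b k) 1"
    using gaussian_process_linear_combination[OF prob_space_axioms gaussian_a, of "{k}" "\<lambda>_. 1"]
      gaussian_process_linear_combination[OF prob_space_axioms gaussian_b, of "{k}" "\<lambda>_. 1"] assms by auto
qed

lemma envelope_measurable [measurable]: "envelope B n \<in> borel_measurable M"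
  unfolding envelope_def
  by (intro borel_measurable_times borel_measurable_sum borel_measurable_add borel_measurable_abs borel_measurable_const) auto

lemma envelope_square_integrable: "integrable M (\<lambda>\<omega>. (envelope B n \<omega>)\<^sup>2)"
proof (rule Bochner_Integration.integrable_bound)
  let ?f = "\<lambda>\<omega>. B\<^sup>2 * ((\<Sum>k\<in>{1..n}. 2 * (a k \<omega>)\<^sup>2 + 2 * (b k \<omega>)\<^sup>2) * real (card {1..n}))"
  show "integrable M ?f"
  proof (intro integrable_mult_right integrable_mult_left Bochner_Integration.integrable_sum Bochner_Integration.integrable_add)
    fix k assume "k \<in> {1..n}"
    then show "integrable M (\<lambda>\<omega>. (a k \<omega>)\<^sup>2)" "integrable M (\<lambda>\<omega>. (b k \<omega>)\<^sup>2)"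
      using centered_normal_moments(1)[OF coefficient_normal(1), of k 2] centered_normal_moments(1)[OF coefficient_normal(2), of k 2] by auto
  qed
  show "AE \<omega> in M. norm ((envelope B n \<omega>)\<^sup>2) \<le> norm (?f \<omega>)"
  proof (rule AE_I2)
    fix \<omega>
    have "(\<Sum>k=1..n. \<bar>a k \<omega>\<bar> + \<bar>b k \<omega>\<bar>)\<^sup>2 \<le> (\<Sum>k=1..n. (\<bar>a k \<omega>\<bar> + \<bar>b k \<omega>\<bar>)\<^sup>2) * card {1..n}"
      by (rule sum_squared_le_sum_of_squares)
    also have "\<dots> \<le> (\<Sum>k=1..n. 2 * (a k \<omega>)\<^sup>2 + 2 * (b k \<omega>)\<^sup>2) * card {1..n}"
    proof (intro mult_right_mono sum_mono)
      fix k show "(\<bar>a k \<omega>\<bar> + \<bar>b k \<omega>\<bar>)\<^sup>2 \<le> 2 * (a k \<omega>)\<^sup>2 + 2 * (b k \<omega>)\<^sup>2"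
        using sum_squares_bound[of "\<bar>a k \<omega>\<bar>" "\<bar>b k \<omega>\<bar>"] by (simp add: power2_sum)
    qed simp
    finally have "(envelope B n \<omega>)\<^sup>2 \<le> ?f \<omega>"
      unfolding envelope_def power_mult_distrib by (rule mult_left_mono) simp
    also have "?f \<omega> \<le> norm (?f \<omega>)" unfolding real_norm_def by (rule abs_ge_self)
    finally show "norm ((envelope B n \<omega>)\<^sup>2) \<le> norm (?f \<omega>)" by (simp only: real_norm_def abs_power2)
  qed
qed measurable

lemma envelope_integrable: "integrable M (envelope B n)"
proof (rule Bochner_Integration.integrable_bound)
  show "integrable M (\<lambda>\<omega>. 1 + (envelope B n \<omega>)\<^sup>2)" using envelope_square_integrable by auto
  have "\<bar>y\<bar> \<le> 1 + y\<^sup>2" for y :: real using sum_squares_bound[of 1 "\<bar>y\<bar>"] by simp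
  then show "AE \<omega> in M. norm (envelope B n \<omega>) \<le> norm (1 + (envelope B n \<omega>)\<^sup>2)"
    by (intro AE_I2) simp
qed measurable

definition spatial_mean :: "(real \<Rightarrow> real) \<Rightarrow> (real \<Rightarrow> complex) \<Rightarrow> nat \<Rightarrow> 'w \<Rightarrow> real" where
  "spatial_mean \<phi> h n \<omega> = (\<integral>x. \<phi> (Y h n x \<omega>) \<partial>circle)"

definition annealed_mean :: "(real \<Rightarrow> real) \<Rightarrow> (real \<Rightarrow> complex) \<Rightarrow> nat \<Rightarrow> real" where
  "annealed_mean \<phi> h n = (\<integral>x. (\<integral>\<omega>. \<phi> (Y h n x \<omega>) \<partial>M) \<partial>circle)"

text \<open>
  The variance is the double integral over \<open>x\<close> and \<open>y\<close> of the covariances of \<open>\<phi>(Y x)\<close> and \<open>\<phi>(Y y)\<close>,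
  which for Gaussian pairs are in absolute value at most twice those of \<open>Y x\<close> and \<open>Y y\<close>.
\<close>

lemma spatial_mean_variance:
  assumes w: "weight B h" and n: "1 \<le> n" and lip: "\<And>x y. \<bar>\<phi> x - \<phi> y\<bar> \<le> \<bar>x - y\<bar>"
  shows "integrable M (\<lambda>\<omega>. (spatial_mean \<phi> h n \<omega> - annealed_mean \<phi> h n)\<^sup>2)"
    and "(\<integral>\<omega>. (spatial_mean \<phi> h n \<omega> - annealed_mean \<phi> h n)\<^sup>2 \<partial>M) \<le> 2 * ((12 * B * ln (1 + 2 * pi * real n))\<^sup>2 / real n)"
proof -
  interpret CC: pair_prob_space circle circle ..
  interpret CM: pair_prob_space circle M ..
  interpret CCM: pair_prob_space "circle \<Otimes>\<^sub>M circle" M ..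
  have "continuous_on UNIV \<phi>"
    by (rule lipschitz_on_continuous_on[where L=1]) (auto intro!: lipschitz_onI simp: dist_real_def lip)
  then have [measurable]: "\<phi> \<in> borel_measurable borel" by (rule borel_measurable_continuous_onI)
  let ?S = "envelope B n"
  have S0: "0 \<le> ?S \<omega>" for \<omega> using weightD(1)[OF w] by (simp add: envelope_def sum_nonneg)
  have \<phi>b: "\<bar>\<phi> (Y h n x \<omega>)\<bar> \<le> \<bar>\<phi> 0\<bar> + ?S \<omega>" for x \<omega>
    using lip[of "Y h n x \<omega>" 0] Y_le_envelope[OF w, where n=n and x=x and \<omega>=\<omega>] by linarith
  have mY[measurable]: "Y h n x \<in> borel_measurable M" for x
    using measurable_Pair2[OF measurable_Y[of h n], of x] by simp
  have mY2[measurable]: "(\<lambda>x. Y h n x \<omega>) \<in> borel_measurable circle" if "\<omega> \<in> space M" for \<omega>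
    using measurable_Pair1[OF measurable_Y[of h n] that] by simp
  have i\<phi>: "integrable M (\<lambda>\<omega>. \<phi> (Y h n x \<omega>))" for x
    by (rule Bochner_Integration.integrable_bound[where f="\<lambda>\<omega>. \<bar>\<phi> 0\<bar> + ?S \<omega>"])
       (use \<phi>b envelope_integrable S0 in auto)
  define G where "G = (\<lambda>x. \<integral>\<omega>. \<phi> (Y h n x \<omega>) \<partial>M)"
  define e where "e = \<bar>\<phi> 0\<bar> + (\<integral>\<omega>. ?S \<omega> \<partial>M)"
  have Gb: "\<bar>G x\<bar> \<le> e" for x
  proof -
    have "\<bar>G x\<bar> \<le> (\<integral>\<omega>. \<bar>\<phi> 0\<bar> + ?S \<omega> \<partial>M)" unfolding G_def
      by (rule order.trans[OF integral_abs_bound integral_mono]) (use i\<phi> \<phi>b envelope_integrable in auto)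
    also have "\<dots> = e" using envelope_integrable prob_space by (simp add: e_def)
    finally show ?thesis .
  qed
  have [measurable]: "G \<in> borel_measurable circle" unfolding G_def
    by (rule borel_measurable_lebesgue_integral) (simp add: split_beta')
  define \<psi> where "\<psi> = (\<lambda>x \<omega>. \<phi> (Y h n x \<omega>) - G x)"
  define K where "K = (\<lambda>\<omega>. (\<bar>\<phi> 0\<bar> + e) + ?S \<omega>)"
  have K0: "0 \<le> K \<omega>" for \<omega> using S0[of \<omega>] Gb[of 0] by (simp add: K_def)
  have \<psi>K: "\<bar>\<psi> x \<omega>\<bar> \<le> K \<omega>" for x \<omega>
    using \<phi>b[of \<omega> x] Gb[of x] by (simp add: \<psi>_def K_def)
  have [measurable]: "(\<lambda>p. \<psi> (fst p) (snd p)) \<in> borel_measurable (circle \<Otimes>\<^sub>M M)"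
    unfolding \<psi>_def by measurable
  have K2: "integrable M (\<lambda>\<omega>. (K \<omega>)\<^sup>2)"
  proof -
    have "(\<lambda>\<omega>. (K \<omega>)\<^sup>2) = (\<lambda>\<omega>. (\<bar>\<phi> 0\<bar> + e)\<^sup>2 + (?S \<omega>)\<^sup>2 + 2 * (\<bar>\<phi> 0\<bar> + e) * ?S \<omega>)"
      by (simp add: K_def power2_sum)
    then show ?thesis using envelope_integrable envelope_square_integrable by auto
  qed
  have \<psi>\<psi>K: "norm (\<psi> x \<omega> * \<psi> y \<omega>) \<le> (K \<omega>)\<^sup>2" for x y \<omega>
    using mult_mono[OF \<psi>K[of x \<omega>] \<psi>K[of y \<omega>] K0] by (simp add: abs_mult power2_eq_square)
  have [measurable]: "(\<lambda>q. \<psi> (fst (fst q)) (snd q) * \<psi> (snd (fst q)) (snd q)) \<in> borel_measurable ((circle \<Otimes>\<^sub>M circle) \<Otimes>\<^sub>M M)"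
  proof -
    have 1: "(\<lambda>q. (fst (fst q), snd q)) \<in> measurable ((circle \<Otimes>\<^sub>M circle) \<Otimes>\<^sub>M M) (circle \<Otimes>\<^sub>M M)"
      and 2: "(\<lambda>q. (snd (fst q), snd q)) \<in> measurable ((circle \<Otimes>\<^sub>M circle) \<Otimes>\<^sub>M M) (circle \<Otimes>\<^sub>M M)" by measurable
    show ?thesis
      using measurable_compose[OF 1 \<open>(\<lambda>p. \<psi> (fst p) (snd p)) \<in> _\<close>] measurable_compose[OF 2 \<open>(\<lambda>p. \<psi> (fst p) (snd p)) \<in> _\<close>]
      by (intro borel_measurable_times) simp_all
  qed
  have int3: "integrable ((circle \<Otimes>\<^sub>M circle) \<Otimes>\<^sub>M M) (\<lambda>(p, \<omega>). \<psi> (fst p) \<omega> * \<psi> (snd p) \<omega>)"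
  proof (rule Bochner_Integration.integrable_bound)
    show "integrable ((circle \<Otimes>\<^sub>M circle) \<Otimes>\<^sub>M M) (\<lambda>(p, \<omega>). (K \<omega>)\<^sup>2)"
      by (rule CCM.Fubini_integrable) (use K2 in \<open>auto simp: K_def\<close>)
    show "AE q in (circle \<Otimes>\<^sub>M circle) \<Otimes>\<^sub>M M. norm (case q of (p, \<omega>) \<Rightarrow> \<psi> (fst p) \<omega> * \<psi> (snd p) \<omega>) \<le> norm (case q of (p, \<omega>) \<Rightarrow> (K \<omega>)\<^sup>2)"
      using \<psi>\<psi>K by (intro AE_I2) (auto split: prod.splits)
  qed (simp add: split_beta')
  have m\<psi>: "(\<lambda>x. \<psi> x \<omega>) \<in> borel_measurable circle" if "\<omega> \<in> space M" for \<omega>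
    using measurable_Pair1[OF \<open>(\<lambda>p. \<psi> (fst p) (snd p)) \<in> _\<close> that] by simp
  have square: "(\<integral>p. \<psi> (fst p) \<omega> * \<psi> (snd p) \<omega> \<partial>(circle \<Otimes>\<^sub>M circle)) = (spatial_mean \<phi> h n \<omega> - annealed_mean \<phi> h n)\<^sup>2"
    if \<omega>: "\<omega> \<in> space M" for \<omega>
  proof -
    note [measurable] = m\<psi>[OF \<omega>]
    have i: "integrable (circle \<Otimes>\<^sub>M circle) (\<lambda>p. \<psi> (fst p) \<omega> * \<psi> (snd p) \<omega>)"
      by (rule CC.integrable_const_bound[where B="(K \<omega>)\<^sup>2"]) (use \<psi>\<psi>K in auto)
    have "(\<integral>p. \<psi> (fst p) \<omega> * \<psi> (snd p) \<omega> \<partial>(circle \<Otimes>\<^sub>M circle)) = (\<integral>x. (\<integral>y. \<psi> x \<omega> * \<psi> y \<omega> \<partial>circle) \<partial>circle)"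
      using CC.integral_fst'[OF i] by simp
    also have "\<dots> = (\<integral>x. \<psi> x \<omega> \<partial>circle)\<^sup>2" by (simp add: power2_eq_square)
    also have "(\<integral>x. \<psi> x \<omega> \<partial>circle) = spatial_mean \<phi> h n \<omega> - annealed_mean \<phi> h n"
      unfolding \<psi>_def spatial_mean_def annealed_mean_def G_def[symmetric]
    proof (rule Bochner_Integration.integral_diff)
      show "integrable circle (\<lambda>x. \<phi> (Y h n x \<omega>))"
        by (rule circle.integrable_const_bound[where B="\<bar>\<phi> 0\<bar> + ?S \<omega>"]) (use \<phi>b mY2[OF \<omega>] in auto)
      show "integrable circle (\<lambda>x. G x)"
        by (rule circle.integrable_const_bound[where B=e]) (use Gb in auto)
    qed
    finally show ?thesis .
  qed
  have int4: "integrable M (\<lambda>\<omega>. \<integral>p. \<psi> (fst p) \<omega> * \<psi> (snd p) \<omega> \<partial>(circle \<Otimes>\<^sub>M circle))"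
    using CCM.integrable_snd[OF int3] .
  then show "integrable M (\<lambda>\<omega>. (spatial_mean \<phi> h n \<omega> - annealed_mean \<phi> h n)\<^sup>2)"
    by (rule Bochner_Integration.integrable_cong[THEN iffD1, OF refl square, rotated])
  have "(\<integral>\<omega>. (spatial_mean \<phi> h n \<omega> - annealed_mean \<phi> h n)\<^sup>2 \<partial>M)
     = (\<integral>\<omega>. (\<integral>p. \<psi> (fst p) \<omega> * \<psi> (snd p) \<omega> \<partial>(circle \<Otimes>\<^sub>M circle)) \<partial>M)"
    by (rule Bochner_Integration.integral_cong[OF refl square[symmetric]])
  also have "\<dots> = (\<integral>p. (\<integral>\<omega>. \<psi> (fst p) \<omega> * \<psi> (snd p) \<omega> \<partial>M) \<partial>(circle \<Otimes>\<^sub>M circle))"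
    by (rule CCM.Fubini_integral[OF int3])
  also have "\<dots> \<le> (\<integral>p. 2 * \<bar>covar h n (fst p) (snd p)\<bar> \<partial>(circle \<Otimes>\<^sub>M circle))"
  proof (rule integral_mono)
    show "integrable (circle \<Otimes>\<^sub>M circle) (\<lambda>p. \<integral>\<omega>. \<psi> (fst p) \<omega> * \<psi> (snd p) \<omega> \<partial>M)"
      using CCM.integrable_fst[OF int3] .
    show "integrable (circle \<Otimes>\<^sub>M circle) (\<lambda>p. 2 * \<bar>covar h n (fst p) (snd p)\<bar>)"
      by (rule CC.integrable_const_bound[where B="2 * (B\<^sup>2 * real n)"]) (use covar_bound[OF w] in auto)
    fix p :: "real \<times> real"
    obtain x y where p: "p = (x, y)" by (cases p)
    have i2: "integrable M (\<lambda>\<omega>. \<phi> (Y h n x \<omega>) * \<phi> (Y h n y \<omega>))"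
    proof -
      have [measurable]: "\<psi> x \<in> borel_measurable M" "\<psi> y \<in> borel_measurable M" unfolding \<psi>_def by measurable
      have "integrable M (\<lambda>\<omega>. \<psi> x \<omega> * \<psi> y \<omega>)"
        by (rule Bochner_Integration.integrable_bound[OF K2]) (use \<psi>\<psi>K in auto)
      then have "integrable M (\<lambda>\<omega>. \<psi> x \<omega> * \<psi> y \<omega> + (G x * \<phi> (Y h n y \<omega>) + G y * \<phi> (Y h n x \<omega>) - G x * G y))"
        using i\<phi> by auto
      then show ?thesis by (simp add: \<psi>_def algebra_simps)
    qed
    have "(\<integral>\<omega>. \<psi> x \<omega> * \<psi> y \<omega> \<partial>M) = (\<integral>\<omega>. \<phi> (Y h n x \<omega>) * \<phi> (Y h n y \<omega>) - (G x * \<phi> (Y h n y \<omega>) + G y * \<phi> (Y h n x \<omega>) - G x * G y) \<partial>M)"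
      by (intro Bochner_Integration.integral_cong) (auto simp: \<psi>_def algebra_simps)
    also have "\<dots> = (\<integral>\<omega>. \<phi> (Y h n x \<omega>) * \<phi> (Y h n y \<omega>) \<partial>M) - G x * G y"
      using i2 i\<phi> prob_space by (simp add: G_def)
    also have "\<dots> \<le> 2 * \<bar>covar h n x y\<bar>"
      using normal_pair_covariance_bound[OF mY[of x] mY[of y] Y_pair_normal[OF w] lip] unfolding G_def by linarith
    finally show "(\<integral>\<omega>. \<psi> (fst p) \<omega> * \<psi> (snd p) \<omega> \<partial>M) \<le> 2 * \<bar>covar h n (fst p) (snd p)\<bar>" by (simp add: p)
  qed
  also have "\<dots> \<le> 2 * ((12 * B * ln (1 + 2 * pi * real n))\<^sup>2 / real n)"
    using covar_L1[OF w n] by simp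
  finally show "(\<integral>\<omega>. (spatial_mean \<phi> h n \<omega> - annealed_mean \<phi> h n)\<^sup>2 \<partial>M) \<le> 2 * ((12 * B * ln (1 + 2 * pi * real n))\<^sup>2 / real n)" .
qed

end

section \<open>Almost sure concentration of spatial means\<close>

lemma AE_summable_of_summable_integral:
  fixes Z :: "nat \<Rightarrow> 'a \<Rightarrow> real"
  assumes i: "\<And>n. integrable M (Z n)" and nn: "\<And>n \<omega>. 0 \<le> Z n \<omega>" and s: "summable (\<lambda>n. \<integral>\<omega>. Z n \<omega> \<partial>M)"
  shows "AE \<omega> in M. summable (\<lambda>n. Z n \<omega>)"
proof -
  have [measurable]: "Z n \<in> borel_measurable M" for n using i by auto
  have "(\<integral>\<^sup>+\<omega>. (\<Sum>n. ennreal (Z n \<omega>)) \<partial>M) = (\<Sum>n. \<integral>\<^sup>+\<omega>. ennreal (Z n \<omega>) \<partial>M)"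
    by (rule nn_integral_suminf) simp
  also have "\<dots> = (\<Sum>n. ennreal (\<integral>\<omega>. Z n \<omega> \<partial>M))"
    using i nn by (simp add: nn_integral_eq_integral)
  also have "\<dots> = ennreal (\<Sum>n. \<integral>\<omega>. Z n \<omega> \<partial>M)"
    using s nn by (intro suminf_ennreal2) (auto intro: integral_nonneg_AE)
  finally have "(\<integral>\<^sup>+\<omega>. (\<Sum>n. ennreal (Z n \<omega>)) \<partial>M) \<noteq> \<infinity>" by simp
  then have "AE \<omega> in M. (\<Sum>n. ennreal (Z n \<omega>)) \<noteq> \<infinity>"
    by (intro nn_integral_PInf_AE) auto
  then show ?thesis
    by eventually_elim (rule summable_suminf_not_top[OF nn], simp)
qed

text \<open>
  Bounding the logarithm by a multiple of the power \<open>1 / 4\<close> leaves the summable exponent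
  \<open>1 / 2 - 2 = -3 / 2\<close>.
\<close>

lemma summable_log_squared_over_square:
  "summable (\<lambda>j::nat. 2 * ((12 * B * ln (1 + 2 * pi * real ((Suc j)\<^sup>2)))\<^sup>2 / real ((Suc j)\<^sup>2)))"
proof -
  have bound: "norm ((ln (1 + 2 * pi * (real j + 1)\<^sup>2))\<^sup>2 / (real j + 1)\<^sup>2) \<le> 192 * real (Suc j) powr (-3/2)" for j :: nat
  proof -
    define y where "y = real j + 1"
    have y: "1 \<le> y" by (simp add: y_def)
    have "1 + 2 * pi * y\<^sup>2 \<le> 1 * y\<^sup>2 + 8 * y\<^sup>2"
      using y pi_less_4 by (intro add_mono mult_right_mono) (auto simp: one_le_power)
    then have "1 + 2 * pi * y\<^sup>2 \<le> (3 * y)\<^sup>2" by (simp add: power_mult_distrib)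
    then have "ln (1 + 2 * pi * y\<^sup>2) \<le> ln ((3 * y)\<^sup>2)"
      using y by (subst ln_le_cancel_iff) (auto intro: add_pos_nonneg)
    also have "\<dots> = 2 * ln (3 * y)" by (subst ln_realpow) (use y in auto)
    also have "\<dots> \<le> 2 * ((3 * y) powr (1 / 4) / (1 / 4))" using y by (intro mult_left_mono ln_powr_bound) auto
    finally have "ln (1 + 2 * pi * y\<^sup>2) \<le> 8 * (3 * y) powr (1 / 4)" by simp
    moreover have "0 \<le> ln (1 + 2 * pi * y\<^sup>2)" by (intro ln_ge_zero) simp
    ultimately have "(ln (1 + 2 * pi * y\<^sup>2))\<^sup>2 \<le> (8 * (3 * y) powr (1 / 4))\<^sup>2" by (intro power_mono)
    also have "\<dots> = 64 * (3 * y) powr (1 / 2)"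
    proof -
      have "((3 * y) powr (1 / 4))\<^sup>2 = (3 * y) powr (1 / 4 + 1 / 4)" unfolding power2_eq_square powr_add ..
      then show ?thesis by (simp add: power_mult_distrib)
    qed
    also have "\<dots> \<le> 64 * (3 * y powr (1 / 2))"
    proof -
      have "(3 * y) powr (1 / 2) = 3 powr (1 / 2) * y powr (1 / 2)" by (rule powr_mult)
      moreover have "3 powr (1 / 2) \<le> (3::real) powr 1" by (intro powr_mono) auto
      then have "3 powr (1 / 2) * y powr (1 / 2) \<le> 3 powr 1 * y powr (1 / 2)" by (intro mult_right_mono) auto
      ultimately show ?thesis by (simp add: mult.commute)
    qed
    finally have "(ln (1 + 2 * pi * y\<^sup>2))\<^sup>2 / y\<^sup>2 \<le> 192 * y powr (1 / 2) / y\<^sup>2"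
      by (intro divide_right_mono) auto
    also have "y\<^sup>2 = y powr 2" using y by simp
    also have "192 * y powr (1 / 2) / y powr 2 = 192 * y powr (-3/2)"
      using powr_diff[of y "1/2" 2] by simp
    finally show ?thesis using y by (simp add: y_def add.commute)
  qed
  have "summable (\<lambda>j. 192 * real (Suc j) powr (-3/2))"
    by (intro summable_mult, subst summable_Suc_iff[of "\<lambda>j. real j powr (-3/2)"]) (simp add: summable_real_powr_iff)
  then have "summable (\<lambda>j::nat. (ln (1 + 2 * pi * (real j + 1)\<^sup>2))\<^sup>2 / (real j + 1)\<^sup>2)"
    by (rule summable_comparison_test') (rule bound)
  then have "summable (\<lambda>j::nat. (2 * (12 * B)\<^sup>2) * ((ln (1 + 2 * pi * (real j + 1)\<^sup>2))\<^sup>2 / (real j + 1)\<^sup>2))"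
    by (rule summable_mult)
  then show ?thesis by (simp add: power_mult_distrib add.commute mult.assoc)
qed

lemma (in prob_space) abs_mean_le_sqrt:
  fixes f :: "'a \<Rightarrow> real"
  assumes "integrable M f" "integrable M (\<lambda>x. (f x)\<^sup>2)" "(\<integral>x. (f x)\<^sup>2 \<partial>M) \<le> c"
  shows "(\<integral>x. \<bar>f x\<bar> \<partial>M) \<le> sqrt c"
proof -
  have "(\<integral>x. \<bar>f x\<bar> \<partial>M)\<^sup>2 \<le> (\<integral>x. (f x)\<^sup>2 \<partial>M)"
    using variance_positive[of "\<lambda>x. \<bar>f x\<bar>"] variance_eq[of "\<lambda>x. \<bar>f x\<bar>"] assms(1,2) by simp
  then have "(\<integral>x. \<bar>f x\<bar> \<partial>M)\<^sup>2 \<le> c" using assms(3) by simp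
  then show ?thesis by (rule real_le_rsqrt)
qed

text \<open>
  Written as the real part of a polynomial in \<open>cis x\<close> with one complex coefficient per frequency, so
  that Parseval applies.
\<close>

lemma wpoly_eq_Re:
  "wpoly a b h n x = Re (\<Sum>k=1..n. (Complex (a k) (- b k) * (h (real k / real n) / sqrt n)) * cis (real k * x))"
proof -
  have "a * Re (w * c / s) + b * Im (w * c / s) = Re (Complex a (- b) * (w / s) * c)" for a b s :: real and w c :: complex
    by (simp add: Re_divide_of_real Im_divide_of_real algebra_simps add_divide_distrib diff_divide_distrib)
  then show ?thesis unfolding wpoly_def Re_sum by (intro sum.cong refl)
qed

text \<open>
  Changing \<open>n\<close> to \<open>m\<close> changes the argument of \<open>h\<close> and the normalization; both effects are of
  relative size \<open>(n - m) / m\<close>.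
\<close>

lemma weight_difference:
  assumes w: "weight B h" and k: "1 \<le> k" "k \<le> m" and mn: "1 \<le> m" "m \<le> n"
  shows "cmod (h (real k / real n) / sqrt n - h (real k / real m) / sqrt m) \<le> 2 * B * (real n - real m) / (real m * sqrt m)"
proof -
  have m0: "0 < real m" "0 < real n" "real m \<le> real n" using mn by auto
  have B: "0 < B" using weightD(1)[OF w] .
  have s: "sqrt m \<le> sqrt n" "0 < sqrt m" "0 < sqrt n" using m0 by auto
  have e: "h (real k / real n) / sqrt n - h (real k / real m) / sqrt m
      = (h (real k / real n) - h (real k / real m)) / sqrt n + h (real k / real m) * (1 / sqrt n - 1 / sqrt m)"
    by (simp add: diff_divide_distrib right_diff_distrib)
  have in1: "real k / real n \<in> {0..1}" "real k / real m \<in> {0..1}" using k mn by (auto simp: divide_simps)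
  have t1: "cmod ((h (real k / real n) - h (real k / real m)) / sqrt n) \<le> B * (real n - real m) / (real m * sqrt m)"
  proof -
    have "\<bar>real k / real n - real k / real m\<bar> = real k * (real n - real m) / (real m * real n)"
    proof -
      have "real k / real m - real k / real n = real k * (real n - real m) / (real m * real n)"
        using m0 by (simp add: field_simps)
      moreover have "0 \<le> real k * (real n - real m) / (real m * real n)" using m0 by simp
      ultimately show ?thesis by linarith
    qed
    also have "\<dots> \<le> real m * (real n - real m) / (real m * real n)"
      using k m0 by (intro divide_right_mono mult_right_mono) auto
    also have "\<dots> = (real n - real m) / real n" using m0 by simp
    also have "\<dots> \<le> (real n - real m) / real m" using m0 by (intro divide_left_mono) auto
    finally have d: "\<bar>real k / real n - real k / real m\<bar> \<le> (real n - real m) / real m" .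
    have "cmod ((h (real k / real n) - h (real k / real m)) / sqrt n) = cmod (h (real k / real n) - h (real k / real m)) / sqrt n"
      by (simp add: norm_divide)
    also have "\<dots> \<le> (B * ((real n - real m) / real m)) / sqrt m"
      using weightD(3)[OF w in1] d B s by (intro frac_le order.trans[OF weightD(3)[OF w in1]] mult_left_mono) (auto intro: mult_nonneg_nonneg simp: m0)
    finally show ?thesis by simp
  qed
  have t2: "cmod (h (real k / real m) * (1 / sqrt n - 1 / sqrt m)) \<le> B * (real n - real m) / (real m * sqrt m)"
  proof -
    have "1 / sqrt m - 1 / sqrt n = (sqrt n - sqrt m) / (sqrt m * sqrt n)" using s by (simp add: field_simps)
    also have "\<dots> = (real n - real m) / ((sqrt n + sqrt m) * (sqrt m * sqrt n))"
    proof -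
      have "(sqrt n - sqrt m) * (sqrt n + sqrt m) = real n - real m" by (simp add: algebra_simps)
      moreover have "sqrt n + sqrt m \<noteq> 0" using s by linarith
      then have "(sqrt n - sqrt m) / (sqrt m * sqrt n)
          = ((sqrt n + sqrt m) * (sqrt n - sqrt m)) / ((sqrt n + sqrt m) * (sqrt m * sqrt n))"
        by (rule mult_divide_mult_cancel_left[symmetric])
      ultimately show ?thesis by (simp only: mult.commute[of "sqrt n - sqrt m"])
    qed
    also have "\<dots> \<le> (real n - real m) / (real m * sqrt m)"
    proof (rule divide_left_mono)
      have "real m * sqrt m = sqrt m * (sqrt m * sqrt m)" by simp
      also have "\<dots> \<le> (sqrt n + sqrt m) * (sqrt m * sqrt n)" using s by (intro mult_mono) auto
      finally show "real m * sqrt m \<le> (sqrt n + sqrt m) * (sqrt m * sqrt n)" .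
      show "0 < ((sqrt n + sqrt m) * (sqrt m * sqrt n)) * (real m * sqrt m)"
        by (intro mult_pos_pos add_pos_pos s m0)
    qed (use m0 in auto)
    finally have d: "1 / sqrt m - 1 / sqrt n \<le> (real n - real m) / (real m * sqrt m)" .
    have "0 \<le> 1 / sqrt m - 1 / sqrt n" using s by (simp add: frac_le)
    then have "cmod (complex_of_real (1 / sqrt n - 1 / sqrt m)) = 1 / sqrt m - 1 / sqrt n" unfolding norm_of_real by linarith
    then have "cmod (h (real k / real m) * (1 / sqrt n - 1 / sqrt m)) = cmod (h (real k / real m)) * (1 / sqrt m - 1 / sqrt n)"
      by (simp only: norm_mult of_real_diff of_real_divide of_real_1)
    also have "\<dots> \<le> B * ((real n - real m) / (real m * sqrt m))"
      using weightD(2)[OF w in1(2)] d B \<open>0 \<le> 1 / sqrt m - 1 / sqrt n\<close> by (intro mult_mono) auto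
    finally show ?thesis by simp
  qed
  have "B * (real n - real m) / (real m * sqrt m) + B * (real n - real m) / (real m * sqrt m)
      = 2 * B * (real n - real m) / (real m * sqrt m)" by simp
  then show ?thesis unfolding e using norm_triangle_le[OF add_mono[OF t1 t2]] by simp
qed

text \<open>
  Between consecutive squares \<open>j\<^sup>2 \<le> n \<le> (j + 1)\<^sup>2\<close> there are \<open>O(j)\<close> new frequencies, each with
  multiplier of size \<open>O(1 / j)\<close>, and the multipliers of the \<open>j\<^sup>2\<close> old ones change by \<open>O(1 / j\<^sup>2)\<close>.
  By Parseval the squared \<open>L\<^sup>2\<close> distance is \<open>O(1 / j)\<close> times the largest squared coefficient, which
  is of order \<open>sqrt j\<close> by assumption.
\<close>

lemma interpolation_L2:
  fixes a b :: "nat \<Rightarrow> real"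
  assumes w: "weight B h" and C: "0 \<le> C" "\<And>k. 1 \<le> k \<Longrightarrow> (a k)\<^sup>2 + (b k)\<^sup>2 \<le> C * sqrt (sqrt k)"
    and j: "1 \<le> j" "j\<^sup>2 \<le> n" "n \<le> (Suc j)\<^sup>2"
  shows "(\<integral>x. \<bar>wpoly a b h n x - wpoly a b h (j\<^sup>2) x\<bar> \<partial>circle) \<le> sqrt (39 * B\<^sup>2 * C * sqrt (2 * j) / j)"
    and "integrable circle (\<lambda>x. \<bar>wpoly a b h n x - wpoly a b h (j\<^sup>2) x\<bar>)"
proof -
  define m where "m = j\<^sup>2"
  define d where "d = (\<lambda>k. h (real k / real n) / sqrt n - (if k \<le> m then h (real k / real m) / sqrt m else 0))"
  define z where "z = (\<lambda>k. Complex (a k) (- b k))"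
  have m1: "1 \<le> m" using j(1) by (simp add: m_def)
  have mn: "m \<le> n" using j(2) by (simp add: m_def)
  have jr: "1 \<le> real j" using j(1) by simp
  have B: "0 < B" using weightD(1)[OF w] .
  have rm: "real m = (real j)\<^sup>2" "sqrt (real m) = real j" by (simp_all add: m_def)
  have nm: "real n - real m \<le> 3 * real j"
  proof -
    have "real n \<le> real ((Suc j)\<^sup>2)" using j(3) by (rule of_nat_mono)
    also have "\<dots> = (real j)\<^sup>2 + 2 * real j + 1" by (simp add: power2_eq_square algebra_simps)
    finally show ?thesis using jr by (simp add: rm)
  qed
  have zk: "(cmod (z k))\<^sup>2 \<le> C * sqrt (2 * j)" if "k \<in> {1..n}" for k
  proof -
    have "(cmod (z k))\<^sup>2 = (a k)\<^sup>2 + (b k)\<^sup>2" by (simp add: z_def cmod_power2)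
    also have "\<dots> \<le> C * sqrt (sqrt k)" using that by (intro C) auto
    also have "\<dots> \<le> C * sqrt (2 * j)"
    proof (intro mult_left_mono C real_sqrt_le_mono)
      have "sqrt (real k) \<le> sqrt (real ((Suc j)\<^sup>2))" using that j(3) by (intro real_sqrt_le_mono of_nat_mono) auto
      also have "\<dots> = real (Suc j)" unfolding of_nat_power by (rule real_sqrt_abs2[unfolded power2_eq_square[symmetric], THEN trans]) simp
      also have "\<dots> \<le> real (2 * j)" using j(1) by (intro of_nat_mono) auto
      finally show "sqrt (real k) \<le> real (2 * j)" .
    qed
    finally show ?thesis .
  qed
  have diff: "wpoly a b h n x - wpoly a b h m x = Re (\<Sum>k\<in>{1..n}. (z k * d k) * cis (real k * x))" for x
  proof -
    have "(\<Sum>k=1..m. z k * (h (real k / real m) / sqrt m) * cis (real k * x))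
       = (\<Sum>k=1..n. z k * (if k \<le> m then h (real k / real m) / sqrt m else 0) * cis (real k * x))"
      using mn by (intro sum.mono_neutral_cong_left) auto
    then have e2: "wpoly a b h m x = Re (\<Sum>k=1..n. z k * (if k \<le> m then h (real k / real m) / sqrt m else 0) * cis (real k * x))"
      unfolding wpoly_eq_Re z_def by simp
    have e1: "wpoly a b h n x = Re (\<Sum>k=1..n. z k * (h (real k / real n) / sqrt n) * cis (real k * x))"
      unfolding wpoly_eq_Re z_def ..
    have e3: "(\<Sum>k=1..n. z k * (h (real k / real n) / sqrt n) * cis (real k * x))
        - (\<Sum>k=1..n. z k * (if k \<le> m then h (real k / real m) / sqrt m else 0) * cis (real k * x))
        = (\<Sum>k\<in>{1..n}. (z k * d k) * cis (real k * x))"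
      unfolding sum_subtractf[symmetric] d_def by (intro sum.cong refl) (simp only: left_diff_distrib right_diff_distrib)
    show ?thesis unfolding e1 e2 e3[symmetric] by (rule minus_complex.sel(1)[symmetric])
  qed
  have pars: "(\<integral>x. (cmod (\<Sum>k\<in>{1..n}. (z k * d k) * cis (real k * x)))\<^sup>2 \<partial>circle) = (\<Sum>k\<in>{1..n}. (cmod (z k * d k))\<^sup>2)"
    by (rule circle_parseval) simp
  let ?P = "\<lambda>x. \<Sum>k\<in>{1..n}. (z k * d k) * cis (real k * x)"
  have cP: "continuous_on UNIV ?P" unfolding cis_conv_exp by (intro continuous_intros)
  have bP: "cmod (?P x) \<le> (\<Sum>k\<in>{1..n}. cmod (z k * d k))" for x
    by (rule sum_norm_le) (simp only: norm_mult norm_cis mult_1_right order_refl)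
  define T where "T = (\<Sum>k\<in>{1..n}. cmod (z k * d k))"
  have iP2: "integrable circle (\<lambda>x. (cmod (?P x))\<^sup>2)"
  proof (rule integrable_circle_continuous)
    show "continuous_on UNIV (\<lambda>x. (cmod (?P x))\<^sup>2)" by (intro continuous_on_power continuous_on_norm cP)
    show "\<bar>(cmod (?P x))\<^sup>2\<bar> \<le> T\<^sup>2" for x
      unfolding abs_power2 T_def by (intro power_mono bP norm_ge_zero)
  qed
  have iR: "integrable circle (\<lambda>x. Re (?P x))"
  proof (rule integrable_circle_continuous)
    show "continuous_on UNIV (\<lambda>x. Re (?P x))" by (intro continuous_on_Re cP)
    show "\<bar>Re (?P x)\<bar> \<le> T" for x unfolding T_def by (rule order.trans[OF abs_Re_le_cmod bP])
  qed
  have Rb: "(Re (?P x))\<^sup>2 \<le> (cmod (?P x))\<^sup>2" for x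
    unfolding cmod_power2 by (rule le_add_same_cancel1[THEN iffD2]) (rule zero_le_power2)
  have iR2: "integrable circle (\<lambda>x. (Re (?P x))\<^sup>2)"
  proof (rule integrable_circle_continuous)
    show "continuous_on UNIV (\<lambda>x. (Re (?P x))\<^sup>2)" by (intro continuous_on_power continuous_on_Re cP)
    show "\<bar>(Re (?P x))\<^sup>2\<bar> \<le> T\<^sup>2" for x
      unfolding abs_power2 T_def by (rule order.trans[OF Rb]) (intro power_mono bP norm_ge_zero)
  qed
  have "(\<integral>x. (Re (?P x))\<^sup>2 \<partial>circle) \<le> (\<integral>x. (cmod (?P x))\<^sup>2 \<partial>circle)"
    by (rule integral_mono[OF iR2 iP2 Rb])
  also have "\<dots> = (\<Sum>k\<in>{1..m}. (cmod (z k))\<^sup>2 * (cmod (d k))\<^sup>2) + (\<Sum>k\<in>{m<..n}. (cmod (z k))\<^sup>2 * (cmod (d k))\<^sup>2)"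
  proof -
    have "{1..n} = {1..m} \<union> {m<..n}" using mn m1 by auto
    moreover have "(\<Sum>k\<in>{1..m} \<union> {m<..n}. (cmod (z k))\<^sup>2 * (cmod (d k))\<^sup>2)
       = (\<Sum>k\<in>{1..m}. (cmod (z k))\<^sup>2 * (cmod (d k))\<^sup>2) + (\<Sum>k\<in>{m<..n}. (cmod (z k))\<^sup>2 * (cmod (d k))\<^sup>2)"
      by (rule sum.union_disjoint) auto
    ultimately show ?thesis unfolding pars by (simp add: norm_mult power_mult_distrib)
  qed
  \<comment> \<open>There are at most \<open>2 j + 1 \<le> 3 j\<close> new frequencies; \<open>36 = (2 * 3)\<^sup>2\<close> comes from the change of the old multipliers.\<close>
  also have "\<dots> \<le> 36 * B\<^sup>2 * C * sqrt (2 * j) / j + 3 * B\<^sup>2 * C * sqrt (2 * j) / j"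
  proof (rule add_mono)
    have dk: "(cmod (d k))\<^sup>2 \<le> 36 * B\<^sup>2 / (real j)^4" if k: "k \<in> {1..m}" for k
    proof -
      have "cmod (d k) \<le> 2 * B * (real n - real m) / (real m * sqrt m)"
        using weight_difference[OF w, of k m n] k m1 mn by (simp add: d_def)
      also have "\<dots> \<le> 2 * B * (3 * real j) / (real m * sqrt m)"
        using nm B by (intro divide_right_mono mult_left_mono) auto
      also have "\<dots> = 6 * B / (real j)\<^sup>2" using jr unfolding rm by (simp add: power2_eq_square)
      finally have "(cmod (d k))\<^sup>2 \<le> (6 * B / (real j)\<^sup>2)\<^sup>2" by (intro power_mono) auto
      also have "\<dots> = 36 * B\<^sup>2 / (real j)^4" by (simp add: power_divide power_mult_distrib)
      finally show ?thesis .
    qed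
    have "(\<Sum>k\<in>{1..m}. (cmod (z k))\<^sup>2 * (cmod (d k))\<^sup>2) \<le> (\<Sum>k\<in>{1..m}. (C * sqrt (2 * j)) * (36 * B\<^sup>2 / (real j)^4))"
      using zk dk mn C by (intro sum_mono mult_mono) auto
    also have "\<dots> = (36 * B\<^sup>2 * C * sqrt (2 * j)) * (real m / (real j)^4)" by simp
    also have "\<dots> \<le> (36 * B\<^sup>2 * C * sqrt (2 * j)) * (1 / j)"
    proof (rule mult_left_mono)
      have "real m / (real j)^4 = 1 / (real j)\<^sup>2" using jr unfolding rm by (simp add: power2_eq_square power4_eq_xxxx)
      also have "\<dots> \<le> 1 / j" using jr by (intro divide_left_mono) (auto simp: power2_eq_square)
      finally show "real m / (real j)^4 \<le> 1 / j" .
    qed (use C in auto)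
    finally show "(\<Sum>k\<in>{1..m}. (cmod (z k))\<^sup>2 * (cmod (d k))\<^sup>2) \<le> 36 * B\<^sup>2 * C * sqrt (2 * j) / j" by simp
    have dk2: "(cmod (d k))\<^sup>2 \<le> B\<^sup>2 / (real j)\<^sup>2" if k: "k \<in> {m<..n}" for k
    proof -
      have nj: "real j \<le> sqrt n" using mn by (intro real_le_rsqrt) (simp add: rm[symmetric])
      have "cmod (d k) = cmod (h (real k / real n)) / sqrt n" using k by (simp add: d_def norm_divide)
      also have "\<dots> \<le> B / real j" using k nj jr B by (intro frac_le weightD(2)[OF w]) (auto simp: divide_simps)
      finally have "(cmod (d k))\<^sup>2 \<le> (B / real j)\<^sup>2" by (intro power_mono) auto
      then show ?thesis by (simp add: power_divide)
    qed
    have "(\<Sum>k\<in>{m<..n}. (cmod (z k))\<^sup>2 * (cmod (d k))\<^sup>2) \<le> (\<Sum>k\<in>{m<..n}. (C * sqrt (2 * j)) * (B\<^sup>2 / (real j)\<^sup>2))"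
      using zk dk2 m1 C by (intro sum_mono mult_mono) auto
    also have "\<dots> = (real n - real m) * ((C * sqrt (2 * j)) * (B\<^sup>2 / (real j)\<^sup>2))" using mn by (simp add: of_nat_diff)
    also have "\<dots> \<le> (3 * real j) * ((C * sqrt (2 * j)) * (B\<^sup>2 / (real j)\<^sup>2))"
      using nm C by (intro mult_right_mono) auto
    also have "\<dots> = 3 * B\<^sup>2 * C * sqrt (2 * j) / j" using jr by (simp add: power2_eq_square)
    finally show "(\<Sum>k\<in>{m<..n}. (cmod (z k))\<^sup>2 * (cmod (d k))\<^sup>2) \<le> 3 * B\<^sup>2 * C * sqrt (2 * j) / j" .
  qed
  also have "\<dots> = 39 * B\<^sup>2 * C * sqrt (2 * j) / j" by (simp add: add_divide_distrib[symmetric] algebra_simps)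
  finally have "(\<integral>x. (Re (?P x))\<^sup>2 \<partial>circle) \<le> 39 * B\<^sup>2 * C * sqrt (2 * j) / j" .
  then have "(\<integral>x. \<bar>Re (?P x)\<bar> \<partial>circle) \<le> sqrt (39 * B\<^sup>2 * C * sqrt (2 * j) / j)"
    by (rule circle.abs_mean_le_sqrt[OF iR iR2])
  then show "(\<integral>x. \<bar>wpoly a b h n x - wpoly a b h (j\<^sup>2) x\<bar> \<partial>circle) \<le> sqrt (39 * B\<^sup>2 * C * sqrt (2 * j) / j)"
    unfolding m_def[symmetric] diff .
  show "integrable circle (\<lambda>x. \<bar>wpoly a b h n x - wpoly a b h (j\<^sup>2) x\<bar>)"
    unfolding m_def[symmetric] diff using iR by (rule integrable_abs)
qed

lemma filterlim_floor_sqrt: "filterlim floor_sqrt at_top at_top"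
  unfolding filterlim_at_top
proof
  fix Z :: nat
  show "\<forall>\<^sub>F n in at_top. Z \<le> floor_sqrt n"
    using eventually_ge_at_top[of "Z\<^sup>2"]
    by eventually_elim (metis floor_sqrt_inverse_power2 mono_floor_sqrt')
qed

lemma filterlim_floor_sqrt_square: "filterlim (\<lambda>n. (floor_sqrt n)\<^sup>2) at_top at_top"
proof (rule filterlim_at_top_mono[OF filterlim_floor_sqrt])
  show "\<forall>\<^sub>F n in sequentially. floor_sqrt n \<le> (floor_sqrt n)\<^sup>2"
    by (intro always_eventually allI) (simp add: power2_eq_square le_square)
qed

lemma continuous_wpoly: "continuous_on S (wpoly a b h n)"
proof -
  have "wpoly a b h n = (\<lambda>x. Re (\<Sum>k=1..n. (Complex (a k) (- b k) * (h (real k / real n) / sqrt n)) * cis (real k * x)))"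
    by (simp add: wpoly_eq_Re fun_eq_iff)
  then show ?thesis unfolding cis_conv_exp by (simp only:) (intro continuous_intros)
qed

lemma wpoly_bounded: "\<bar>wpoly a b h n x\<bar> \<le> (\<Sum>k=1..n. cmod (Complex (a k) (- b k) * (h (real k / real n) / sqrt n)))"
proof -
  have "\<bar>wpoly a b h n x\<bar> \<le> cmod (\<Sum>k=1..n. (Complex (a k) (- b k) * (h (real k / real n) / sqrt n)) * cis (real k * x))"
    unfolding wpoly_eq_Re by (rule abs_Re_le_cmod)
  also have "\<dots> \<le> (\<Sum>k=1..n. cmod (Complex (a k) (- b k) * (h (real k / real n) / sqrt n)))"
    by (rule sum_norm_le) (simp only: norm_mult norm_cis mult_1_right order_refl)
  finally show ?thesis .
qed

context gaussian_coefficients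
begin

text \<open>
  The sixteenth moments of the coefficients are constant, so the sixteenth powers divided by \<open>k\<^sup>2\<close>
  are almost surely summable, in particular bounded. Taking eighth roots, the squares grow at most
  like \<open>k powr (1 / 4)\<close>.
\<close>

lemma coefficient_growth:
  "AE \<omega> in M. \<exists>C\<ge>0. \<forall>k\<ge>1. (a k \<omega>)\<^sup>2 + (b k \<omega>)\<^sup>2 \<le> C * sqrt (sqrt k)"
proof -
  define c where "c = (\<integral>z. std_normal_density z * z ^ 16 \<partial>lborel)"
  define Z where "Z = (\<lambda>j \<omega>. ((a (Suc j) \<omega>)^16 + (b (Suc j) \<omega>)^16) / (real (Suc j))\<^sup>2)"
  note na = coefficient_normal(1) and nb = coefficient_normal(2)
  have i: "integrable M (Z j)" for j
    unfolding Z_def using centered_normal_moments(1)[OF na, of "Suc j" 16] centered_normal_moments(1)[OF nb, of "Suc j" 16] by auto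
  have EZ: "(\<integral>\<omega>. Z j \<omega> \<partial>M) = 2 * c * (1 / (real (Suc j))\<^sup>2)" for j
    unfolding Z_def using centered_normal_moments[OF na, of "Suc j" 16] centered_normal_moments[OF nb, of "Suc j" 16]
    by (simp add: c_def)
  have "AE \<omega> in M. summable (\<lambda>j. Z j \<omega>)"
  proof (rule AE_summable_of_summable_integral[OF i])
    show "0 \<le> Z j \<omega>" for j \<omega> by (simp add: Z_def)
    have "summable (\<lambda>j. inverse (real (Suc j) ^ 2))" by (rule inverse_squares_sums[THEN sums_summable, THEN summable_cong[THEN iffD1, rotated]]) (auto simp: field_simps)
    then show "summable (\<lambda>j. \<integral>\<omega>. Z j \<omega> \<partial>M)" unfolding EZ by (intro summable_mult) (simp add: inverse_eq_divide)
  qed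
  then show ?thesis
  proof eventually_elim
    case (elim \<omega>)
    define S where "S = (\<Sum>j. Z j \<omega>)"
    have S0: "0 \<le> S" unfolding S_def by (rule suminf_nonneg[OF elim]) (simp add: Z_def)
    have ZS: "Z j \<omega> \<le> S" for j
    proof -
      have "sum (\<lambda>j. Z j \<omega>) {j} \<le> S" unfolding S_def by (rule sum_le_suminf[OF elim]) (auto simp: Z_def)
      then show ?thesis by simp
    qed
    have root: "y\<^sup>2 \<le> root 8 S * sqrt (sqrt k)" if "y^16 \<le> S * (real k)\<^sup>2" for y k
    proof -
      have "root 8 ((y\<^sup>2)^8) \<le> root 8 (S * (real k)\<^sup>2)" using that by (intro real_root_le_mono) auto
      moreover have "root 8 ((y\<^sup>2)^8) = y\<^sup>2" by (rule real_root_power_cancel) auto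
      moreover have "root 8 ((real k)\<^sup>2) = sqrt (sqrt k)"
      proof -
        have "root 8 ((real k)\<^sup>2) = root (2 * 4) ((real k)\<^sup>2)" by simp
        also have "\<dots> = sqrt (root (2 * 2) ((real k)\<^sup>2))" unfolding sqrt_def by (subst real_root_mult_exp) simp
        also have "root (2 * 2) ((real k)\<^sup>2) = sqrt (sqrt ((real k)\<^sup>2))" unfolding sqrt_def by (rule real_root_mult_exp)
        finally show ?thesis by simp
      qed
      ultimately show ?thesis by (simp add: real_root_mult)
    qed
    have "(a k \<omega>)\<^sup>2 + (b k \<omega>)\<^sup>2 \<le> (2 * root 8 S) * sqrt (sqrt k)" if k: "1 \<le> k" for k
    proof -
      obtain j where j: "k = Suc j" using k by (cases k) auto
      have "((a k \<omega>)^16 + (b k \<omega>)^16) \<le> S * (real k)\<^sup>2"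
        using ZS[of j] unfolding Z_def j by (simp add: divide_le_eq)
      moreover have "0 \<le> (a k \<omega>)^16" "0 \<le> (b k \<omega>)^16" by simp_all
      ultimately have "(a k \<omega>)^16 \<le> S * (real k)\<^sup>2" "(b k \<omega>)^16 \<le> S * (real k)\<^sup>2" by linarith+
      then show ?thesis using root[of "a k \<omega>" k] root[of "b k \<omega>" k] by simp
    qed
    then show ?case using S0 by (intro exI[of _ "2 * root 8 S"]) auto
  qed
qed

lemma concentration_along_squares:
  assumes w: "weight B h" and lip: "\<And>x y. \<bar>\<phi> x - \<phi> y\<bar> \<le> \<bar>x - y\<bar>"
  shows "AE \<omega> in M. (\<lambda>j. spatial_mean \<phi> h ((Suc j)\<^sup>2) \<omega> - annealed_mean \<phi> h ((Suc j)\<^sup>2)) \<longlonglongrightarrow> 0"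
proof -
  let ?Z = "\<lambda>j \<omega>. (spatial_mean \<phi> h ((Suc j)\<^sup>2) \<omega> - annealed_mean \<phi> h ((Suc j)\<^sup>2))\<^sup>2"
  have n: "1 \<le> (Suc j)\<^sup>2" for j by simp
  have "AE \<omega> in M. summable (\<lambda>j. ?Z j \<omega>)"
  proof (rule AE_summable_of_summable_integral)
    show "integrable M (?Z j)" for j by (rule spatial_mean_variance(1)[OF w n lip])
    show "summable (\<lambda>j. \<integral>\<omega>. ?Z j \<omega> \<partial>M)"
      by (rule summable_comparison_test'[OF summable_log_squared_over_square[of B], of 0])
         (use spatial_mean_variance(2)[OF w n lip] in \<open>simp add: integral_nonneg_AE del: of_nat_power of_nat_Suc power_Suc\<close>)
  qed simp
  then show ?thesis
  proof eventually_elim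
    case (elim \<omega>)
    then have "(\<lambda>j. ?Z j \<omega>) \<longlonglongrightarrow> 0" by (rule summable_LIMSEQ_zero)
    then have "(\<lambda>j. sqrt (?Z j \<omega>)) \<longlonglongrightarrow> sqrt 0" by (rule tendsto_real_sqrt)
    then show ?case by (simp add: tendsto_rabs_zero_iff)
  qed
qed

text \<open>
  The variance bound is summable along the squares only, which gives almost sure convergence there.
  The spatial means at \<open>n\<close> and at the largest square below \<open>n\<close> differ by at most the \<open>L\<^sup>1\<close> distance
  of the polynomials because \<open>\<phi>\<close> is Lipschitz. The annealed mean is left at the square: when it
  converges, the same limit results.
\<close>

lemma spatial_mean_concentration:
  assumes w: "weight B h" and lip: "\<And>x y. \<bar>\<phi> x - \<phi> y\<bar> \<le> \<bar>x - y\<bar>"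
  shows "AE \<omega> in M. (\<lambda>n. spatial_mean \<phi> h n \<omega> - annealed_mean \<phi> h ((floor_sqrt n)\<^sup>2)) \<longlonglongrightarrow> 0"
  using coefficient_growth concentration_along_squares[OF w lip]
proof eventually_elim
  case (elim \<omega>)
  obtain C where C: "0 \<le> C" "\<And>k. 1 \<le> k \<Longrightarrow> (a k \<omega>)\<^sup>2 + (b k \<omega>)\<^sup>2 \<le> C * sqrt (sqrt k)" using elim(1) by blast
  have cont: "continuous_on UNIV \<phi>"
    by (rule lipschitz_on_continuous_on[where L=1]) (auto intro!: lipschitz_onI simp: dist_real_def lip)
  have i: "integrable circle (\<lambda>x. \<phi> (Y h n x \<omega>))" for n
  proof (rule integrable_circle_continuous)
    show "continuous_on UNIV (\<lambda>x. \<phi> (Y h n x \<omega>))"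
      using continuous_on_compose2[OF cont continuous_wpoly] by simp
    show "\<bar>\<phi> (Y h n x \<omega>)\<bar> \<le> \<bar>\<phi> 0\<bar> + (\<Sum>k=1..n. cmod (Complex (a k \<omega>) (- b k \<omega>) * (h (real k / real n) / sqrt n)))" for x
      using lip[of "Y h n x \<omega>" 0] wpoly_bounded[of "\<lambda>k. a k \<omega>" "\<lambda>k. b k \<omega>" h n x] by linarith
  qed
  have step: "\<bar>spatial_mean \<phi> h n \<omega> - spatial_mean \<phi> h ((floor_sqrt n)\<^sup>2) \<omega>\<bar> \<le> sqrt (39 * B\<^sup>2 * C * sqrt (2 * floor_sqrt n) / floor_sqrt n)"
    if n: "1 \<le> n" for n
  proof -
    define j where "j = floor_sqrt n"
    have j: "1 \<le> j" "j\<^sup>2 \<le> n" "n \<le> (Suc j)\<^sup>2"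
      using n Suc_floor_sqrt_power2_gt[of n] by (auto simp: j_def Suc_le_eq)
    note I = interpolation_L2[OF w C j]
    have "\<bar>spatial_mean \<phi> h n \<omega> - spatial_mean \<phi> h (j\<^sup>2) \<omega>\<bar> = \<bar>\<integral>x. \<phi> (Y h n x \<omega>) - \<phi> (Y h (j\<^sup>2) x \<omega>) \<partial>circle\<bar>"
      unfolding spatial_mean_def using i by simp
    also have "\<dots> \<le> (\<integral>x. \<bar>Y h n x \<omega> - Y h (j\<^sup>2) x \<omega>\<bar> \<partial>circle)"
      by (rule order.trans[OF integral_abs_bound integral_mono]) (use i I(2) lip in auto)
    also have "\<dots> \<le> sqrt (39 * B\<^sup>2 * C * sqrt (2 * j) / j)" by (rule I(1))
    finally show ?thesis by (simp add: j_def)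
  qed
  have l1: "(\<lambda>n. sqrt (39 * B\<^sup>2 * C * sqrt (2 * floor_sqrt n) / floor_sqrt n)) \<longlonglongrightarrow> 0"
  proof -
    have "(\<lambda>j::nat. sqrt (2 * real j) / real j) \<longlonglongrightarrow> 0" by real_asymp
    then have "(\<lambda>j::nat. sqrt ((39 * B\<^sup>2 * C) * (sqrt (2 * real j) / real j))) \<longlonglongrightarrow> sqrt ((39 * B\<^sup>2 * C) * 0)"
      by (intro tendsto_intros)
    then have "(\<lambda>j::nat. sqrt (39 * B\<^sup>2 * C * sqrt (2 * real j) / real j)) \<longlonglongrightarrow> 0" by simp
    from filterlim_compose[OF this filterlim_floor_sqrt] show ?thesis by simp
  qed
  have l2: "(\<lambda>n. spatial_mean \<phi> h ((floor_sqrt n)\<^sup>2) \<omega> - annealed_mean \<phi> h ((floor_sqrt n)\<^sup>2)) \<longlonglongrightarrow> 0"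
  proof -
    have "(\<lambda>j. spatial_mean \<phi> h (j\<^sup>2) \<omega> - annealed_mean \<phi> h (j\<^sup>2)) \<longlonglongrightarrow> 0"
      by (rule LIMSEQ_imp_Suc) (rule elim(2))
    from filterlim_compose[OF this filterlim_floor_sqrt] show ?thesis by simp
  qed
  have "(\<lambda>n. spatial_mean \<phi> h n \<omega> - spatial_mean \<phi> h ((floor_sqrt n)\<^sup>2) \<omega>) \<longlonglongrightarrow> 0"
    by (rule Lim_null_comparison[OF _ l1])
       (use step in \<open>auto simp: eventually_sequentially intro!: exI[of _ 1]\<close>)
  from tendsto_add[OF this l2] show ?case by simp
qed

end

section \<open>The localized process as a polynomial with multiplier\<close>

text \<open>
  Repeated times in a list are collected, because the Gaussian property of a process is about sums
  over finite sets of distinct indices.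
\<close>

definition node_coefficient :: "(real \<times> real) list \<Rightarrow> real \<Rightarrow> real" where
  "node_coefficient xs t = (\<Sum>(l, s)\<leftarrow>xs. if s = t then l else 0)"

lemma sum_list_by_nodes:
  fixes F :: "real \<Rightarrow> 'a :: real_algebra_1"
  shows "(\<Sum>(l, t)\<leftarrow>xs. of_real l * F t) = (\<Sum>t\<in>snd ` set xs. of_real (node_coefficient xs t) * F t)"
proof -
  have "(\<Sum>(l, t)\<leftarrow>xs. of_real l * F t) = (\<Sum>t\<in>T. of_real (node_coefficient xs t) * F t)"
    if "finite T" "snd ` set xs \<subseteq> T" for T
    using that
  proof (induction xs)
    case Nil
    then show ?case by (simp add: node_coefficient_def)
  next
    case (Cons x xs)
    obtain l s where x: "x = (l, s)" by (cases x)
    have s: "s \<in> T" using Cons.prems by (simp add: x)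
    have "(\<Sum>t\<in>T. of_real (node_coefficient (x # xs) t) * F t)
      = (\<Sum>t\<in>T. (if s = t then of_real l * F t else 0) + of_real (node_coefficient xs t) * F t)"
      by (intro sum.cong refl) (simp add: node_coefficient_def x distrib_right)
    also have "\<dots> = of_real l * F s + (\<Sum>t\<in>T. of_real (node_coefficient xs t) * F t)"
      using Cons.prems(1) s by (simp add: sum.distrib)
    finally show ?case using Cons by (simp add: x)
  qed
  then show ?thesis by simp
qed

lemma point_evaluations_by_nodes:
  "point_evaluations xs g = (\<Sum>t\<in>snd ` set xs. node_coefficient xs t * g t)"
  using sum_list_by_nodes[of g xs] by (simp add: point_evaluations_def)

text \<open>
  The multiplier that turns the random polynomial at \<open>X\<close> into the given combination of values of the
  localized process.
\<close>

definition evaluation_weight :: "(real \<times> real) list \<Rightarrow> real \<Rightarrow> complex" where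
  "evaluation_weight xs s = (\<Sum>(l, t)\<leftarrow>xs. of_real l * cis (s * t))"

lemma evaluation_weight_by_nodes:
  "evaluation_weight xs s = (\<Sum>t\<in>snd ` set xs. of_real (node_coefficient xs t) * cis (s * t))"
  using sum_list_by_nodes[of "\<lambda>t. cis (s * t)" xs] by (simp add: evaluation_weight_def)

lemma cmod_cis_diff_le: "cmod (cis x - cis y) \<le> \<bar>x - y\<bar>"
proof -
  have "cis x - cis y = cis x * (1 - cis (y - x))" by (simp add: right_diff_distrib cis_mult)
  then have "cmod (cis x - cis y) = 2 * \<bar>sin ((y - x) / 2)\<bar>" by (simp add: norm_mult cmod_1_minus_cis)
  also have "\<dots> \<le> 2 * \<bar>(y - x) / 2\<bar>" using abs_sin_x_le_abs_x[of "(y - x) / 2"] by simp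
  finally show ?thesis by simp
qed

lemma weight_evaluation_weight: "\<exists>B. weight B (evaluation_weight xs)"
proof -
  define B where "B = 1 + (\<Sum>(l, t)\<leftarrow>xs. \<bar>l\<bar> * (1 + \<bar>t\<bar>))"
  have p: "cmod (evaluation_weight xs s) \<le> (\<Sum>(l, t)\<leftarrow>xs. \<bar>l\<bar> * (1 + \<bar>t\<bar>))"
    "cmod (evaluation_weight xs s - evaluation_weight xs r) \<le> (\<Sum>(l, t)\<leftarrow>xs. \<bar>l\<bar> * (1 + \<bar>t\<bar>)) * \<bar>s - r\<bar>"
    "0 \<le> (\<Sum>(l, t)\<leftarrow>xs. \<bar>l\<bar> * (1 + \<bar>t\<bar>))" for s r
  proof (induction xs)
    case (Cons x xs)
    obtain l t where x: "x = (l, t)" by (cases x)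
    let ?S = "\<Sum>(l, t)\<leftarrow>xs. \<bar>l\<bar> * (1 + \<bar>t\<bar>)"
    {
      case 1
      have "cmod (of_real l * cis (s * t) + evaluation_weight xs s) \<le> \<bar>l\<bar> + ?S"
        using Cons.IH(1) by (intro norm_triangle_le add_mono) (auto simp: norm_mult)
      also have "\<dots> \<le> \<bar>l\<bar> * (1 + \<bar>t\<bar>) + ?S" by (simp add: distrib_left)
      finally show ?case by (simp add: x evaluation_weight_def)
    next
      case 2
      have "cmod (of_real l * (cis (s * t) - cis (r * t))) \<le> \<bar>l\<bar> * (\<bar>t\<bar> * \<bar>s - r\<bar>)"
      proof -
        have "cmod (cis (s * t) - cis (r * t)) \<le> \<bar>s * t - r * t\<bar>" by (rule cmod_cis_diff_le)
        also have "\<dots> = \<bar>t\<bar> * \<bar>s - r\<bar>" by (simp add: left_diff_distrib[symmetric] abs_mult)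
        finally show ?thesis unfolding norm_mult norm_of_real by (intro mult_left_mono) auto
      qed
      also have "\<dots> \<le> \<bar>l\<bar> * ((1 + \<bar>t\<bar>) * \<bar>s - r\<bar>)" by (intro mult_left_mono mult_right_mono) auto
      finally have 1: "cmod (of_real l * (cis (s * t) - cis (r * t))) \<le> \<bar>l\<bar> * (1 + \<bar>t\<bar>) * \<bar>s - r\<bar>" by (simp add: mult.assoc)
      have "evaluation_weight (x # xs) s - evaluation_weight (x # xs) r
        = of_real l * (cis (s * t) - cis (r * t)) + (evaluation_weight xs s - evaluation_weight xs r)"
        by (simp add: x evaluation_weight_def algebra_simps)
      also have "cmod \<dots> \<le> \<bar>l\<bar> * (1 + \<bar>t\<bar>) * \<bar>s - r\<bar> + ?S * \<bar>s - r\<bar>"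
        by (rule norm_triangle_le[OF add_mono[OF 1 Cons.IH(2)]])
      finally show ?case by (simp add: x distrib_right)
    next
      case 3
      then show ?case using Cons.IH(3) by (simp add: x)
    }
  qed (auto simp: evaluation_weight_def)
  have "weight B (evaluation_weight xs)"
    unfolding weight_def
  proof (intro conjI ballI)
    show "0 < B" using p(3) by (simp add: B_def)
    show "cmod (evaluation_weight xs s) \<le> B" for s using p(1)[of s] by (simp add: B_def)
    show "cmod (evaluation_weight xs s - evaluation_weight xs r) \<le> B * \<bar>s - r\<bar>" for s r
      using p(2)[of s r] by (rule order.trans) (auto simp: B_def intro!: mult_right_mono)
  qed
  then show ?thesis by blast
qed

text \<open>
  A Riemann sum for the integral of \<open>cos (s \<theta>)\<close> over the unit interval, evaluated in closed form by
  multiplying with \<open>2 sin (\<theta> / (2 n))\<close>. This is where the sinc covariance of the limit comes from.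
\<close>

lemma cos_riemann_sum:
  "(\<lambda>n. (\<Sum>k=1..n. cos (real k / real n * \<theta>)) / real n) \<longlonglongrightarrow> sinc \<theta>"
proof (cases "\<theta> = 0")
  case True
  have "\<forall>\<^sub>F n in sequentially. (\<Sum>k=1..n. cos (real k / real n * \<theta>)) / real n = 1"
    using eventually_ge_at_top[of 1] by eventually_elim (simp add: True)
  then show ?thesis using True by (simp add: tendsto_eventually)
next
  case False
  have tel: "2 * sin (\<alpha> / 2) * (\<Sum>k=1..n. cos (real k * \<alpha>)) = sin (real n * \<alpha> + \<alpha> / 2) - sin (\<alpha> / 2)" for \<alpha> n
  proof (induction n)
    case (Suc n)
    have "2 * sin (\<alpha> / 2) * cos (real (Suc n) * \<alpha>) = sin (real (Suc n) * \<alpha> + \<alpha> / 2) - sin (real n * \<alpha> + \<alpha> / 2)"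
    proof -
      have "real n * \<alpha> + \<alpha> / 2 = real (Suc n) * \<alpha> - \<alpha> / 2" by (simp add: algebra_simps)
      then show ?thesis by (simp only: sin_add sin_diff) simp
    qed
    then show ?case using Suc by (simp add: distrib_left)
  qed simp
  have to0: "(\<lambda>n. \<theta> / (2 * real n)) \<longlonglongrightarrow> 0"
    by (intro real_tendsto_divide_at_top[OF tendsto_const] filterlim_tendsto_pos_mult_at_top[OF tendsto_const] filterlim_real_sequentially) auto
  have q: "(\<lambda>n. sinc (\<theta> / (2 * real n))) \<longlonglongrightarrow> sinc 0"
    by (rule isCont_tendsto_compose[OF isCont_sinc to0])
  then have nz: "\<forall>\<^sub>F n in sequentially. sinc (\<theta> / (2 * real n)) > 0"
    by (rule order_tendstoD(1)) simp
  have num: "(\<lambda>n. sin (\<theta> + \<theta> / (2 * real n)) - sin (\<theta> / (2 * real n))) \<longlonglongrightarrow> sin (\<theta> + 0) - sin 0"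
    by (intro tendsto_intros to0)
  have "(\<lambda>n. (sin (\<theta> + \<theta> / (2 * real n)) - sin (\<theta> / (2 * real n))) / (\<theta> * sinc (\<theta> / (2 * real n))))
     \<longlonglongrightarrow> (sin (\<theta> + 0) - sin 0) / (\<theta> * sinc 0)"
    by (rule tendsto_divide[OF num tendsto_mult[OF tendsto_const q]]) (use False in simp)
  moreover have "\<forall>\<^sub>F n in sequentially. (sin (\<theta> + \<theta> / (2 * real n)) - sin (\<theta> / (2 * real n))) / (\<theta> * sinc (\<theta> / (2 * real n)))
     = (\<Sum>k=1..n. cos (real k / real n * \<theta>)) / real n"
    using nz eventually_gt_at_top[of "0::nat"]
  proof eventually_elim
    case (elim n)
    have s1: "sinc (\<theta> / (2 * real n)) = sin (\<theta> / (2 * real n)) / (\<theta> / (2 * real n))"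
      using False elim(2) by simp
    have s0: "sin (\<theta> / (2 * real n)) \<noteq> 0" using elim(1) unfolding s1 by auto
    have e1: "2 * sin (\<theta> / (2 * real n)) * (\<Sum>k=1..n. cos (real k / real n * \<theta>)) = sin (\<theta> + \<theta> / (2 * real n)) - sin (\<theta> / (2 * real n))"
      using tel[of "\<theta> / real n" n] elim(2) by (simp add: mult.commute)
    have e2: "\<theta> * sinc (\<theta> / (2 * real n)) = 2 * sin (\<theta> / (2 * real n)) * real n"
      unfolding s1 using False elim(2) by simp
    show ?case unfolding e2 e1[symmetric] using s0 by simp
  qed
  ultimately show ?thesis using False by (simp add: tendsto_cong)
qed

text \<open>
  The limit is the variance of the combination of the limit process \<open>N\<close>.
\<close>

lemma kernel_mass_evaluation_weight:
  "kernel_mass (evaluation_weight xs) \<longlonglongrightarrow>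
     (\<Sum>s\<in>snd ` set xs. \<Sum>t\<in>snd ` set xs. node_coefficient xs s * node_coefficient xs t * sinc (t - s))"
proof -
  let ?T = "snd ` set xs" and ?c = "node_coefficient xs"
  have sq: "(cmod (evaluation_weight xs s))\<^sup>2 = (\<Sum>p\<in>?T. \<Sum>q\<in>?T. ?c p * ?c q * cos (s * (q - p)))" for s
  proof -
    have "complex_of_real ((cmod (evaluation_weight xs s))\<^sup>2)
       = (\<Sum>p\<in>?T. \<Sum>q\<in>?T. of_real (?c p * ?c q) * cis (s * (p - q)))"
      unfolding complex_norm_square evaluation_weight_by_nodes cnj_sum sum_product
      by (intro sum.cong refl) (simp add: cis_cnj right_diff_distrib cis_divide[symmetric] divide_inverse cis_inverse mult_ac)
    then have "(cmod (evaluation_weight xs s))\<^sup>2 = Re (\<Sum>p\<in>?T. \<Sum>q\<in>?T. of_real (?c p * ?c q) * cis (s * (p - q)))"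
      by (metis Re_complex_of_real)
    also have "\<dots> = (\<Sum>p\<in>?T. \<Sum>q\<in>?T. ?c p * ?c q * cos (s * (q - p)))"
    proof -
      have "cos (s * (p - q)) = cos (s * (q - p))" for p q
        using cos_minus[of "s * (q - p)"] by (simp add: minus_mult_right)
      then show ?thesis by simp
    qed
    finally show ?thesis .
  qed
  have km: "kernel_mass (evaluation_weight xs) n
     = (\<Sum>p\<in>?T. \<Sum>q\<in>?T. ?c p * ?c q * ((\<Sum>k=1..n. cos (real k / real n * (q - p))) / real n))" for n
  proof -
    have "(\<Sum>k=1..n. \<Sum>p\<in>?T. \<Sum>q\<in>?T. ?c p * ?c q * cos (real k / real n * (q - p)))
      = (\<Sum>p\<in>?T. \<Sum>q\<in>?T. \<Sum>k=1..n. ?c p * ?c q * cos (real k / real n * (q - p)))"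
      by (subst sum.swap, intro sum.cong refl, subst sum.swap) simp
    then show ?thesis
      unfolding kernel_mass_def sq by (simp add: sum_divide_distrib sum_distrib_left)
  qed
  show ?thesis unfolding km by (intro tendsto_sum tendsto_mult_left cos_riemann_sum)
qed

lemma localized_eq_wpoly:
  assumes "t \<in> {0..2*pi}"
  shows "localized a b n x t = wpoly a b (\<lambda>s. cis (s * t)) n x"
proof -
  have e: "cis (real k / real n * t) * cis (real k * x) = cis (real k * (x + t / real n))" for k
    by (simp add: cis_mult algebra_simps)
  show ?thesis
    using assms unfolding localized_def trig_poly_def wpoly_def e
    by (simp add: sum_distrib_left Re_divide_of_real Im_divide_of_real add_divide_distrib)
qed

lemma wpoly_linear:
  "wpoly a b (\<lambda>s. of_real l * g s + h s) n x = l * wpoly a b g n x + wpoly a b h n x"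
  unfolding wpoly_def sum_distrib_left sum.distrib[symmetric]
  by (intro sum.cong refl) (simp add: Re_divide_of_real Im_divide_of_real algebra_simps add_divide_distrib diff_divide_distrib)

lemma point_evaluations_localized:
  assumes "snd ` set xs \<subseteq> {0..2*pi}"
  shows "point_evaluations xs (localized a b n x) = wpoly a b (evaluation_weight xs) n x"
  using assms
proof (induction xs)
  case Nil
  then show ?case by (simp add: evaluation_weight_def wpoly_def)
next
  case (Cons y xs)
  obtain l t where y: "y = (l, t)" by (cases y)
  have "evaluation_weight (y # xs) = (\<lambda>s. of_real l * cis (s * t) + evaluation_weight xs s)"
    by (simp add: evaluation_weight_def y fun_eq_iff)
  then show ?case using Cons by (simp add: y wpoly_linear localized_eq_wpoly)
qed

lemma wpoly_periodic: "wpoly a b h n (x + 2 * pi) = wpoly a b h n x"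
proof -
  have "cis (real k * (x + 2 * pi)) = cis (real k * x)" for k
  proof -
    have "cis (real k * (x + 2 * pi)) = cis (real k * x) * cis (2 * pi * real k)"
      by (simp add: cis_mult algebra_simps)
    also have "cis (2 * pi * real k) = 1" by (rule cis_multiple_2pi) simp
    finally show ?thesis by simp
  qed
  then show ?thesis by (simp add: wpoly_def)
qed

definition derivative_weight :: "nat \<Rightarrow> real \<Rightarrow> complex" where
  "derivative_weight j s = (\<i> * of_real s) ^ j"

lemma weight_derivative_weight: "weight (1 + real j) (derivative_weight j)"
  unfolding weight_def
proof (intro conjI ballI)
  fix s t :: real assume s: "s \<in> {0..1}" and t: "t \<in> {0..1}"
  have "cmod (derivative_weight j s - derivative_weight j t) \<le> real j * cmod (\<i> * of_real s - \<i> * of_real t)"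
    unfolding derivative_weight_def using s t by (intro norm_power_diff) (auto simp: norm_mult)
  also have "\<i> * of_real s - \<i> * of_real t = \<i> * of_real (s - t)" by (simp add: algebra_simps)
  also have "real j * cmod (\<i> * of_real (s - t)) \<le> (1 + real j) * \<bar>s - t\<bar>"
    unfolding norm_mult norm_of_real by (simp add: mult_right_mono)
  finally show "cmod (derivative_weight j s - derivative_weight j t) \<le> (1 + real j) * \<bar>s - t\<bar>" .
next
  fix s :: real assume s: "s \<in> {0..1}"
  then have "cmod (derivative_weight j s) \<le> 1"
    by (simp add: derivative_weight_def norm_power norm_mult power_le_one)
  then show "cmod (derivative_weight j s) \<le> 1 + real j" by simp
qed simp

lemma wpoly_has_derivative:
  "((\<lambda>t. wpoly a b (derivative_weight j) n (x + t / real n)) has_real_derivative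
     wpoly a b (derivative_weight (Suc j)) n (x + t / real n)) (at t within S)"
proof (cases "n = 0")
  case False
  have d: "((\<lambda>t. Re (w * cis (k * (x + t / real n)) / complex_of_real r)) has_real_derivative Re (\<i> * (k / real n) * w * cis (k * (x + t / real n)) / complex_of_real r)) (at t within S)"
    "((\<lambda>t. Im (w * cis (k * (x + t / real n)) / complex_of_real r)) has_real_derivative Im (\<i> * (k / real n) * w * cis (k * (x + t / real n)) / complex_of_real r)) (at t within S)"
    for w k r
  proof -
    have f: "Re (w * cis y / complex_of_real r) = (1 / r) * (Re w * cos y - Im w * sin y)"
      "Im (w * cis y / complex_of_real r) = (1 / r) * (Re w * sin y + Im w * cos y)"
      "Re (\<i> * (k / real n) * w * cis y / complex_of_real r) = (1 / r) * (Re w * (- sin y * (k / real n)) - Im w * (cos y * (k / real n)))"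
      "Im (\<i> * (k / real n) * w * cis y / complex_of_real r) = (1 / r) * (Re w * (cos y * (k / real n)) + Im w * (- sin y * (k / real n)))" for y
      using False by (cases "r = 0"; simp add: Re_divide_of_real Im_divide_of_real; simp add: field_simps)+
    have th: "((\<lambda>t. k * (x + t / real n)) has_real_derivative k / real n) (at t within S)"
      using False by (auto intro!: derivative_eq_intros)
    note c = DERIV_chain2[OF DERIV_cos th] and si = DERIV_chain2[OF DERIV_sin th]
    have "((\<lambda>t. (1 / r) * (Re w * cos (k * (x + t / real n)) - Im w * sin (k * (x + t / real n)))) has_real_derivative
      (1 / r) * (Re w * (- sin (k * (x + t / real n)) * (k / real n)) - Im w * (cos (k * (x + t / real n)) * (k / real n)))) (at t within S)"
      by (rule DERIV_cmult[OF DERIV_diff[OF DERIV_cmult[OF c] DERIV_cmult[OF si]]])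
    then show "((\<lambda>t. Re (w * cis (k * (x + t / real n)) / complex_of_real r)) has_real_derivative Re (\<i> * (k / real n) * w * cis (k * (x + t / real n)) / complex_of_real r)) (at t within S)"
      unfolding f .
    have "((\<lambda>t. (1 / r) * (Re w * sin (k * (x + t / real n)) + Im w * cos (k * (x + t / real n)))) has_real_derivative
      (1 / r) * (Re w * (cos (k * (x + t / real n)) * (k / real n)) + Im w * (- sin (k * (x + t / real n)) * (k / real n)))) (at t within S)"
      by (rule DERIV_cmult[OF DERIV_add[OF DERIV_cmult[OF si] DERIV_cmult[OF c]]])
    then show "((\<lambda>t. Im (w * cis (k * (x + t / real n)) / complex_of_real r)) has_real_derivative Im (\<i> * (k / real n) * w * cis (k * (x + t / real n)) / complex_of_real r)) (at t within S)"
      unfolding f .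
  qed
  have w: "\<i> * (real k / real n) * derivative_weight j (real k / real n) = derivative_weight (Suc j) (real k / real n)" for k
    by (simp add: derivative_weight_def)
  have dk: "((\<lambda>t. Re (derivative_weight j (real k / real n) * cis (real k * (x + t / real n)) / sqrt n)) has_real_derivative
      Re (derivative_weight (Suc j) (real k / real n) * cis (real k * (x + t / real n)) / sqrt n)) (at t within S)"
    "((\<lambda>t. Im (derivative_weight j (real k / real n) * cis (real k * (x + t / real n)) / sqrt n)) has_real_derivative
      Im (derivative_weight (Suc j) (real k / real n) * cis (real k * (x + t / real n)) / sqrt n)) (at t within S)" for k
    using d[of "derivative_weight j (real k / real n)" "real k" "sqrt (real n)"] unfolding w .
  show ?thesis
    unfolding wpoly_def by (intro DERIV_sum DERIV_add DERIV_cmult dk)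
qed (simp add: wpoly_def)

section \<open>Tightness of the localized process\<close>

lemma integral_circle_eq_lborel:
  fixes f :: "real \<Rightarrow> real"
  assumes [measurable]: "f \<in> borel_measurable borel"
  shows "(\<integral>x. f x \<partial>circle) = (\<integral>x. indicator {0..2*pi} x * f x \<partial>lborel) / (2 * pi)"
proof -
  have eq: "circle = density lborel (\<lambda>x. ennreal (indicator {0..2*pi} x / (2 * pi)))"
    unfolding circle_def uniform_measure_def
    by (intro density_cong) (auto simp: indicator_def divide_ennreal[symmetric] ennreal_1[symmetric] simp del: ennreal_1)
  have "(\<integral>x. f x \<partial>circle) = (\<integral>x. (indicator {0..2*pi} x / (2 * pi)) *\<^sub>R f x \<partial>lborel)"
    unfolding eq by (rule integral_density) auto
  then show ?thesis by simp
qed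

text \<open>
  A one-dimensional Sobolev inequality: compare \<open>G t\<close> with \<open>G s\<close> by integrating the derivative and
  average over \<open>s\<close>.
\<close>

lemma sup_le_circle_means:
  fixes G G' :: "real \<Rightarrow> real"
  assumes G: "\<And>s. (G has_real_derivative G' s) (at s)" and G': "continuous_on UNIV G'"
    and t: "t \<in> {0..2*pi}" and b: "\<And>s. \<bar>G s\<bar> \<le> b" "\<And>s. \<bar>G' s\<bar> \<le> b'"
  shows "\<bar>G t\<bar> \<le> (\<integral>s. \<bar>G s\<bar> \<partial>circle) + 2 * pi * (\<integral>s. \<bar>G' s\<bar> \<partial>circle)"
proof -
  have cG: "continuous_on UNIV G" using G by (meson DERIV_isCont continuous_at_imp_continuous_on)
  have [measurable]: "G' \<in> borel_measurable borel" using G' by (rule borel_measurable_continuous_onI)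
  have iG: "integrable circle (\<lambda>s. \<bar>G s\<bar>)"
    by (rule integrable_circle_continuous[where B=b]) (auto intro!: continuous_intros cG b)
  have il: "integrable lborel (\<lambda>s. indicator {0..2*pi} s * \<bar>G' s\<bar>)"
    using borel_integrable_compact[of "{0..2*pi}" "\<lambda>s. \<bar>G' s\<bar>"] continuous_on_subset[OF G', of "{0..2*pi}"]
    by (auto intro!: continuous_intros)
  have *: "\<bar>G v - G u\<bar> \<le> 2 * pi * (\<integral>s. \<bar>G' s\<bar> \<partial>circle)" if uv: "0 \<le> u" "u \<le> v" "v \<le> 2 * pi" for u v
  proof -
    have h: "has_bochner_integral lborel (\<lambda>s. indicator {u..v} s *\<^sub>R G' s) (G v - G u)"
      using G uv continuous_on_subset[OF G']
      by (intro has_bochner_integral_FTC_Icc) (auto simp: has_real_derivative_iff_has_vector_derivative[symmetric] intro: DERIV_subset)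
    have "\<bar>G v - G u\<bar> = \<bar>\<integral>s. indicator {u..v} s *\<^sub>R G' s \<partial>lborel\<bar>"
      using h by (simp add: has_bochner_integral_iff)
    also have "\<dots> \<le> (\<integral>s. indicator {0..2*pi} s * \<bar>G' s\<bar> \<partial>lborel)"
    proof (rule order.trans[OF integral_abs_bound integral_mono])
      show "integrable lborel (\<lambda>s. \<bar>indicator {u..v} s *\<^sub>R G' s\<bar>)" using h by (auto simp: has_bochner_integral_iff)
      show "\<bar>indicator {u..v} s *\<^sub>R G' s\<bar> \<le> indicator {0..2*pi} s * \<bar>G' s\<bar>" for s
        using uv by (auto simp: indicator_def)
    qed (rule il)
    also have "\<dots> = 2 * pi * (\<integral>s. \<bar>G' s\<bar> \<partial>circle)" by (subst integral_circle_eq_lborel) auto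
    finally show ?thesis .
  qed
  have J: "AE s in circle. s \<in> {0..2*pi}" unfolding circle_def by (rule AE_uniform_measureI) auto
  have "\<bar>G t\<bar> = (\<integral>s. \<bar>G t\<bar> \<partial>circle)" using circle.prob_space by simp
  also have "\<dots> \<le> (\<integral>s. \<bar>G s\<bar> + 2 * pi * (\<integral>s. \<bar>G' s\<bar> \<partial>circle) \<partial>circle)"
  proof (rule integral_mono_AE)
    show "AE s in circle. \<bar>G t\<bar> \<le> \<bar>G s\<bar> + 2 * pi * (\<integral>s. \<bar>G' s\<bar> \<partial>circle)"
      using J
    proof eventually_elim
      case (elim s)
      have "\<bar>G t - G s\<bar> \<le> 2 * pi * (\<integral>s. \<bar>G' s\<bar> \<partial>circle)"
        using *[of s t] *[of t s] elim t by (cases "s \<le> t") (auto simp: abs_minus_commute)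
      then show ?case by linarith
    qed
  qed (use iG in auto)
  also have "\<dots> = (\<integral>s. \<bar>G s\<bar> \<partial>circle) + 2 * pi * (\<integral>s. \<bar>G' s\<bar> \<partial>circle)"
    using iG circle.prob_space by simp
  finally show ?thesis .
qed

text \<open>
  The mean over \<open>t\<close> of the \<open>j\<close>-th derivative, in absolute value, of the localized path at \<open>x\<close>.
\<close>

definition local_mean :: "(nat \<Rightarrow> real) \<Rightarrow> (nat \<Rightarrow> real) \<Rightarrow> nat \<Rightarrow> nat \<Rightarrow> real \<Rightarrow> real" where
  "local_mean a b j n x = (\<integral>t. \<bar>wpoly a b (derivative_weight j) n (x + t / real n)\<bar> \<partial>circle)"

lemma wpoly_uniformly_bounded: "\<exists>c. \<forall>x. \<bar>wpoly a b h n x\<bar> \<le> c"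
  using wpoly_bounded by blast

lemma continuous_wpoly_comp [continuous_intros]:
  "continuous_on S f \<Longrightarrow> continuous_on S (\<lambda>x. wpoly a b h n (f x))"
  using continuous_on_compose2[OF continuous_wpoly[of UNIV]] by blast

text \<open>
  By the Sobolev inequality the path and its first two derivatives are bounded by \<open>R\<close> if the local
  means of order at most 3 add up to at most \<open>R / 8\<close>. The bound on the second derivative makes the
  first one Lipschitz, which provides the modulus of continuity. The factor 8 covers \<open>2 pi\<close>.
\<close>

lemma localized_in_c1_compact:
  assumes R: "8 * (local_mean a b 0 n x + local_mean a b 1 n x + local_mean a b 2 n x + local_mean a b 3 n x) \<le> R" "0 < R"
  shows "localized a b n x \<in> c1_compact 0 (2 * pi) R (\<lambda>j. 1 / (real (Suc j) * R))"
proof -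
  define G where "G = (\<lambda>j t. wpoly a b (derivative_weight j) n (x + t / real n))"
  have dG: "(G j has_real_derivative G (Suc j) t) (at t within S)" for j t S
    unfolding G_def by (rule wpoly_has_derivative)
  have cG: "continuous_on S (G j)" for j S unfolding G_def
    by (cases "n = 0") (auto intro!: continuous_intros simp: wpoly_def)
  have I0: "0 \<le> local_mean a b j n x" for j unfolding local_mean_def by (intro integral_nonneg_AE) auto
  have lm: "local_mean a b j n x = (\<integral>t. \<bar>G j t\<bar> \<partial>circle)" for j by (simp add: local_mean_def G_def)
  have sup: "\<bar>G j t\<bar> \<le> local_mean a b j n x + 2 * pi * local_mean a b (Suc j) n x" if "t \<in> {0..2*pi}" for j t
  proof -
    obtain c c' where "\<And>t. \<bar>G j t\<bar> \<le> c" "\<And>t. \<bar>G (Suc j) t\<bar> \<le> c'"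
      unfolding G_def using wpoly_uniformly_bounded by metis
    then show ?thesis unfolding lm using sup_le_circle_means[OF dG cG that] by blast
  qed
  have supR: "\<bar>G j t\<bar> \<le> R" if "t \<in> {0..2*pi}" "j < 3" for j t
  proof -
    have "2 * pi * local_mean a b (Suc j) n x \<le> 8 * local_mean a b (Suc j) n x"
      using I0 pi_less_4 by (intro mult_right_mono) auto
    then have "\<bar>G j t\<bar> \<le> local_mean a b j n x + 8 * local_mean a b (Suc j) n x" using sup[OF that(1), of j] by linarith
    moreover have "j = 0 \<or> j = 1 \<or> j = 2" using that(2) by auto
    ultimately show ?thesis using R(1) I0[of 0] I0[of 1] I0[of 2] I0[of 3]
      by (elim disjE) (simp_all add: numeral_2_eq_2 numeral_3_eq_3)
  qed
  have loc: "localized a b n x t = G 0 t" if "t \<in> {0..2*pi}" for t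
  proof -
    have "cis (real k / real n * t) * cis (real k * x) = cis (real k * (x + t / real n))" for k
      by (simp add: cis_mult algebra_simps)
    then show ?thesis unfolding localized_eq_wpoly[OF that] G_def wpoly_def by (simp add: derivative_weight_def)
  qed
  have dl: "(localized a b n x has_real_derivative G 1 t) (at t within {0..2*pi})" if t: "t \<in> {0..2*pi}" for t
    by (rule has_field_derivative_transform_within[OF dG[of 0, unfolded One_nat_def[symmetric]] zero_less_one t]) (use loc in auto)
  have ext: "localized a b n x \<in> extensional {0..2*pi}" by (simp add: localized_def)
  note c1 = c1_spaceI[OF _ ext cG[of _ 1] dl, simplified]
  have d1: "c1_deriv 0 (2 * pi) (localized a b n x) t = G 1 t" if "t \<in> {0..2*pi}" for t
    using c1(2) that by simp
  have lip: "\<bar>G 1 s - G 1 t\<bar> \<le> R * \<bar>s - t\<bar>" if "s \<in> {0..2*pi}" "t \<in> {0..2*pi}" for s t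
    using field_differentiable_bound[of "{0..2*pi}" "G 1" "G 2" R s t] dG[of 1] supR[of _ 2] that
    by (auto simp: numeral_2_eq_2)
  show ?thesis
    unfolding c1_compact_def
  proof (intro CollectI conjI ballI allI impI)
    show "localized a b n x \<in> c1_space 0 (2 * pi)" by (rule c1(1))
    show "\<bar>localized a b n x 0\<bar> \<le> R" using supR[of 0 0] loc[of 0] by simp
    show "\<bar>c1_deriv 0 (2 * pi) (localized a b n x) t\<bar> \<le> R" if "t \<in> {0..2*pi}" for t
      using supR[OF that, of 1] d1[OF that] by simp
    fix j :: nat and s t :: real
    assume st: "s \<in> {0..2*pi}" "t \<in> {0..2*pi}" "\<bar>s - t\<bar> \<le> 1 / (real (Suc j) * R)"
    have "\<bar>G 1 s - G 1 t\<bar> \<le> R * (1 / (real (Suc j) * R))"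
      using lip[OF st(1,2)] st(3) R(2) by (meson mult_left_mono order.trans less_imp_le)
    also have "\<dots> = 1 / real (Suc j)" using R(2) by simp
    finally show "\<bar>c1_deriv 0 (2 * pi) (localized a b n x) s - c1_deriv 0 (2 * pi) (localized a b n x) t\<bar> \<le> 1 / real (Suc j)"
      using d1 st by simp
  qed
qed

lemma localized_c1: "localized a b n x \<in> c1_space 0 (2 * pi)"
proof -
  define T where "T = 8 * (local_mean a b 0 n x + local_mean a b 1 n x + local_mean a b 2 n x + local_mean a b 3 n x)"
  have "localized a b n x \<in> c1_compact 0 (2 * pi) (max 1 T) (\<lambda>j. 1 / (real (Suc j) * max 1 T))"
    by (rule localized_in_c1_compact) (auto simp: T_def)
  then show ?thesis by (simp add: c1_compact_def)
qed

text \<open>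
  The uniform law on the circle is invariant under the shifts by \<open>t / n\<close>.
\<close>

lemma local_mean_integral:
  "integrable circle (local_mean a b j n)"
  "(\<integral>x. local_mean a b j n x \<partial>circle) = (\<integral>x. \<bar>wpoly a b (derivative_weight j) n x\<bar> \<partial>circle)"
proof -
  interpret C: pair_prob_space circle circle ..
  let ?w = "wpoly a b (derivative_weight j) n"
  obtain c where c: "\<And>x. \<bar>?w x\<bar> \<le> c" using wpoly_uniformly_bounded by metis
  have [measurable]: "?w \<in> borel_measurable borel" by (intro borel_measurable_continuous_onI continuous_wpoly)
  have i: "integrable (circle \<Otimes>\<^sub>M circle) (\<lambda>(x, t). \<bar>?w (x + t / real n)\<bar>)"
  proof (rule C.integrable_const_bound[where B=c])
    show "AE p in circle \<Otimes>\<^sub>M circle. norm (case p of (x, t) \<Rightarrow> \<bar>?w (x + t / real n)\<bar>) \<le> c"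
      using c by (intro AE_I2) (auto split: prod.splits)
    show "(\<lambda>(x, t). \<bar>?w (x + t / real n)\<bar>) \<in> borel_measurable (circle \<Otimes>\<^sub>M circle)" by measurable
  qed
  show "integrable circle (local_mean a b j n)"
    using C.integrable_fst[OF i] by (simp add: local_mean_def[abs_def])
  have "(\<integral>x. local_mean a b j n x \<partial>circle) = (\<integral>t. (\<integral>x. \<bar>?w (x + t / real n)\<bar> \<partial>circle) \<partial>circle)"
    unfolding local_mean_def by (rule C.Fubini_integral[OF i, symmetric])
  also have "\<dots> = (\<integral>t. (\<integral>x. \<bar>?w x\<bar> \<partial>circle) \<partial>circle)"
    by (intro Bochner_Integration.integral_cong refl integral_circle_shift) (auto simp: wpoly_periodic)
  also have "\<dots> = (\<integral>x. \<bar>?w x\<bar> \<partial>circle)" using circle.prob_space by simp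
  finally show "(\<integral>x. local_mean a b j n x \<partial>circle) = (\<integral>x. \<bar>?w x\<bar> \<partial>circle)" .
qed

text \<open>
  Markov's inequality for the sum of the four local means, whose expectations are those of the
  absolute values of the polynomials.
\<close>

lemma localized_tight:
  assumes m: "\<And>n j. j < 4 \<Longrightarrow> (\<integral>x. \<bar>wpoly a b (derivative_weight j) n x\<bar> \<partial>circle) \<le> m" and e: "0 < e"
  shows "\<exists>R \<delta>. (\<forall>j. 0 < \<delta> j) \<and> (\<forall>n. \<exists>A\<in>sets circle. measure circle (space circle - A) \<le> e \<and>
     (\<forall>x\<in>A. localized a b n x \<in> c1_compact 0 (2 * pi) R \<delta>))"
proof -
  have "0 \<le> (\<integral>x. \<bar>wpoly a b (derivative_weight 0) 0 x\<bar> \<partial>circle)" by (intro integral_nonneg_AE) auto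
  then have m0: "0 \<le> m" using m[of 0 0] by linarith
  define R where "R = 32 * m / e + 1"
  have R: "0 < R" using m0 e by (simp add: R_def add_nonneg_pos)
  show ?thesis
  proof (intro exI[of _ R] exI[of _ "\<lambda>j. 1 / (real (Suc j) * R)"] conjI allI)
    show "0 < 1 / (real (Suc j) * R)" for j using R by simp
    fix n
    define T where "T = (\<lambda>x. 8 * (local_mean a b 0 n x + local_mean a b 1 n x + local_mean a b 2 n x + local_mean a b 3 n x))"
    have iT: "integrable circle T" unfolding T_def
      by (intro integrable_mult_right Bochner_Integration.integrable_add local_mean_integral(1))
    have [measurable]: "T \<in> borel_measurable circle" using iT by auto
    have T0: "0 \<le> T x" for x unfolding T_def local_mean_def
      by (intro mult_nonneg_nonneg add_nonneg_nonneg integral_nonneg_AE) auto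
    have "(\<integral>x. T x \<partial>circle) \<le> 32 * m"
    proof -
      have "(\<integral>x. T x \<partial>circle) = 8 * ((\<integral>x. local_mean a b 0 n x \<partial>circle) + (\<integral>x. local_mean a b 1 n x \<partial>circle)
          + (\<integral>x. local_mean a b 2 n x \<partial>circle) + (\<integral>x. local_mean a b 3 n x \<partial>circle))"
        unfolding T_def by (simp add: local_mean_integral(1))
      also have "\<dots> \<le> 8 * (m + m + m + m)"
        unfolding local_mean_integral(2) by (intro mult_left_mono add_mono m) auto
      finally show ?thesis by simp
    qed
    then have "(\<integral>x. T x \<partial>circle) / R \<le> 32 * m / R" using R by (intro divide_right_mono) auto
    also have "\<dots> \<le> e" using m0 e R by (simp add: divide_le_eq R_def field_simps)
    finally have mk: "(\<integral>x. T x \<partial>circle) / R \<le> e" .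
    have "measure circle {x \<in> space circle. R \<le> T x} \<le> (\<integral>x. T x \<partial>circle) / R"
      by (rule integral_Markov_inequality_measure[OF iT, of "{}"]) (use T0 R in auto)
    then have pm: "measure circle {x \<in> space circle. R \<le> T x} \<le> e" using mk by linarith
    let ?A = "{x \<in> space circle. T x < R}"
    have "space circle - ?A = {x \<in> space circle. R \<le> T x}" by auto
    then have pA: "measure circle (space circle - ?A) \<le> e" using pm by simp
    show "\<exists>A\<in>sets circle. measure circle (space circle - A) \<le> e \<and>
       (\<forall>x\<in>A. localized a b n x \<in> c1_compact 0 (2 * pi) R (\<lambda>j. 1 / (real (Suc j) * R)))"
    proof (intro bexI[of _ ?A] conjI ballI)
      show "measure circle (space circle - ?A) \<le> e" by (rule pA)
      show "localized a b n x \<in> c1_compact 0 (2 * pi) R (\<lambda>j. 1 / (real (Suc j) * R))" if "x \<in> ?A" for x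
        by (rule localized_in_c1_compact[OF _ R]) (use that in \<open>simp add: T_def\<close>)
    qed measurable
  qed
qed

section \<open>Limits of spatial means and of the localized process\<close>

lemma abs_cos_diff_le: "\<bar>cos x - cos y\<bar> \<le> \<bar>x - y\<bar>" for x y :: real
  using abs_Re_le_cmod[of "cis x - cis y"] cmod_cis_diff_le[of x y] by simp

lemma abs_sin_diff_le: "\<bar>sin x - sin y\<bar> \<le> \<bar>x - y\<bar>" for x y :: real
  using abs_Im_le_cmod[of "cis x - cis y"] cmod_cis_diff_le[of x y] by simp

lemma c1_space_scale:
  assumes f: "f \<in> c1_space a b" and "a < b"
  shows "(\<lambda>t\<in>{a..b}. c * f t) \<in> c1_space a b"
proof (rule c1_spaceI(1)[OF \<open>a < b\<close>])
  show "continuous_on {a..b} (\<lambda>t. c * c1_deriv a b f t)" by (intro continuous_intros c1_spaceD(2)[OF f])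
  fix t assume t: "t \<in> {a..b}"
  show "((\<lambda>t\<in>{a..b}. c * f t) has_real_derivative c * c1_deriv a b f t) (at t within {a..b})"
    by (rule has_field_derivative_transform_within[OF DERIV_cmult[OF c1_has_deriv[OF f t]] zero_less_one t]) simp
qed simp

context gaussian_coefficients
begin

lemma Y_normal:
  assumes w: "weight B h"
  shows "centered_normal M (Y h n x) (\<integral>u. fejer h n (x - u) \<partial>\<mu>)"
  using Y_pair_normal[OF w, of 1 n x 0 x] by simp

lemma annealed_cos:
  assumes w: "weight B h"
  shows "annealed_mean cos h n = (\<integral>x. exp (- (\<integral>u. fejer h n (x - u) \<partial>\<mu>) / 2) \<partial>circle)"
  unfolding annealed_mean_def centered_normal_cos_sin(1)[OF Y_normal[OF w]] ..

lemma annealed_sin: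
  assumes w: "weight B h"
  shows "annealed_mean sin h n = 0"
  unfolding annealed_mean_def centered_normal_cos_sin(2)[OF Y_normal[OF w]] by simp

text \<open>
  Since \<open>\<bar>y\<bar> \<le> 1 + y\<^sup>2\<close>, it is enough to average the variance over the circle, and this average is
  the mass of the kernel.
\<close>

lemma annealed_abs:
  assumes w: "weight B h"
  shows "annealed_mean abs h n \<le> 1 + B\<^sup>2"
proof -
  define V where "V = (\<lambda>x. \<integral>u. fejer h n (x - u) \<partial>\<mu>)"
  have Vm: "V \<in> borel_measurable borel"
    unfolding V_def by (rule spectral.borel_measurable_lebesgue_integral) measurable
  have [measurable]: "V \<in> borel_measurable circle" using Vm by (simp cong: measurable_cong_sets)
  have V0: "0 \<le> V x" for x unfolding V_def by (intro integral_nonneg_AE) auto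
  have Vb: "V x \<le> B\<^sup>2 * real n" for x
  proof -
    have "V x \<le> (\<integral>u. B\<^sup>2 * real n \<partial>\<mu>)"
      unfolding V_def by (intro integral_mono integrable_kernel(1)[OF spectral.finite_measure_axioms sets_spectral w]
        spectral.integrable_const kernel_bound[OF w])
    then show ?thesis using spectral.prob_space by simp
  qed
  have iV: "integrable circle V"
    by (rule circle.integrable_const_bound[where B="B\<^sup>2 * real n"]) (use V0 Vb in auto)
  have EV: "(\<integral>x. V x \<partial>circle) = kernel_mass h n"
  proof (cases "n = 0")
    case False
    have "fejer h n (x + 2 * pi - u) = fejer h n (x - u)" for x u
      using kernel_periodic[of h n "x - u"] by (simp add: algebra_simps)
    then have "(\<integral>x. V x \<partial>circle) = (\<integral>x. V x \<partial>window)"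
      by (intro integral_window_periodic[symmetric] Vm) (simp add: V_def)
    also have "\<dots> = kernel_mass h n"
      using integral_kernel_smoothing(3)[OF w spectral.finite_measure_axioms sets_spectral, of "\<lambda>_. 1" n] False spectral.prob_space
      by (simp add: V_def)
    finally show ?thesis .
  qed (simp add: V_def fejer_def kernel_mass_def)
  have E: "(\<integral>\<omega>. \<bar>Y h n x \<omega>\<bar> \<partial>M) \<le> 1 + V x" and E0: "0 \<le> (\<integral>\<omega>. \<bar>Y h n x \<omega>\<bar> \<partial>M)" for x
  proof -
    note nY = Y_normal[OF w, of n x]
    have i: "integrable M (\<lambda>\<omega>. (Y h n x \<omega>)\<^sup>2)" "integrable M (Y h n x)"
      using centered_normal_moments(1)[OF nY, of 2] centered_normal_moments(1)[OF nY, of 1] by auto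
    have s: "\<bar>y\<bar> \<le> 1 + y\<^sup>2" for y :: real using sum_squares_bound[of 1 "\<bar>y\<bar>"] by simp
    have "(\<integral>\<omega>. \<bar>Y h n x \<omega>\<bar> \<partial>M) \<le> (\<integral>\<omega>. 1 + (Y h n x \<omega>)\<^sup>2 \<partial>M)"
      using i s by (intro integral_mono) auto
    also have "\<dots> = 1 + V x" using i centered_normal_second_moment[OF nY] prob_space by (simp add: V_def)
    finally show "(\<integral>\<omega>. \<bar>Y h n x \<omega>\<bar> \<partial>M) \<le> 1 + V x" .
    show "0 \<le> (\<integral>\<omega>. \<bar>Y h n x \<omega>\<bar> \<partial>M)" by (intro integral_nonneg_AE) auto
  qed
  have "annealed_mean abs h n \<le> (\<integral>x. 1 + V x \<partial>circle)"
    unfolding annealed_mean_def using E E0 V0 iV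
    by (intro Bochner_Integration.integral_mono') (auto intro: add_nonneg_nonneg)
  also have "\<dots> = 1 + kernel_mass h n" using iV EV circle.prob_space by simp
  also have "\<dots> \<le> 1 + B\<^sup>2" using kernel_mass_bound[OF w] by simp
  finally show ?thesis .
qed

lemma spatial_cos_limit:
  assumes w: "weight B h" and ac: "ac_density_of \<mu> \<psi>" and \<kappa>: "kernel_mass h \<longlonglongrightarrow> \<kappa>"
  shows "AE \<omega> in M. (\<lambda>n. spatial_mean cos h n \<omega>) \<longlonglongrightarrow> (\<integral>x. exp (- (pi * \<kappa> * \<psi> x)) \<partial>circle)"
  using spatial_mean_concentration[OF w abs_cos_diff_le]
proof eventually_elim
  case (elim \<omega>)
  have "(\<lambda>n. annealed_mean cos h n) \<longlonglongrightarrow> (\<integral>x. exp (- (pi * \<kappa> * \<psi> x)) \<partial>circle)"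
    unfolding annealed_cos[OF w] by (rule kernel_smoothing_limit[OF spectral ac w \<kappa>])
  from tendsto_add[OF elim filterlim_compose[OF this filterlim_floor_sqrt_square]] show ?case by simp
qed

lemma spatial_sin_limit:
  assumes w: "weight B h"
  shows "AE \<omega> in M. (\<lambda>n. spatial_mean sin h n \<omega>) \<longlonglongrightarrow> 0"
  using spatial_mean_concentration[OF w abs_sin_diff_le] by (simp add: annealed_sin[OF w])

lemma spatial_abs_bounded:
  assumes w: "weight B h"
  shows "AE \<omega> in M. \<exists>m. \<forall>n. spatial_mean abs h n \<omega> \<le> m"
  using spatial_mean_concentration[OF w abs_triangle_ineq3]
proof eventually_elim
  case (elim \<omega>)
  then have "Bseq (\<lambda>n. spatial_mean abs h n \<omega> - annealed_mean abs h ((floor_sqrt n)\<^sup>2))"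
    by (intro convergent_imp_Bseq) (auto simp: convergent_def)
  then obtain K where K: "\<And>n. \<bar>spatial_mean abs h n \<omega> - annealed_mean abs h ((floor_sqrt n)\<^sup>2)\<bar> \<le> K"
    by (auto simp: Bseq_def)
  have "spatial_mean abs h n \<omega> \<le> K + (1 + B\<^sup>2)" for n
    using K[of n] annealed_abs[OF w, of "(floor_sqrt n)\<^sup>2"] by linarith
  then show ?case by blast
qed

end

lemma distributed_uniform_eq_circle:
  assumes "distributed M lborel X (\<lambda>x. indicator {0..2*pi} x / measure lborel {0..2*pi})"
  shows "distr M borel X = circle"
proof -
  have "distr M borel X = distr M lborel X" by (rule distr_cong) auto
  also have "\<dots> = density lborel (\<lambda>x. indicator {0..2*pi} x / measure lborel {0..2*pi})"
    using assms by (rule distributed_distr_eq_density)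
  also have "\<dots> = circle"
    unfolding circle_def uniform_measure_def
    by (intro density_cong) (auto simp: indicator_def divide_ennreal[symmetric] ennreal_1[symmetric] simp del: ennreal_1)
  finally show ?thesis .
qed

lemma (in prob_space) independent_elements_imp_indep_var:
  assumes ind: "independent_elements M S X T Z" and f: "f \<in> measurable T N"
  shows "indep_var S X N (\<lambda>\<omega>. f (Z \<omega>))"
  unfolding indep_var_eq
proof (intro conjI)
  have X: "X \<in> measurable M S" and Z: "Z \<in> measurable M T"
    and I: "indep_set (sigma_sets (space M) {X -` A \<inter> space M | A. A \<in> sets S})
       (sigma_sets (space M) {Z -` A \<inter> space M | A. A \<in> sets T})"
    using ind by (auto simp: independent_elements_def)
  show "X \<in> measurable M S" by (rule X)
  show "(\<lambda>\<omega>. f (Z \<omega>)) \<in> measurable M N" by (rule measurable_compose[OF Z f])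
  have sub: "sigma_sets (space M) {(\<lambda>\<omega>. f (Z \<omega>)) -` A \<inter> space M | A. A \<in> sets N}
     \<subseteq> sigma_sets (space M) {Z -` A \<inter> space M | A. A \<in> sets T}"
  proof (rule sigma_sets_mono')
    show "{(\<lambda>\<omega>. f (Z \<omega>)) -` A \<inter> space M | A. A \<in> sets N} \<subseteq> {Z -` A \<inter> space M | A. A \<in> sets T}"
    proof safe
      fix A assume "A \<in> sets N"
      then have "f -` A \<inter> space T \<in> sets T" using f by (rule measurable_sets[rotated])
      moreover have "(\<lambda>\<omega>. f (Z \<omega>)) -` A \<inter> space M = Z -` (f -` A \<inter> space T) \<inter> space M"
        using measurable_space[OF Z] by auto
      ultimately show "\<exists>B. (\<lambda>\<omega>. f (Z \<omega>)) -` A \<inter> space M = Z -` B \<inter> space M \<and> B \<in> sets T" by blast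
    qed
  qed
  show "indep_set (sigma_sets (space M) {X -` A \<inter> space M | A. A \<in> sets S})
       (sigma_sets (space M) {(\<lambda>\<omega>. f (Z \<omega>)) -` A \<inter> space M | A. A \<in> sets N})"
    using indep_setD_ev1[OF I] indep_setD_ev2[OF I] indep_setD[OF I] sub
    by (intro indep_setI) blast+
qed

text \<open>
  A constant factor \<open>c\<close> is included because the limit process is \<open>N\<close> multiplied by a function of
  \<open>X\<close>, which is frozen by conditioning on \<open>X\<close>.
\<close>

lemma (in prob_space) gaussian_evaluations_normal:
  assumes g: "centered_gaussian_process M I N" and xs: "snd ` set xs \<subseteq> I"
    and cov: "\<And>s t. s \<in> I \<Longrightarrow> t \<in> I \<Longrightarrow> (\<integral>\<omega>. N s \<omega> * N t \<omega> \<partial>M) = r s t"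
  shows "centered_normal M (\<lambda>\<omega>. c * point_evaluations xs (\<lambda>t. N t \<omega>))
    (c\<^sup>2 * (\<Sum>s\<in>snd ` set xs. \<Sum>t\<in>snd ` set xs. node_coefficient xs s * node_coefficient xs t * r s t))"
proof -
  let ?T = "snd ` set xs" and ?k = "node_coefficient xs"
  have "centered_normal M (\<lambda>\<omega>. \<Sum>t\<in>?T. (c * ?k t) * N t \<omega>)
    (\<Sum>s\<in>?T. \<Sum>t\<in>?T. (c * ?k s) * (c * ?k t) * (\<integral>\<omega>. N s \<omega> * N t \<omega> \<partial>M))"
    by (rule gaussian_process_linear_combination[OF prob_space_axioms g _ xs]) simp
  also have "(\<lambda>\<omega>. \<Sum>t\<in>?T. (c * ?k t) * N t \<omega>) = (\<lambda>\<omega>. c * point_evaluations xs (\<lambda>t. N t \<omega>))"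
    by (simp add: point_evaluations_by_nodes sum_distrib_left mult.assoc)
  also have "(\<Sum>s\<in>?T. \<Sum>t\<in>?T. (c * ?k s) * (c * ?k t) * (\<integral>\<omega>. N s \<omega> * N t \<omega> \<partial>M))
     = c\<^sup>2 * (\<Sum>s\<in>?T. \<Sum>t\<in>?T. ?k s * ?k t * r s t)"
    unfolding sum_distrib_left using xs by (intro sum.cong refl) (auto simp: cov subset_iff power2_eq_square)
  finally show ?thesis .
qed

lemma point_evaluations_cong:
  assumes "snd ` set xs \<subseteq> I" "\<And>t. t \<in> I \<Longrightarrow> f t = g t"
  shows "point_evaluations xs f = point_evaluations xs g"
  using assms by (induction xs) auto

lemma point_evaluations_scale: "point_evaluations xs (\<lambda>t. c * g t) = c * point_evaluations xs g"
  by (induction xs) (auto simp: algebra_simps)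

theorem theorem1p6:
  fixes \<mu> :: "real measure" and \<psi> :: "real \<Rightarrow> real"
    and M :: "'w measure"
    and a b :: "nat \<Rightarrow> 'w \<Rightarrow> real" and X :: "'w \<Rightarrow> real" and N :: "real \<Rightarrow> 'w \<Rightarrow> real"
  assumes "spectral_measure \<mu>"
    and "ac_density_of \<mu> \<psi>"
    and "prob_space M"
    and "centered_gaussian_process M {1..} a"
    and "centered_gaussian_process M {1..} b"
    and "\<And>k l. k \<ge> 1 \<Longrightarrow> l \<ge> 1 \<Longrightarrow>
           complex_of_real (\<integral>\<omega>. a k \<omega> * a l \<omega> \<partial>M) = spectral_corr \<mu> \<bar>int k - int l\<bar>"
    and "\<And>k l. k \<ge> 1 \<Longrightarrow> l \<ge> 1 \<Longrightarrow>
           complex_of_real (\<integral>\<omega>. b k \<omega> * b l \<omega> \<partial>M) = spectral_corr \<mu> \<bar>int k - int l\<bar>"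
    and "prob_space.indep_var M
           (Pi\<^sub>M {1..} (\<lambda>_. borel)) (\<lambda>\<omega>. \<lambda>k\<in>{1..}. a k \<omega>)
           (Pi\<^sub>M {1..} (\<lambda>_. borel)) (\<lambda>\<omega>. \<lambda>k\<in>{1..}. b k \<omega>)"
    and "distributed M lborel X (\<lambda>x. indicator {0..2*pi} x / measure lborel {0..2*pi})"
    and "independent_elements M
           borel X
           (Pi\<^sub>M {1..} (\<lambda>_. borel) \<Otimes>\<^sub>M Pi\<^sub>M {1..} (\<lambda>_. borel))
           (\<lambda>\<omega>. (\<lambda>k\<in>{1..}. a k \<omega>, \<lambda>k\<in>{1..}. b k \<omega>))"
    and "centered_gaussian_process M {0..2*pi} N"
    and "\<And>s t. s \<in> {0..2*pi} \<Longrightarrow> t \<in> {0..2*pi} \<Longrightarrow> (\<integral>\<omega>. N s \<omega> * N t \<omega> \<partial>M) = sinc (t - s)"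
    and "\<And>\<omega>. \<omega> \<in> space M \<Longrightarrow> (\<lambda>t\<in>{0..2*pi}. N t \<omega>) \<in> c1_space 0 (2*pi)"
    and "independent_elements M
           borel X (Pi\<^sub>M {0..2*pi} (\<lambda>_. borel)) (\<lambda>\<omega>. \<lambda>t\<in>{0..2*pi}. N t \<omega>)"
  shows "AE \<omega> in M.
    converges_in_distribution (c1_topology 0 (2*pi))
      (\<lambda>_. distr M borel X) (\<lambda>n. localized (\<lambda>k. a k \<omega>) (\<lambda>k. b k \<omega>) n)
      M (\<lambda>\<omega>'. \<lambda>t\<in>{0..2*pi}. sqrt (2 * pi * \<psi> (X \<omega>')) * N t \<omega>')"
proof -
  interpret gaussian_coefficients M \<mu> a b
    using assms(1,3-8) by (intro gaussian_coefficients.intro gaussian_coefficients_axioms.intro)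
  note ac = assms(2) and N_gauss = assms(11) and N_cov = assms(12) and N_c1 = assms(13) and XN = assms(14)
  have law: "distr M borel X = circle" by (rule distributed_uniform_eq_circle) fact
  have [measurable]: "\<psi> \<in> borel_measurable borel" and \<psi>0: "\<And>x. 0 \<le> \<psi> x"
    using ac by (auto simp: ac_density_of_def)
  have [measurable]: "X \<in> borel_measurable M" using XN by (simp add: independent_elements_def)
  have N_meas: "N t \<in> borel_measurable M" if "t \<in> {0..2*pi}" for t
    using gaussian_process_linear_combination[OF prob_space_axioms N_gauss, of "{t}" "\<lambda>_. 1"] that
    by (simp add: centered_normal_def)
  let ?T = "\<rat> \<inter> {0..2*pi}"
  let ?Z = "\<lambda>\<omega>. \<lambda>t\<in>{0..2*pi}. sqrt (2 * pi * \<psi> (X \<omega>)) * N t \<omega>"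
  define lists_T where "lists_T = {xs :: (real \<times> real) list. set xs \<subseteq> \<rat> \<times> ?T}"
  define \<kappa> where "\<kappa> = (\<lambda>xs. \<Sum>s\<in>snd ` set xs. \<Sum>t\<in>snd ` set xs. node_coefficient xs s * node_coefficient xs t * sinc (t - s))"
  have "lists_T = lists (\<rat> \<times> ?T)" by (auto simp: lists_T_def lists_eq_set)
  then have countable: "countable lists_T"
    by (simp add: countable_rat countable_Int1)
  have nodes: "snd ` set xs \<subseteq> {0..2*pi}" if "xs \<in> lists_T" for xs using that by (auto simp: lists_T_def)
  \<comment> \<open>The limit process has a mixed Gaussian law: condition on X and integrate its Gaussian characteristic function.\<close>
  have limit: "(\<integral>\<omega>. cos (point_evaluations xs (?Z \<omega>)) \<partial>M) = (\<integral>x. exp (- (pi * \<kappa> xs * \<psi> x)) \<partial>circle)"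
    "(\<integral>\<omega>. sin (point_evaluations xs (?Z \<omega>)) \<partial>M) = 0" if xs: "xs \<in> lists_T" for xs
  proof -
    define L where "L = (\<lambda>\<omega>. point_evaluations xs (\<lambda>t\<in>{0..2*pi}. N t \<omega>))"
    have pe: "(\<lambda>f. point_evaluations xs f) \<in> borel_measurable (Pi\<^sub>M {0..2*pi} (\<lambda>_. borel))"
      unfolding point_evaluations_by_nodes
    proof (intro borel_measurable_sum borel_measurable_times borel_measurable_const)
      fix t assume "t \<in> snd ` set xs"
      then show "(\<lambda>f. f t) \<in> borel_measurable (Pi\<^sub>M {0..2*pi} (\<lambda>_. borel :: real measure))"
        using nodes[OF xs] by (intro measurable_component_singleton) auto
    qed
    have ind: "indep_var borel X borel L"
      unfolding L_def by (rule independent_elements_imp_indep_var[OF XN pe])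
    have [measurable]: "L \<in> borel_measurable M" by (rule indep_var_rv2[OF ind])
    have Lc: "L \<omega> = point_evaluations xs (\<lambda>t. N t \<omega>)" for \<omega>
      unfolding L_def by (rule point_evaluations_cong[OF nodes[OF xs]]) simp
    have ZL: "point_evaluations xs (?Z \<omega>) = sqrt (2 * pi * \<psi> (X \<omega>)) * L \<omega>" for \<omega>
      unfolding Lc point_evaluations_scale[symmetric]
      by (rule point_evaluations_cong[OF nodes[OF xs]]) simp
    have nL: "centered_normal M (\<lambda>\<omega>. c * L \<omega>) (c\<^sup>2 * \<kappa> xs)" for c
      unfolding Lc \<kappa>_def by (rule gaussian_evaluations_normal[OF N_gauss nodes[OF xs] N_cov])
    have joint: "distr M (borel \<Otimes>\<^sub>M borel) (\<lambda>\<omega>. (X \<omega>, L \<omega>)) = circle \<Otimes>\<^sub>M distr M borel L"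
      using ind law unfolding indep_var_distribution_eq by simp
    interpret dL: prob_space "distr M borel L" by (rule prob_space_distr) simp
    interpret CL: pair_prob_space circle "distr M borel L" ..
    \<comment> \<open>X and L are independent, so X may be integrated last.\<close>
    have fub: "(\<integral>\<omega>. f (sqrt (2 * pi * \<psi> (X \<omega>)) * L \<omega>) \<partial>M) = (\<integral>x. (\<integral>\<omega>. f (sqrt (2 * pi * \<psi> x) * L \<omega>) \<partial>M) \<partial>circle)"
      if [measurable]: "f \<in> borel_measurable borel" and f1: "\<And>y. \<bar>f y\<bar> \<le> 1" for f :: "real \<Rightarrow> real"
    proof -
      have m: "(\<lambda>(x, l). f (sqrt (2 * pi * \<psi> x) * l)) \<in> borel_measurable (borel \<Otimes>\<^sub>M borel)" by measurable
      then have m': "(\<lambda>(x, l). f (sqrt (2 * pi * \<psi> x) * l)) \<in> borel_measurable (circle \<Otimes>\<^sub>M distr M borel L)"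
        by (simp cong: measurable_cong_sets sets_pair_measure_cong)
      have "(\<integral>\<omega>. f (sqrt (2 * pi * \<psi> (X \<omega>)) * L \<omega>) \<partial>M)
         = (\<integral>p. (case p of (x, l) \<Rightarrow> f (sqrt (2 * pi * \<psi> x) * l)) \<partial>distr M (borel \<Otimes>\<^sub>M borel) (\<lambda>\<omega>. (X \<omega>, L \<omega>)))"
        by (subst integral_distr) (use m in auto)
      also have "\<dots> = (\<integral>x. (\<integral>l. f (sqrt (2 * pi * \<psi> x) * l) \<partial>distr M borel L) \<partial>circle)"
        unfolding joint
        by (subst CL.integral_fst'[symmetric])
           (use m' f1 in \<open>auto intro!: CL.integrable_const_bound[where B=1] split: prod.splits\<close>)
      also have "\<dots> = (\<integral>x. (\<integral>\<omega>. f (sqrt (2 * pi * \<psi> x) * L \<omega>) \<partial>M) \<partial>circle)"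
        by (simp add: integral_distr)
      finally show ?thesis .
    qed
    have e: "- ((sqrt (2 * pi * \<psi> x))\<^sup>2 * \<kappa> xs) / 2 = - (pi * \<kappa> xs * \<psi> x)" for x using \<psi>0[of x] by simp
    show "(\<integral>\<omega>. cos (point_evaluations xs (?Z \<omega>)) \<partial>M) = (\<integral>x. exp (- (pi * \<kappa> xs * \<psi> x)) \<partial>circle)"
      unfolding ZL by (subst fub) (simp_all only: centered_normal_cos_sin(1)[OF nL] e abs_cos_le_one borel_measurable_cos measurable_ident_sets)
    show "(\<integral>\<omega>. sin (point_evaluations xs (?Z \<omega>)) \<partial>M) = 0"
      unfolding ZL by (subst fub) (auto simp: centered_normal_cos_sin(2)[OF nL])
  qed
  \<comment> \<open>One exceptional null set serves for the countably many test lists.\<close>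
  have "AE \<omega> in M. \<forall>xs\<in>lists_T. (\<lambda>n. spatial_mean cos (evaluation_weight xs) n \<omega>) \<longlonglongrightarrow> (\<integral>x. exp (- (pi * \<kappa> xs * \<psi> x)) \<partial>circle)
      \<and> (\<lambda>n. spatial_mean sin (evaluation_weight xs) n \<omega>) \<longlonglongrightarrow> 0"
    unfolding AE_ball_countable[OF countable]
  proof
    fix xs assume "xs \<in> lists_T"
    obtain B where w: "weight B (evaluation_weight xs)" using weight_evaluation_weight by blast
    have "kernel_mass (evaluation_weight xs) \<longlonglongrightarrow> \<kappa> xs"
      unfolding \<kappa>_def by (rule kernel_mass_evaluation_weight)
    from spatial_cos_limit[OF w ac this] spatial_sin_limit[OF w]
    show "AE \<omega> in M. (\<lambda>n. spatial_mean cos (evaluation_weight xs) n \<omega>) \<longlonglongrightarrow> (\<integral>x. exp (- (pi * \<kappa> xs * \<psi> x)) \<partial>circle)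
      \<and> (\<lambda>n. spatial_mean sin (evaluation_weight xs) n \<omega>) \<longlonglongrightarrow> 0"
      by eventually_elim simp
  qed
  moreover have "AE \<omega> in M. \<forall>j\<in>{..<4}. \<exists>m. \<forall>n. spatial_mean abs (derivative_weight j) n \<omega> \<le> m"
    by (subst AE_ball_countable) (auto intro: spatial_abs_bounded[OF weight_derivative_weight])
  ultimately show ?thesis
  proof eventually_elim
    case (elim \<omega>)
    let ?L = "localized (\<lambda>k. a k \<omega>) (\<lambda>k. b k \<omega>)"
    obtain m where m: "\<And>j n. j < 4 \<Longrightarrow> spatial_mean abs (derivative_weight j) n \<omega> \<le> m j"
      using elim(2) by (metis lessThan_iff)
    have mM: "(\<integral>x. \<bar>wpoly (\<lambda>k. a k \<omega>) (\<lambda>k. b k \<omega>) (derivative_weight j) n x\<bar> \<partial>circle) \<le> Max (m ` {..<4})" if "j < 4" for n j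
      using order.trans[OF m[OF that, of n] Max_ge[of "m ` {..<4}" "m j"]] that by (simp add: spatial_mean_def)
    have spm: "(\<integral>x. f (point_evaluations xs (?L n x)) \<partial>circle) = spatial_mean f (evaluation_weight xs) n \<omega>"
      if "xs \<in> lists_T" for f xs n
      unfolding spatial_mean_def point_evaluations_localized[OF nodes[OF that]] ..
    show ?case
      unfolding law
    proof (rule converges_in_distribution_c1I)
      show "0 < 2 * pi" by simp
      show "prob_space circle" by (rule prob_space_circle)
      show "prob_space M" by (rule prob_space_axioms)
      show "?L n x \<in> c1_space 0 (2 * pi)" for n x by (rule localized_c1)
      show "(\<lambda>x. ?L n x t) \<in> borel_measurable circle" if "t \<in> {0..2 * pi}" for n t
        unfolding localized_eq_wpoly[OF that]
        using borel_measurable_continuous_onI[OF continuous_wpoly] by (simp cong: measurable_cong_sets)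
      show "?Z \<omega>' \<in> c1_space 0 (2 * pi)" if "\<omega>' \<in> space M" for \<omega>'
      proof -
        have "(\<lambda>t\<in>{0..2*pi}. sqrt (2 * pi * \<psi> (X \<omega>')) * (\<lambda>t\<in>{0..2*pi}. N t \<omega>') t) \<in> c1_space 0 (2 * pi)"
          by (rule c1_space_scale[OF N_c1[OF that]]) simp
        also have "(\<lambda>t\<in>{0..2*pi}. sqrt (2 * pi * \<psi> (X \<omega>')) * (\<lambda>t\<in>{0..2*pi}. N t \<omega>') t) = ?Z \<omega>'"
          by (auto simp: fun_eq_iff)
        finally show ?thesis .
      qed
      show "(\<lambda>\<omega>'. ?Z \<omega>' t) \<in> borel_measurable M" if "t \<in> {0..2 * pi}" for t
      proof -
        have [measurable]: "N t \<in> borel_measurable M" by (rule N_meas[OF that])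
        have "(\<lambda>\<omega>'. sqrt (2 * pi * \<psi> (X \<omega>')) * N t \<omega>') \<in> borel_measurable M" by measurable
        then show ?thesis using that by simp
      qed
      fix xs :: "(real \<times> real) list" assume "set xs \<subseteq> \<rat> \<times> ?T"
      then have xs: "xs \<in> lists_T" by (simp add: lists_T_def)
      show "(\<lambda>n. \<integral>x. cos (point_evaluations xs (?L n x)) \<partial>circle) \<longlonglongrightarrow> (\<integral>\<omega>'. cos (point_evaluations xs (?Z \<omega>')) \<partial>M)"
        unfolding spm[OF xs] limit(1)[OF xs] using elim(1) xs by blast
      show "(\<lambda>n. \<integral>x. sin (point_evaluations xs (?L n x)) \<partial>circle) \<longlonglongrightarrow> (\<integral>\<omega>'. sin (point_evaluations xs (?Z \<omega>')) \<partial>M)"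
        unfolding spm[OF xs] limit(2)[OF xs] using elim(1) xs by blast
    next
      fix e :: real assume "0 < e"
      from localized_tight[of "\<lambda>k. a k \<omega>" "\<lambda>k. b k \<omega>", OF mM this]
      show "\<exists>R \<delta>. (\<forall>j. 0 < \<delta> j) \<and> (\<forall>n. \<exists>A\<in>sets circle. measure circle (space circle - A) \<le> e \<and>
         (\<forall>x\<in>A. ?L n x \<in> c1_compact 0 (2 * pi) R \<delta>))" .
    qed
  qed
qed

end
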